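(* For each $n$, let $(\mathbf{W}_n^{(\ell)})_{\ell\in\mathbb{N}}=(n^{-1/2}\mathbf{X}_n^{(\ell)})_{\ell\in\mathbb{N}}$ be independent normalized real Wigner matrices with uniformly controlled moments (as defined in the context). Let $\mathbf{D}_n^{(\ell)}$ be the diagonal matrix of row sums of $\mathbf{W}_n^{(\ell)}$, and for $p,q\in\mathbb{R}$ let $\mathbf{M}_{n,p,q}^{(\ell)}=p\mathbf{W}_n^{(\ell)}+q\mathbf{D}_n^{(\ell)}$. Put $\mathcal{M}_n^{(\ell)}=(\mathbf{M}_{n,p,q}^{(\ell)})_{p,q\in\mathbb{R}}$. Then the families $(\mathcal{M}_n^{(\ell)}:\ell\in\mathbb{N})$ are asymptotically traffic independent, and the limiting traffic distribution $\lim_{n\to\infty}\tau_{\mathcal{M}_n^{(\ell)}}$ of each family is stable and universal (i.e. it does not depend on $\ell$ nor on the choice of the real Wigner matrices).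
   Context: Real Wigner matrices: for each $n$, $(\mathbf{X}_n^{(\ell)})_{\ell\in\mathbb{N}}$ are random real symmetric $n\times n$ matrices with entries $(\mathbf{X}_n^{(\ell)}(j,k):1\le j\le k\le n,\ \ell\in\mathbb{N})$ independent; for $j<k$, $\mathbb{E}\mathbf{X}_n^{(\ell)}(j,k)=0$ and $\mathbb{E}\mathbf{X}_n^{(\ell)}(j,k)^2=1$; and for every finite $L_0\subset\mathbb{N}$ and every $r\in\mathbb{N}$, $\sup_n\sup_{\ell\in L_0}\sup_{j\le k}\mathbb{E}|\mathbf{X}_n^{(\ell)}(j,k)|^r<\infty$. Test graphs: for a label set $S$, a test graph in $S$ is a finite connected directed multigraph $T=(V,E,\mathrm{src},\mathrm{tar})$ (loops, multi-edges allowed, $V\ne\emptyset$) with labels $E\to S$. A $*$-test graph in $\mathbf{x}=(x_i)_{i\in J}$ has labels $(\gamma(e),\varepsilon(e))\in J\times\{1,*\}$, read as $x_{\gamma(e)}^{\varepsilon(e)}$; $\mathbb{C}\mathcal{T}\langle\mathbf{x},\mathbf{x}^*\rangle$ is the space of finite linear combinations. For a family $\mathfrak{A}_n=(\mathbf{A}_n^{(i)})_{i\in J}$ of random matrices with all moments, $\tau_{\mathfrak{A}_n}(T)=\mathbb{E}[\frac1n\sum_{\phi:V\to[n]}\prod_{e}(\mathbf{A}_n^{(\gamma(e))})^{\varepsilon(e)}(\phi(\mathrm{tar}(e)),\phi(\mathrm{src}(e)))]$ is its traffic distribution; convergence in traffic distribution means pointwise convergence. The injective version of any functional $\tau$ on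 test graphs is $\tau^0[T]=\sum_{\pi\in\mathcal{P}(V)}\tau[T^\pi]\mu(0_V,\pi)$, where $\mathcal P(V)$ is the partition lattice of $V$, $\mu$ its Möbius function and $T^\pi$ is obtained by identifying the vertices within each block of $\pi$ (so $\tau[T]=\sum_\pi\tau^0[T^\pi]$). Free products: let labels be partitioned into groups indexed by $k\in K$. For a test graph $T$ let $(T_{k,\ell})_\ell$ be the connected components of the subgraph spanned by the edges with labels in group $k$; $\chi(T)$ is the simple bipartite graph whose vertices are all $T_{k,\ell}$ and all vertices of $T$ lying in more than one component, with edges given by membership. $T$ is a free product if $\chi(T)$ is a tree (a one-vertex edgeless $T$ counts as a free product with empty product $1$). Traffic independence: asymptotic traffic independence of families means that the joint traffic distributions converge pointwise to a functional $\tau$ such that $\tau^0[T]=\prod_k\prod_\ell\tau^0[T_{k,\ell}]$ if $T$ is a free product and $\tau^0[T]=0$ otherwise. Families $\mathbf{a}_k$ in a traffic space are traffic independent if the same identity holds for the injective version $\tau^0[T(\mathbf{a})]$ of the traffic state. Traffic space: a $K$-graph operation $g$ is a finite connected directed multigraph with $K$ edges ordered by $1,\dots,K$ and two distinguished (possibly equal) vertices $v_{\rm in},v_{\rm out}$. A traffic space is a tracial $*$-probability space $(\mathcal{A},\varphi)$ with multilinear maps $Z_g:\mathcal{A}^{\otimes K}\to\mathcal{A}$ for all $K\ge0$ and all $K$-graph operations $g$ such that: (i) $Z_{g(g_1,\dots,g_K)}=Z_g\circ(Z_{g_1}\otimes\cdots\otimes Z_{g_K})$, where $g(g_1,\dots,g_K)$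 replaces the $k$-th edge of $g$ by $g_k$, identifying its source with the input and its target with the output of $g_k$; (ii) for $g$ a directed path from $v_{\rm in}$ to $v_{\rm out}$ with consecutive edges $1,\dots,K$, $Z_g(a_1\otimes\cdots\otimes a_K)=a_K\cdots a_1$, and the one-vertex operation gives $1_{\mathcal{A}}$; (iii) permuting the ordering of the edges together with the arguments does not change the value; (iv) $Z_g(a_1\otimes\cdots\otimes a_K)^*=Z_{g^*}(a_1^*\otimes\cdots\otimes a_K^* )$, where $g^*$ reverses all edges and swaps $v_{\rm in},v_{\rm out}$; (v) there is a linear functional $\tau$ (the traffic state) on finite linear combinations of test graphs with labels in $\mathcal{A}$ such that $\varphi(Z_g(a_1\otimes\cdots\otimes a_K))=\tau[T]$, where $T$ is obtained from $g$ by labelling the $k$-th edge with $a_k$, identifying $v_{\rm in}$ and $v_{\rm out}$ and forgetting their roles; (vi) positivity: for each $m\ge1$ and each finite linear combination $t$ of test graphs in $\mathcal{A}$ with $m$ distinguished vertices, $\tau[\Delta_m(t^*,t)]\ge0$, where $t^*$ is the conjugate-linear operation reversing edges and replacing labels by adjoints, and $\Delta_m$ bilinearly glues two such graphs along their distinguished vertices coordinatewise. The traffic distribution of $\mathbf{a}=(a_i)_{i\in J}$ in $\mathcal{A}$ is $\tau_{\mathbf{a}}(T)=\tau[T(\mathbf{a})]$ for $*$-test graphs $T$, with $x_i^\varepsilon$ replaced by $a_i^\varepsilon$. Stable: a traffic distribution $\nu:\mathbb{C}\mathcal{T}\langle\mathbf{x},\mathbf{x}^*\rangle\to\mathbb{C}$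 of a family of centered random variables is stable if there are traffic independent families $\mathbf{a}_1=(a_1^{(i)})_{i\in J}$, $\mathbf{a}_2=(a_2^{(i)})_{i\in J}$ in a traffic space with $\tau_{\mathbf{a}_1}=\tau_{\mathbf{a}_2}=\nu$ and a constant $c\in\mathbb{R}_+$ such that the sum $\mathbf{a}=(a_1^{(i)}+a_2^{(i)})_{i\in J}$ satisfies $\tau_{\mathbf{a}}(T)=c^{\#(E)/2}\nu(T)$ for every $*$-test graph $T=(V,E,\gamma,\varepsilon)$. *)

theory Defs
  imports
    "HOL-Probability.Probability"
    "HOL-Library.Nat_Bijection"
    "HOL-Library.Nonpos_Ints"
    "Graph_Theory.Digraph_Component"
    "Graph_Theory.Digraph_Isomorphism"
    "Jordan_Normal_Form.VS_Connect"
    "Jordan_Normal_Form.Schur_Decomposition"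
begin

section \<open>Test graphs\<close>

text \<open>
  Test graphs matter only up to isomorphism, so vertices and edges are natural numbers.
  A linear functional on formal linear combinations of test graphs is represented by its
  values on the test graphs themselves; values on pairs that are not test graphs are irrelevant.
  The source and target of an edge are its \<open>tail\<close> and \<open>head\<close>.
\<close>

type_synonym 's test_graph = "(nat, nat) pre_digraph \<times> (nat \<Rightarrow> 's)"

definition is_test_graph :: "'s test_graph \<Rightarrow> bool" where
  "is_test_graph T \<longleftrightarrow> fin_digraph (fst T) \<and> Digraph_Component.connected (fst T)"

datatype star_exp = Plain | Adjoint

type_synonym 'j star_test_graph = "('j \<times> star_exp) test_graph"

text \<open>
  The result of identifying vertices along the equivalence relation generated by \<open>R\<close>; each class
  is represented by its least element.
\<close>

definition glue_map :: "(nat \<Rightarrow> nat \<Rightarrow> bool) \<Rightarrow> nat \<Rightarrow> nat" where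
  "glue_map R v = (LEAST w. equivclp R v w)"

definition glue :: "(nat \<Rightarrow> nat \<Rightarrow> bool) \<Rightarrow> (nat, 'e) pre_digraph \<Rightarrow> (nat, 'e) pre_digraph" where
  "glue R G = \<lparr> verts = glue_map R ` verts G, arcs = arcs G,
     tail = glue_map R \<circ> tail G, head = glue_map R \<circ> head G \<rparr>"

definition quotient_graph :: "nat set set \<Rightarrow> 's test_graph \<Rightarrow> 's test_graph" where
  "quotient_graph \<pi> T = (glue (\<lambda>v w. \<exists>B\<in>\<pi>. v \<in> B \<and> w \<in> B) (fst T), snd T)"

definition reverse_graph :: "('v, 'e) pre_digraph \<Rightarrow> ('v, 'e) pre_digraph" where
  "reverse_graph G = \<lparr> verts = verts G, arcs = arcs G, tail = head G, head = tail G \<rparr>"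

definition test_graph_iso :: "'s test_graph \<Rightarrow> 's test_graph \<Rightarrow> bool" where
  "test_graph_iso T T' \<longleftrightarrow>
     (\<exists>h. pre_digraph.digraph_isomorphism (fst T) h \<and> fst T' = app_iso h (fst T) \<and>
          (\<forall>e\<in>arcs (fst T). snd T' (iso_arcs h e) = snd T e))"

section \<open>The injective version of a functional\<close>

lemma finite_refines: "finite V \<Longrightarrow> finite {\<sigma>. refines V \<rho> \<sigma>}" "finite V \<Longrightarrow> finite {\<sigma>. refines V \<sigma> \<pi>}"
  by (rule finite_subset[of _ "Pow (Pow V)"]; auto simp: refines_def partition_on_def)+

function partition_moebius :: "'v set \<Rightarrow> 'v set set \<Rightarrow> 'v set set \<Rightarrow> int" where
  "partition_moebius V \<rho> \<pi> =
     (if finite V \<and> refines V \<rho> \<pi> then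
        (if \<rho> = \<pi> then 1
         else - (\<Sum>\<sigma> \<in> {\<sigma>. refines V \<rho> \<sigma> \<and> refines V \<sigma> \<pi> \<and> \<sigma> \<noteq> \<pi>}. partition_moebius V \<rho> \<sigma>))
      else 0)"
  by pat_completeness auto
termination
proof (relation "Wellfounded.measure (\<lambda>(V, \<rho>, \<pi>). card {\<sigma>. refines V \<sigma> \<pi>})", goal_cases)
  case 1
  then show ?case by simp
next
  case (2 V \<rho> \<pi> \<sigma>)
  then have \<sigma>: "refines V \<sigma> \<pi>" "\<sigma> \<noteq> \<pi>" and V: "finite V" by auto
  have "\<not> refines V \<pi> \<sigma>" using \<sigma> refines_asym by blast
  moreover have "refines V \<pi> \<pi>" using \<sigma>(1) by (auto simp: refines_def)
  moreover have "{\<tau>. refines V \<tau> \<sigma>} \<subseteq> {\<tau>. refines V \<tau> \<pi>}" using \<sigma>(1) refines_trans by blast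
  ultimately have "{\<tau>. refines V \<tau> \<sigma>} \<subset> {\<tau>. refines V \<tau> \<pi>}" by blast
  then show ?case using finite_refines(2)[OF V] by (simp add: psubset_card_mono)
qed

declare partition_moebius.simps [simp del]

definition injective_version :: "('s test_graph \<Rightarrow> complex) \<Rightarrow> 's test_graph \<Rightarrow> complex" where
  "injective_version \<tau> T =
     (\<Sum>\<pi> | partition_on (verts (fst T)) \<pi>.
        \<tau> (quotient_graph \<pi> T) *
        of_int (partition_moebius (verts (fst T)) ((\<lambda>v. {v}) ` verts (fst T)) \<pi>))"

section \<open>Free products of test graphs\<close>

definition group_subgraph :: "('s \<Rightarrow> 'k) \<Rightarrow> 's test_graph \<Rightarrow> 'k \<Rightarrow> (nat, nat) pre_digraph" where
  "group_subgraph grp T k =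
     (let G = fst T; E = {e \<in> arcs G. grp (snd T e) = k}
      in \<lparr> verts = tail G ` E \<union> head G ` E, arcs = E, tail = tail G, head = head G \<rparr>)"

definition connected_components :: "('v, 'e) pre_digraph \<Rightarrow> ('v, 'e) pre_digraph set" where
  "connected_components G =
     {H. induced_subgraph H G \<and> Digraph_Component.connected H \<and>
         \<not> (\<exists>H'. induced_subgraph H' G \<and> Digraph_Component.connected H' \<and> verts H \<subset> verts H')}"

text \<open>
  Components of different groups have disjoint nonempty edge sets, so the component determines
  its group and the union below loses no information.
\<close>

definition group_components :: "('s \<Rightarrow> 'k) \<Rightarrow> 's test_graph \<Rightarrow> (nat, nat) pre_digraph set" where
  "group_components grp T = (\<Union>k. connected_components (group_subgraph grp T k))"

definition component_graph ::
    "('s \<Rightarrow> 'k) \<Rightarrow> 's test_graph \<Rightarrow> ((nat, nat) pre_digraph + nat) pair_pre_digraph" where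
  "component_graph grp T =
     (let C = group_components grp T;
          S = {v. \<exists>H\<in>C. \<exists>H'\<in>C. H \<noteq> H' \<and> v \<in> verts H \<and> v \<in> verts H'};
          I = {(H, v). H \<in> C \<and> v \<in> S \<and> v \<in> verts H}
      in \<lparr> pverts = C <+> S,
           parcs = (\<lambda>(H, v). (Inl H, Inr v)) ` I \<union> (\<lambda>(H, v). (Inr v, Inl H)) ` I \<rparr>)"

text \<open>
  Simple graphs are symmetric digraphs here, in which a single undirected edge is already a
  directed cycle of length 2; the library's \<open>tree\<close> would therefore be the wrong notion.
\<close>

definition simple_tree :: "'v pair_pre_digraph \<Rightarrow> bool" where
  "simple_tree G \<longleftrightarrow>
     Digraph_Component.connected (with_proj G) \<and>
     \<not> (\<exists>p. pre_digraph.cycle (with_proj G) p \<and> 3 \<le> length p)"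

text \<open>The edgeless test graph has an empty component graph and is a free product by convention.\<close>

definition is_free_product :: "('s \<Rightarrow> 'k) \<Rightarrow> 's test_graph \<Rightarrow> bool" where
  "is_free_product grp T \<longleftrightarrow> arcs (fst T) = {} \<or> simple_tree (component_graph grp T)"

text \<open>
  The factorisation defining traffic independence, for a functional on \<open>*\<close>-test graphs in
  variables indexed by pairs \<open>(k, i)\<close> of a group \<open>k\<close> and an index \<open>i\<close> within the group.
\<close>

definition factorises_over_free_products :: "(('k \<times> 'i) star_test_graph \<Rightarrow> complex) \<Rightarrow> bool" where
  "factorises_over_free_products \<tau> \<longleftrightarrow>
     (let grp = (\<lambda>l. fst (fst l))
      in \<forall>T. is_test_graph T \<longrightarrow>
           injective_version \<tau> T =
             (if is_free_product grp T
              then \<Prod>H\<in>group_components grp T. injective_version \<tau> (H, snd T)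
              else 0))"

section \<open>Traffic distributions of random matrices\<close>

fun mat_exp_star :: "star_exp \<Rightarrow> complex mat \<Rightarrow> complex mat" where
  "mat_exp_star Plain A = A"
| "mat_exp_star Adjoint A = mat_adjoint A"

definition mat_traffic_dist ::
    "'w measure \<Rightarrow> nat \<Rightarrow> ('i \<Rightarrow> 'w \<Rightarrow> complex mat) \<Rightarrow> 'i star_test_graph \<Rightarrow> complex" where
  "mat_traffic_dist M n A T =
     (let G = fst T; l = snd T
      in LINT \<omega>|M. (1 / of_nat n) *
           (\<Sum>\<phi> \<in> verts G \<rightarrow>\<^sub>E {..<n}. \<Prod>e\<in>arcs G.
              mat_exp_star (snd (l e)) (A (fst (l e)) \<omega>) $$ (\<phi> (head G e), \<phi> (tail G e))))"

definition traffic_converges ::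
    "(nat \<Rightarrow> 's test_graph \<Rightarrow> complex) \<Rightarrow> ('s test_graph \<Rightarrow> complex) \<Rightarrow> bool" where
  "traffic_converges \<tau>n \<tau> \<longleftrightarrow> (\<forall>T. is_test_graph T \<longrightarrow> (\<lambda>n. \<tau>n n T) \<longlonglongrightarrow> \<tau> T)"

text \<open>
  \<open>A n k i\<close> is the \<open>i\<close>-th random \<open>n \<times> n\<close> matrix of the \<open>k\<close>-th family, defined on the probability
  space \<open>M n\<close>.
\<close>

definition asymptotically_traffic_independent ::
    "(nat \<Rightarrow> 'w measure) \<Rightarrow> (nat \<Rightarrow> 'k \<Rightarrow> 'i \<Rightarrow> 'w \<Rightarrow> complex mat) \<Rightarrow> bool" where
  "asymptotically_traffic_independent M A \<longleftrightarrow>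
     (\<exists>\<tau>. traffic_converges (\<lambda>n. mat_traffic_dist (M n) n (\<lambda>(k, i). A n k i)) \<tau> \<and>
          factorises_over_free_products \<tau>)"

section \<open>Graph operations\<close>

record graph_op =
  op_graph :: "(nat, nat) pre_digraph"
  op_in :: nat
  op_out :: nat

text \<open>The edges of a \<open>K\<close>-graph operation are ordered as \<open>0, \<dots>, K - 1\<close>.\<close>

definition is_graph_op :: "nat \<Rightarrow> graph_op \<Rightarrow> bool" where
  "is_graph_op K g \<longleftrightarrow>
     fin_digraph (op_graph g) \<and> Digraph_Component.connected (op_graph g) \<and>
     arcs (op_graph g) = {..<K} \<and> op_in g \<in> verts (op_graph g) \<and> op_out g \<in> verts (op_graph g)"

text \<open>
  \<open>op_subst g gs\<close> replaces the \<open>k\<close>-th edge of \<open>g\<close> by \<open>gs ! k\<close>. A vertex \<open>v\<close> of \<open>g\<close> becomes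
  \<open>prod_encode (0, v)\<close>, a vertex \<open>v\<close> of \<open>gs ! k\<close> becomes \<open>prod_encode (Suc k, v)\<close>. Edges are
  ordered lexicographically: the \<open>m\<close>-th edge is edge \<open>j\<close> of \<open>gs ! k\<close> where
  \<open>(k, j) = op_subst_edges gs ! m\<close>.
\<close>

definition op_subst_edges :: "graph_op list \<Rightarrow> (nat \<times> nat) list" where
  "op_subst_edges gs =
     concat (map (\<lambda>k. map (Pair k) [0..<card (arcs (op_graph (gs ! k)))]) [0..<length gs])"

definition op_subst_rel :: "graph_op \<Rightarrow> graph_op list \<Rightarrow> nat \<Rightarrow> nat \<Rightarrow> bool" where
  "op_subst_rel g gs x y \<longleftrightarrow>
     (\<exists>k<length gs.
        (x = prod_encode (0, tail (op_graph g) k) \<and> y = prod_encode (Suc k, op_in (gs ! k))) \<or>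
        (x = prod_encode (0, head (op_graph g) k) \<and> y = prod_encode (Suc k, op_out (gs ! k))))"

definition op_subst :: "graph_op \<Rightarrow> graph_op list \<Rightarrow> graph_op" where
  "op_subst g gs =
     (let es = op_subst_edges gs; R = op_subst_rel g gs
      in \<lparr> op_graph = glue R
             \<lparr> verts = (\<lambda>v. prod_encode (0, v)) ` verts (op_graph g) \<union>
                 (\<Union>k<length gs. (\<lambda>v. prod_encode (Suc k, v)) ` verts (op_graph (gs ! k))),
               arcs = {..<length es},
               tail = (\<lambda>m. case es ! m of (k, j) \<Rightarrow> prod_encode (Suc k, tail (op_graph (gs ! k)) j)),
               head = (\<lambda>m. case es ! m of (k, j) \<Rightarrow> prod_encode (Suc k, head (op_graph (gs ! k)) j)) \<rparr>,
           op_in = glue_map R (prod_encode (0, op_in g)),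
           op_out = glue_map R (prod_encode (0, op_out g)) \<rparr>)"

definition op_path :: "nat \<Rightarrow> graph_op" where
  "op_path K = \<lparr> op_graph = \<lparr> verts = {..K}, arcs = {..<K}, tail = (\<lambda>k. k), head = Suc \<rparr>,
                 op_in = 0, op_out = K \<rparr>"

definition op_reverse :: "graph_op \<Rightarrow> graph_op" where
  "op_reverse g = \<lparr> op_graph = reverse_graph (op_graph g), op_in = op_out g, op_out = op_in g \<rparr>"

text \<open>An isomorphism of graph operations that may permute the ordering of the edges.\<close>

definition graph_op_isomorphism ::
    "(nat, nat, nat, nat) digraph_isomorphism \<Rightarrow> graph_op \<Rightarrow> graph_op \<Rightarrow> bool" where
  "graph_op_isomorphism h g g' \<longleftrightarrow>
     pre_digraph.digraph_isomorphism (op_graph g) h \<and> op_graph g' = app_iso h (op_graph g) \<and>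
     op_in g' = iso_verts h (op_in g) \<and> op_out g' = iso_verts h (op_out g)"

definition op_closure :: "graph_op \<Rightarrow> 's list \<Rightarrow> 's test_graph" where
  "op_closure g as = (glue (\<lambda>x y. x = op_in g \<and> y = op_out g) (op_graph g), \<lambda>k. as ! k)"

section \<open>Test graphs with distinguished vertices\<close>

text \<open>The distinguished vertices form a tuple and may repeat.\<close>

type_synonym 's marked_graph = "'s test_graph \<times> nat list"

definition is_marked_graph :: "nat \<Rightarrow> 's set \<Rightarrow> 's marked_graph \<Rightarrow> bool" where
  "is_marked_graph m S t \<longleftrightarrow>
     is_test_graph (fst t) \<and> snd (fst t) ` arcs (fst (fst t)) \<subseteq> S \<and>
     length (snd t) = m \<and> set (snd t) \<subseteq> verts (fst (fst t))"

definition marked_star :: "('s \<Rightarrow> 's) \<Rightarrow> 's marked_graph \<Rightarrow> 's marked_graph" where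
  "marked_star st t = ((reverse_graph (fst (fst t)), st \<circ> snd (fst t)), snd t)"

definition disjoint_union_graph ::
    "(nat, nat) pre_digraph \<Rightarrow> (nat, nat) pre_digraph \<Rightarrow> (nat, nat) pre_digraph" where
  "disjoint_union_graph G H =
     \<lparr> verts = sum_encode ` (verts G <+> verts H),
       arcs = sum_encode ` (arcs G <+> arcs H),
       tail = (\<lambda>e. sum_encode (map_sum (tail G) (tail H) (sum_decode e))),
       head = (\<lambda>e. sum_encode (map_sum (head G) (head H) (sum_decode e))) \<rparr>"

definition marked_glue :: "'s marked_graph \<Rightarrow> 's marked_graph \<Rightarrow> 's test_graph" where
  "marked_glue t t' =
     (glue (\<lambda>x y. \<exists>i<length (snd t). x = sum_encode (Inl (snd t ! i)) \<and>
                                       y = sum_encode (Inr (snd t' ! i)))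
        (disjoint_union_graph (fst (fst t)) (fst (fst t'))),
      \<lambda>e. case_sum (snd (fst t)) (snd (fst t')) (sum_decode e))"

section \<open>Traffic spaces\<close>

record 'a traffic_space = "(complex, 'a) module" +
  star :: "'a \<Rightarrow> 'a"
  state :: "'a \<Rightarrow> complex"
  graph_action :: "graph_op \<Rightarrow> 'a list \<Rightarrow> 'a"
  traffic_state :: "'a test_graph \<Rightarrow> complex"

locale star_algebra =
  fixes A :: "('a, 'z) traffic_space_scheme" (structure)
  assumes ring: "ring A"
    and module: "module (class_ring :: complex ring) A"
    and smult_mult_left: "\<lbrakk>x \<in> carrier A; y \<in> carrier A\<rbrakk> \<Longrightarrow> (c \<odot> x) \<otimes> y = c \<odot> (x \<otimes> y)"
    and smult_mult_right: "\<lbrakk>x \<in> carrier A; y \<in> carrier A\<rbrakk> \<Longrightarrow> x \<otimes> (c \<odot> y) = c \<odot> (x \<otimes> y)"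
    and star_closed: "x \<in> carrier A \<Longrightarrow> star A x \<in> carrier A"
    and star_star: "x \<in> carrier A \<Longrightarrow> star A (star A x) = x"
    and star_add: "\<lbrakk>x \<in> carrier A; y \<in> carrier A\<rbrakk> \<Longrightarrow> star A (x \<oplus> y) = star A x \<oplus> star A y"
    and star_smult: "x \<in> carrier A \<Longrightarrow> star A (c \<odot> x) = cnj c \<odot> star A x"
    and star_mult: "\<lbrakk>x \<in> carrier A; y \<in> carrier A\<rbrakk> \<Longrightarrow> star A (x \<otimes> y) = star A y \<otimes> star A x"

locale tracial_star_prob_space = star_algebra +
  assumes state_add: "\<lbrakk>x \<in> carrier A; y \<in> carrier A\<rbrakk> \<Longrightarrow> state A (x \<oplus> y) = state A x + state A y"
    and state_smult: "x \<in> carrier A \<Longrightarrow> state A (c \<odot> x) = c * state A x"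
    and state_one: "state A \<one> = 1"
    and state_pos: "x \<in> carrier A \<Longrightarrow> state A (star A x \<otimes> x) \<in> \<real>\<^sub>\<ge>\<^sub>0"
    and state_tracial: "\<lbrakk>x \<in> carrier A; y \<in> carrier A\<rbrakk> \<Longrightarrow> state A (x \<otimes> y) = state A (y \<otimes> x)"

text \<open>
  \<open>action_iso\<close> combines two facts: graph operations are considered up to renaming of vertices, and
  permuting the ordering of the edges together with the arguments does not change the value.
  In \<open>traffic_state_pos\<close>, the linear combination is \<open>t = (\<Sum>s\<in>F. u s \<cdot> s)\<close>.
\<close>

locale traffic_space = tracial_star_prob_space +
  assumes action_closed:
      "\<lbrakk>is_graph_op (length as) g; set as \<subseteq> carrier A\<rbrakk> \<Longrightarrow> graph_action A g as \<in> carrier A"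
    and action_add:
      "\<lbrakk>is_graph_op (length as) g; set as \<subseteq> carrier A; k < length as; x \<in> carrier A; y \<in> carrier A\<rbrakk>
       \<Longrightarrow> graph_action A g (as[k := x \<oplus> y]) =
           graph_action A g (as[k := x]) \<oplus> graph_action A g (as[k := y])"
    and action_smult:
      "\<lbrakk>is_graph_op (length as) g; set as \<subseteq> carrier A; k < length as; x \<in> carrier A\<rbrakk>
       \<Longrightarrow> graph_action A g (as[k := c \<odot> x]) = c \<odot> graph_action A g (as[k := x])"
    and action_subst:
      "\<lbrakk>is_graph_op (length gs) g;
        list_all2 (\<lambda>as h. is_graph_op (length as) h \<and> set as \<subseteq> carrier A) ass gs\<rbrakk>
       \<Longrightarrow> graph_action A (op_subst g gs) (concat ass) =
           graph_action A g (map2 (graph_action A) gs ass)"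
    and action_path:
      "set as \<subseteq> carrier A \<Longrightarrow> graph_action A (op_path (length as)) as = foldr (\<otimes>) (rev as) \<one>"
    and action_iso:
      "\<lbrakk>is_graph_op (length as) g; is_graph_op (length as) g'; graph_op_isomorphism h g g';
        set as \<subseteq> carrier A; length as' = length as; \<And>k. k < length as \<Longrightarrow> as' ! iso_arcs h k = as ! k\<rbrakk>
       \<Longrightarrow> graph_action A g' as' = graph_action A g as"
    and action_star:
      "\<lbrakk>is_graph_op (length as) g; set as \<subseteq> carrier A\<rbrakk>
       \<Longrightarrow> star A (graph_action A g as) = graph_action A (op_reverse g) (map (star A) as)"
    and traffic_state_iso:
      "\<lbrakk>is_test_graph T; is_test_graph T'; snd T ` arcs (fst T) \<subseteq> carrier A; test_graph_iso T T'\<rbrakk>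
       \<Longrightarrow> traffic_state A T' = traffic_state A T"
    and state_action:
      "\<lbrakk>is_graph_op (length as) g; set as \<subseteq> carrier A\<rbrakk>
       \<Longrightarrow> state A (graph_action A g as) = traffic_state A (op_closure g as)"
    and traffic_state_pos:
      "\<lbrakk>1 \<le> m; finite F; \<forall>s\<in>F. is_marked_graph m (carrier A) s\<rbrakk>
       \<Longrightarrow> (\<Sum>s\<in>F. \<Sum>s'\<in>F. cnj (u s) * u s' *
              traffic_state A (marked_glue (marked_star (star A) s) s')) \<in> \<real>\<^sub>\<ge>\<^sub>0"

fun exp_star :: "('a, 'z) traffic_space_scheme \<Rightarrow> star_exp \<Rightarrow> 'a \<Rightarrow> 'a" where
  "exp_star A Plain x = x"
| "exp_star A Adjoint x = star A x"

definition traffic_dist ::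
    "('a, 'z) traffic_space_scheme \<Rightarrow> ('j \<Rightarrow> 'a) \<Rightarrow> 'j star_test_graph \<Rightarrow> complex" where
  "traffic_dist A a T =
     traffic_state A (fst T, \<lambda>e. exp_star A (snd (snd T e)) (a (fst (snd T e))))"

definition traffic_independent ::
    "('a, 'z) traffic_space_scheme \<Rightarrow> ('k \<Rightarrow> 'j \<Rightarrow> 'a) \<Rightarrow> bool" where
  "traffic_independent A a \<longleftrightarrow> factorises_over_free_products (traffic_dist A (\<lambda>(k, i). a k i))"

section \<open>Stable traffic distributions\<close>

text \<open>
  The traffic space in the definition of stability may be arbitrary, but an existential quantifier
  needs a fixed type for its elements. The type below is large enough for this to be no
  restriction: the traffic subspace generated by families \<open>a\<^sub>1\<close>, \<open>a\<^sub>2\<close> indexed by \<open>'j\<close> is spanned by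
  the values of graph operations on the \<open>a\<^sub>k\<^sup>(\<^sup>i\<^sup>)\<close> and their adjoints, so the elements of the subspace
  correspond injectively to functions from labelled graph operations to coefficients.
  The two families are indexed by \<open>bool\<close>.
\<close>

type_synonym 'j traffic_elem = "graph_op \<times> ((bool \<times> 'j) \<times> star_exp) list \<Rightarrow> complex"

definition loop_graph :: "'s \<Rightarrow> 's test_graph" where
  "loop_graph s = (\<lparr> verts = {0}, arcs = {0}, tail = (\<lambda>_. 0), head = (\<lambda>_. 0) \<rparr>, \<lambda>_. s)"

text \<open>
  The first conjunct says that the variables are centered: identifying input and output of a single
  edge gives a loop, so \<open>\<phi>(a\<^sup>(\<^sup>i\<^sup>)) = \<tau>[loop labelled a\<^sup>(\<^sup>i\<^sup>)]\<close>. The factor \<open>c\<^bsup>#E/2\<^esup>\<close> is written as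
  \<open>(sqrt c)\<^bsup>#E\<^esup>\<close>, since \<open>0 powr 0 = 0\<close>.
\<close>

definition stable :: "('j star_test_graph \<Rightarrow> complex) \<Rightarrow> bool" where
  "stable \<nu> \<longleftrightarrow>
     (\<forall>i. \<nu> (loop_graph (i, Plain)) = 0) \<and>
     (\<exists>(A :: 'j traffic_elem traffic_space) (a :: bool \<Rightarrow> 'j \<Rightarrow> 'j traffic_elem) (c :: real).
        traffic_space A \<and> (\<forall>k i. a k i \<in> carrier A) \<and>
        traffic_independent A a \<and>
        (\<forall>k T. is_test_graph T \<longrightarrow> traffic_dist A (a k) T = \<nu> T) \<and>
        0 \<le> c \<and>
        (\<forall>T. is_test_graph T \<longrightarrow>
           traffic_dist A (\<lambda>i. a False i \<oplus>\<^bsub>A\<^esub> a True i) T =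
             of_real (sqrt c ^ card (arcs (fst T))) * \<nu> T))"

section \<open>Wigner matrices\<close>

text \<open>\<open>X n l\<close> is the \<open>l\<close>-th unnormalised \<open>n \<times> n\<close> matrix, defined on the probability space \<open>M n\<close>.\<close>

definition real_wigner ::
    "(nat \<Rightarrow> 'w measure) \<Rightarrow> (nat \<Rightarrow> nat \<Rightarrow> 'w \<Rightarrow> real mat) \<Rightarrow> bool" where
  "real_wigner M X \<longleftrightarrow>
     (\<forall>n\<ge>1. prob_space (M n)) \<and>
     (\<forall>n\<ge>1. \<forall>l. \<forall>\<omega>\<in>space (M n). X n l \<omega> \<in> carrier_mat n n \<and> transpose_mat (X n l \<omega>) = X n l \<omega>) \<and>
     (\<forall>n\<ge>1. prob_space.indep_vars (M n) (\<lambda>_. borel) (\<lambda>(l, j, k) \<omega>. X n l \<omega> $$ (j, k))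
               {(l, j, k). j \<le> k \<and> k < n}) \<and>
     (\<forall>n\<ge>1. \<forall>l j k. j < k \<and> k < n \<longrightarrow>
        (LINT \<omega>|M n. X n l \<omega> $$ (j, k)) = 0 \<and> (LINT \<omega>|M n. (X n l \<omega> $$ (j, k))\<^sup>2) = 1) \<and>
     (\<forall>L\<^sub>0. finite L\<^sub>0 \<longrightarrow> (\<forall>r.
        (SUP n\<in>{1..}. SUP l\<in>L\<^sub>0. SUP (j, k)\<in>{(j, k). j \<le> k \<and> k < n}.
           \<integral>\<^sup>+\<omega>. ennreal (\<bar>X n l \<omega> $$ (j, k)\<bar> ^ r) \<partial>M n) < \<infinity>))"

definition row_sum_mat :: "'a::comm_monoid_add mat \<Rightarrow> 'a mat" where
  "row_sum_mat W = Matrix.mat (dim_row W) (dim_row W)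
     (\<lambda>(i, j). if i = j then \<Sum>k<dim_col W. W $$ (i, k) else 0)"

definition normalized_mat :: "real mat \<Rightarrow> real mat" where
  "normalized_mat X = (1 / sqrt (real (dim_row X))) \<cdot>\<^sub>m X"

definition M_mat :: "real \<Rightarrow> real \<Rightarrow> real mat \<Rightarrow> real mat" where
  "M_mat p q W = p \<cdot>\<^sub>m W + q \<cdot>\<^sub>m row_sum_mat W"

definition M_family :: "('w \<Rightarrow> real mat) \<Rightarrow> real \<times> real \<Rightarrow> 'w \<Rightarrow> complex mat" where
  "M_family X = (\<lambda>(p, q) \<omega>. map_mat complex_of_real (M_mat p q (normalized_mat (X \<omega>))))"

end

theory Submission
  imports Defs "HOL-Real_Asymp.Real_Asymp"
begin

text \<open>
  Sum over the injective maps \<open>\<phi>\<close> of a test graph, and expand the row sum at every loop over the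
  position of its summand. Then every edge carries a single Wigner entry, whose position is an
  unordered pair of indices. As off-diagonal entries are centered, only terms in which all
  off-diagonal positions are repeated contribute, and counting free indices shows that only pairings
  of the edges survive in the limit, such that edges of a pair have equal colour and nested sets of
  ends, and the pairs containing a non-loop form a tree on the vertices. Each of them contributes the
  product of the weights \<open>q\<close> over the loops and \<open>p\<close> over the other edges.

  The tree condition is an Euler count that is additive over coloured components, which gives the
  factorisation over free products. Since only variances enter, the limit is universal, and for
  stability it can be realised by random signs. The matrices obtained from these by graph operations,
  at all sizes simultaneously, form a traffic space whose state is the limiting normalised trace.
  Adding two independent copies multiplies the limit by \<open>(sqrt 2) ^ #E\<close>, as a pairing of \<open>E\<close> is
  monochromatic for \<open>2 ^ (#E / 2)\<close> of the two-colourings of \<open>E\<close>.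
\<close>


section \<open>Connectivity and gluing\<close>

text \<open>The obstacle is the row sums: they let loops contribute at the same order as other
  edges, while diagonal Wigner entries are not assumed centered. Let \<open>E\<close> be the number
  of edges and \<open>u\<close> the number of index values used by a term. A term carries the factor
  \<open>n\<close> to the power \<open>-1 - E/2\<close>, and about \<open>n\<close> to the power
  \<open>u\<close> terms use \<open>u\<close> values. Positions carried by non-loops number at least
  \<open>card (verts G) - 1\<close> by connectivity, and each index value not taken by a vertex
  needs a position of its own. All these positions are off-diagonal, hence occur at least twice, so
  \<open>E \<ge> 2 * (u - 1)\<close>. A term survives only in the case of equality, which forces
  multiplicity exactly two, a tree, and distinct new values. Diagonal positions may occur once, but
  they cost an edge and add no value, so they drop out. Stability asks for an abstract traffic
  space. Random signs have finitely many outcomes at each size, so expectations are finite sums; the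
  existence of limits is then the only analytic condition, and multilinearity reduces it to the
  convergence proved for test graphs.\<close>

lemma (in wf_digraph) connected_iff_cut:
  "Digraph_Component.connected G \<longleftrightarrow> verts G \<noteq> {} \<and>
     (\<forall>S. (\<forall>e\<in>arcs G. tail G e \<in> S \<longleftrightarrow> head G e \<in> S) \<longrightarrow> verts G \<subseteq> S \<or> verts G \<inter> S = {})"
    (is "_ \<longleftrightarrow> _ \<and> ?cut")
proof -
  let ?R = "(arcs_ends G)\<^sup>s"
  have R: "(x, y) \<in> ?R \<longleftrightarrow>
      (\<exists>e\<in>arcs G. (x = tail G e \<and> y = head G e) \<or> (x = head G e \<and> y = tail G e))" for x y
    by (auto simp: symcl_def arcs_ends_def arc_to_ends_def)
  have "?cut \<longleftrightarrow> (\<forall>u\<in>verts G. \<forall>v\<in>verts G. (u, v) \<in> rtrancl_on (verts G) ?R)"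
  proof
    assume c: ?cut
    show "\<forall>u\<in>verts G. \<forall>v\<in>verts G. (u, v) \<in> rtrancl_on (verts G) ?R"
    proof (intro ballI)
      fix u v assume u: "u \<in> verts G" and v: "v \<in> verts G"
      \<comment> \<open>The set of vertices reachable from \<open>u\<close> is crossed by no arc, so
        the cut condition applies to it.\<close>
      let ?S = "{w. (u, w) \<in> rtrancl_on (verts G) ?R}"
      have "\<forall>e\<in>arcs G. tail G e \<in> ?S \<longleftrightarrow> head G e \<in> ?S"
        using R wellformed by (fastforce intro: rtrancl_on_into_rtrancl_on)
      moreover have "u \<in> ?S" using u by auto
      ultimately show "(u, v) \<in> rtrancl_on (verts G) ?R" using c u v by blast
    qed
  next
    assume r: "\<forall>u\<in>verts G. \<forall>v\<in>verts G. (u, v) \<in> rtrancl_on (verts G) ?R"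
    show ?cut
    proof (intro allI impI)
      fix S assume S: "\<forall>e\<in>arcs G. tail G e \<in> S \<longleftrightarrow> head G e \<in> S"
      have "u \<in> S \<longleftrightarrow> v \<in> S" if "(u, v) \<in> rtrancl_on (verts G) ?R" for u v
        using that by (induction rule: rtrancl_on.induct) (use R S in auto)
      then show "verts G \<subseteq> S \<or> verts G \<inter> S = {}" using r by blast
    qed
  qed
  then show ?thesis by (simp add: connected_conv)
qed

text \<open>Cuts are the form in which connectivity is used: a set crossed by no arc can be pulled
  back along gluings and restricted to subgraphs, without handling walks.\<close>

lemma is_test_graph_iff_cut:
  "is_test_graph T \<longleftrightarrow> fin_digraph (fst T) \<and> verts (fst T) \<noteq> {} \<and>
     (\<forall>S. (\<forall>e\<in>arcs (fst T). tail (fst T) e \<in> S \<longleftrightarrow> head (fst T) e \<in> S) \<longrightarrow>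
          verts (fst T) \<subseteq> S \<or> verts (fst T) \<inter> S = {})"
  unfolding is_test_graph_def
  using wf_digraph.connected_iff_cut[of "fst T"] fin_digraph.axioms(1) by blast

text \<open>Grow a set \<open>S\<close> one vertex at a time. While \<open>S\<close> is not all of
  \<open>V\<close>, some \<open>X\<close> in \<open>J\<close> crosses its boundary; it has one
  element inside and one outside, and it is new because the members used so far lie inside
  \<open>S\<close>. Reaching \<open>V\<close> thus uses \<open>card V - 1\<close> members of
  \<open>J\<close>.\<close>

lemma card_le_of_cut:
  assumes fin: "finite V" "finite J" and "V \<noteq> {}"
    and J: "\<And>X. X \<in> J \<Longrightarrow> X \<subseteq> V \<and> card X \<le> 2"
    and cut: "\<And>S. \<forall>X\<in>J. X \<subseteq> S \<or> X \<inter> S = {} \<Longrightarrow> V \<subseteq> S \<or> V \<inter> S = {}"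
  shows "card V \<le> card J + 1"
proof -
  have "\<exists>S J'. S \<subseteq> V \<and> card S = Suc k \<and> J' \<subseteq> J \<and> card J' = k \<and> (\<forall>X\<in>J'. X \<subseteq> S)"
    if "Suc k \<le> card V" for k
    using that
  proof (induction k)
    case 0
    from \<open>V \<noteq> {}\<close> obtain v where "v \<in> V" by blast
    then show ?case by (intro exI[of _ "{v}"] exI[of _ "{}"]) auto
  next
    case (Suc k)
    then obtain S J' where S: "S \<subseteq> V" "card S = Suc k" "J' \<subseteq> J" "card J' = k" "\<forall>X\<in>J'. X \<subseteq> S"
      by auto
    have "\<not> V \<subseteq> S" 
    proof
      assume "V \<subseteq> S"
      with S have "V = S" by blast
      with S Suc.prems show False by simp
    qed
    moreover have "S \<noteq> {}" using S by auto
    then have "V \<inter> S \<noteq> {}" using S by blast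
    ultimately obtain X where X: "X \<in> J" "\<not> X \<subseteq> S" "X \<inter> S \<noteq> {}" using cut by blast
    then obtain a b where ab: "a \<in> X" "a \<in> S" "b \<in> X" "b \<notin> S" by blast
    have "finite X" using J[OF X(1)] fin finite_subset by blast
    moreover have "card X \<le> card {a, b}" using J[OF X(1)] ab by (cases "a = b") auto
    ultimately have "X = {a, b}"
      using ab by (intro card_seteq[symmetric]) auto
    then have "\<forall>Y\<in>insert X J'. Y \<subseteq> insert b S" using S ab by auto
    moreover have "X \<notin> J'" using X S by auto
    moreover have "b \<in> V" using J[OF X(1)] ab by blast
    moreover have "finite J'" "finite S" using S fin finite_subset by blast+
    ultimately show ?case
      using S X ab J by (intro exI[of _ "insert b S"] exI[of _ "insert X J'"]) auto
  qed
  from this[of "card V - 1"] obtain J' where "J' \<subseteq> J" "card J' = card V - 1"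
    using fin \<open>V \<noteq> {}\<close> by (metis Suc_diff_1 card_gt_0_iff le_refl)
  then show ?thesis using fin card_mono[of J J'] by linarith
qed

lemma equivclp_respects:
  assumes "equivclp R v w" "\<And>x y. R x y \<Longrightarrow> f x = f y"
  shows "f v = f w"
  using assms(1)
  by (induction rule: equivclp_induct) (use assms(2) in metis)+

lemma equivclp_glue_map: "equivclp R v (glue_map R v)"
  unfolding glue_map_def by (rule LeastI[of _ v]) simp

lemma glue_map_eq_iff: "glue_map R v = glue_map R w \<longleftrightarrow> equivclp R v w"
proof
  assume "glue_map R v = glue_map R w"
  then show "equivclp R v w"
    by (metis equivclp_glue_map equivclp_sym equivclp_trans)
next
  assume "equivclp R v w"
  then have "equivclp R v = equivclp R w"
    by (intro ext) (metis equivclp_sym equivclp_trans)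
  then show "glue_map R v = glue_map R w" unfolding glue_map_def by simp
qed

lemma glue_map_idem [simp]: "glue_map R (glue_map R v) = glue_map R v"
  using equivclp_glue_map[of R v] by (simp add: glue_map_eq_iff equivclp_sym)

lemma glue_map_in:
  assumes "\<And>x y. R x y \<Longrightarrow> x \<in> V \<and> y \<in> V" "v \<in> V"
  shows "glue_map R v \<in> V"
  using equivclp_respects[OF equivclp_glue_map, of R "\<lambda>x. x \<in> V" v] assms by blast

text \<open>Composition with \<open>glue_map\<close> identifies the maps on glued vertices with the
  maps on \<open>V\<close> that are constant along \<open>R\<close>. Quotients, closures,
  substitutions and marked gluings all pass through this change of variables.\<close>

lemma sum_glue:
  assumes R: "\<And>x y. R x y \<Longrightarrow> x \<in> V \<and> y \<in> V"
  shows "(\<Sum>\<phi>\<in>glue_map R ` V \<rightarrow>\<^sub>E N. H (restrict (\<phi> \<circ> glue_map R) V)) =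
         (\<Sum>\<psi> | \<psi> \<in> V \<rightarrow>\<^sub>E N \<and> (\<forall>x y. R x y \<longrightarrow> \<psi> x = \<psi> y). H \<psi>)"
proof (rule sum.reindex_bij_witness[where i = "\<lambda>\<psi>. restrict \<psi> (glue_map R ` V)"
        and j = "\<lambda>\<phi>. restrict (\<phi> \<circ> glue_map R) V"], goal_cases)
  case (1 \<phi>)
  then show ?case using glue_map_in[OF R]
    by (intro ext) (auto simp: restrict_def PiE_def extensional_def)
next
  case (2 \<phi>)
  have "glue_map R x = glue_map R y" if "R x y" for x y
    using that by (auto simp: glue_map_eq_iff)
  then show ?case using 2 R by (auto simp: PiE_def Pi_def)
next
  case (3 \<psi>)
  then have resp: "\<psi> (glue_map R v) = \<psi> v" for v
    using equivclp_respects[OF equivclp_glue_map, of R \<psi> v] by auto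
  show ?case
  proof (intro ext)
    fix x
    show "restrict (restrict \<psi> (glue_map R ` V) \<circ> glue_map R) V x = \<psi> x"
      using 3 by (cases "x \<in> V") (auto simp: resp PiE_def extensional_def)
  qed
next
  case (4 \<psi>)
  then show ?case using glue_map_in[OF R] by (auto simp: PiE_def Pi_def)
next
  case (5 \<phi>)
  then show ?case by simp
qed

text \<open>The unnormalised trace of a labelled graph, as inside \<open>mat_traffic_dist\<close>.
  Matrices are plain functions of two indices, so that Wigner matrices, random signs and elements of
  the traffic space can all be inserted for \<open>B\<close>.\<close>

definition vertex_sum :: "nat \<Rightarrow> ('s \<Rightarrow> nat \<Rightarrow> nat \<Rightarrow> complex) \<Rightarrow> 's test_graph \<Rightarrow> complex" where
  "vertex_sum n B T = (\<Sum>\<phi>\<in>verts (fst T) \<rightarrow>\<^sub>E {..<n}.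
     \<Prod>e\<in>arcs (fst T). B (snd T e) (\<phi> (head (fst T) e)) (\<phi> (tail (fst T) e)))"

lemma vertex_sum_glue:
  assumes "wf_digraph G" and R: "\<And>x y. R x y \<Longrightarrow> x \<in> verts G \<and> y \<in> verts G"
  shows "vertex_sum n B (glue R G, l) =
    (\<Sum>\<psi> | \<psi> \<in> verts G \<rightarrow>\<^sub>E {..<n} \<and> (\<forall>x y. R x y \<longrightarrow> \<psi> x = \<psi> y).
       \<Prod>e\<in>arcs G. B (l e) (\<psi> (head G e)) (\<psi> (tail G e)))"
proof -
  have "vertex_sum n B (glue R G, l) = (\<Sum>\<phi>\<in>glue_map R ` verts G \<rightarrow>\<^sub>E {..<n}.
     (\<lambda>\<psi>. \<Prod>e\<in>arcs G. B (l e) (\<psi> (head G e)) (\<psi> (tail G e))) (restrict (\<phi> \<circ> glue_map R) (verts G)))"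
    unfolding vertex_sum_def glue_def
    using wf_digraph.head_in_verts[OF assms(1)] wf_digraph.tail_in_verts[OF assms(1)]
    by (intro sum.cong prod.cong) auto
  also note sum_glue[OF R]
  finally show ?thesis by simp
qed

lemma fin_digraph_glue:
  assumes "fin_digraph G"
  shows "fin_digraph (glue R G)"
proof -
  interpret fin_digraph G by fact
  show ?thesis by unfold_locales (auto simp: glue_def)
qed

text \<open>A cut of the glued graph pulls back along \<open>glue_map\<close> to a cut that also
  respects \<open>R\<close>. Hence \<open>G\<close> itself may be disconnected, as in substitutions
  and in the gluing of two marked graphs.\<close>

lemma is_test_graph_glue:
  assumes "fin_digraph G" "verts G \<noteq> {}"
    and cut: "\<And>S. \<forall>e\<in>arcs G. tail G e \<in> S \<longleftrightarrow> head G e \<in> S \<Longrightarrow>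
      (\<And>x y. R x y \<Longrightarrow> x \<in> S \<longleftrightarrow> y \<in> S) \<Longrightarrow> verts G \<subseteq> S \<or> verts G \<inter> S = {}"
  shows "is_test_graph (glue R G, l)"
proof -
  have "verts (glue R G) \<subseteq> S \<or> verts (glue R G) \<inter> S = {}"
    if "\<forall>e\<in>arcs (glue R G). tail (glue R G) e \<in> S \<longleftrightarrow> head (glue R G) e \<in> S" for S
  proof -
    have "glue_map R x = glue_map R y" if "R x y" for x y
      using that by (auto simp: glue_map_eq_iff)
    then have "verts G \<subseteq> glue_map R -` S \<or> verts G \<inter> glue_map R -` S = {}"
      using that by (intro cut) (auto simp: glue_def)
    then show ?thesis by (auto simp: glue_def)
  qed
  then show ?thesis
    using fin_digraph_glue[OF assms(1)] assms(2) by (auto simp: is_test_graph_iff_cut glue_def)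
qed

lemma is_test_graph_glue_connected:
  assumes "is_test_graph (G, l)"
  shows "is_test_graph (glue R G, l')"
  using assms by (intro is_test_graph_glue) (auto simp: is_test_graph_iff_cut)

lemma is_test_graph_quotient:
  assumes "is_test_graph T"
  shows "is_test_graph (quotient_graph \<pi> T)"
  unfolding quotient_graph_def using assms
  by (intro is_test_graph_glue_connected[of _ "snd T"]) auto

lemma is_test_graph_relabel: "is_test_graph (G, l) \<Longrightarrow> is_test_graph (G, l')"
  by (simp add: is_test_graph_def)


section \<open>Injective versions of vertex sums\<close>

text \<open>The recursion defining \<open>partition_moebius\<close> expresses the value at the top
  element \<open>\<pi>\<close> as minus the sum over the rest of the interval.\<close>

lemma sum_partition_moebius:
  assumes "finite V" "refines V \<rho> \<pi>"
  shows "(\<Sum>\<sigma> | refines V \<rho> \<sigma> \<and> refines V \<sigma> \<pi>. partition_moebius V \<rho> \<sigma>) = (if \<rho> = \<pi> then 1 else 0)"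
proof -
  have \<rho>: "partition_on V \<rho>" and \<pi>: "partition_on V \<pi>" using assms by (auto simp: refines_def)
  show ?thesis
  proof (cases "\<rho> = \<pi>")
    case True
    then have "{\<sigma>. refines V \<rho> \<sigma> \<and> refines V \<sigma> \<pi>} = {\<rho>}"
      using refines_asym[of V] \<rho> by (auto simp: refines_refl)
    moreover have "partition_moebius V \<rho> \<rho> = 1"
      using assms True by (subst partition_moebius.simps) auto
    ultimately show ?thesis using True by simp
  next
    case False
    let ?A = "{\<sigma>. refines V \<rho> \<sigma> \<and> refines V \<sigma> \<pi>}"
    have fin: "finite ?A" using finite_refines(1)[OF assms(1)] by (rule rev_finite_subset) auto
    have \<pi>A: "\<pi> \<in> ?A" using assms \<pi> by (auto simp: refines_refl)
    have "?A - {\<pi>} = {\<sigma>. refines V \<rho> \<sigma> \<and> refines V \<sigma> \<pi> \<and> \<sigma> \<noteq> \<pi>}" by auto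
    then have "partition_moebius V \<rho> \<pi> = - (\<Sum>\<sigma>\<in>?A - {\<pi>}. partition_moebius V \<rho> \<sigma>)"
      using assms False by (subst partition_moebius.simps) simp
    then show ?thesis using sum.remove[OF fin \<pi>A, of "partition_moebius V \<rho>"] False by simp
  qed
qed

definition kernel_partition :: "'v set \<Rightarrow> ('v \<Rightarrow> 'x) \<Rightarrow> 'v set set" where
  "kernel_partition V \<phi> = (\<lambda>v. {w\<in>V. \<phi> w = \<phi> v}) ` V"

lemma partition_on_unique_block:
  assumes "partition_on V \<pi>" "B \<in> \<pi>" "B' \<in> \<pi>" "v \<in> B" "v \<in> B'"
  shows "B = B'"
  using assms by (auto simp: partition_on_def disjoint_def)

lemma partition_on_kernel: "partition_on V (kernel_partition V \<phi>)"
  by (rule partition_onI) (auto simp: kernel_partition_def disjnt_def)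

definition block_constant :: "'v set set \<Rightarrow> ('v \<Rightarrow> 'x) \<Rightarrow> bool" where
  "block_constant \<pi> \<phi> \<longleftrightarrow> (\<forall>B\<in>\<pi>. \<forall>v\<in>B. \<forall>w\<in>B. \<phi> v = \<phi> w)"

lemma refines_kernel_iff:
  "refines V \<pi> (kernel_partition V \<phi>) \<longleftrightarrow>
     partition_on V \<pi> \<and> block_constant \<pi> \<phi>" (is "?L \<longleftrightarrow> ?R")
proof
  assume ?L
  then have \<pi>: "partition_on V \<pi>" and "\<forall>B\<in>\<pi>. \<exists>u. B \<subseteq> {w\<in>V. \<phi> w = \<phi> u}"
    by (auto simp: refines_def kernel_partition_def)
  then have "\<phi> v = \<phi> w" if "B \<in> \<pi>" "v \<in> B" "w \<in> B" for B v w
    using that by (metis (mono_tags, lifting) mem_Collect_eq subsetD)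
  with \<pi> show ?R unfolding block_constant_def by blast
next
  assume R: ?R
  have "\<exists>Y\<in>kernel_partition V \<phi>. B \<subseteq> Y" if "B \<in> \<pi>" for B
  proof -
    have "B \<noteq> {}" "B \<subseteq> V" using R that by (auto simp: partition_on_def)
    then obtain v where "v \<in> B" "v \<in> V" by blast
    moreover have "B \<subseteq> {w\<in>V. \<phi> w = \<phi> v}" using R that \<open>B \<subseteq> V\<close> \<open>v \<in> B\<close> unfolding block_constant_def by blast
    ultimately show ?thesis by (auto simp: kernel_partition_def)
  qed
  then show ?L using R partition_on_kernel[of V \<phi>] unfolding refines_def by blast
qed

lemma kernel_partition_eq_singletons_iff:
  "(\<lambda>v. {v}) ` V = kernel_partition V \<phi> \<longleftrightarrow> inj_on \<phi> V"
proof
  assume eq: "(\<lambda>v. {v}) ` V = kernel_partition V \<phi>"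
  show "inj_on \<phi> V"
  proof (rule inj_onI)
    fix v w assume vw: "v \<in> V" "w \<in> V" "\<phi> v = \<phi> w"
    then have "{u\<in>V. \<phi> u = \<phi> v} \<in> (\<lambda>v. {v}) ` V" unfolding eq by (auto simp: kernel_partition_def)
    then obtain u where "{u\<in>V. \<phi> u = \<phi> v} = {u}" by blast
    then show "v = w" using vw by (metis (mono_tags, lifting) mem_Collect_eq singletonD)
  qed
next
  assume "inj_on \<phi> V"
  then show "(\<lambda>v. {v}) ` V = kernel_partition V \<phi>"
    unfolding kernel_partition_def by (intro image_cong) (auto dest: inj_onD)
qed

text \<open>The partitions on whose blocks \<open>\<phi>\<close> is constant form the interval from
  the singletons to the kernel of \<open>\<phi>\<close>. Its Moebius sum is 1 if the interval is a
  point, that is, if \<open>\<phi>\<close> is injective, and 0 otherwise.\<close>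

lemma sum_partition_moebius_kernel:
  assumes "finite V"
  shows "(\<Sum>\<pi> | partition_on V \<pi> \<and> block_constant \<pi> \<phi>.
            partition_moebius V ((\<lambda>v. {v}) ` V) \<pi>) = (if inj_on \<phi> V then 1 else 0)"
proof -
  have sing: "refines V ((\<lambda>v. {v}) ` V) \<pi>" if "partition_on V \<pi>" for \<pi>
    using that by (auto simp: refines_def partition_on_def disjoint_def)
  then have "{\<pi>. partition_on V \<pi> \<and> block_constant \<pi> \<phi>} =
      {\<pi>. refines V ((\<lambda>v. {v}) ` V) \<pi> \<and> refines V \<pi> (kernel_partition V \<phi>)}"
    by (auto simp: refines_kernel_iff)
  then show ?thesis
    using sum_partition_moebius[OF assms sing[OF partition_on_kernel[of V \<phi>]]]
    by (simp add: kernel_partition_eq_singletons_iff)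
qed

abbreviation same_block :: "'v set set \<Rightarrow> 'v \<Rightarrow> 'v \<Rightarrow> bool" where
  "same_block \<pi> \<equiv> \<lambda>v w. \<exists>B\<in>\<pi>. v \<in> B \<and> w \<in> B"

lemma equivclp_same_block:
  assumes "partition_on V \<pi>" "v \<in> V"
  shows "equivclp (same_block \<pi>) v w \<longleftrightarrow> same_block \<pi> v w"
proof
  assume "equivclp (same_block \<pi>) v w"
  then show "same_block \<pi> v w"
  proof (induction rule: equivclp_induct)
    case base
    then show ?case using assms by (auto simp: partition_on_def)
  next
    case (step y z)
    then show ?case using assms partition_on_unique_block[OF assms(1)] by metis
  qed
qed auto

lemma same_block_kernel:
  "same_block (kernel_partition V \<phi>) v w \<longleftrightarrow> v \<in> V \<and> w \<in> V \<and> \<phi> v = \<phi> w"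
  by (auto simp: kernel_partition_def)

lemma kernel_partition_eq_iff:
  assumes \<pi>: "partition_on V \<pi>"
  shows "kernel_partition V \<psi> = \<pi> \<longleftrightarrow> (\<forall>v\<in>V. \<forall>w\<in>V. \<psi> v = \<psi> w \<longleftrightarrow> same_block \<pi> v w)"
    (is "_ \<longleftrightarrow> ?C")
proof
  assume "kernel_partition V \<psi> = \<pi>"
  then show ?C using same_block_kernel[of V \<psi>] by metis
next
  assume C: ?C
  have sub: "B \<subseteq> V" if "B \<in> \<pi>" for B using \<pi> that by (auto simp: partition_on_def)
  have *: "{w\<in>V. \<psi> w = \<psi> v} = B" if "v \<in> B" "B \<in> \<pi>" for v B
  proof (intro Set.set_eqI iffI)
    fix w assume "w \<in> {w\<in>V. \<psi> w = \<psi> v}"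
    then have "w \<in> V" "\<psi> v = \<psi> w" by (simp_all only: mem_Collect_eq)
    then have "same_block \<pi> v w" using C sub that by blast
    then obtain B' where "B' \<in> \<pi>" "v \<in> B'" "w \<in> B'" by blast
    then show "w \<in> B" using partition_on_unique_block[OF \<pi>, of B' B v] that by auto
  qed (use C sub that in blast)
  show "kernel_partition V \<psi> = \<pi>"
  proof (intro Set.set_eqI iffI)
    fix B assume "B \<in> kernel_partition V \<psi>"
    then obtain v where v: "v \<in> V" "B = {w\<in>V. \<psi> w = \<psi> v}" by (auto simp: kernel_partition_def)
    then obtain B' where "B' \<in> \<pi>" "v \<in> B'" using \<pi> by (auto simp: partition_on_def)
    then show "B \<in> \<pi>" using *[of v B'] v by simp
  next
    fix B assume B: "B \<in> \<pi>"
    then obtain v where "v \<in> B" "v \<in> V" using \<pi> sub by (metis ex_in_conv partition_onD3 subsetD)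
    then show "B \<in> kernel_partition V \<psi>"
      unfolding kernel_partition_def using *[OF _ B] by blast
  qed
qed

lemma same_block_in:
  assumes "partition_on V \<pi>" "same_block \<pi> x y"
  shows "x \<in> V \<and> y \<in> V"
  using assms by (auto simp: partition_on_def)

definition inj_vertex_sum :: "nat \<Rightarrow> ('s \<Rightarrow> nat \<Rightarrow> nat \<Rightarrow> complex) \<Rightarrow> 's test_graph \<Rightarrow> complex" where
  "inj_vertex_sum n B T = (\<Sum>\<phi> | \<phi> \<in> verts (fst T) \<rightarrow>\<^sub>E {..<n} \<and> inj_on \<phi> (verts (fst T)).
     \<Prod>e\<in>arcs (fst T). B (snd T e) (\<phi> (head (fst T) e)) (\<phi> (tail (fst T) e)))"

lemma vertex_sum_quotient:
  assumes "is_test_graph T" "partition_on (verts (fst T)) \<pi>"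
  shows "vertex_sum n B (quotient_graph \<pi> T) =
    (\<Sum>\<phi>\<in>verts (fst T) \<rightarrow>\<^sub>E {..<n}. if block_constant \<pi> \<phi> then
       \<Prod>e\<in>arcs (fst T). B (snd T e) (\<phi> (head (fst T) e)) (\<phi> (tail (fst T) e)) else 0)"
proof -
  have wf: "wf_digraph (fst T)" and fin: "finite (verts (fst T) \<rightarrow>\<^sub>E {..<n})"
    using assms(1) fin_digraph.axioms(1) fin_digraph.finite_verts
    by (auto simp: is_test_graph_def intro!: finite_PiE)
  have eq: "{\<psi>. \<psi> \<in> verts (fst T) \<rightarrow>\<^sub>E {..<n} \<and> (\<forall>x y. same_block \<pi> x y \<longrightarrow> \<psi> x = \<psi> y)} =
     {\<phi> \<in> verts (fst T) \<rightarrow>\<^sub>E {..<n}. block_constant \<pi> \<phi>}"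
    unfolding block_constant_def by blast
  show ?thesis
    unfolding quotient_graph_def
    by (subst vertex_sum_glue[OF wf]) (use same_block_in[OF assms(2)] fin in \<open>simp_all add: eq sum.inter_filter\<close>)
qed

text \<open>A map of the quotient is injective exactly when its pullback to \<open>T\<close> also
  separates different blocks, so that the kernel of the pullback is \<open>\<pi>\<close> itself and
  not merely coarser.\<close>

lemma inj_vertex_sum_quotient:
  assumes "is_test_graph T" and \<pi>: "partition_on (verts (fst T)) \<pi>"
  shows "inj_vertex_sum n B (quotient_graph \<pi> T) =
    (\<Sum>\<phi> | \<phi> \<in> verts (fst T) \<rightarrow>\<^sub>E {..<n} \<and> kernel_partition (verts (fst T)) \<phi> = \<pi>.
       \<Prod>e\<in>arcs (fst T). B (snd T e) (\<phi> (head (fst T) e)) (\<phi> (tail (fst T) e)))"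
proof -
  let ?G = "fst T" and ?V = "verts (fst T)" and ?R = "same_block \<pi>"
  have wf: "wf_digraph ?G" and finV: "finite ?V"
    using assms(1) fin_digraph.axioms(1) fin_digraph.finite_verts by (auto simp: is_test_graph_def)
  have R: "\<And>x y. ?R x y \<Longrightarrow> x \<in> ?V \<and> y \<in> ?V" using same_block_in[OF \<pi>] by blast
  have ker: "kernel_partition ?V \<psi> = \<pi> \<longleftrightarrow>
      (\<forall>x y. ?R x y \<longrightarrow> \<psi> x = \<psi> y) \<and> (\<forall>v\<in>?V. \<forall>w\<in>?V. \<psi> v = \<psi> w \<longrightarrow> ?R v w)"
    for \<psi> :: "nat \<Rightarrow> nat"
    using R kernel_partition_eq_iff[OF \<pi>, of \<psi>] by blast
  let ?W = "\<lambda>\<psi>. \<Prod>e\<in>arcs ?G. B (snd T e) (\<psi> (head ?G e)) (\<psi> (tail ?G e))"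
  let ?H = "\<lambda>\<psi>. if \<forall>v\<in>?V. \<forall>w\<in>?V. \<psi> v = \<psi> w \<longrightarrow> ?R v w then ?W \<psi> else 0"
  have "inj_vertex_sum n B (quotient_graph \<pi> T) =
     (\<Sum>\<phi>\<in>glue_map ?R ` ?V \<rightarrow>\<^sub>E {..<n}. if inj_on \<phi> (glue_map ?R ` ?V)
        then ?W (restrict (\<phi> \<circ> glue_map ?R) ?V) else 0)"
    unfolding inj_vertex_sum_def quotient_graph_def glue_def
    using wf_digraph.head_in_verts[OF wf] wf_digraph.tail_in_verts[OF wf] finV
    by (subst sum.inter_filter) (auto simp: finite_PiE intro!: sum.cong prod.cong)
  also have "\<dots> = (\<Sum>\<phi>\<in>glue_map ?R ` ?V \<rightarrow>\<^sub>E {..<n}. ?H (restrict (\<phi> \<circ> glue_map ?R) ?V))"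
  proof (intro sum.cong refl if_cong)
    fix \<phi> :: "nat \<Rightarrow> nat"
    have "glue_map ?R v = glue_map ?R w \<longleftrightarrow> ?R v w" if "v \<in> ?V" for v w
      using that by (simp only: glue_map_eq_iff equivclp_same_block[OF \<pi>])
    moreover have "inj_on \<phi> (glue_map ?R ` ?V) \<longleftrightarrow> (\<forall>v\<in>?V. \<forall>w\<in>?V.
        \<phi> (glue_map ?R v) = \<phi> (glue_map ?R w) \<longrightarrow> glue_map ?R v = glue_map ?R w)"
      unfolding inj_on_def by blast
    ultimately show "inj_on \<phi> (glue_map ?R ` ?V) \<longleftrightarrow> (\<forall>v\<in>?V. \<forall>w\<in>?V.
        restrict (\<phi> \<circ> glue_map ?R) ?V v = restrict (\<phi> \<circ> glue_map ?R) ?V w \<longrightarrow> ?R v w)"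
      by (simp only: o_apply restrict_apply' cong: ball_cong)
  qed
  also have "\<dots> = (\<Sum>\<psi> | \<psi> \<in> ?V \<rightarrow>\<^sub>E {..<n} \<and> (\<forall>x y. ?R x y \<longrightarrow> \<psi> x = \<psi> y). ?H \<psi>)"
    by (rule sum_glue[OF R])
  also have "\<dots> = (\<Sum>\<phi> | \<phi> \<in> ?V \<rightarrow>\<^sub>E {..<n} \<and> kernel_partition ?V \<phi> = \<pi>. ?W \<phi>)"
  proof -
    have "finite (?V \<rightarrow>\<^sub>E {..<n})" using finV by (intro finite_PiE) auto
    then have "finite {\<psi>. \<psi> \<in> ?V \<rightarrow>\<^sub>E {..<n} \<and> (\<forall>x y. ?R x y \<longrightarrow> \<psi> x = \<psi> y)}"
      by (rule rev_finite_subset) blast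
    moreover have "{\<phi>. \<phi> \<in> ?V \<rightarrow>\<^sub>E {..<n} \<and> kernel_partition ?V \<phi> = \<pi>} =
        {\<psi> \<in> {\<psi>. \<psi> \<in> ?V \<rightarrow>\<^sub>E {..<n} \<and> (\<forall>x y. ?R x y \<longrightarrow> \<psi> x = \<psi> y)}.
           \<forall>v\<in>?V. \<forall>w\<in>?V. \<psi> v = \<psi> w \<longrightarrow> ?R v w}"
      unfolding ker by blast
    ultimately show ?thesis by (simp only: sum.inter_filter)
  qed
  finally show ?thesis .
qed

lemma finite_partitions: "finite V \<Longrightarrow> finite {\<pi>. partition_on V \<pi>}"
  by (rule finite_subset[of _ "Pow (Pow V)"]) (auto simp: partition_on_def)

text \<open>Group all maps by their kernel.\<close>

lemma vertex_sum_eq_sum_inj: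
  assumes "is_test_graph T"
  shows "vertex_sum n B T =
    (\<Sum>\<pi> | partition_on (verts (fst T)) \<pi>. inj_vertex_sum n B (quotient_graph \<pi> T))"
proof -
  let ?V = "verts (fst T)"
  have finV: "finite ?V" using assms fin_digraph.finite_verts by (auto simp: is_test_graph_def)
  then have fin: "finite (?V \<rightarrow>\<^sub>E {..<n})" by (intro finite_PiE) auto
  show ?thesis
    unfolding vertex_sum_def using partition_on_kernel
    by (subst sum.group[OF fin finite_partitions[OF finV], of "kernel_partition ?V", symmetric])
      (auto simp: inj_vertex_sum_quotient[OF assms])
qed

text \<open>After exchanging the sums over \<open>\<pi>\<close> and \<open>\<phi>\<close>, each map
  is weighted by the Moebius sum over the partitions below its kernel, which removes the
  non-injective maps. So the abstract injective version is a sum over injective maps.\<close>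

lemma injective_version_vertex_sum:
  assumes "is_test_graph T"
  shows "injective_version (vertex_sum n B) T = inj_vertex_sum n B T"
proof -
  let ?V = "verts (fst T)" and ?P = "{\<pi>. partition_on (verts (fst T)) \<pi>}"
  let ?W = "\<lambda>\<phi>. \<Prod>e\<in>arcs (fst T). B (snd T e) (\<phi> (head (fst T) e)) (\<phi> (tail (fst T) e))"
  let ?\<mu> = "partition_moebius ?V ((\<lambda>v. {v}) ` ?V)"
  have finV: "finite ?V" using assms fin_digraph.finite_verts by (auto simp: is_test_graph_def)
  then have finP: "finite ?P" by (rule finite_partitions)
  have "injective_version (vertex_sum n B) T = (\<Sum>\<pi>\<in>?P. \<Sum>\<phi>\<in>?V \<rightarrow>\<^sub>E {..<n}.
      ?W \<phi> * of_int (if block_constant \<pi> \<phi> then ?\<mu> \<pi> else 0))"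
    unfolding injective_version_def
  proof (rule sum.cong[OF refl], goal_cases)
    case (1 \<pi>)
    then have \<pi>: "partition_on ?V \<pi>" by simp
    show ?case
      unfolding vertex_sum_quotient[OF assms \<pi>] sum_distrib_right
      by (rule sum.cong[OF refl]) simp
  qed
  also have "\<dots> = (\<Sum>\<phi>\<in>?V \<rightarrow>\<^sub>E {..<n}. ?W \<phi> *
      of_int (\<Sum>\<pi>\<in>?P. if block_constant \<pi> \<phi> then ?\<mu> \<pi> else 0))"
    by (subst sum.swap) (simp add: sum_distrib_left)
  also have "\<dots> = (\<Sum>\<phi>\<in>?V \<rightarrow>\<^sub>E {..<n}. ?W \<phi> * of_int (if inj_on \<phi> ?V then 1 else 0))"
  proof (rule sum.cong[OF refl])
    fix \<phi> :: "nat \<Rightarrow> nat"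
    have "(\<Sum>\<pi>\<in>?P. if block_constant \<pi> \<phi> then ?\<mu> \<pi> else 0) =
        (if inj_on \<phi> ?V then 1 else 0)"
      by (subst sum.inter_filter[OF finP, symmetric])
        (simp only: mem_Collect_eq sum_partition_moebius_kernel[OF finV])
    then show "?W \<phi> * of_int (\<Sum>\<pi>\<in>?P. if block_constant \<pi> \<phi> then ?\<mu> \<pi> else 0) =
        ?W \<phi> * of_int (if inj_on \<phi> ?V then 1 else 0)"
      by (simp only:)
  qed
  also have "\<dots> = inj_vertex_sum n B T"
    unfolding inj_vertex_sum_def using finV
    by (subst sum.inter_filter) (auto intro!: sum.cong finite_PiE)
  finally show ?thesis .
qed


section \<open>Pairings of edges\<close>

definition ends :: "('v, 'e) pre_digraph \<Rightarrow> 'e \<Rightarrow> 'v set" where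
  "ends G e = {tail G e, head G e}"

definition loop_arcs :: "('v, 'e) pre_digraph \<Rightarrow> 'e set" where
  "loop_arcs G = {e\<in>arcs G. tail G e = head G e}"

definition link_arcs :: "('v, 'e) pre_digraph \<Rightarrow> 'e set" where
  "link_arcs G = {e\<in>arcs G. tail G e \<noteq> head G e}"

text \<open>Nested ends are what two edges need in order to carry the same Wigner entry in a
  dominant term: two non-loops with the same ends, a loop at an end of a non-loop (its row-sum index
  being the other end), or two loops at the same vertex.\<close>

definition is_pair :: "('v, 'e) pre_digraph \<Rightarrow> ('e \<Rightarrow> 'k) \<Rightarrow> 'e set \<Rightarrow> bool" where
  "is_pair G c B \<longleftrightarrow> card B = 2 \<and>
     (\<forall>e\<in>B. \<forall>e'\<in>B. c e = c e' \<and> (ends G e \<subseteq> ends G e' \<or> ends G e' \<subseteq> ends G e))"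

definition pairings :: "('v, 'e) pre_digraph \<Rightarrow> ('e \<Rightarrow> 'k) \<Rightarrow> 'e set set set" where
  "pairings G c = {m. partition_on (arcs G) m \<and> (\<forall>B\<in>m. is_pair G c B)}"

definition link_blocks :: "('v, 'e) pre_digraph \<Rightarrow> 'e set set \<Rightarrow> 'e set set" where
  "link_blocks G m = {B\<in>m. B \<inter> link_arcs G \<noteq> {}}"

text \<open>The non-loops of a block share their ends, so a block containing one acts as an edge on
  the vertices. These edges connect the vertices of a test graph, so the cardinality condition says
  that they form a spanning tree.\<close>

definition tree_pairings :: "('v, 'e) pre_digraph \<Rightarrow> ('e \<Rightarrow> 'k) \<Rightarrow> 'e set set set" where
  "tree_pairings G c = {m\<in>pairings G c. card (link_blocks G m) + 1 = card (verts G)}"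

lemma arcs_split: "arcs G = loop_arcs G \<union> link_arcs G" "loop_arcs G \<inter> link_arcs G = {}"
  by (auto simp: loop_arcs_def link_arcs_def)

lemma finite_tree_pairings: "finite (arcs G) \<Longrightarrow> finite (tree_pairings G c)"
  by (rule finite_subset[OF _ finite_partitions]) (auto simp: tree_pairings_def pairings_def)

lemma card_ends_link: "e \<in> link_arcs G \<Longrightarrow> card (ends G e) = 2"
  by (auto simp: link_arcs_def ends_def)

lemma ends_loop: "e \<in> loop_arcs G \<Longrightarrow> ends G e = {head G e}"
  by (auto simp: loop_arcs_def ends_def)

lemma ends_eq_of_nested:
  assumes "e \<in> link_arcs G" "e' \<in> link_arcs G" "ends G e \<subseteq> ends G e' \<or> ends G e' \<subseteq> ends G e"
  shows "ends G e = ends G e'"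
  using assms card_ends_link[of e G] card_ends_link[of e' G]
    card_subset_eq[of "ends G e" "ends G e'"] card_subset_eq[of "ends G e'" "ends G e"]
  by (auto simp: ends_def)

lemma card_verts_le_ends:
  assumes "is_test_graph (G, l)"
  shows "card (verts G) \<le> card (ends G ` link_arcs G) + 1"
proof (rule card_le_of_cut)
  interpret fin_digraph G using assms by (simp add: is_test_graph_def)
  show "finite (verts G)" "finite (ends G ` link_arcs G)" "verts G \<noteq> {}"
    using assms by (auto simp: is_test_graph_iff_cut link_arcs_def)
  show "X \<subseteq> verts G \<and> card X \<le> 2" if "X \<in> ends G ` link_arcs G" for X
    using that by (auto simp: ends_def link_arcs_def)
  show "verts G \<subseteq> S \<or> verts G \<inter> S = {}" if "\<forall>X\<in>ends G ` link_arcs G. X \<subseteq> S \<or> X \<inter> S = {}" for S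
  proof -
    have "tail G e \<in> S \<longleftrightarrow> head G e \<in> S" if "e \<in> arcs G" for e
      using that \<open>\<forall>X\<in>_. _\<close> by (cases "tail G e = head G e") (auto simp: ends_def link_arcs_def)
    then show ?thesis using assms by (auto simp: is_test_graph_iff_cut)
  qed
qed

text \<open>The colour and position of the Wigner entry carried by \<open>e\<close> once the row
  sums at loops are expanded, with \<open>\<kappa> e\<close> the index of the chosen summand.
  Positions are unordered because the matrices are symmetric, so edges with equal keys carry the
  same random variable.\<close>

definition edge_key :: "('v, 'e) pre_digraph \<Rightarrow> ('e \<Rightarrow> 'k) \<Rightarrow> ('v \<Rightarrow> 'x) \<Rightarrow> ('e \<Rightarrow> 'x) \<Rightarrow> 'e \<Rightarrow> 'k \<times> 'x set" where
  "edge_key G c \<phi> \<kappa> e = (c e, {\<phi> (head G e), if tail G e = head G e then \<kappa> e else \<phi> (tail G e)})"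

text \<open>\<open>realises\<close> describes the maps whose edge keys coincide exactly within the blocks of the tree pairing \<open>m\<close>.\<close>

definition realises :: "('v, 'e) pre_digraph \<Rightarrow> 'e set set \<Rightarrow> ('v \<Rightarrow> 'x) \<Rightarrow> ('e \<Rightarrow> 'x) \<Rightarrow> bool" where
  "realises G m \<phi> \<kappa> \<longleftrightarrow>
     (\<forall>B\<in>m. \<forall>d\<in>B \<inter> loop_arcs G. \<forall>e\<in>B \<inter> link_arcs G. {\<phi> (head G d), \<kappa> d} = \<phi> ` ends G e) \<and>
     (\<forall>B\<in>m. B \<subseteq> loop_arcs G \<longrightarrow> (\<forall>d\<in>B. \<kappa> d \<notin> \<phi> ` verts G)) \<and>
     (\<forall>B\<in>m. \<forall>B'\<in>m. B \<subseteq> loop_arcs G \<longrightarrow> B' \<subseteq> loop_arcs G \<longrightarrow>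
        (\<forall>d\<in>B. \<forall>d'\<in>B'. \<kappa> d = \<kappa> d' \<longleftrightarrow> B = B'))"

section \<open>Index maps with the maximal number of free indices\<close>

locale edge_pattern =
  fixes G :: "(nat, nat) pre_digraph" and l :: "nat \<Rightarrow> 's" and c :: "nat \<Rightarrow> 'k"
    and \<phi> :: "nat \<Rightarrow> 'x" and \<kappa> :: "nat \<Rightarrow> 'x"
  assumes test: "is_test_graph (G, l)" and inj: "inj_on \<phi> (verts G)"
begin

sublocale fin_digraph G using test by (simp add: is_test_graph_def)

abbreviation "key \<equiv> edge_key G c \<phi> \<kappa>"
abbreviation "U \<equiv> \<phi> ` verts G \<union> \<kappa> ` loop_arcs G"
abbreviation "\<phi>V \<equiv> \<phi> ` verts G"

lemma fst_key [simp]: "fst (key e) = c e"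
  by (simp add: edge_key_def)

lemma snd_key_link: "e \<in> link_arcs G \<Longrightarrow> snd (key e) = \<phi> ` ends G e"
  by (auto simp: edge_key_def link_arcs_def ends_def)

lemma snd_key_loop: "d \<in> loop_arcs G \<Longrightarrow> snd (key d) = {\<phi> (head G d), \<kappa> d}"
  by (auto simp: edge_key_def loop_arcs_def)

lemma key_eq_iff: "key e = key e' \<longleftrightarrow> c e = c e' \<and> snd (key e) = snd (key e')"
  by (simp add: prod_eq_iff)

lemma ends_subset: "e \<in> arcs G \<Longrightarrow> ends G e \<subseteq> verts G"
  by (auto simp: ends_def)

lemma finite_loop_arcs: "finite (loop_arcs G)"
  by (auto simp: link_arcs_def loop_arcs_def)

lemma link_in_arcs: "e \<in> link_arcs G \<Longrightarrow> e \<in> arcs G" and loop_in_arcs: "d \<in> loop_arcs G \<Longrightarrow> d \<in> arcs G"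
  by (auto simp: link_arcs_def loop_arcs_def)

lemma phi_image_ends_eq:
  "e \<in> arcs G \<Longrightarrow> e' \<in> arcs G \<Longrightarrow> \<phi> ` ends G e = \<phi> ` ends G e' \<longleftrightarrow> ends G e = ends G e'"
  using inj ends_subset inj_on_image_eq_iff by metis

lemma card_snd_key_link: "e \<in> link_arcs G \<Longrightarrow> card (snd (key e)) = 2"
  using card_ends_link[of e G] ends_subset[OF link_in_arcs] inj
  by (metis snd_key_link card_image inj_on_subset)

lemma head_in_phiV: "d \<in> arcs G \<Longrightarrow> \<phi> (head G d) \<in> \<phi>V"
  by auto

text \<open>Keys are sorted by their role in the count. Link keys hold the graph together; new keys
  belong to loops whose summation index is not the value of a vertex, and only they enlarge the set
  of index values; the remaining keys, among them the diagonal ones, do neither.\<close>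

definition "link_keys = key ` link_arcs G"
definition "new_keys = key ` {d\<in>loop_arcs G. \<kappa> d \<notin> \<phi>V}"
definition "other_keys = key ` arcs G - link_keys - new_keys"

lemma new_key_notin_link: "d \<in> loop_arcs G \<Longrightarrow> \<kappa> d \<notin> \<phi>V \<Longrightarrow> key d \<notin> link_keys"
proof
  assume d: "d \<in> loop_arcs G" "\<kappa> d \<notin> \<phi>V" and "key d \<in> link_keys"
  then obtain e where e: "e \<in> link_arcs G" "key d = key e" by (auto simp: link_keys_def)
  then have "\<kappa> d \<in> \<phi> ` ends G e" using snd_key_loop[OF d(1)] snd_key_link[OF e(1)] by simp
  then show False using d(2) ends_subset[OF link_in_arcs[OF e(1)]] by blast
qed

lemma keys_split:
  "key ` arcs G = link_keys \<union> new_keys \<union> other_keys" "link_keys \<inter> new_keys = {}"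
  "(link_keys \<union> new_keys) \<inter> other_keys = {}"
  "finite link_keys" "finite new_keys" "finite other_keys"
proof -
  have "link_keys \<subseteq> key ` arcs G" "new_keys \<subseteq> key ` arcs G"
    by (auto simp: link_keys_def new_keys_def link_arcs_def loop_arcs_def)
  then show "key ` arcs G = link_keys \<union> new_keys \<union> other_keys"
    "finite link_keys" "finite new_keys" "finite other_keys"
    by (auto simp: other_keys_def dest: finite_subset)
  show "link_keys \<inter> new_keys = {}" using new_key_notin_link by (auto simp: new_keys_def)
  show "(link_keys \<union> new_keys) \<inter> other_keys = {}" by (auto simp: other_keys_def)
qed

abbreviation "key_mult x \<equiv> card {e\<in>arcs G. key e = x}"

lemma card_arcs_eq: "card (arcs G) = (\<Sum>x\<in>key ` arcs G. key_mult x)"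
  using sum.image_gen[OF finite_arcs, of "\<lambda>_. 1::nat" key] by simp

lemma mult_pos: "x \<in> key ` arcs G \<Longrightarrow> 1 \<le> key_mult x"
  by (auto simp: Suc_le_eq card_gt_0_iff)

lemma card_link_keys: "card (verts G) \<le> card link_keys + 1"
proof -
  have "card (ends G ` link_arcs G) = card ((`) \<phi> ` ends G ` link_arcs G)"
  proof (rule card_image[symmetric])
    have "ends G ` link_arcs G \<subseteq> Pow (verts G)" using ends_subset[OF link_in_arcs] by blast
    then show "inj_on ((`) \<phi>) (ends G ` link_arcs G)"
      using inj_on_image_Pow[OF inj] inj_on_subset by blast
  qed
  also have "(`) \<phi> ` ends G ` link_arcs G = snd ` link_keys"
    unfolding link_keys_def image_image by (rule image_cong[OF refl]) (rule snd_key_link[symmetric])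
  also have "card \<dots> \<le> card link_keys" by (intro card_image_le keys_split)
  finally show ?thesis using card_verts_le_ends[OF test] by linarith
qed

text \<open>For a new key the difference is a singleton. Two new keys may still share this value,
  through loops at different vertices or of different colours; only the extremal case will exclude
  it.\<close>

definition "new_vertex x = the_elem (snd x - \<phi>V)"

lemma new_vertex_key: "d \<in> loop_arcs G \<Longrightarrow> \<kappa> d \<notin> \<phi>V \<Longrightarrow> new_vertex (key d) = \<kappa> d"
proof -
  assume d: "d \<in> loop_arcs G" "\<kappa> d \<notin> \<phi>V"
  then have "snd (key d) - \<phi>V = {\<kappa> d}"
    unfolding snd_key_loop[OF d(1)] using head_in_phiV[OF loop_in_arcs[OF d(1)]] by (simp add: insert_Diff_if)
  then show ?thesis by (simp add: new_vertex_def)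
qed

lemma new_vertices: "U - \<phi>V = new_vertex ` new_keys"
  unfolding new_keys_def image_image using new_vertex_key by (auto simp: image_iff)

lemma card_U: "card U = card (verts G) + card (new_vertex ` new_keys)"
proof -
  have "card U = card \<phi>V + card (U - \<phi>V)"
    using finite_loop_arcs by (subst card_Un_disjoint[symmetric]) (auto intro!: arg_cong[of _ _ card])
  then show ?thesis using new_vertices card_image[OF inj] by simp
qed

text \<open>Every term with nonzero expectation satisfies this assumption: an off-diagonal position
  used by a single edge contributes the mean of a centered entry as a factor.\<close>

context
  assumes multiplicity: "\<And>e. e \<in> arcs G \<Longrightarrow> card (snd (key e)) = 2 \<Longrightarrow> 2 \<le> key_mult (key e)"
begin

lemma mult_ge_2: "x \<in> link_keys \<union> new_keys \<Longrightarrow> 2 \<le> key_mult x"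
proof -
  assume "x \<in> link_keys \<union> new_keys"
  then consider e where "e \<in> link_arcs G" "x = key e"
    | d where "d \<in> loop_arcs G" "\<kappa> d \<notin> \<phi>V" "x = key d"
    by (auto simp: link_keys_def new_keys_def)
  then show ?thesis
  proof cases
    case 1
    then show ?thesis using multiplicity[of e] card_snd_key_link link_in_arcs by auto
  next
    case 2
    then have "\<kappa> d \<noteq> \<phi> (head G d)" using head_in_phiV[OF loop_in_arcs, of d] by metis
    then show ?thesis using 2 multiplicity[of d] loop_in_arcs by (auto simp: snd_key_loop)
  qed
qed

text \<open>The weight of the remaining keys is only 1, since a diagonal position may occur once.
  This is enough because these keys add no index value.\<close>

lemma sum_lower:
  "(\<Sum>x\<in>key ` arcs G. if x \<in> other_keys then 1 else 2) =
     2 * card link_keys + 2 * card new_keys + card other_keys"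
proof -
  have "(\<Sum>x\<in>key ` arcs G. if x \<in> other_keys then 1 else 2::nat) =
      (\<Sum>x\<in>link_keys \<union> new_keys. if x \<in> other_keys then 1 else 2) +
      (\<Sum>x\<in>other_keys. if x \<in> other_keys then 1 else 2)"
    unfolding keys_split(1) using keys_split by (intro sum.union_disjoint) auto
  also have "(\<Sum>x\<in>link_keys \<union> new_keys. if x \<in> other_keys then 1 else 2::nat) =
      (\<Sum>x\<in>link_keys \<union> new_keys. 2)"
    using keys_split(3) by (intro sum.cong) auto
  finally show ?thesis using keys_split by (simp add: card_Un_disjoint)
qed

lemma lower_le: "x \<in> key ` arcs G \<Longrightarrow> (if x \<in> other_keys then 1 else 2) \<le> key_mult x"
  using mult_ge_2[of x] mult_pos[of x] keys_split(1) by (cases "x \<in> other_keys") auto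

lemma card_arcs_ge: "2 * card link_keys + 2 * card new_keys + card other_keys \<le> card (arcs G)"
  unfolding card_arcs_eq sum_lower[symmetric] by (rule sum_mono[OF lower_le])

text \<open>The normalisation is \<open>n\<close> to the power \<open>-1 - E/2\<close>, so a family
  of terms with \<open>card U\<close> free indices can only survive if \<open>card U\<close> is at
  least \<open>1 + E/2\<close>.\<close>

context
  assumes tight: "card (arcs G) + 2 \<le> 2 * card U"
begin

text \<open>The estimates chain up to \<open>2 * card U \<le> 2 * (card link_keys + 1) + 2 * card
  new_keys \<le> card (arcs G) + 2\<close>. With \<open>tight\<close> the chain closes, so each
  estimate in it is an equality, including the lower bound on every single multiplicity.\<close>

lemma tight_facts:
  "other_keys = {}" "card link_keys + 1 = card (verts G)" "inj_on new_vertex new_keys"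
  "\<And>x. x \<in> key ` arcs G \<Longrightarrow> key_mult x = 2"
proof -
  have le: "card (new_vertex ` new_keys) \<le> card new_keys" by (intro card_image_le keys_split)
  have *: "card other_keys = 0" "card link_keys + 1 = card (verts G)"
    "card (new_vertex ` new_keys) = card new_keys"
    "card (arcs G) = 2 * card link_keys + 2 * card new_keys + card other_keys"
    using le card_arcs_ge card_U card_link_keys tight by linarith+
  then show o: "other_keys = {}" using keys_split by simp
  show "card link_keys + 1 = card (verts G)" by fact
  show "inj_on new_vertex new_keys" using * keys_split by (intro eq_card_imp_inj_on) auto
  have "(\<Sum>x\<in>key ` arcs G. if x \<in> other_keys then 1 else 2) = (\<Sum>x\<in>key ` arcs G. key_mult x)"
    using *(4) by (simp only: sum_lower card_arcs_eq)
  from sum_mono_inv[OF this lower_le] show "key_mult x = 2" if "x \<in> key ` arcs G" for x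
    using that o by auto
qed

lemma loop_pair_new:
  assumes "d \<in> loop_arcs G" "key d \<notin> link_keys"
  shows "\<kappa> d \<notin> \<phi>V"
proof
  assume "\<kappa> d \<in> \<phi>V"
  have "key d \<in> new_keys" using assms tight_facts(1) loop_in_arcs keys_split(1) by blast
  then obtain d' where d': "d' \<in> loop_arcs G" "\<kappa> d' \<notin> \<phi>V" "key d = key d'"
    by (auto simp: new_keys_def)
  then have "\<kappa> d' \<in> {\<phi> (head G d), \<kappa> d}"
    using snd_key_loop[OF assms(1)] snd_key_loop[OF d'(1)] by auto
  then show False using d' \<open>\<kappa> d \<in> \<phi>V\<close> head_in_phiV[OF loop_in_arcs[OF assms(1)]] by auto
qed

lemma nested_of_key_eq:
  assumes e: "e \<in> arcs G" "e' \<in> arcs G" "key e = key e'"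
  shows "ends G e \<subseteq> ends G e' \<or> ends G e' \<subseteq> ends G e"
proof -
  have mixed: "ends G d \<subseteq> ends G f" if "d \<in> loop_arcs G" "f \<in> link_arcs G" "key d = key f" for d f
  proof -
    have "\<phi> (head G d) \<in> \<phi> ` ends G f"
      using snd_key_loop[OF that(1)] snd_key_link[OF that(2)] that(3) by auto
    then have "head G d \<in> ends G f"
      using inj ends_subset[OF link_in_arcs[OF that(2)]] loop_in_arcs[OF that(1)]
      by (metis inj_on_image_mem_iff head_in_verts)
    then show ?thesis using ends_loop[OF that(1)] by simp
  qed
  consider "e \<in> link_arcs G" "e' \<in> link_arcs G" | "e \<in> loop_arcs G" "e' \<in> link_arcs G"
    | "e \<in> link_arcs G" "e' \<in> loop_arcs G" | "e \<in> loop_arcs G" "e' \<in> loop_arcs G"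
    using e arcs_split(1)[of G] by blast
  then show ?thesis
  proof cases
    case 1
    then show ?thesis using e phi_image_ends_eq[of e e'] snd_key_link by (metis order_refl)
  next
    case 2
    then show ?thesis using mixed e by blast
  next
    case 3
    then show ?thesis using mixed[of e' e] e by simp
  next
    case 4
    show ?thesis
    proof (cases "key e \<in> link_keys")
      \<comment> \<open>A non-loop with the same key would be a third edge besides two distinct
        loops, against multiplicity two. Hence the two loops are equal.\<close>
      case True
      then obtain f where f: "f \<in> link_arcs G" "key f = key e" by (auto simp: link_keys_def)
      then have "{e, e', f} \<subseteq> {g\<in>arcs G. key g = key e}" using e link_in_arcs by auto
      moreover have "key_mult (key e) = 2" using tight_facts(4) e by blast
      ultimately have "card {e, e', f} \<le> 2" by (metis (no_types, lifting) card_mono card.infinite zero_neq_numeral)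
      moreover have "f \<noteq> e" "f \<noteq> e'" using 4 f arcs_split(2)[of G] by auto
      ultimately have "e = e'" by (cases "e = e'") auto
      then show ?thesis by simp
    next
      \<comment> \<open>The new index is not the value of any vertex, so equality of the two-element
        sets matches vertex with vertex and new index with new index.\<close>
      case False
      then have "\<kappa> e \<notin> \<phi>V" "\<kappa> e' \<notin> \<phi>V" using loop_pair_new 4 e by auto
      moreover have "\<phi> (head G e) \<in> \<phi>V" "\<phi> (head G e') \<in> \<phi>V" using e by auto
      moreover have "{\<phi> (head G e), \<kappa> e} = {\<phi> (head G e'), \<kappa> e'}" using 4 e snd_key_loop by metis
      ultimately have "\<phi> (head G e) = \<phi> (head G e')" by (metis doubleton_eq_iff)
      then have "head G e = head G e'" using inj e by (auto dest: inj_onD)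
      then show ?thesis using 4 by (simp add: ends_loop)
    qed
  qed
qed

text \<open>The blocks are the classes of equal keys. Those containing a non-loop correspond
  bijectively to link keys, so \<open>tight_facts\<close> supplies both the block size and the tree
  count.\<close>

lemma tight_tree_pairing: "kernel_partition (arcs G) key \<in> tree_pairings G c"
proof -
  let ?m = "kernel_partition (arcs G) key"
  have "is_pair G c B" if "B \<in> ?m" for B
  proof -
    from that obtain e where e: "e \<in> arcs G" "B = {e'\<in>arcs G. key e' = key e}"
      by (auto simp: kernel_partition_def)
    then have "card B = 2" using tight_facts(4)[of "key e"] by simp
    moreover have "c f = c g" if "f \<in> B" "g \<in> B" for f g using that e by (metis (mono_tags, lifting) fst_key mem_Collect_eq)
    moreover have "ends G f \<subseteq> ends G g \<or> ends G g \<subseteq> ends G f" if "f \<in> B" "g \<in> B" for f g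
      using that e by (intro nested_of_key_eq) auto
    ultimately show ?thesis unfolding is_pair_def by blast
  qed
  moreover have "link_blocks G ?m = (\<lambda>x. {e\<in>arcs G. key e = x}) ` link_keys"
  proof (intro Set.set_eqI iffI)
    fix B assume "B \<in> link_blocks G ?m"
    then obtain e f where "B = {e'\<in>arcs G. key e' = key e}" "f \<in> B" "f \<in> link_arcs G"
      by (auto simp: link_blocks_def kernel_partition_def)
    then have "B = {e'\<in>arcs G. key e' = key f}" "f \<in> link_arcs G" by auto
    then show "B \<in> (\<lambda>x. {e\<in>arcs G. key e = x}) ` link_keys" unfolding link_keys_def by blast
  next
    fix B assume "B \<in> (\<lambda>x. {e\<in>arcs G. key e = x}) ` link_keys"
    then obtain f where f: "f \<in> link_arcs G" "B = {e\<in>arcs G. key e = key f}"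
      by (auto simp: link_keys_def)
    then have "f \<in> B" "B \<in> ?m" using link_in_arcs by (auto simp: kernel_partition_def)
    then show "B \<in> link_blocks G ?m" using f by (auto simp: link_blocks_def)
  qed
  moreover have "inj_on (\<lambda>x. {e\<in>arcs G. key e = x}) link_keys"
  proof (rule inj_onI)
    fix x y assume xy: "x \<in> link_keys" "y \<in> link_keys" "{e\<in>arcs G. key e = x} = {e\<in>arcs G. key e = y}"
    then obtain e where "e \<in> {e\<in>arcs G. key e = x}" "key e = x" using link_in_arcs by (auto simp: link_keys_def)
    then show "x = y" using xy by simp
  qed
  ultimately show ?thesis
    using partition_on_kernel tight_facts(2)
    by (auto simp: tree_pairings_def pairings_def card_image)
qed

lemma tight_realises: "realises G (kernel_partition (arcs G) key) \<phi> \<kappa>"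
proof -
  let ?m = "kernel_partition (arcs G) key"
  have eq: "key e = key e'" if "B \<in> ?m" "e \<in> B" "e' \<in> B" for B e e'
    using that by (auto simp: kernel_partition_def)
  have B_eq: "B = {e'\<in>arcs G. key e' = key e}" if "B \<in> ?m" "e \<in> B" for B e
    using that by (auto simp: kernel_partition_def)
  have nolink: "key d \<notin> link_keys" if "B \<in> ?m" "B \<subseteq> loop_arcs G" "d \<in> B" for B d
    using that B_eq[OF that(1,3)] arcs_split(2)[of G] by (auto simp: link_keys_def link_arcs_def)
  have "{\<phi> (head G d), \<kappa> d} = \<phi> ` ends G e"
    if "B \<in> ?m" "d \<in> B \<inter> loop_arcs G" "e \<in> B \<inter> link_arcs G" for B d e
    using eq[OF that(1), of d e] that snd_key_loop snd_key_link by (metis IntD1 IntD2)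
  moreover have new: "\<kappa> d \<notin> \<phi>V" if "B \<in> ?m" "B \<subseteq> loop_arcs G" "d \<in> B" for B d
    using loop_pair_new nolink[OF that] that by auto
  moreover have "\<kappa> d = \<kappa> d' \<longleftrightarrow> B = B'"
    if B: "B \<in> ?m" "B' \<in> ?m" "B \<subseteq> loop_arcs G" "B' \<subseteq> loop_arcs G" "d \<in> B" "d' \<in> B'" for B B' d d'
  proof
    \<comment> \<open>Here the injectivity of \<open>new_vertex\<close> enters: different new keys
      do not share their new index.\<close>
    assume "\<kappa> d = \<kappa> d'"
    then have "new_vertex (key d) = new_vertex (key d')"
      using new_vertex_key new B by (metis subsetD)
    moreover have "key d \<in> new_keys" "key d' \<in> new_keys"
      using new B unfolding new_keys_def by blast+
    ultimately have "key d = key d'" using tight_facts(3) by (auto dest: inj_onD)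
    then show "B = B'" using B_eq[OF B(1,5)] B_eq[OF B(2,6)] by simp
  next
    assume "B = B'"
    then have "key d = key d'" using eq B by blast
    then have "{\<phi> (head G d), \<kappa> d} = {\<phi> (head G d'), \<kappa> d'}"
      using B snd_key_loop by (metis subsetD)
    moreover have "\<kappa> d \<notin> \<phi>V" "\<kappa> d' \<notin> \<phi>V" using new B by metis+
    moreover have "d \<in> arcs G" "d' \<in> arcs G" using B loop_in_arcs by blast+
    then have "\<phi> (head G d) \<in> \<phi>V" "\<phi> (head G d') \<in> \<phi>V" by (auto intro!: imageI)
    ultimately show "\<kappa> d = \<kappa> d'" by (metis doubleton_eq_iff)
  qed
  ultimately show ?thesis unfolding realises_def by (intro conjI ballI impI) assumption+
qed

end
end

text \<open>This is the converse of \<open>tight_realises\<close>: a realising map has no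
  coincidences beyond those of \<open>m\<close>, so the sets of realising maps are disjoint for
  different \<open>m\<close>. Moreover all its positions are off-diagonal and used exactly twice,
  whence only variances appear, and the diagonal summand of weight \<open>p\<close> at a loop is
  never chosen.\<close>

lemma realises_key:
  assumes real: "realises G m \<phi> \<kappa>" and m: "m \<in> tree_pairings G c"
  shows "kernel_partition (arcs G) key = m" (is ?A)
    and "\<And>e. e \<in> arcs G \<Longrightarrow> card (snd (key e)) = 2"
    and "\<And>e. e \<in> loop_arcs G \<Longrightarrow> \<kappa> e \<noteq> \<phi> (head G e)"
proof -
  have part: "partition_on (arcs G) m" and pair: "\<And>B. B \<in> m \<Longrightarrow> is_pair G c B"
    and links: "card (link_blocks G m) + 1 = card (verts G)"
    using m by (auto simp: tree_pairings_def pairings_def)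
  have r1: "{\<phi> (head G d), \<kappa> d} = \<phi> ` ends G e"
    if "B \<in> m" "d \<in> B" "d \<in> loop_arcs G" "e \<in> B" "e \<in> link_arcs G" for B d e
    using conjunct1[OF real[unfolded realises_def]] that by blast
  have r2: "\<kappa> d \<notin> \<phi>V" if "B \<in> m" "B \<subseteq> loop_arcs G" "d \<in> B" for B d
    using conjunct1[OF conjunct2[OF real[unfolded realises_def]]] that by blast
  have r3: "\<kappa> d = \<kappa> d' \<longleftrightarrow> B = B'"
    if "B \<in> m" "B' \<in> m" "B \<subseteq> loop_arcs G" "B' \<subseteq> loop_arcs G" "d \<in> B" "d' \<in> B'" for B B' d d'
    using conjunct2[OF conjunct2[OF real[unfolded realises_def]]] that by metis
  have sub: "B \<subseteq> arcs G" if "B \<in> m" for B using part that by (auto simp: partition_on_def)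
  have nonlink: "B \<subseteq> loop_arcs G" if "B \<in> m" "B \<notin> link_blocks G m" for B
    using that sub[OF that(1)] arcs_split(1)[of G] by (auto simp: link_blocks_def)
  have same: "key e = key e'" if B: "B \<in> m" "e \<in> B" "e' \<in> B" for B e e'
  proof -
    have ce: "c e = c e'" and nest: "ends G e \<subseteq> ends G e' \<or> ends G e' \<subseteq> ends G e"
      using pair[OF B(1)] B unfolding is_pair_def by blast+
    consider "e \<in> link_arcs G" "e' \<in> link_arcs G" | "e \<in> loop_arcs G" "e' \<in> link_arcs G"
      | "e \<in> link_arcs G" "e' \<in> loop_arcs G" | "e \<in> loop_arcs G" "e' \<in> loop_arcs G"
      using sub B arcs_split(1)[of G] by blast
    then have "snd (key e) = snd (key e')"
    proof cases
      case 1
      then show ?thesis using ends_eq_of_nested[OF 1 nest] by (simp add: snd_key_link)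
    next
      case 2
      then show ?thesis using r1 B by (simp add: snd_key_link snd_key_loop)
    next
      case 3
      then show ?thesis using r1[of B e' e] B by (simp add: snd_key_link snd_key_loop)
    next
      case 4
      show ?thesis
      proof (cases "e = e'")
        case False
        have "card B = 2" using pair[OF B(1)] by (simp add: is_pair_def)
        then have "B = {e, e'}" using B False
          by (metis card_2_iff doubleton_eq_iff insert_iff singletonD)
        then have "B \<subseteq> loop_arcs G" using 4 by auto
        then have "\<kappa> e = \<kappa> e'" using r3 B by blast
        moreover have "head G e = head G e'" using nest 4 by (auto simp: ends_loop)
        ultimately show ?thesis using 4 by (simp add: snd_key_loop)
      qed simp
    qed
    with ce show ?thesis by (simp add: key_eq_iff)
  qed
  \<comment> \<open>By \<open>same\<close>, the ends do not depend on which non-loop of the block is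
    selected.\<close>
  define g where "g B = ends G (SOME e. e \<in> B \<inter> link_arcs G)" for B
  have g: "g B = ends G e" if "B \<in> m" "e \<in> B" "e \<in> link_arcs G" for B e
  proof -
    let ?f = "SOME e. e \<in> B \<inter> link_arcs G"
    have f: "?f \<in> B \<inter> link_arcs G" using that by (intro someI[of "\<lambda>e. e \<in> B \<inter> link_arcs G" e]) auto
    then have "\<phi> ` ends G ?f = \<phi> ` ends G e"
      using same[OF that(1), of ?f e] that snd_key_link[of ?f] snd_key_link[of e] by (metis IntD1 IntD2)
    then show ?thesis unfolding g_def using phi_image_ends_eq f that link_in_arcs by auto
  qed
  have fin: "finite (link_blocks G m)"
    using part finite_elements[of "arcs G" m] by (auto simp: link_blocks_def)
  have "ends G ` link_arcs G \<subseteq> g ` link_blocks G m"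
  proof
    fix X assume "X \<in> ends G ` link_arcs G"
    then obtain e where e: "e \<in> link_arcs G" "X = ends G e" by blast
    then obtain B where "B \<in> m" "e \<in> B" using part link_in_arcs by (auto simp: partition_on_def)
    then show "X \<in> g ` link_blocks G m" using e g by (auto simp: link_blocks_def image_iff intro!: bexI[of _ B])
  qed
  \<comment> \<open>By connectivity the pairs of ends already number at least
    \<open>card (verts G) - 1\<close>, which is the number of blocks containing a non-loop. So no
    two such blocks have the same ends.\<close>
  then have "card (ends G ` link_arcs G) \<le> card (g ` link_blocks G m)"
    using fin by (intro card_mono) auto
  then have "card (g ` link_blocks G m) = card (link_blocks G m)"
    using card_verts_le_ends[OF test] links card_image_le[OF fin, of g] by linarith
  then have inj_g: "inj_on g (link_blocks G m)" by (rule eq_card_imp_inj_on[OF fin])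
  have snd_link: "snd (key e) = \<phi> ` g B" "g B \<subseteq> verts G" "card (g B) = 2"
    if B: "B \<in> link_blocks G m" "e \<in> B" for B e
  proof -
    from B obtain f where f: "f \<in> B" "f \<in> link_arcs G" "B \<in> m" by (auto simp: link_blocks_def)
    then show "snd (key e) = \<phi> ` g B" using same[OF f(3) B(2) f(1)] g[OF f(3,1,2)] snd_key_link by simp
    show "g B \<subseteq> verts G" "card (g B) = 2"
      using g[OF f(3,1,2)] ends_subset[OF link_in_arcs[OF f(2)]] card_ends_link[OF f(2)] by auto
  qed
  have snd_loop: "snd (key d) = {\<phi> (head G d), \<kappa> d}" "\<kappa> d \<notin> \<phi>V" "\<phi> (head G d) \<in> \<phi>V"
    if "B \<in> m" "B \<notin> link_blocks G m" "d \<in> B" for B d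
  proof -
    have "d \<in> loop_arcs G" using nonlink that by blast
    then show "snd (key d) = {\<phi> (head G d), \<kappa> d}" "\<phi> (head G d) \<in> \<phi>V"
      using loop_in_arcs by (auto simp: snd_key_loop)
    show "\<kappa> d \<notin> \<phi>V" using r2 nonlink that by blast
  qed
  have diff: "B = B'" if B: "B \<in> m" "B' \<in> m" "e \<in> B" "e' \<in> B'" "key e = key e'" for B B' e e'
  proof -
    have eq: "snd (key e) = snd (key e')" using B by simp
    consider "B \<in> link_blocks G m" "B' \<in> link_blocks G m"
      | "B \<in> link_blocks G m" "B' \<notin> link_blocks G m"
      | "B \<notin> link_blocks G m" "B' \<in> link_blocks G m"
      | "B \<notin> link_blocks G m" "B' \<notin> link_blocks G m" by blast
    then show ?thesis
    proof cases
      case 1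
      then have "\<phi> ` g B = \<phi> ` g B'" using snd_link(1)[of B e] snd_link(1)[of B' e'] B eq by simp
      then have "g B = g B'" using inj snd_link(2) 1 B by (metis inj_on_image_eq_iff)
      then show ?thesis using inj_g 1 by (auto dest: inj_onD)
    next
      case 2
      then have "\<kappa> e' \<in> \<phi> ` g B" using snd_loop[OF B(2) 2(2) B(4)] snd_link(1)[OF 2(1) B(3)] eq by auto
      then show ?thesis using snd_loop(2)[OF B(2) 2(2) B(4)] snd_link(2)[OF 2(1) B(3)] by auto
    next
      case 3
      then have "\<kappa> e \<in> \<phi> ` g B'" using snd_loop[OF B(1) 3(1) B(3)] snd_link(1)[OF 3(2) B(4)] eq by auto
      then show ?thesis using snd_loop(2)[OF B(1) 3(1) B(3)] snd_link(2)[OF 3(2) B(4)] by auto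
    next
      case 4
      then have "\<kappa> e = \<kappa> e'"
        using snd_loop[OF B(1) 4(1) B(3)] snd_loop[OF B(2) 4(2) B(4)] eq by (metis doubleton_eq_iff)
      then show ?thesis using r3[OF B(1,2) nonlink nonlink B(3,4)] 4 B by blast
    qed
  qed
  have "key v = key w \<longleftrightarrow> same_block m v w" if "v \<in> arcs G" "w \<in> arcs G" for v w
  proof -
    from that have "v \<in> \<Union>m" "w \<in> \<Union>m" using part by (simp_all add: partition_on_def)
    then obtain B B' where "B \<in> m" "v \<in> B" "B' \<in> m" "w \<in> B'" by blast
    then show ?thesis using same diff by metis
  qed
  then show ?A using kernel_partition_eq_iff[OF part, of key] by blast
  show "card (snd (key e)) = 2" if e: "e \<in> arcs G" for e
  proof -
    obtain B where B: "B \<in> m" "e \<in> B" using e part by (auto simp: partition_on_def)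
    show ?thesis
    proof (cases "B \<in> link_blocks G m")
      case True
      then show ?thesis using snd_link[OF True B(2)] inj by (metis card_image inj_on_subset)
    next
      case False
      then have "\<phi> (head G e) \<noteq> \<kappa> e" using snd_loop[OF B(1) False B(2)] by metis
      then show ?thesis using snd_loop(1)[OF B(1) False B(2)] by simp
    qed
  qed
  then show "\<kappa> d \<noteq> \<phi> (head G d)" if "d \<in> loop_arcs G" for d
    using that loop_in_arcs snd_key_loop by fastforce
qed

end


section \<open>Counting and asymptotics\<close>

definition inj_maps :: "'v set \<Rightarrow> nat \<Rightarrow> ('v \<Rightarrow> nat) set" where
  "inj_maps V n = {\<phi> \<in> V \<rightarrow>\<^sub>E {..<n}. inj_on \<phi> V}"

lemma finite_inj_maps: "finite V \<Longrightarrow> finite (inj_maps V n)"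
  unfolding inj_maps_def by (rule finite_subset[OF _ finite_PiE[of V "\<lambda>_. {..<n}"]]) auto

lemma partition_on_obtains:
  assumes "partition_on A P" "x \<in> A"
  obtains B where "B \<in> P" "x \<in> B"
proof -
  have "x \<in> \<Union>P" using assms by (simp add: partition_on_def)
  then show ?thesis using that by blast
qed

lemma card_inj_PiE:
  assumes "finite A" "finite C"
  shows "card {f \<in> A \<rightarrow>\<^sub>E C. inj_on f A} = (\<Prod>i<card A. card C - i)"
  using card_inj_on_subset_funcset[OF assms subset_refl] by (simp add: atLeast0LessThan)

text \<open>Once \<open>\<phi>\<close> is chosen, a loop paired with a non-loop must take the other
  end of that edge as its index. The freedom left is one value per block of loops, outside the image
  of \<open>\<phi>\<close> and different for different blocks, which gives a falling factorial from
  \<open>n - card (verts G)\<close>.\<close>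

lemma card_realises:
  assumes test: "is_test_graph (G, l)" and m: "m \<in> tree_pairings G c" and \<phi>: "\<phi> \<in> inj_maps (verts G) n"
  shows "card {\<kappa> \<in> loop_arcs G \<rightarrow>\<^sub>E {..<n}. realises G m \<phi> \<kappa>} =
         (\<Prod>i<card (m - link_blocks G m). n - card (verts G) - i)"
proof -
  interpret fin_digraph G using test by (simp add: is_test_graph_def)
  let ?O = "loop_arcs G" and ?N = "link_arcs G" and ?L = "m - link_blocks G m" and ?V = "\<phi> ` verts G"
  have inj: "inj_on \<phi> (verts G)" and \<phi>n: "?V \<subseteq> {..<n}" using \<phi> by (auto simp: inj_maps_def)
  have part: "partition_on (arcs G) m" and pair: "\<And>B. B \<in> m \<Longrightarrow> is_pair G c B"
    using m by (auto simp: tree_pairings_def pairings_def)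
  have sub: "B \<subseteq> arcs G" if "B \<in> m" for B using part that by (auto simp: partition_on_def)
  have L_iff: "B \<in> ?L \<longleftrightarrow> B \<subseteq> ?O" if "B \<in> m" for B
    using that sub[OF that] arcs_split[of G] by (auto simp: link_blocks_def)
  have finm: "finite m" using part finite_elements[of "arcs G" m] by auto
  define blk where "blk d = (THE B. B \<in> m \<and> d \<in> B)" for d
  have blk: "blk d = B" if "B \<in> m" "d \<in> B" for B d
    unfolding blk_def using that partition_on_unique_block[OF part] by (intro the_equality) blast+
  have blk_in: "blk d \<in> m" "d \<in> blk d" if "d \<in> ?O" for d
  proof -
    have "d \<in> arcs G" using that by (simp add: loop_arcs_def)
    then obtain B where "B \<in> m" "d \<in> B" by (metis part partition_on_obtains)
    then show "blk d \<in> m" "d \<in> blk d" using blk by auto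
  qed
  have ex: "\<exists>y. y \<in> ?V \<and> (\<forall>e\<in>blk d \<inter> ?N. {\<phi> (head G d), y} = \<phi> ` ends G e)"
    if d: "d \<in> ?O" "blk d \<notin> ?L" for d
  proof -
    obtain e where e: "e \<in> blk d" "e \<in> ?N" using d blk_in[OF d(1)] by (auto simp: link_blocks_def)
    have "card (blk d) = 2" using pair[OF blk_in(1)[OF d(1)]] by (simp add: is_pair_def)
    moreover have "d \<noteq> e" using d e arcs_split(2)[of G] by auto
    ultimately have be: "blk d = {d, e}" using e(1) blk_in(2)[OF d(1)]
      by (metis card_2_iff doubleton_eq_iff insert_iff singletonD)
    have "ends G d \<subseteq> ends G e \<or> ends G e \<subseteq> ends G d"
      using pair[OF blk_in(1)[OF d(1)]] e blk_in(2)[OF d(1)] unfolding is_pair_def by blast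
    then have "head G d \<in> ends G e"
      using card_ends_link[OF e(2)] ends_loop[OF d(1)]
      by (metis card_1_singleton_iff card_mono finite.emptyI finite.insertI insert_subset
          is_singletonI is_singleton_altdef not_less_eq_eq numeral_2_eq_2 One_nat_def order_refl)
    then have "head G d = tail G e \<or> head G d = head G e" by (simp add: ends_def)
    then obtain w where w: "ends G e = {head G d, w}" by (metis ends_def insert_commute)
    then have "w \<in> verts G" using e by (auto simp: ends_def link_arcs_def doubleton_eq_iff)
    then show ?thesis using be w d arcs_split(2)[of G] by (intro exI[of _ "\<phi> w"]) auto
  qed
  define lnk where "lnk d = (SOME y. y \<in> ?V \<and> (\<forall>e\<in>blk d \<inter> ?N. {\<phi> (head G d), y} = \<phi> ` ends G e))" for d
  have lnk: "lnk d \<in> ?V" "\<And>e. e \<in> blk d \<Longrightarrow> e \<in> ?N \<Longrightarrow> {\<phi> (head G d), lnk d} = \<phi> ` ends G e"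
    if "d \<in> ?O" "blk d \<notin> ?L" for d
    using someI_ex[OF ex[OF that]] unfolding lnk_def by auto
  let ?K = "{\<kappa> \<in> ?O \<rightarrow>\<^sub>E {..<n}. realises G m \<phi> \<kappa>}"
  let ?H = "{g \<in> ?L \<rightarrow>\<^sub>E ({..<n} - ?V). inj_on g ?L}"
  let ?f = "\<lambda>\<kappa>. restrict (\<lambda>B. \<kappa> (SOME d. d \<in> B)) ?L"
  let ?f' = "\<lambda>g. restrict (\<lambda>d. if blk d \<in> ?L then g (blk d) else lnk d) ?O"
  have some: "(SOME d. d \<in> B) \<in> B" if "B \<in> m" for B
    using that partition_onD3[OF part] by (metis all_not_in_conv someI_ex)
  have r1: "{\<phi> (head G d), \<kappa> d} = \<phi> ` ends G e"
    if "realises G m \<phi> \<kappa>" "B \<in> m" "d \<in> B" "d \<in> ?O" "e \<in> B" "e \<in> ?N" for \<kappa> B d e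
    using conjunct1[OF that(1)[unfolded realises_def]] that(2-) by blast
  have r2: "\<kappa> d \<notin> ?V" if "realises G m \<phi> \<kappa>" "B \<in> ?L" "d \<in> B" for \<kappa> B d
    using conjunct1[OF conjunct2[OF that(1)[unfolded realises_def]]] that(2-) L_iff by blast
  have r3: "\<kappa> d = \<kappa> d' \<longleftrightarrow> B = B'"
    if "realises G m \<phi> \<kappa>" "B \<in> ?L" "B' \<in> ?L" "d \<in> B" "d' \<in> B'" for \<kappa> B B' d d'
    using conjunct2[OF conjunct2[OF that(1)[unfolded realises_def]]] that(2-) L_iff by (metis DiffD1)
  have "bij_betw ?f ?K ?H"
  proof (rule bij_betw_byWitness[where f' = ?f'])
    show "\<forall>\<kappa>\<in>?K. ?f' (?f \<kappa>) = \<kappa>"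
    proof
      fix \<kappa> assume \<kappa>: "\<kappa> \<in> ?K"
      then have real: "realises G m \<phi> \<kappa>" by blast
      show "?f' (?f \<kappa>) = \<kappa>"
      proof
        fix d
        show "?f' (?f \<kappa>) d = \<kappa> d"
        proof (cases "d \<in> ?O")
          case False
          then show ?thesis using \<kappa> by (auto simp: PiE_def extensional_def)
        next
          case True
          show ?thesis
          proof (cases "blk d \<in> ?L")
            case L: True
            then have "\<kappa> (SOME d'. d' \<in> blk d) = \<kappa> d"
              using r3[OF real L L some blk_in(2)[OF True]] by blast
            then show ?thesis using True L by simp
          next
            case L: False
            then obtain e where e: "e \<in> blk d" "e \<in> ?N"
              using blk_in[OF True] by (auto simp: link_blocks_def)
            have "{\<phi> (head G d), \<kappa> d} = {\<phi> (head G d), lnk d}"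
              using lnk(2)[OF True L e] r1[OF real blk_in[OF True] True e] by simp
            then show ?thesis using True L by (auto simp: doubleton_eq_iff)
          qed
        qed
      qed
    qed
    show "\<forall>g\<in>?H. ?f (?f' g) = g"
    proof
      fix g assume g: "g \<in> ?H"
      show "?f (?f' g) = g"
      proof
        fix B
        show "?f (?f' g) B = g B"
        proof (cases "B \<in> ?L")
          case True
          then have B: "B \<in> m" "B \<subseteq> ?O" using L_iff by auto
          then show ?thesis using True some[OF B(1)] blk[OF B(1) some[OF B(1)]] by auto
        next
          case False
          then show ?thesis using g by (auto simp: PiE_def extensional_def)
        qed
      qed
    qed
    show "?f ` ?K \<subseteq> ?H"
    proof (intro image_subsetI CollectI conjI PiE_I)
      fix \<kappa> B assume \<kappa>: "\<kappa> \<in> ?K" and B: "B \<in> ?L"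
      then have "(SOME d. d \<in> B) \<in> ?O" using some L_iff by blast
      then have "\<kappa> (SOME d. d \<in> B) \<in> {..<n}" using \<kappa> by (auto simp: PiE_def Pi_def)
      then show "?f \<kappa> B \<in> {..<n} - ?V" using \<kappa> B r2[of \<kappa> B] some by auto
    next
      fix \<kappa> assume \<kappa>: "\<kappa> \<in> ?K"
      then have real: "realises G m \<phi> \<kappa>" by blast
      show "inj_on (?f \<kappa>) ?L"
      proof (rule inj_onI)
        fix B B' assume B: "B \<in> ?L" "B' \<in> ?L" "?f \<kappa> B = ?f \<kappa> B'"
        then have "\<kappa> (SOME d. d \<in> B) = \<kappa> (SOME d. d \<in> B')" by simp
        then show "B = B'" using r3[OF real B(1,2) some some] B by blast
      qed
    qed auto
    show "?f' ` ?H \<subseteq> ?K"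
    proof (intro image_subsetI CollectI conjI PiE_I)
      fix g d assume g: "g \<in> ?H" and d: "d \<in> ?O"
      have "g (blk d) \<in> {..<n}" if "blk d \<in> ?L" using g that by (auto simp: PiE_def Pi_def)
      then show "?f' g d \<in> {..<n}" using lnk(1)[OF d] d \<phi>n by auto
    next
      fix g assume g: "g \<in> ?H"
      have g1: "g B \<notin> ?V" if "B \<in> ?L" for B using g that by (auto simp: PiE_def Pi_def)
      have eqL: "?f' g d = g B" if "B \<in> ?L" "d \<in> B" for B d
        using that blk[of B d] L_iff[of B] by auto
      have g_inj: "g B = g B' \<longleftrightarrow> B = B'" if "B \<in> ?L" "B' \<in> ?L" for B B'
        using g that by (auto dest: inj_onD)
      show "realises G m \<phi> (?f' g)"
        unfolding realises_def
      proof (intro conjI ballI impI)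
        fix B d e assume B: "B \<in> m" "d \<in> B \<inter> ?O" "e \<in> B \<inter> ?N"
        then have b: "blk d = B" "B \<notin> ?L" using blk by (auto simp: link_blocks_def)
        then have "?f' g d = lnk d" using B by auto
        then show "{\<phi> (head G d), ?f' g d} = \<phi> ` ends G e" using lnk(2)[of d e] B b by auto
      next
        fix B d assume B: "B \<in> m" "B \<subseteq> ?O" "d \<in> B"
        then have L: "B \<in> ?L" using L_iff by blast
        show "?f' g d \<notin> ?V" unfolding eqL[OF L B(3)] by (rule g1[OF L])
      next
        fix B B' d d' assume B: "B \<in> m" "B' \<in> m" "B \<subseteq> ?O" "B' \<subseteq> ?O" "d \<in> B" "d' \<in> B'"
        then have L: "B \<in> ?L" "B' \<in> ?L" using L_iff by blast+
        show "?f' g d = ?f' g d' \<longleftrightarrow> B = B'"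
          unfolding eqL[OF L(1) B(5)] eqL[OF L(2) B(6)] by (rule g_inj[OF L])
      qed
    qed auto
  qed
  then have "card ?K = card ?H" by (rule bij_betw_same_card)
  also have "\<dots> = (\<Prod>i<card ?L. card ({..<n} - ?V) - i)" using finm by (intro card_inj_PiE) auto
  also have "card ({..<n} - ?V) = n - card (verts G)"
    using \<phi>n card_image[OF inj] by (simp add: card_Diff_subset finite_subset)
  finally show ?thesis .
qed

text \<open>The diagonal entry \<open>p * x a a + q * (\<Sum>k<n. x a k)\<close> contains
  \<open>x a k\<close> with coefficient \<open>q\<close>, increased by \<open>p\<close> if
  \<open>k = a\<close>. This is the factor at a loop; a non-loop has the coefficient
  \<open>p\<close>.\<close>

definition pattern_weight ::
    "('v, 'e) pre_digraph \<Rightarrow> ('e \<Rightarrow> real) \<Rightarrow> ('e \<Rightarrow> real) \<Rightarrow> ('v \<Rightarrow> 'x) \<Rightarrow> ('e \<Rightarrow> 'x) \<Rightarrow> real" where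
  "pattern_weight G p q \<phi> \<kappa> = (\<Prod>e\<in>arcs G. if tail G e = head G e
     then q e + (if \<kappa> e = \<phi> (head G e) then p e else 0) else p e)"

definition edge_weight :: "('v, 'e) pre_digraph \<Rightarrow> ('e \<Rightarrow> real) \<Rightarrow> ('e \<Rightarrow> real) \<Rightarrow> real" where
  "edge_weight G p q = (\<Prod>e\<in>arcs G. if tail G e = head G e then q e else p e)"

text \<open>The expectation of the product of the chosen entries: entries at different keys are
  independent, and a key used \<open>r\<close> times contributes its \<open>r\<close>-th
  moment.\<close>

definition key_moment :: "('v, 'e) pre_digraph \<Rightarrow> ('e \<Rightarrow> 'k) \<Rightarrow> ('k \<times> 'x set \<Rightarrow> nat \<Rightarrow> real) \<Rightarrow>
    ('v \<Rightarrow> 'x) \<Rightarrow> ('e \<Rightarrow> 'x) \<Rightarrow> real" where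
  "key_moment G c \<mu> \<phi> \<kappa> = (\<Prod>x\<in>edge_key G c \<phi> \<kappa> ` arcs G.
     \<mu> x (card {e\<in>arcs G. edge_key G c \<phi> \<kappa> e = x}))"

definition patterns :: "('v, 'e) pre_digraph \<Rightarrow> nat \<Rightarrow> (('v \<Rightarrow> nat) \<times> ('e \<Rightarrow> nat)) set" where
  "patterns G n = inj_maps (verts G) n \<times> (loop_arcs G \<rightarrow>\<^sub>E {..<n})"

text \<open>A pair of maps with at most \<open>r\<close> values factors through
  \<open>{..<r}\<close>. The outer map has \<open>n ^ r\<close> choices and the inner maps have a
  number of choices independent of \<open>n\<close>.\<close>

lemma card_small_patterns:
  assumes "finite V" "finite O'" "V \<noteq> {}"
  shows "card {(\<phi>, \<kappa>) \<in> (V \<rightarrow>\<^sub>E {..<n}) \<times> (O' \<rightarrow>\<^sub>E {..<n}). card (\<phi> ` V \<union> \<kappa> ` O') \<le> r}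
           \<le> n ^ r * r ^ (card V + card O')" (is "card ?S \<le> _")
proof -
  let ?A = "({..<r} \<rightarrow>\<^sub>E {..<n}) \<times> (V \<rightarrow>\<^sub>E {..<r}) \<times> (O' \<rightarrow>\<^sub>E {..<r})"
  let ?F = "\<lambda>(g, h, k). (restrict (g \<circ> h) V, restrict (g \<circ> k) O')"
  have "?S \<subseteq> ?F ` ?A"
  proof clarify
    fix \<phi> \<kappa> assume \<phi>: "\<phi> \<in> V \<rightarrow>\<^sub>E {..<n}" and \<kappa>: "\<kappa> \<in> O' \<rightarrow>\<^sub>E {..<n}" and r: "card (\<phi> ` V \<union> \<kappa> ` O') \<le> r"
    let ?U = "\<phi> ` V \<union> \<kappa> ` O'"
    have U: "finite ?U" "?U \<noteq> {}" "?U \<subseteq> {..<n}" using assms \<phi> \<kappa> by auto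
    obtain f where f: "bij_betw f ?U {..<card ?U}"
      using ex_bij_betw_finite_nat[OF U(1)] by (auto simp: atLeast0LessThan)
    obtain u where u: "u \<in> ?U" using U(2) by blast
    define g where "g = restrict (\<lambda>i. if i < card ?U then inv_into ?U f i else u) {..<r}"
    have gf: "g (f x) = x" if "x \<in> ?U" for x
    proof -
      have "f x < card ?U" using bij_betwE[OF f] that by blast
      then show ?thesis using r that bij_betw_imp_inj_on[OF f] by (simp add: g_def inv_into_f_f)
    qed
    have "inv_into ?U f i \<in> {..<n}" if "i < card ?U" for i
      using f that U(3) by (metis bij_betw_def inv_into_into lessThan_iff subsetD)
    moreover have "u \<in> {..<n}" using U(3) u by blast
    ultimately have "g \<in> {..<r} \<rightarrow>\<^sub>E {..<n}" by (auto simp: g_def)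
    moreover have fr: "f x < r" if "x \<in> ?U" for x
      using bij_betwE[OF f] that r by (metis lessThan_iff order_less_le_trans)
    then have "restrict (f \<circ> \<phi>) V \<in> V \<rightarrow>\<^sub>E {..<r}" "restrict (f \<circ> \<kappa>) O' \<in> O' \<rightarrow>\<^sub>E {..<r}" by auto
    moreover have "restrict (g \<circ> restrict (f \<circ> \<phi>) V) V = \<phi>"
      using gf \<phi> by (intro ext) (auto simp: PiE_def extensional_def)
    moreover have "restrict (g \<circ> restrict (f \<circ> \<kappa>) O') O' = \<kappa>"
      using gf \<kappa> by (intro ext) (auto simp: PiE_def extensional_def)
    ultimately show "(\<phi>, \<kappa>) \<in> ?F ` ?A"
      by (intro image_eqI[of _ _ "(g, restrict (f \<circ> \<phi>) V, restrict (f \<circ> \<kappa>) O')"]) auto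
  qed
  moreover have fin: "finite ?A" using assms by (intro finite_cartesian_product finite_PiE) auto
  ultimately have "card ?S \<le> card (?F ` ?A)" by (intro card_mono) auto
  also have "\<dots> \<le> card ?A" by (rule card_image_le[OF fin])
  also have "\<dots> = n ^ r * r ^ (card V + card O')"
    using assms by (simp add: card_cartesian_product card_funcsetE power_add)
  finally show ?thesis .
qed

text \<open>Patterns realising a tree pairing contribute exactly the edge weight each, and their
  number has the order of the inverse normalisation. Every other nonzero term has too few index
  values, and all terms are uniformly bounded, so the rest vanishes.\<close>

lemma pattern_limit:
  assumes test: "is_test_graph (G, l)"
    and bdd: "\<And>r. \<exists>C. \<forall>n\<ge>1. \<forall>e\<in>arcs G. \<forall>a<n. \<forall>b<n. \<bar>\<mu> n (c e, {a, b}) r\<bar> \<le> C"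
    and mu1: "\<And>n e a b. e \<in> arcs G \<Longrightarrow> a < n \<Longrightarrow> b < n \<Longrightarrow> a \<noteq> b \<Longrightarrow> \<mu> n (c e, {a, b}) 1 = 0"
    and mu2: "\<And>n e a b. e \<in> arcs G \<Longrightarrow> a < n \<Longrightarrow> b < n \<Longrightarrow> a \<noteq> b \<Longrightarrow> \<mu> n (c e, {a, b}) 2 = 1"
  shows "(\<lambda>n. 1 / real n * (1 / sqrt (real n)) ^ card (arcs G) *
            (\<Sum>(\<phi>, \<kappa>)\<in>patterns G n. pattern_weight G p q \<phi> \<kappa> * key_moment G c (\<mu> n) \<phi> \<kappa>))
         \<longlonglongrightarrow> edge_weight G p q * real (card (tree_pairings G c))"
proof -
  interpret fin_digraph G using test by (simp add: is_test_graph_def)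
  let ?E = "card (arcs G)" and ?V = "verts G" and ?O = "loop_arcs G" and ?TP = "tree_pairings G c"
  have fO: "finite ?O" by (auto simp: loop_arcs_def)
  have V0: "?V \<noteq> {}" using test by (simp add: is_test_graph_iff_cut)
  have finP: "finite (patterns G n)" for n
    unfolding patterns_def using fO by (intro finite_cartesian_product finite_inj_maps finite_PiE) auto
  have finTP: "finite ?TP" by (rule finite_tree_pairings) simp
  have pat: "edge_pattern G l \<phi>" if "(\<phi>, \<kappa>) \<in> patterns G n" for \<phi> \<kappa> n
    using test that by unfold_locales (auto simp: patterns_def inj_maps_def)
  have key_form: "\<exists>a b. a < n \<and> b < n \<and> edge_key G c \<phi> \<kappa> e = (c e, {a, b})"
    if x: "(\<phi>, \<kappa>) \<in> patterns G n" "e \<in> arcs G" for \<phi> \<kappa> n e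
  proof -
    have "\<phi> (head G e) < n" "\<phi> (tail G e) < n" using x by (auto simp: patterns_def inj_maps_def)
    moreover have "\<kappa> e < n" if "tail G e = head G e"
      using that x by (auto simp: patterns_def loop_arcs_def)
    ultimately show ?thesis unfolding edge_key_def by (cases "tail G e = head G e") auto
  qed
  let ?R = "\<lambda>m n. {(\<phi>, \<kappa>) \<in> patterns G n. realises G m \<phi> \<kappa>}"
  let ?F = "\<lambda>n (\<phi>, \<kappa>). pattern_weight G p q \<phi> \<kappa> * key_moment G c (\<mu> n) \<phi> \<kappa>"
  let ?W = "edge_weight G p q"
  let ?s = "\<lambda>n. 1 / real n * (1 / sqrt (real n)) ^ ?E"
  have mu_key1: "\<mu> n (edge_key G c \<phi> \<kappa> e) 1 = 0" "\<mu> n (edge_key G c \<phi> \<kappa> e) 2 = 1"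
    if x: "(\<phi>, \<kappa>) \<in> patterns G n" "e \<in> arcs G" "card (snd (edge_key G c \<phi> \<kappa> e)) = 2" for \<phi> \<kappa> n e
  proof -
    obtain a b where ab: "a < n" "b < n" "edge_key G c \<phi> \<kappa> e = (c e, {a, b})"
      using key_form[OF x(1,2)] by blast
    moreover from this have "a \<noteq> b" using x(3) by auto
    ultimately show "\<mu> n (edge_key G c \<phi> \<kappa> e) 1 = 0" "\<mu> n (edge_key G c \<phi> \<kappa> e) 2 = 1"
      using mu1 mu2 x(2) by auto
  qed
  have F_good: "?F n x = ?W" if m: "m \<in> ?TP" and x: "x \<in> ?R m n" for m n x
  proof -
    obtain \<phi> \<kappa> where x: "x = (\<phi>, \<kappa>)" "(\<phi>, \<kappa>) \<in> patterns G n" "realises G m \<phi> \<kappa>" using x by auto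
    interpret edge_pattern G l c \<phi> \<kappa> by (rule pat[OF x(2)])
    note rk = realises_key[OF x(3) m]
    have "pattern_weight G p q \<phi> \<kappa> = ?W"
      unfolding pattern_weight_def edge_weight_def
      by (intro prod.cong refl) (use rk(3) in \<open>auto simp: loop_arcs_def\<close>)
    moreover have "key_moment G c (\<mu> n) \<phi> \<kappa> = 1"
      unfolding key_moment_def
    proof (intro prod.neutral ballI)
      fix k assume "k \<in> key ` arcs G"
      then obtain e where e: "e \<in> arcs G" "k = key e" by blast
      have "{e'\<in>arcs G. key e' = key e} \<in> m"
        unfolding rk(1)[symmetric] kernel_partition_def using e by blast
      then have "card {e'\<in>arcs G. key e' = k} = 2"
        using m e by (auto simp: tree_pairings_def pairings_def is_pair_def)
      then show "\<mu> n k (card {e'\<in>arcs G. key e' = k}) = 1"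
        using mu_key1(2)[OF x(2) e(1) rk(2)[OF e(1)]] e by simp
    qed
    ultimately show ?thesis using x by simp
  qed
  \<comment> \<open>A nonzero term repeats all its off-diagonal positions. If it also had at least
    \<open>1 + E/2\<close> index values, it would realise the tree pairing given by its own
    keys.\<close>
  have F_bad: "2 * card (fst x ` ?V \<union> snd x ` ?O) \<le> ?E + 1"
    if x: "x \<in> patterns G n" "\<forall>m\<in>?TP. x \<notin> ?R m n" "?F n x \<noteq> 0" for n x
  proof (rule ccontr)
    obtain \<phi> \<kappa> where x': "x = (\<phi>, \<kappa>)" by force
    interpret edge_pattern G l c \<phi> \<kappa> using pat x x' by simp
    assume "\<not> 2 * card (fst x ` ?V \<union> snd x ` ?O) \<le> ?E + 1"
    then have tight: "card (arcs G) + 2 \<le> 2 * card U" using x' by simp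
    have mult: "2 \<le> key_mult (key e)" if e: "e \<in> arcs G" "card (snd (key e)) = 2" for e
    proof (rule ccontr)
      assume "\<not> 2 \<le> key_mult (key e)"
      moreover have "1 \<le> key_mult (key e)" using e mult_pos by blast
      ultimately have "key_mult (key e) = 1" by linarith
      then have "\<mu> n (key e) (key_mult (key e)) = 0" using mu_key1(1)[of \<phi> \<kappa> n e] x x' e by simp
      then have "key_moment G c (\<mu> n) \<phi> \<kappa> = 0"
        unfolding key_moment_def using e by (intro prod_zero) auto
      then show False using x x' by simp
    qed
    show False
      using tight_tree_pairing[OF mult tight] tight_realises[OF mult tight] x x' by blast
  qed
  obtain C0 where C0: "\<And>r. \<forall>n\<ge>1. \<forall>e\<in>arcs G. \<forall>a<n. \<forall>b<n. \<bar>\<mu> n (c e, {a, b}) r\<bar> \<le> C0 r"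
    using bdd by metis
  \<comment> \<open>Multiplicities are at most \<open>?E\<close>, so finitely many moment bounds are
    involved. The summand 1 makes the powers of \<open>C\<close> increasing, so that
    \<open>C ^ ?E\<close> also covers fewer than \<open>?E\<close> keys.\<close>
  define C where "C = 1 + (\<Sum>r\<le>?E. \<bar>C0 r\<bar>)"
  have C1: "1 \<le> C" unfolding C_def by (simp add: sum_nonneg)
  have C0_le: "C0 r \<le> C" if "r \<le> ?E" for r
    using member_le_sum[of r "{..?E}" "\<lambda>r. \<bar>C0 r\<bar>"] that unfolding C_def by auto
  define C' where "C' = (\<Prod>e\<in>arcs G. \<bar>p e\<bar> + \<bar>q e\<bar>) * C ^ ?E"
  have C'0: "0 \<le> C'" unfolding C'_def using C1 by (intro mult_nonneg_nonneg prod_nonneg) auto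
  have F_bound: "\<bar>?F n x\<bar> \<le> C'" if nx: "n \<ge> 1" "x \<in> patterns G n" for n x
  proof -
    obtain \<phi> \<kappa> where x: "x = (\<phi>, \<kappa>)" by force
    have "\<bar>pattern_weight G p q \<phi> \<kappa>\<bar> \<le> (\<Prod>e\<in>arcs G. \<bar>p e\<bar> + \<bar>q e\<bar>)"
      unfolding pattern_weight_def abs_prod by (intro prod_mono) auto
    moreover have "\<bar>key_moment G c (\<mu> n) \<phi> \<kappa>\<bar> \<le> C ^ ?E"
    proof -
      have "\<bar>key_moment G c (\<mu> n) \<phi> \<kappa>\<bar> \<le> (\<Prod>k\<in>edge_key G c \<phi> \<kappa> ` arcs G. C)"
        unfolding key_moment_def abs_prod
      proof (intro prod_mono conjI abs_ge_zero)
        fix k assume "k \<in> edge_key G c \<phi> \<kappa> ` arcs G"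
        then obtain e where e: "e \<in> arcs G" "k = edge_key G c \<phi> \<kappa> e" by blast
        then obtain a b where ab: "a < n" "b < n" "k = (c e, {a, b})"
          using key_form[of \<phi> \<kappa> n e] nx x by auto
        have "card {e'\<in>arcs G. edge_key G c \<phi> \<kappa> e' = k} \<le> ?E" by (intro card_mono) auto
        from C0_le[OF this] show "\<bar>\<mu> n k (card {e'\<in>arcs G. edge_key G c \<phi> \<kappa> e' = k})\<bar> \<le> C"
          by (rule order_trans[rotated]) (use C0 nx(1) e(1) ab in blast)
      qed
      also have "\<dots> \<le> C ^ ?E"
        using C1 card_image_le[OF finite_arcs, of "edge_key G c \<phi> \<kappa>"] by (simp del: card_image_le add: power_increasing)
      finally show ?thesis .
    qed
    ultimately show ?thesis
      unfolding C'_def x case_prod_conv abs_mult by (intro mult_mono) auto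
  qed
  have R_sub: "?R m n \<subseteq> patterns G n" for m n by auto
  \<comment> \<open>The pairing can be recovered from the pattern as its partition into equal
    keys.\<close>
  have R_disj: "?R m n \<inter> ?R m' n = {}" if "m \<in> ?TP" "m' \<in> ?TP" "m \<noteq> m'" for m m' n
  proof (rule ccontr)
    assume "?R m n \<inter> ?R m' n \<noteq> {}"
    then obtain \<phi> \<kappa> where x: "(\<phi>, \<kappa>) \<in> patterns G n" "realises G m \<phi> \<kappa>" "realises G m' \<phi> \<kappa>" by auto
    interpret edge_pattern G l c \<phi> \<kappa> by (rule pat[OF x(1)])
    show False using realises_key(1)[OF x(2) that(1)] realises_key(1)[OF x(3) that(2)] that(3) by simp
  qed
  let ?Good = "\<lambda>n. \<Union>m\<in>?TP. ?R m n"
  \<comment> \<open>The largest number of index values allowed by \<open>F_bad\<close>. As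
    \<open>2 * r \<le> ?E + 1\<close>, the bound \<open>n ^ r\<close> falls short of the inverse
    normalisation by at least a factor \<open>sqrt n\<close>.\<close>
  define r where "r = (?E + 1) div 2"
  let ?K = "real (r ^ (card ?V + card ?O))"
  have sum_split: "(\<Sum>x\<in>patterns G n. ?F n x) =
      ?W * (\<Sum>m\<in>?TP. real (card (?R m n))) + (\<Sum>x\<in>patterns G n - ?Good n. ?F n x)" for n
  proof -
    have "(\<Sum>x\<in>patterns G n. ?F n x) = (\<Sum>x\<in>patterns G n - ?Good n. ?F n x) + (\<Sum>x\<in>?Good n. ?F n x)"
      by (rule sum.subset_diff) (auto simp: finP)
    also have "(\<Sum>x\<in>?Good n. ?F n x) = (\<Sum>m\<in>?TP. \<Sum>x\<in>?R m n. ?F n x)"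
      using finTP finite_subset[OF R_sub finP] R_disj by (intro sum.UNION_disjoint) auto
    also have "\<dots> = (\<Sum>m\<in>?TP. \<Sum>x\<in>?R m n. ?W)"
      by (intro sum.cong refl F_good)
    finally show ?thesis by (simp add: sum_distrib_left mult.commute)
  qed
  have rest: "\<bar>\<Sum>x\<in>patterns G n - ?Good n. ?F n x\<bar> \<le> C' * ?K * real n ^ r" if "n \<ge> 1" for n
  proof -
    let ?S = "{(\<phi>, \<kappa>) \<in> (?V \<rightarrow>\<^sub>E {..<n}) \<times> (?O \<rightarrow>\<^sub>E {..<n}). card (\<phi> ` ?V \<union> \<kappa> ` ?O) \<le> r}"
    let ?B = "{x \<in> patterns G n - ?Good n. ?F n x \<noteq> 0}"
    have fS: "finite ?S" by (rule finite_subset[of _ "(?V \<rightarrow>\<^sub>E {..<n}) \<times> (?O \<rightarrow>\<^sub>E {..<n})"])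
      (use fO in \<open>auto intro!: finite_PiE\<close>)
    have "?B \<subseteq> ?S"
    proof
      fix x assume x: "x \<in> ?B"
      then have "2 * card (fst x ` ?V \<union> snd x ` ?O) \<le> ?E + 1" by (intro F_bad[of _ n]) blast+
      then have "card (fst x ` ?V \<union> snd x ` ?O) \<le> r" unfolding r_def by linarith
      then show "x \<in> ?S" using x by (auto simp: patterns_def inj_maps_def)
    qed
    then have "card ?B \<le> n ^ r * r ^ (card ?V + card ?O)"
      by (intro order_trans[OF card_mono[OF fS] card_small_patterns[OF finite_verts fO V0]])
    then have "real (card ?B) \<le> real (n ^ r * r ^ (card ?V + card ?O))" by (simp only: of_nat_le_iff)
    then have "real (card ?B) \<le> real n ^ r * ?K" by simp
    moreover have "(\<Sum>x\<in>patterns G n - ?Good n. ?F n x) = (\<Sum>x\<in>?B. ?F n x)"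
      using finP by (intro sum.mono_neutral_right) auto
    moreover have "\<bar>\<Sum>x\<in>?B. ?F n x\<bar> \<le> (\<Sum>x\<in>?B. C')"
      using F_bound[OF that] by (intro order_trans[OF sum_abs] sum_mono) blast
    ultimately show ?thesis
      using C'0 mult_left_mono[of "real (card ?B)" "real n ^ r * ?K" C'] by (simp add: algebra_simps)
  qed
  have inv0: "(\<lambda>n. 1 / sqrt (real n)) \<longlonglongrightarrow> 0" by real_asymp
  have rest_lim: "(\<lambda>n. ?s n * (\<Sum>x\<in>patterns G n - ?Good n. ?F n x)) \<longlonglongrightarrow> 0"
  proof (rule Lim_null_comparison)
    have s: "\<bar>?s n * (\<Sum>x\<in>patterns G n - ?Good n. ?F n x)\<bar> \<le> C' * ?K * (1 / sqrt (real n))" if "n \<ge> 1" for n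
    proof -
      let ?t = "sqrt (real n)"
      have t: "?t \<ge> 1" "real n = ?t ^ 2" using that by auto
      have "?s n * real n ^ r \<le> 1 / ?t"
      proof -
        have "real n ^ r = ?t ^ (2 * r)" using t(2) by (simp add: power_mult)
        also have "\<dots> \<le> ?t ^ (?E + 1)" using t(1) unfolding r_def by (intro power_increasing) auto
        finally have "?s n * real n ^ r \<le> ?s n * ?t ^ (?E + 1)" by (intro mult_left_mono) auto
        also have "\<dots> = 1 / ?t" using t by (simp add: power_divide field_simps power2_eq_square)
        finally show ?thesis .
      qed
      have "\<bar>?s n * (\<Sum>x\<in>patterns G n - ?Good n. ?F n x)\<bar> \<le> ?s n * (C' * ?K * real n ^ r)"
        unfolding abs_mult using rest[OF that] by (intro mult_mono) auto
      also have "\<dots> = C' * ?K * (?s n * real n ^ r)" by (simp only: mult_ac)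
      also have "\<dots> \<le> C' * ?K * (1 / ?t)" using \<open>?s n * real n ^ r \<le> 1 / ?t\<close> C'0 by (intro mult_left_mono) auto
      finally show ?thesis .
    qed
    then show "\<forall>\<^sub>F n in sequentially. norm (?s n * (\<Sum>x\<in>patterns G n - ?Good n. ?F n x)) \<le> C' * ?K * (1 / sqrt (real n))"
      unfolding real_norm_def by (rule eventually_sequentiallyI[of 1])
    show "(\<lambda>n. C' * ?K * (1 / sqrt (real n))) \<longlonglongrightarrow> 0"
      by (rule tendsto_mult_right_zero[OF inv0])
  qed
  \<comment> \<open>The count is a product of \<open>?v + ?lp\<close> factors of the form
    \<open>n - i\<close>. Since the arcs are paired and \<open>?v - 1\<close> pairs contain a
    non-loop, \<open>?E + 2 = 2 * (?v + ?lp)\<close>, so the normalisation cancels exactly.\<close>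
  have R_lim: "(\<lambda>n. ?s n * real (card (?R m n))) \<longlonglongrightarrow> 1" if m: "m \<in> ?TP" for m
  proof -
    let ?v = "card ?V" and ?lp = "card (m - link_blocks G m)"
    have part: "partition_on (arcs G) m" and links: "card (link_blocks G m) + 1 = ?v"
      and two: "\<And>B. B \<in> m \<Longrightarrow> card B = 2"
      using m by (auto simp: tree_pairings_def pairings_def is_pair_def)
    have finm: "finite m" using part finite_elements[of "arcs G" m] by auto
    have "?E = (\<Sum>B\<in>m. card B)" using part two by (intro product_partition) (auto intro: card_ge_0_finite)
    then have "?E = 2 * card m" using two by simp
    moreover have "card m = card (link_blocks G m) + ?lp"
      using finm by (subst card_Diff_subset) (auto simp: link_blocks_def card_mono finite_subset)
    ultimately have "?E + 2 = 2 * (card (link_blocks G m) + 1 + ?lp)" by simp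
    then have E: "?E + 2 = 2 * (?v + ?lp)" unfolding links .
    have cardR: "card (?R m n) = (\<Prod>i<?v. n - i) * (\<Prod>i<?lp. n - ?v - i)" for n
    proof -
      have "?R m n = Sigma (inj_maps ?V n) (\<lambda>\<phi>. {\<kappa> \<in> ?O \<rightarrow>\<^sub>E {..<n}. realises G m \<phi> \<kappa>})"
        by (auto simp: patterns_def)
      then have "card (?R m n) = (\<Sum>\<phi>\<in>inj_maps ?V n. card {\<kappa> \<in> ?O \<rightarrow>\<^sub>E {..<n}. realises G m \<phi> \<kappa>})"
        using fO by (auto intro!: card_SigmaI finite_inj_maps intro: finite_subset[OF _ finite_PiE[of ?O "\<lambda>_. {..<n}"]])
      also have "\<dots> = (\<Sum>\<phi>\<in>inj_maps ?V n. (\<Prod>i<?lp. n - ?v - i))"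
        by (intro sum.cong refl card_realises[OF test m])
      also have "\<dots> = card (inj_maps ?V n) * (\<Prod>i<?lp. n - ?v - i)" by simp
      also have "card (inj_maps ?V n) = (\<Prod>i<?v. n - i)"
        unfolding inj_maps_def by (subst card_inj_PiE) auto
      finally show ?thesis .
    qed
    have one: "(\<lambda>n. real (n - k) / real n) \<longlonglongrightarrow> 1" for k
    proof (rule Lim_transform_eventually)
      show "(\<lambda>n. (real n - real k) / real n) \<longlonglongrightarrow> 1" by real_asymp
      show "\<forall>\<^sub>F n in sequentially. (real n - real k) / real n = real (n - k) / real n"
        by (intro eventually_sequentiallyI[of k]) (simp add: of_nat_diff)
    qed
    have "(\<lambda>n. (\<Prod>i<?v. real (n - i) / real n) * (\<Prod>i<?lp. real (n - (?v + i)) / real n)) \<longlonglongrightarrow>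
        (\<Prod>i<?v. 1) * (\<Prod>i<?lp. 1)"
      by (intro tendsto_mult tendsto_prod one)
    then have lim: "(\<lambda>n. (\<Prod>i<?v. real (n - i) / real n) * (\<Prod>i<?lp. real (n - (?v + i)) / real n)) \<longlonglongrightarrow> 1"
      by simp
    show ?thesis
    proof (rule Lim_transform_eventually[OF lim], rule eventually_sequentiallyI[of 1])
      fix n :: nat assume n: "1 \<le> n"
      have "?s n = 1 / (sqrt (real n) ^ 2 * sqrt (real n) ^ ?E)" using n by (simp add: power_divide)
      also have "sqrt (real n) ^ 2 * sqrt (real n) ^ ?E = sqrt (real n) ^ (?E + 2)"
        by (simp only: power_add mult.commute)
      also have "\<dots> = real n ^ (?v + ?lp)" unfolding E power_mult by simp
      finally have s: "?s n = 1 / real n ^ (?v + ?lp)" .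
      show "(\<Prod>i<?v. real (n - i) / real n) * (\<Prod>i<?lp. real (n - (?v + i)) / real n) =
          ?s n * real (card (?R m n))"
        unfolding s cardR by (simp add: prod_dividef power_add)
    qed
  qed
  have "(\<lambda>n. ?W * (\<Sum>m\<in>?TP. ?s n * real (card (?R m n))) + ?s n * (\<Sum>x\<in>patterns G n - ?Good n. ?F n x))
      \<longlonglongrightarrow> ?W * (\<Sum>m\<in>?TP. 1) + 0"
    by (intro tendsto_intros R_lim rest_lim)
  then show ?thesis
    by (simp add: sum_split[unfolded split_beta'] case_prod_unfold distrib_left sum_distrib_left mult_ac)
qed


section \<open>Traffic distributions of Wigner matrices\<close>

text \<open>The entries of \<open>M_mat p q\<close> after normalisation, written for an arbitrary
  array \<open>x\<close>, so that the same limit theorem covers the given Wigner matrices and the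
  random signs used for stability.\<close>

definition wigner_entry :: "real \<Rightarrow> real \<Rightarrow> (nat \<Rightarrow> nat \<Rightarrow> real) \<Rightarrow> nat \<Rightarrow> nat \<Rightarrow> nat \<Rightarrow> real" where
  "wigner_entry p q x n a b = (p * x a b + q * (if a = b then \<Sum>k<n. x a k else 0)) / sqrt (real n)"

definition inj_limit :: "('s \<Rightarrow> 'k) \<Rightarrow> ('s \<Rightarrow> real) \<Rightarrow> ('s \<Rightarrow> real) \<Rightarrow> 's test_graph \<Rightarrow> complex" where
  "inj_limit clr P Q T = of_real (edge_weight (fst T) (P \<circ> snd T) (Q \<circ> snd T) *
     real (card (tree_pairings (fst T) (clr \<circ> snd T))))"

text \<open>Summation over quotients is the inverse of the Moebius formula, so this is the
  functional whose injective version ought to be \<open>inj_limit\<close>.\<close>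

definition traffic_limit :: "('s \<Rightarrow> 'k) \<Rightarrow> ('s \<Rightarrow> real) \<Rightarrow> ('s \<Rightarrow> real) \<Rightarrow> 's test_graph \<Rightarrow> complex" where
  "traffic_limit clr P Q T = (\<Sum>\<pi> | partition_on (verts (fst T)) \<pi>. inj_limit clr P Q (quotient_graph \<pi> T))"

text \<open>The moments \<open>\<mu> n (k, {a, b}) r\<close> are those of the entry in position \<open>(a, b)\<close> of the \<open>k\<close>-th matrix.\<close>

locale wigner_moments =
  fixes M :: "nat \<Rightarrow> 'w measure" and X :: "nat \<Rightarrow> 'k \<Rightarrow> 'w \<Rightarrow> nat \<Rightarrow> nat \<Rightarrow> real"
    and \<mu> :: "nat \<Rightarrow> 'k \<times> nat set \<Rightarrow> nat \<Rightarrow> real"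
  assumes sym: "\<lbrakk>1 \<le> n; \<omega> \<in> space (M n); a < n; b < n\<rbrakk> \<Longrightarrow> X n k \<omega> a b = X n k \<omega> b a"
    and moments: "\<lbrakk>1 \<le> n; finite K; \<And>x. x \<in> K \<Longrightarrow> \<exists>a<n. \<exists>b<n. snd x = {a, b}\<rbrakk> \<Longrightarrow>
      has_bochner_integral (M n) (\<lambda>\<omega>. \<Prod>x\<in>K. X n (fst x) \<omega> (Min (snd x)) (Max (snd x)) ^ r x)
        (\<Prod>x\<in>K. \<mu> n x (r x))"
    and bounded_moments: "\<exists>C. \<forall>n\<ge>1. \<forall>a<n. \<forall>b<n. \<bar>\<mu> n (k, {a, b}) d\<bar> \<le> C"
    and moment_1: "\<lbrakk>a < n; b < n; a \<noteq> b\<rbrakk> \<Longrightarrow> \<mu> n (k, {a, b}) 1 = 0"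
    and moment_2: "\<lbrakk>a < n; b < n; a \<noteq> b\<rbrakk> \<Longrightarrow> \<mu> n (k, {a, b}) 2 = 1"
begin

context
  fixes clr :: "'s \<Rightarrow> 'k" and P Q :: "'s \<Rightarrow> real"
begin

abbreviation B :: "nat \<Rightarrow> 'w \<Rightarrow> 's \<Rightarrow> nat \<Rightarrow> nat \<Rightarrow> complex" where
  "B n \<omega> s a b \<equiv> of_real (wigner_entry (P s) (Q s) (X n (clr s) \<omega>) n a b)"

text \<open>A row sum at a loop is expanded over the position of its summand.\<close>

lemma prod_wigner_entry:
  fixes T :: "'s test_graph"
  assumes n: "1 \<le> n" and \<omega>: "\<omega> \<in> space (M n)" and T: "is_test_graph T"
    and \<phi>: "\<phi> \<in> inj_maps (verts (fst T)) n"
  shows "(\<Prod>e\<in>arcs (fst T). wigner_entry (P (snd T e)) (Q (snd T e)) (X n (clr (snd T e)) \<omega>) n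
            (\<phi> (head (fst T) e)) (\<phi> (tail (fst T) e))) =
    (1 / sqrt (real n)) ^ card (arcs (fst T)) * (\<Sum>\<kappa>\<in>loop_arcs (fst T) \<rightarrow>\<^sub>E {..<n}.
       pattern_weight (fst T) (P \<circ> snd T) (Q \<circ> snd T) \<phi> \<kappa> *
       (\<Prod>x\<in>edge_key (fst T) (clr \<circ> snd T) \<phi> \<kappa> ` arcs (fst T).
          X n (fst x) \<omega> (Min (snd x)) (Max (snd x)) ^
            card {e\<in>arcs (fst T). edge_key (fst T) (clr \<circ> snd T) \<phi> \<kappa> e = x}))"
proof -
  obtain G l where Tdef: "T = (G, l)" by force
  interpret fin_digraph G using T Tdef by (simp add: is_test_graph_def)
  let ?E = "arcs G" and ?O = "loop_arcs G" and ?N = "link_arcs G"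
  let ?x = "\<lambda>e. X n (clr (l e)) \<omega>"
  let ?k = "edge_key G (clr \<circ> l) \<phi>"
  have fin: "finite ?O" "finite ?N" by (auto simp: loop_arcs_def link_arcs_def)
  have \<phi>n: "\<phi> v < n" if "v \<in> verts G" for v using \<phi> that Tdef by (auto simp: inj_maps_def)
  have \<phi>inj: "\<phi> v \<noteq> \<phi> w" if "v \<in> verts G" "w \<in> verts G" "v \<noteq> w" for v w
    using \<phi> that Tdef by (auto simp: inj_maps_def dest: inj_onD)
  have split: "(\<Prod>e\<in>?E. f e) = (\<Prod>e\<in>?O. f e) * (\<Prod>e\<in>?N. f e)" for f :: "nat \<Rightarrow> real"
    using arcs_split[of G] fin by (metis prod.union_disjoint)
  have loop: "wigner_entry (P (l e)) (Q (l e)) (?x e) n (\<phi> (head G e)) (\<phi> (tail G e)) =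
      1 / sqrt (real n) * (\<Sum>k<n. (Q (l e) + (if k = \<phi> (head G e) then P (l e) else 0)) * ?x e (\<phi> (head G e)) k)"
    if "e \<in> ?O" for e
  proof -
    have "tail G e = head G e" "\<phi> (head G e) < n" using that \<phi>n by (auto simp: loop_arcs_def)
    then have "(\<Sum>k<n. (Q (l e) + (if k = \<phi> (head G e) then P (l e) else 0)) * ?x e (\<phi> (head G e)) k) =
        Q (l e) * (\<Sum>k<n. ?x e (\<phi> (head G e)) k) + P (l e) * ?x e (\<phi> (head G e)) (\<phi> (head G e))"
      by (simp add: distrib_right sum.distrib sum_distrib_left if_distrib[of "\<lambda>t. t * _"] sum.delta cong: if_cong)
    then show ?thesis using \<open>tail G e = head G e\<close> by (simp add: wigner_entry_def add.commute)
  qed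
  have link: "wigner_entry (P (l e)) (Q (l e)) (?x e) n (\<phi> (head G e)) (\<phi> (tail G e)) =
      1 / sqrt (real n) * (P (l e) * ?x e (\<phi> (head G e)) (\<phi> (tail G e)))" if "e \<in> ?N" for e
    using that \<phi>inj[of "head G e" "tail G e"] by (auto simp: wigner_entry_def link_arcs_def)
  have prod_loop: "(\<Prod>e\<in>?O. wigner_entry (P (l e)) (Q (l e)) (?x e) n (\<phi> (head G e)) (\<phi> (tail G e))) =
      (\<Prod>e\<in>?O. 1 / sqrt (real n)) *
      (\<Prod>e\<in>?O. \<Sum>k<n. (Q (l e) + (if k = \<phi> (head G e) then P (l e) else 0)) * ?x e (\<phi> (head G e)) k)"
    unfolding prod.distrib[symmetric] by (intro prod.cong refl loop)
  have prod_link: "(\<Prod>e\<in>?N. wigner_entry (P (l e)) (Q (l e)) (?x e) n (\<phi> (head G e)) (\<phi> (tail G e))) =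
      (\<Prod>e\<in>?N. 1 / sqrt (real n)) * (\<Prod>e\<in>?N. P (l e) * ?x e (\<phi> (head G e)) (\<phi> (tail G e)))"
    unfolding prod.distrib[symmetric, where A = ?N and g = "\<lambda>_. 1 / sqrt (real n)"] by (intro prod.cong refl link)
  have "(\<Prod>e\<in>?E. wigner_entry (P (l e)) (Q (l e)) (?x e) n (\<phi> (head G e)) (\<phi> (tail G e))) =
      (\<Prod>e\<in>?O. 1 / sqrt (real n)) * (\<Prod>e\<in>?N. 1 / sqrt (real n)) *
      ((\<Prod>e\<in>?O. \<Sum>k<n. (Q (l e) + (if k = \<phi> (head G e) then P (l e) else 0)) * ?x e (\<phi> (head G e)) k) *
       (\<Prod>e\<in>?N. P (l e) * ?x e (\<phi> (head G e)) (\<phi> (tail G e))))"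
    unfolding split prod_loop prod_link by (simp only: mult_ac)
  also have "(\<Prod>e\<in>?O. 1 / sqrt (real n)) * (\<Prod>e\<in>?N. 1 / sqrt (real n)) = (1 / sqrt (real n)) ^ card ?E"
    unfolding split[symmetric] by simp
  also have "(\<Prod>e\<in>?O. \<Sum>k<n. (Q (l e) + (if k = \<phi> (head G e) then P (l e) else 0)) * ?x e (\<phi> (head G e)) k) =
      (\<Sum>\<kappa>\<in>?O \<rightarrow>\<^sub>E {..<n}. \<Prod>e\<in>?O. (Q (l e) + (if \<kappa> e = \<phi> (head G e) then P (l e) else 0)) * ?x e (\<phi> (head G e)) (\<kappa> e))"
    using fin by (intro prod_sum_PiE) auto
  also have "\<dots> * (\<Prod>e\<in>?N. P (l e) * ?x e (\<phi> (head G e)) (\<phi> (tail G e))) =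
     (\<Sum>\<kappa>\<in>?O \<rightarrow>\<^sub>E {..<n}. pattern_weight G (P \<circ> l) (Q \<circ> l) \<phi> \<kappa> *
       (\<Prod>x\<in>?k \<kappa> ` ?E. X n (fst x) \<omega> (Min (snd x)) (Max (snd x)) ^ card {e\<in>?E. ?k \<kappa> e = x}))"
    unfolding sum_distrib_right
  proof (intro sum.cong refl)
    fix \<kappa> assume \<kappa>: "\<kappa> \<in> ?O \<rightarrow>\<^sub>E {..<n}"
    let ?far = "\<lambda>e. if tail G e = head G e then \<kappa> e else \<phi> (tail G e)"
    have pw: "pattern_weight G (P \<circ> l) (Q \<circ> l) \<phi> \<kappa> =
        (\<Prod>e\<in>?O. Q (l e) + (if \<kappa> e = \<phi> (head G e) then P (l e) else 0)) * (\<Prod>e\<in>?N. P (l e))"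
      unfolding pattern_weight_def split by (intro arg_cong2[of _ _ _ _ times] prod.cong) (auto simp: loop_arcs_def link_arcs_def)
    have "(\<Prod>e\<in>?E. ?x e (\<phi> (head G e)) (?far e)) =
        (\<Prod>e\<in>?O. ?x e (\<phi> (head G e)) (\<kappa> e)) * (\<Prod>e\<in>?N. ?x e (\<phi> (head G e)) (\<phi> (tail G e)))"
      unfolding split by (intro arg_cong2[of _ _ _ _ times] prod.cong) (auto simp: loop_arcs_def link_arcs_def)
    moreover have "(\<Prod>e\<in>?E. ?x e (\<phi> (head G e)) (?far e)) =
        (\<Prod>e\<in>?E. X n (fst (?k \<kappa> e)) \<omega> (Min (snd (?k \<kappa> e))) (Max (snd (?k \<kappa> e))))"
    proof (intro prod.cong refl)
      fix e assume e: "e \<in> ?E"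
      have far: "?far e < n" "\<phi> (head G e) < n" using e \<kappa> \<phi>n by (auto simp: loop_arcs_def)
      show "?x e (\<phi> (head G e)) (?far e) = X n (fst (?k \<kappa> e)) \<omega> (Min (snd (?k \<kappa> e))) (Max (snd (?k \<kappa> e)))"
        using sym[OF n \<omega> far, of "clr (l e)"] by (simp add: edge_key_def min_def max_def)
    qed
    \<comment> \<open>Edges with the same key carry the same entry; collecting them into powers
      leaves independent factors.\<close>
    moreover have "\<dots> = (\<Prod>x\<in>?k \<kappa> ` ?E. X n (fst x) \<omega> (Min (snd x)) (Max (snd x)) ^ card {e\<in>?E. ?k \<kappa> e = x})"
      by (subst prod.image_gen[OF finite_arcs, of _ "?k \<kappa>"]) (intro prod.cong refl, simp)
    ultimately show "(\<Prod>e\<in>?O. (Q (l e) + (if \<kappa> e = \<phi> (head G e) then P (l e) else 0)) * ?x e (\<phi> (head G e)) (\<kappa> e)) *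
          (\<Prod>e\<in>?N. P (l e) * ?x e (\<phi> (head G e)) (\<phi> (tail G e))) =
        pattern_weight G (P \<circ> l) (Q \<circ> l) \<phi> \<kappa> *
          (\<Prod>x\<in>?k \<kappa> ` ?E. X n (fst x) \<omega> (Min (snd x)) (Max (snd x)) ^ card {e\<in>?E. ?k \<kappa> e = x})"
      by (simp add: pw prod.distrib mult_ac)
  qed
  finally show ?thesis by (simp add: Tdef)
qed

text \<open>By independence the expectation is exact at every size. Integrability is recorded along
  with the value, since sums over partitions must later be exchanged with the integral.\<close>

lemma has_integral_inj_vertex_sum:
  fixes T :: "'s test_graph"
  assumes n: "1 \<le> n" and T: "is_test_graph T"
  shows "has_bochner_integral (M n) (\<lambda>\<omega>. 1 / of_nat n * inj_vertex_sum n (B n \<omega>) T)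
    (of_real (1 / real n * (1 / sqrt (real n)) ^ card (arcs (fst T)) *
       (\<Sum>(\<phi>, \<kappa>)\<in>patterns (fst T) n. pattern_weight (fst T) (P \<circ> snd T) (Q \<circ> snd T) \<phi> \<kappa> *
          key_moment (fst T) (clr \<circ> snd T) (\<mu> n) \<phi> \<kappa>)))"
proof -
  obtain G l where Tdef: "T = (G, l)" by force
  interpret fin_digraph G using T Tdef by (simp add: is_test_graph_def)
  let ?k = "edge_key G (clr \<circ> l)"
  let ?Y = "\<lambda>\<phi> \<kappa> \<omega>. \<Prod>x\<in>?k \<phi> \<kappa> ` arcs G. X n (fst x) \<omega> (Min (snd x)) (Max (snd x)) ^ card {e\<in>arcs G. ?k \<phi> \<kappa> e = x}"
  have "has_bochner_integral (M n) (\<lambda>\<omega>. of_real (1 / real n * (1 / sqrt (real n)) ^ card (arcs G) *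
       (\<Sum>x\<in>patterns G n. pattern_weight G (P \<circ> l) (Q \<circ> l) (fst x) (snd x) * ?Y (fst x) (snd x) \<omega>)) :: complex)
    (of_real (1 / real n * (1 / sqrt (real n)) ^ card (arcs G) *
       (\<Sum>x\<in>patterns G n. pattern_weight G (P \<circ> l) (Q \<circ> l) (fst x) (snd x) * key_moment G (clr \<circ> l) (\<mu> n) (fst x) (snd x))))"
    unfolding key_moment_def
  proof (intro has_bochner_integral_of_real has_bochner_integral_mult_right has_bochner_integral_sum moments n)
    fix y k assume y: "y \<in> patterns G n" and "k \<in> ?k (fst y) (snd y) ` arcs G"
    then obtain e where e: "e \<in> arcs G" "k = ?k (fst y) (snd y) e" by blast
    then have "fst y (head G e) < n" "fst y (tail G e) < n" "tail G e = head G e \<Longrightarrow> snd y e < n"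
      using y by (auto simp: patterns_def inj_maps_def loop_arcs_def)
    then show "\<exists>a<n. \<exists>b<n. snd k = {a, b}"
      unfolding e(2) edge_key_def by (cases "tail G e = head G e") auto
  qed auto
  also have "?this \<longleftrightarrow> ?thesis"
  proof (rule has_bochner_integral_cong[OF refl])
    fix \<omega> assume \<omega>: "\<omega> \<in> space (M n)"
    have "inj_vertex_sum n (B n \<omega>) T = of_real (\<Sum>\<phi>\<in>inj_maps (verts G) n.
        \<Prod>e\<in>arcs G. wigner_entry (P (l e)) (Q (l e)) (X n (clr (l e)) \<omega>) n (\<phi> (head G e)) (\<phi> (tail G e)))"
      unfolding inj_vertex_sum_def Tdef inj_maps_def by simp
    also have "\<dots> = of_real (\<Sum>\<phi>\<in>inj_maps (verts G) n. (1 / sqrt (real n)) ^ card (arcs G) *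
        (\<Sum>\<kappa>\<in>loop_arcs G \<rightarrow>\<^sub>E {..<n}. pattern_weight G (P \<circ> l) (Q \<circ> l) \<phi> \<kappa> * ?Y \<phi> \<kappa> \<omega>))"
      using prod_wigner_entry[OF n \<omega> T] unfolding Tdef fst_conv snd_conv
      by (intro arg_cong[of _ _ of_real] sum.cong refl) blast
    also have "\<dots> = of_real ((1 / sqrt (real n)) ^ card (arcs G) *
        (\<Sum>x\<in>patterns G n. pattern_weight G (P \<circ> l) (Q \<circ> l) (fst x) (snd x) * ?Y (fst x) (snd x) \<omega>))"
      unfolding sum_distrib_left[symmetric] sum.cartesian_product patterns_def by (simp add: case_prod_unfold)
    finally show "of_real (1 / real n * (1 / sqrt (real n)) ^ card (arcs G) *
       (\<Sum>x\<in>patterns G n. pattern_weight G (P \<circ> l) (Q \<circ> l) (fst x) (snd x) * ?Y (fst x) (snd x) \<omega>)) =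
      1 / of_nat n * inj_vertex_sum n (B n \<omega>) T" by simp
  qed (simp add: Tdef case_prod_unfold)
  finally show ?thesis .
qed

lemma inj_traffic_converges:
  assumes T: "is_test_graph T"
  shows "(\<lambda>n. LINT \<omega>|M n. 1 / of_nat n * inj_vertex_sum n (B n \<omega>) T) \<longlonglongrightarrow> inj_limit clr P Q T"
proof -
  obtain G l where Tdef: "T = (G, l)" by force
  have test: "is_test_graph (G, l)" using T Tdef by simp
  interpret fin_digraph G using test by (simp add: is_test_graph_def)
  have "\<exists>C. \<forall>n\<ge>1. \<forall>e\<in>arcs G. \<forall>a<n. \<forall>b<n. \<bar>\<mu> n ((clr \<circ> l) e, {a, b}) r\<bar> \<le> C" for r
  proof -
    \<comment> \<open>The moment bound depends on the colour. Only finitely many colours occur on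
      the arcs, so the sum of their bounds serves for all of them.\<close>
    obtain C where C: "\<And>k. \<forall>n\<ge>1. \<forall>a<n. \<forall>b<n. \<bar>\<mu> n (k, {a, b}) r\<bar> \<le> C k"
      using bounded_moments[of _ r] by metis
    have "\<bar>\<mu> n ((clr \<circ> l) e, {a, b}) r\<bar> \<le> (\<Sum>e\<in>arcs G. \<bar>C (clr (l e))\<bar>)"
      if "n \<ge> 1" "e \<in> arcs G" "a < n" "b < n" for n e a b
    proof -
      have "\<bar>\<mu> n ((clr \<circ> l) e, {a, b}) r\<bar> \<le> \<bar>C (clr (l e))\<bar>"
        using C that by (smt (verit) o_apply)
      also have "\<dots> \<le> (\<Sum>e\<in>arcs G. \<bar>C (clr (l e))\<bar>)" using that by (intro member_le_sum) auto
      finally show ?thesis .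
    qed
    then show ?thesis by blast
  qed
  from pattern_limit[OF test this moment_1 moment_2, of "P \<circ> l" "Q \<circ> l"]
  have "(\<lambda>n. of_real (1 / real n * (1 / sqrt (real n)) ^ card (arcs G) *
            (\<Sum>(\<phi>, \<kappa>)\<in>patterns G n. pattern_weight G (P \<circ> l) (Q \<circ> l) \<phi> \<kappa> * key_moment G (clr \<circ> l) (\<mu> n) \<phi> \<kappa>)))
      \<longlonglongrightarrow> inj_limit clr P Q T"
    unfolding inj_limit_def Tdef fst_conv snd_conv by (rule tendsto_of_real)
  then show ?thesis
  proof (rule Lim_transform_eventually, intro eventually_sequentiallyI[of 1])
    fix n :: nat assume "1 \<le> n"
    from has_bochner_integral_integral_eq[OF has_integral_inj_vertex_sum[OF this T]]
    show "of_real (1 / real n * (1 / sqrt (real n)) ^ card (arcs G) *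
            (\<Sum>(\<phi>, \<kappa>)\<in>patterns G n. pattern_weight G (P \<circ> l) (Q \<circ> l) \<phi> \<kappa> * key_moment G (clr \<circ> l) (\<mu> n) \<phi> \<kappa>)) =
        (LINT \<omega>|M n. 1 / of_nat n * inj_vertex_sum n (B n \<omega>) T)"
      by (simp only: Tdef fst_conv snd_conv)
  qed
qed

lemma integral_vertex_sum:
  assumes "1 \<le> n" "is_test_graph T"
  shows "integrable (M n) (\<lambda>\<omega>. 1 / of_nat n * vertex_sum n (B n \<omega>) T)"
    and "(LINT \<omega>|M n. 1 / of_nat n * vertex_sum n (B n \<omega>) T) =
      (\<Sum>\<pi> | partition_on (verts (fst T)) \<pi>.
         LINT \<omega>|M n. 1 / of_nat n * inj_vertex_sum n (B n \<omega>) (quotient_graph \<pi> T))"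
proof -
  have "integrable (M n) (\<lambda>\<omega>. 1 / of_nat n * inj_vertex_sum n (B n \<omega>) (quotient_graph \<pi> T))" for \<pi>
    using has_integral_inj_vertex_sum[OF assms(1) is_test_graph_quotient[OF assms(2)]]
    by (auto simp: has_bochner_integral_iff)
  note int = this
  show "integrable (M n) (\<lambda>\<omega>. 1 / of_nat n * vertex_sum n (B n \<omega>) T)"
    unfolding vertex_sum_eq_sum_inj[OF assms(2)] sum_distrib_left
    by (rule Bochner_Integration.integrable_sum) (rule int)
  show "(LINT \<omega>|M n. 1 / of_nat n * vertex_sum n (B n \<omega>) T) =
      (\<Sum>\<pi> | partition_on (verts (fst T)) \<pi>.
         LINT \<omega>|M n. 1 / of_nat n * inj_vertex_sum n (B n \<omega>) (quotient_graph \<pi> T))"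
    unfolding vertex_sum_eq_sum_inj[OF assms(2)] sum_distrib_left
    by (rule Bochner_Integration.integral_sum) (rule int)
qed

lemma traffic_converges_limit:
  "traffic_converges (\<lambda>n T. LINT \<omega>|M n. 1 / of_nat n * vertex_sum n (B n \<omega>) T) (traffic_limit clr P Q)"
  unfolding traffic_converges_def
proof (intro allI impI)
  fix T :: "'s test_graph" assume T: "is_test_graph T"
  have "(\<lambda>n. \<Sum>\<pi> | partition_on (verts (fst T)) \<pi>.
      LINT \<omega>|M n. 1 / of_nat n * inj_vertex_sum n (B n \<omega>) (quotient_graph \<pi> T)) \<longlonglongrightarrow> traffic_limit clr P Q T"
    unfolding traffic_limit_def by (intro tendsto_sum inj_traffic_converges is_test_graph_quotient T)
  then show "(\<lambda>n. LINT \<omega>|M n. 1 / of_nat n * vertex_sum n (B n \<omega>) T) \<longlonglongrightarrow> traffic_limit clr P Q T"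
    by (rule Lim_transform_eventually)
      (rule eventually_sequentiallyI[of 1], rule integral_vertex_sum(2)[OF _ T, symmetric])
qed

text \<open>The injective version is a finite combination of values, hence commutes with the limit,
  and at each positive size it is the sum over injective maps. Uniqueness of limits thus replaces a
  Moebius inversion of \<open>traffic_limit\<close>.\<close>

lemma injective_version_traffic_limit:
  assumes T: "is_test_graph T"
  shows "injective_version (traffic_limit clr P Q) T = inj_limit clr P Q T"
proof (rule LIMSEQ_unique)
  let ?\<tau> = "\<lambda>n T. LINT \<omega>|M n. 1 / of_nat n * vertex_sum n (B n \<omega>) T"
  show "(\<lambda>n. injective_version (?\<tau> n) T) \<longlonglongrightarrow> injective_version (traffic_limit clr P Q) T"
    unfolding injective_version_def
    by (intro tendsto_sum tendsto_mult tendsto_const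
        traffic_converges_limit[unfolded traffic_converges_def, rule_format, OF is_test_graph_quotient[OF T]])
  show "(\<lambda>n. injective_version (?\<tau> n) T) \<longlonglongrightarrow> inj_limit clr P Q T"
  proof (rule Lim_transform_eventually[OF inj_traffic_converges[OF T]], rule eventually_sequentiallyI[of 1])
    fix n :: nat assume n: "1 \<le> n"
    have "injective_version (?\<tau> n) T = (LINT \<omega>|M n. (\<Sum>\<pi> | partition_on (verts (fst T)) \<pi>.
        1 / of_nat n * vertex_sum n (B n \<omega>) (quotient_graph \<pi> T) *
        of_int (partition_moebius (verts (fst T)) ((\<lambda>v. {v}) ` verts (fst T)) \<pi>)))"
      unfolding injective_version_def integral_mult_left_zero[symmetric]
      by (rule Bochner_Integration.integral_sum[symmetric])
        (rule integrable_mult_left, rule integral_vertex_sum(1)[OF n is_test_graph_quotient[OF T]])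
    also have "\<dots> = (LINT \<omega>|M n. 1 / of_nat n * inj_vertex_sum n (B n \<omega>) T)"
      unfolding injective_version_vertex_sum[OF T, symmetric]
      by (simp add: injective_version_def sum_distrib_left mult.assoc)
    finally show "(LINT \<omega>|M n. 1 / of_nat n * inj_vertex_sum n (B n \<omega>) T) = injective_version (?\<tau> n) T" by simp
  qed
qed

end
end

section \<open>Real Wigner matrices as an instance of the moment model\<close>

lemma sqrt_dim_entry:
  assumes "x \<in> carrier_mat n n" "a < n" "b < n"
  shows "M_mat p q (normalized_mat x) $$ (a, b) = wigner_entry p q (\<lambda>j k. x $$ (j, k)) n a b"
  using assms
  by (auto simp: M_mat_def normalized_mat_def row_sum_mat_def wigner_entry_def add_divide_distrib
      sum_divide_distrib sum_distrib_left)

text \<open>These matrices are real and symmetric, so \<open>\<epsilon>\<close> has no effect and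
  all test graphs may be treated as if they were without adjoints.\<close>

lemma mat_exp_star_M_family:
  assumes x: "x \<in> carrier_mat n n" "transpose_mat x = x" and ab: "a < n" "b < n"
  shows "mat_exp_star \<epsilon> (map_mat complex_of_real (M_mat p q (normalized_mat x))) $$ (a, b) =
         of_real (wigner_entry p q (\<lambda>j k. x $$ (j, k)) n a b)"
proof -
  let ?A = "map_mat complex_of_real (M_mat p q (normalized_mat x))"
  have dim: "dim_row (M_mat p q (normalized_mat x)) = n" "dim_col (M_mat p q (normalized_mat x)) = n"
    using x by (auto simp: M_mat_def normalized_mat_def row_sum_mat_def)
  have "x $$ (j, k) = x $$ (k, j)" if "j < n" "k < n" for j k
    using x that by (metis carrier_matD index_transpose_mat(1))
  then have "wigner_entry p q (\<lambda>j k. x $$ (j, k)) n b a = wigner_entry p q (\<lambda>j k. x $$ (j, k)) n a b"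
    using ab by (auto simp: wigner_entry_def)
  then show ?thesis
    using dim ab sqrt_dim_entry[OF x(1) ab] sqrt_dim_entry[OF x(1) ab(2,1)]
    by (cases \<epsilon>) (auto simp: mat_adjoint_def mat_of_rows_def)
qed

lemma real_wignerD:
  assumes "real_wigner M X"
  shows "1 \<le> n \<Longrightarrow> prob_space (M n)"
    and "1 \<le> n \<Longrightarrow> \<omega> \<in> space (M n) \<Longrightarrow> X n k \<omega> \<in> carrier_mat n n"
    and "1 \<le> n \<Longrightarrow> \<omega> \<in> space (M n) \<Longrightarrow> transpose_mat (X n k \<omega>) = X n k \<omega>"
    and "1 \<le> n \<Longrightarrow> prob_space.indep_vars (M n) (\<lambda>_. borel) (\<lambda>(l, j, k) \<omega>. X n l \<omega> $$ (j, k))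
           {(l, j, k). j \<le> k \<and> k < n}"
    and "1 \<le> n \<Longrightarrow> a < b \<Longrightarrow> b < n \<Longrightarrow> (LINT \<omega>|M n. X n k \<omega> $$ (a, b)) = 0"
    and "1 \<le> n \<Longrightarrow> a < b \<Longrightarrow> b < n \<Longrightarrow> (LINT \<omega>|M n. (X n k \<omega> $$ (a, b))\<^sup>2) = 1"
    and "finite L\<^sub>0 \<Longrightarrow> (SUP n\<in>{1..}. SUP l\<in>L\<^sub>0. SUP (j, k)\<in>{(j, k). j \<le> k \<and> k < n}.
           \<integral>\<^sup>+\<omega>. ennreal (\<bar>X n l \<omega> $$ (j, k)\<bar> ^ r) \<partial>M n) < \<infinity>"
proof -
  note a = assms[unfolded real_wigner_def]
  note b = a[THEN conjunct2] note c = b[THEN conjunct2] note d = c[THEN conjunct2]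
  show "1 \<le> n \<Longrightarrow> prob_space (M n)" using a[THEN conjunct1] by blast
  show "1 \<le> n \<Longrightarrow> \<omega> \<in> space (M n) \<Longrightarrow> X n k \<omega> \<in> carrier_mat n n"
    "1 \<le> n \<Longrightarrow> \<omega> \<in> space (M n) \<Longrightarrow> transpose_mat (X n k \<omega>) = X n k \<omega>"
    using b[THEN conjunct1, rule_format] by simp_all
  show "1 \<le> n \<Longrightarrow> prob_space.indep_vars (M n) (\<lambda>_. borel) (\<lambda>(l, j, k) \<omega>. X n l \<omega> $$ (j, k))
           {(l, j, k). j \<le> k \<and> k < n}" using c[THEN conjunct1, rule_format] .
  show "1 \<le> n \<Longrightarrow> a < b \<Longrightarrow> b < n \<Longrightarrow> (LINT \<omega>|M n. X n k \<omega> $$ (a, b)) = 0"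
    "1 \<le> n \<Longrightarrow> a < b \<Longrightarrow> b < n \<Longrightarrow> (LINT \<omega>|M n. (X n k \<omega> $$ (a, b))\<^sup>2) = 1"
    using d[THEN conjunct1, rule_format] by simp_all
  show "finite L\<^sub>0 \<Longrightarrow> (SUP n\<in>{1..}. SUP l\<in>L\<^sub>0. SUP (j, k)\<in>{(j, k). j \<le> k \<and> k < n}.
           \<integral>\<^sup>+\<omega>. ennreal (\<bar>X n l \<omega> $$ (j, k)\<bar> ^ r) \<partial>M n) < \<infinity>"
    using d[THEN conjunct2, rule_format] .
qed

lemma real_wigner_moments:
  assumes W: "real_wigner M X"
  shows "wigner_moments M (\<lambda>n k \<omega> a b. X n k \<omega> $$ (a, b))
    (\<lambda>n x r. LINT \<omega>|M n. (X n (fst x) \<omega> $$ (Min (snd x), Max (snd x))) ^ r)"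
proof -
  let ?Y = "\<lambda>n (k, a, b) \<omega>. X n k \<omega> $$ (a, b)"
  let ?I = "\<lambda>n. {(k :: nat, a :: nat, b :: nat). a \<le> b \<and> b < n}"
  note W' = real_wignerD[OF W]
  note ps = W'(1)
  have indep: "prob_space.indep_vars (M n) (\<lambda>_. borel) (?Y n) (?I n)" if "1 \<le> n" for n
    using W'(4)[OF that] .
  have meas: "?Y n i \<in> borel_measurable (M n)" if "1 \<le> n" "i \<in> ?I n" for n i
    using indep[OF that(1)] that(2) unfolding prob_space.indep_vars_def2[OF ps[OF that(1)]] by blast
  have bound: "\<exists>C. \<forall>n\<ge>1. \<forall>a b. a \<le> b \<and> b < n \<longrightarrow> (\<integral>\<^sup>+\<omega>. ennreal (\<bar>X n k \<omega> $$ (a, b)\<bar> ^ r) \<partial>M n) \<le> ennreal C" for k r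
  proof -
    let ?S = "SUP n\<in>{1..}. SUP l\<in>{k}. SUP (j, k)\<in>{(j, k). j \<le> k \<and> k < n}.
      \<integral>\<^sup>+\<omega>. ennreal (\<bar>X n l \<omega> $$ (j, k)\<bar> ^ r) \<partial>M n"
    have "?S < \<infinity>" by (intro W'(7)) simp
    then have C: "?S = ennreal (enn2real ?S)" by (simp only: ennreal_enn2real infinity_ennreal_def)
    have "(\<integral>\<^sup>+\<omega>. ennreal (\<bar>X n k \<omega> $$ (a, b)\<bar> ^ r) \<partial>M n) \<le> ?S" if "1 \<le> n" "a \<le> b" "b < n" for n a b
      using that by (intro SUP_upper2[of n] SUP_upper2[of k] SUP_upper2[of "(a, b)"]) auto
    then show ?thesis by (subst (asm) C) blast
  qed
  have int: "integrable (M n) (\<lambda>\<omega>. ?Y n i \<omega> ^ r)" if n: "1 \<le> n" and i: "i \<in> ?I n" for n i r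
  proof -
    obtain k a b where kab: "i = (k, a, b)" "a \<le> b" "b < n" using i by auto
    obtain C where "(\<integral>\<^sup>+\<omega>. ennreal (\<bar>X n k \<omega> $$ (a, b)\<bar> ^ r) \<partial>M n) \<le> ennreal C"
      using bound n kab by blast
    then have "(\<integral>\<^sup>+\<omega>. ennreal (norm (?Y n i \<omega> ^ r)) \<partial>M n) < \<infinity>"
      unfolding kab by (simp add: power_abs le_less_trans)
    then show ?thesis using meas[OF n i] by (intro integrableI_bounded) (auto simp: kab)
  qed
  \<comment> \<open>An unordered pair is determined by its minimum and maximum. This embeds the keys
    into the upper-triangular index set on which independence is assumed.\<close>
  let ?idx = "\<lambda>x :: nat \<times> nat set. (fst x, Min (snd x), Max (snd x))"
  show ?thesis
  proof
    fix n \<omega> a b k assume "1 \<le> n" "\<omega> \<in> space (M n)" "a < n" "b < n"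
    moreover from this have "X n k \<omega> \<in> carrier_mat n n" "transpose_mat (X n k \<omega>) = X n k \<omega>"
      using W'(2,3) by blast+
    ultimately show "X n k \<omega> $$ (a, b) = X n k \<omega> $$ (b, a)"
      by (metis carrier_matD index_transpose_mat(1))
  next
    fix n :: nat and K :: "(nat \<times> nat set) set" and r :: "nat \<times> nat set \<Rightarrow> nat"
    assume n: "1 \<le> n" and K: "finite K" and dbl: "\<And>x. x \<in> K \<Longrightarrow> \<exists>a<n. \<exists>b<n. snd x = {a, b}"
    interpret prob_space "M n" by (rule ps[OF n])
    have idx: "?idx x \<in> ?I n" if "x \<in> K" for x using dbl[OF that] by (auto simp: min_def max_def)
    have inj: "inj_on ?idx K"
    proof (rule inj_onI)
      fix x y assume xy: "x \<in> K" "y \<in> K" "?idx x = ?idx y"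
      have eq: "snd z = {Min (snd z), Max (snd z)}" if z: "z \<in> K" for z
      proof -
        obtain a b where ab: "snd z = {a, b}" using dbl[OF z] by blast
        show ?thesis unfolding ab by (auto simp: min_def max_def)
      qed
      have "snd x = {Min (snd x), Max (snd x)}" by (rule eq[OF xy(1)])
      also have "\<dots> = {Min (snd y), Max (snd y)}" using xy(3) by simp
      also have "\<dots> = snd y" by (rule eq[OF xy(2), symmetric])
      finally have "snd x = snd y" .
      then show "x = y" using xy by (simp add: prod_eq_iff)
    qed
    \<comment> \<open>Independence is indexed by triples, so the exponent of a key is transported to
      its triple.\<close>
    let ?r = "\<lambda>i. r (the_inv_into K ?idx i)"
    let ?Z = "\<lambda>i \<omega>. ?Y n i \<omega> ^ ?r i"
    have Z: "indep_vars (\<lambda>_. borel) ?Z (?idx ` K)"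
      by (rule indep_vars_compose2[OF indep_vars_subset[OF indep[OF n]], where Y = "\<lambda>i y. y ^ ?r i"])
        (use idx in blast, simp)
    have Zint: "integrable (M n) (?Z i)" if "i \<in> ?idx ` K" for i using int[OF n] idx that by auto
    have "has_bochner_integral (M n) (\<lambda>\<omega>. \<Prod>i\<in>?idx ` K. ?Z i \<omega>) (\<Prod>i\<in>?idx ` K. LINT \<omega>|M n. ?Z i \<omega>)"
      unfolding has_bochner_integral_iff
      using indep_vars_integrable[OF _ Z Zint] indep_vars_lebesgue_integral[OF _ Z Zint] K by auto
    then show "has_bochner_integral (M n) (\<lambda>\<omega>. \<Prod>x\<in>K. X n (fst x) \<omega> $$ (Min (snd x), Max (snd x)) ^ r x)
        (\<Prod>x\<in>K. LINT \<omega>|M n. (X n (fst x) \<omega> $$ (Min (snd x), Max (snd x))) ^ r x)"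
      unfolding prod.reindex[OF inj] by (simp add: the_inv_into_f_f[OF inj] cong: prod.cong)
  next
    fix k r
    obtain C where C: "\<forall>n\<ge>1. \<forall>a b. a \<le> b \<and> b < n \<longrightarrow> (\<integral>\<^sup>+\<omega>. ennreal (\<bar>X n k \<omega> $$ (a, b)\<bar> ^ r) \<partial>M n) \<le> ennreal C"
      using bound by blast
    \<comment> \<open>The extended bound \<open>ennreal C\<close> is 0 for negative
      \<open>C\<close>, hence \<open>max 0 C\<close> as the real bound.\<close>
    have "\<bar>LINT \<omega>|M n. (X n k \<omega> $$ (Min {a, b}, Max {a, b})) ^ r\<bar> \<le> max 0 C"
      if n: "n \<ge> 1" and ab: "a < n" "b < n" for n a b
    proof -
      let ?f = "\<lambda>\<omega>. (X n k \<omega> $$ (Min {a, b}, Max {a, b})) ^ r"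
      have I: "(k, Min {a, b}, Max {a, b}) \<in> ?I n" using ab by (auto simp: min_def max_def)
      have "ennreal (norm (integral\<^sup>L (M n) ?f)) \<le> (\<integral>\<^sup>+\<omega>. norm (?f \<omega>) \<partial>M n)"
        using int[OF n I, of r] by (intro integral_norm_bound_ennreal) simp
      also have "\<dots> \<le> ennreal (max 0 C)"
        using C n I by (auto simp: power_abs intro: order_trans ennreal_leI)
      finally show ?thesis by (simp only: ennreal_le_iff[OF max.cobounded1] real_norm_def)
    qed
    then show "\<exists>C. \<forall>n\<ge>1. \<forall>a<n. \<forall>b<n. \<bar>LINT \<omega>|M n. (X n (fst (k, {a, b})) \<omega> $$ (Min (snd (k, {a, b})), Max (snd (k, {a, b})))) ^ r\<bar> \<le> C"
      by auto
  next
    fix n a b :: nat and k assume ab: "a < n" "b < n" "a \<noteq> b"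
    then have "Min {a, b} < Max {a, b}" "Max {a, b} < n" "n \<ge> 1" by (auto simp: min_def max_def)
    then show "(LINT \<omega>|M n. (X n (fst (k, {a, b})) \<omega> $$ (Min (snd (k, {a, b})), Max (snd (k, {a, b})))) ^ 1) = 0"
      "(LINT \<omega>|M n. (X n (fst (k, {a, b})) \<omega> $$ (Min (snd (k, {a, b})), Max (snd (k, {a, b})))) ^ 2) = 1"
      using W'(5,6)[of n "Min {a, b}" "Max {a, b}"] by simp_all
  qed
qed

lemma mat_traffic_dist_M_family:
  assumes W: "real_wigner M X" and n: "1 \<le> n" and T: "is_test_graph T"
  shows "mat_traffic_dist (M n) n (\<lambda>i. M_family (X n (f i)) (g i)) T =
    (LINT \<omega>|M n. 1 / of_nat n * vertex_sum n (\<lambda>s a b. of_real (wigner_entry (fst (g (fst s))) (snd (g (fst s)))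
       (\<lambda>j k. X n (f (fst s)) \<omega> $$ (j, k)) n a b)) T)"
  unfolding mat_traffic_dist_def Let_def vertex_sum_def
proof (intro Bochner_Integration.integral_cong refl arg_cong2[of _ _ _ _ times] sum.cong prod.cong)
  interpret fin_digraph "fst T" using T by (simp add: is_test_graph_def)
  fix \<omega> \<phi> e assume \<omega>: "\<omega> \<in> space (M n)" and \<phi>: "\<phi> \<in> verts (fst T) \<rightarrow>\<^sub>E {..<n}" and e: "e \<in> arcs (fst T)"
  have "X n k \<omega> \<in> carrier_mat n n" "transpose_mat (X n k \<omega>) = X n k \<omega>" for k
    using real_wignerD(2,3)[OF W n \<omega>] by blast+
  moreover have "\<phi> (head (fst T) e) < n" "\<phi> (tail (fst T) e) < n" using \<phi> e by auto
  ultimately show "mat_exp_star (snd (snd T e)) (M_family (X n (f (fst (snd T e)))) (g (fst (snd T e))) \<omega>) $$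
      (\<phi> (head (fst T) e), \<phi> (tail (fst T) e)) =
    of_real (wigner_entry (fst (g (fst (snd T e)))) (snd (g (fst (snd T e))))
       (\<lambda>j k. X n (f (fst (snd T e))) \<omega> $$ (j, k)) n (\<phi> (head (fst T) e)) (\<phi> (tail (fst T) e)))"
    unfolding M_family_def case_prod_unfold by (rule mat_exp_star_M_family)
qed

text \<open>The map \<open>f\<close> selects the matrix and \<open>g\<close> its parameters.
  Projections give the joint distribution of all families, and a constant \<open>f\<close> gives
  that of a single family.\<close>

lemma traffic_converges_M_family:
  fixes f :: "'a \<Rightarrow> nat" and g :: "'a \<Rightarrow> real \<times> real"
  assumes W: "real_wigner M X"
  shows "traffic_converges (\<lambda>n. mat_traffic_dist (M n) n (\<lambda>i. M_family (X n (f i)) (g i)))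
    (traffic_limit (\<lambda>s. f (fst s)) (\<lambda>s. fst (g (fst s))) (\<lambda>s. snd (g (fst s))))"
proof -
  interpret wigner_moments M "\<lambda>n k \<omega> a b. X n k \<omega> $$ (a, b)"
    "\<lambda>n x r. LINT \<omega>|M n. (X n (fst x) \<omega> $$ (Min (snd x), Max (snd x))) ^ r"
    by (rule real_wigner_moments[OF W])
  show ?thesis
    unfolding traffic_converges_def
  proof (intro allI impI)
    fix T :: "('a \<times> star_exp) test_graph" assume T: "is_test_graph T"
    note lim = traffic_converges_limit[where clr = "\<lambda>s :: 'a \<times> star_exp. f (fst s)"
        and P = "\<lambda>s. fst (g (fst s))" and Q = "\<lambda>s. snd (g (fst s))",
      unfolded traffic_converges_def, rule_format, OF T]
    show "(\<lambda>n. mat_traffic_dist (M n) n (\<lambda>i. M_family (X n (f i)) (g i)) T) \<longlonglongrightarrow>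
        traffic_limit (\<lambda>s. f (fst s)) (\<lambda>s. fst (g (fst s))) (\<lambda>s. snd (g (fst s))) T"
      using lim by (rule Lim_transform_eventually)
        (rule eventually_sequentiallyI[of 1], rule mat_traffic_dist_M_family[OF W _ T, symmetric])
  qed
qed


section \<open>Trees\<close>

text \<open>This is the growth process of \<open>card_le_of_cut\<close>, now recording that the
  chosen members connect the grown set: a set not crossed by them contains \<open>S\<close> or
  misses it, and the next member ties the added vertex to one in \<open>S\<close>.\<close>

lemma ex_spanning_subset:
  assumes fin: "finite V" "finite J" and "V \<noteq> {}"
    and J: "\<And>X. X \<in> J \<Longrightarrow> X \<subseteq> V \<and> card X = 2"
    and cut: "\<And>S. \<forall>X\<in>J. X \<subseteq> S \<or> X \<inter> S = {} \<Longrightarrow> V \<subseteq> S \<or> V \<inter> S = {}"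
  shows "\<exists>J'\<subseteq>J. card J' + 1 = card V \<and>
    (\<forall>S. (\<forall>X\<in>J'. X \<subseteq> S \<or> X \<inter> S = {}) \<longrightarrow> V \<subseteq> S \<or> V \<inter> S = {})"
proof -
  let ?P = "\<lambda>k S J'. S \<subseteq> V \<and> card S = Suc k \<and> J' \<subseteq> J \<and> card J' = k \<and> (\<forall>X\<in>J'. X \<subseteq> S) \<and>
      (\<forall>A. (\<forall>X\<in>J'. X \<subseteq> A \<or> X \<inter> A = {}) \<longrightarrow> S \<subseteq> A \<or> S \<inter> A = {})"
  have "\<exists>S J'. ?P k S J'" if "Suc k \<le> card V" for k
    using that
  proof (induction k)
    case 0
    from \<open>V \<noteq> {}\<close> obtain v where "v \<in> V" by blast
    then show ?case by (intro exI[of _ "{v}"] exI[of _ "{}"]) auto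
  next
    case (Suc k)
    then obtain S J' where S: "S \<subseteq> V" "card S = Suc k" "J' \<subseteq> J" "card J' = k" "\<forall>X\<in>J'. X \<subseteq> S"
      and conn: "\<forall>A. (\<forall>X\<in>J'. X \<subseteq> A \<or> X \<inter> A = {}) \<longrightarrow> S \<subseteq> A \<or> S \<inter> A = {}"
      by (metis Suc_leD)
    have "\<not> V \<subseteq> S"
    proof
      assume "V \<subseteq> S"
      with S have "V = S" by blast
      with S Suc.prems show False by simp
    qed
    moreover have "S \<noteq> {}" using S by auto
    then have "V \<inter> S \<noteq> {}" using S by blast
    ultimately obtain X where X: "X \<in> J" "\<not> X \<subseteq> S" "X \<inter> S \<noteq> {}" using cut by blast
    then obtain a b where ab: "a \<in> X" "a \<in> S" "b \<in> X" "b \<notin> S" by blast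
    have "X \<notin> J'" using X S(5) by blast
    have "b \<in> V" using J[OF X(1)] ab(3) by blast
    have fin': "finite J'" "finite S" using S(1,3) fin finite_subset by blast+
    have Xab: "X = {a, b}"
      using J[OF X(1)] ab by (metis card_2_iff doubleton_eq_iff insert_iff singletonD)
    have "?P (Suc k) (insert b S) (insert X J')"
    proof (intro conjI allI impI)
      show "insert b S \<subseteq> V" using S(1) \<open>b \<in> V\<close> by blast
      show "card (insert b S) = Suc (Suc k)" using S(2) ab(4) fin' by simp
      show "insert X J' \<subseteq> J" using S(3) X(1) by blast
      show "card (insert X J') = Suc k" using S(4) \<open>X \<notin> J'\<close> fin' by simp
      show "\<forall>Y\<in>insert X J'. Y \<subseteq> insert b S" using S(5) ab(2) unfolding Xab by blast
      fix A assume A: "\<forall>Y\<in>insert X J'. Y \<subseteq> A \<or> Y \<inter> A = {}"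
      then have "S \<subseteq> A \<or> S \<inter> A = {}" using conn by blast
      moreover have "a \<in> A \<longleftrightarrow> b \<in> A" using A ab by blast
      ultimately show "insert b S \<subseteq> A \<or> insert b S \<inter> A = {}" using ab(2) by blast
    qed
    then show ?case by (intro exI[of _ "insert b S"] exI[of _ "insert X J'"])
  qed
  from this[of "card V - 1"] obtain S J' where SJ: "?P (card V - 1) S J'"
    using fin \<open>V \<noteq> {}\<close> by (metis Suc_diff_1 card_gt_0_iff le_refl)
  moreover have "Suc (card V - 1) = card V" using fin \<open>V \<noteq> {}\<close> by (simp add: card_gt_0_iff)
  ultimately have "S = V" using card_subset_eq[OF fin(1), of S] by simp
  then show ?thesis using SJ \<open>Suc (card V - 1) = card V\<close> by (intro exI[of _ J']) auto
qed

section \<open>Trees among connected undirected graphs\<close>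

definition simple_graph :: "'v set \<Rightarrow> 'v set set \<Rightarrow> 'v pair_pre_digraph" where
  "simple_graph W J = \<lparr>pverts = W, parcs = {(a, b). {a, b} \<in> J}\<rparr>"

lemma pcas_preserves:
  assumes "pcas x p y" "\<And>e. e \<in> set p \<Longrightarrow> fst e \<in> S \<longleftrightarrow> snd e \<in> S"
  shows "x \<in> S \<longleftrightarrow> y \<in> S"
  using assms by (induction p arbitrary: x) auto

lemma fst_in_pawalk_verts: "pcas x p y \<Longrightarrow> e \<in> set p \<Longrightarrow> fst e \<in> set (pawalk_verts x p)"
  by (induction p arbitrary: x) auto

lemma last_in_pawalk_verts: "pcas x p y \<Longrightarrow> y \<in> set (pawalk_verts x p)"
  by (induction p arbitrary: x) auto

lemma fst_neq_last:
  assumes "pcas x p y" "distinct (pawalk_verts x p)" "e \<in> set p"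
  shows "fst e \<noteq> y"
  using assms
proof (induction p arbitrary: x)
  case (Cons f p)
  then show ?case using last_in_pawalk_verts[of "snd f" p y] by auto
qed simp

text \<open>An edge on a cycle can be deleted without disconnecting the graph, so a cycle forces
  \<open>card W \<le> card J\<close>. Conversely, if there are more than \<open>card W - 1\<close>
  edges, some edge lies outside a spanning subset, and it closes a path of that subset to a
  cycle.\<close>

lemma simple_tree_iff:
  assumes fin: "finite W" "finite J" and "W \<noteq> {}"
    and J: "\<And>X. X \<in> J \<Longrightarrow> X \<subseteq> W \<and> card X = 2"
    and cut: "\<And>S. \<forall>X\<in>J. X \<subseteq> S \<or> X \<inter> S = {} \<Longrightarrow> W \<subseteq> S \<or> W \<inter> S = {}"
  shows "simple_tree (simple_graph W J) \<longleftrightarrow> card J + 1 = card W"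
proof -
  let ?D = "simple_graph W J"
  have wf: "pair_wf_digraph (simple_graph W J')" if "J' \<subseteq> J" for J'
  proof
    fix e assume "e \<in> parcs (simple_graph W J')"
    then have "{fst e, snd e} \<in> J" using that by (auto simp: simple_graph_def)
    from J[OF this] show "fst e \<in> pverts (simple_graph W J')" "snd e \<in> pverts (simple_graph W J')"
      by (auto simp: simple_graph_def)
  qed
  interpret pair_wf_digraph ?D by (rule wf) simp
  have "card W \<le> card J + 1"
    using fin \<open>W \<noteq> {}\<close> J by (intro card_le_of_cut cut) auto
  have conn: "Digraph_Component.connected (with_proj ?D)"
  proof (subst connected_iff_cut, intro conjI allI impI)
    fix S assume S: "\<forall>e\<in>parcs ?D. fst e \<in> S \<longleftrightarrow> snd e \<in> S"
    have "X \<subseteq> S \<or> X \<inter> S = {}" if X: "X \<in> J" for X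
    proof -
      obtain a b where "X = {a, b}" using J[OF X] by (metis card_2_iff)
      then show ?thesis using S X by (auto simp: simple_graph_def)
    qed
    then show "pverts ?D \<subseteq> S \<or> pverts ?D \<inter> S = {}" using cut[of S] by (simp add: simple_graph_def)
  qed (use \<open>W \<noteq> {}\<close> in \<open>simp add: simple_graph_def\<close>)
  have "card W \<le> card J" if p: "cycle p" "3 \<le> length p" for p
  proof -
    obtain u where u: "awalk u p u" "distinct (tl (pawalk_verts u p))" using p by (auto simp: cycle_def)
    then obtain e q where pq: "p = e # q" using p by (cases p) auto
    obtain v where e: "e = (u, v)" using u(1) pq by (cases e) (auto simp: awalk_def)
    have q: "pcas v q u" "distinct (pawalk_verts v q)" "set q \<subseteq> parcs ?D" and "(u, v) \<in> parcs ?D"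
      using u pq e by (auto simp: awalk_def)
    then have uv: "{u, v} \<in> J" by (simp add: simple_graph_def)
    \<comment> \<open>The cycle does not use the edge between \<open>u\<close> and \<open>v\<close>
      again. The reversed arc would have to be the first arc of \<open>q\<close>; as
      \<open>q\<close> would then be back at its last vertex, the cycle would have length
      two.\<close>
    have ne: "{fst f, snd f} \<noteq> {u, v}" if f: "f \<in> set q" for f
    proof
      assume "{fst f, snd f} = {u, v}"
      moreover have "fst f \<noteq> u" by (rule fst_neq_last[OF q(1,2) f])
      ultimately have fv: "fst f = v" "snd f = u" by (auto simp: doubleton_eq_iff)
      obtain g r where gr: "q = g # r" using f by (cases q) auto
      then have g: "fst g = v" "pcas (snd g) r u" "v \<notin> set (pawalk_verts (snd g) r)"
        using q by auto
      then have "f = g" using f gr fv fst_in_pawalk_verts[OF g(2), of f] by auto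
      then have "pcas u r u" "distinct (pawalk_verts u r)" using g fv q gr by auto
      then have "r = []" by (cases r) (auto dest: last_in_pawalk_verts)
      then show False using p(2) pq gr by simp
    qed
    \<comment> \<open>A set not crossed by the remaining edges has \<open>v\<close> and
      \<open>u\<close> on the same side, because \<open>q\<close> leads from \<open>v\<close> to
      \<open>u\<close>.\<close>
    have "card W \<le> card (J - {{u, v}}) + 1"
    proof (rule card_le_of_cut)
      fix S assume S: "\<forall>X\<in>J - {{u, v}}. X \<subseteq> S \<or> X \<inter> S = {}"
      have "fst f \<in> S \<longleftrightarrow> snd f \<in> S" if f: "f \<in> set q" for f
      proof -
        have "{fst f, snd f} \<in> J" using q(3) f by (auto simp: simple_graph_def)
        then have "{fst f, snd f} \<in> J - {{u, v}}" using ne[OF f] by simp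
        from S[rule_format, OF this] show ?thesis by auto
      qed
      then have "v \<in> S \<longleftrightarrow> u \<in> S" by (rule pcas_preserves[OF q(1)])
      then have "\<forall>X\<in>J. X \<subseteq> S \<or> X \<inter> S = {}" using S by auto
      then show "W \<subseteq> S \<or> W \<inter> S = {}" by (rule cut)
    qed (use fin J \<open>W \<noteq> {}\<close> in auto)
    then show ?thesis using card.remove[OF fin(2) uv] by simp
  qed
  moreover have "\<exists>p. cycle p \<and> 3 \<le> length p" if less: "card W < card J + 1"
  proof -
    obtain J' where J': "J' \<subseteq> J" "card J' + 1 = card W"
      and cut': "\<And>S. \<forall>X\<in>J'. X \<subseteq> S \<or> X \<inter> S = {} \<Longrightarrow> W \<subseteq> S \<or> W \<inter> S = {}"
      using ex_spanning_subset[OF fin \<open>W \<noteq> {}\<close> J cut] by metis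
    then obtain X where X: "X \<in> J" "X \<notin> J'" using less by (metis add_less_cancel_right less_irrefl psubsetI psubset_imp_ex_mem subset_antisym subsetI)
    then obtain a b where ab: "X = {a, b}" "a \<noteq> b" "a \<in> W" "b \<in> W" using J[OF X(1)] by (auto simp: card_2_iff)
    interpret D': pair_wf_digraph "simple_graph W J'" by (rule wf[OF J'(1)])
    let ?R = "{w. a \<rightarrow>\<^sup>*\<^bsub>with_proj (simple_graph W J')\<^esub> w}"
    have "Y \<subseteq> ?R \<or> Y \<inter> ?R = {}" if Y: "Y \<in> J'" for Y
    proof -
      obtain x y where xy: "Y = {x, y}" using J Y J'(1) by (metis card_2_iff subsetD)
      then have arcs: "(x, y) \<in> parcs (simple_graph W J')" "(y, x) \<in> parcs (simple_graph W J')"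
        using Y by (auto simp: simple_graph_def insert_commute)
      have "x \<in> ?R \<longleftrightarrow> y \<in> ?R" using arcs D'.reachable_adj_trans by auto
      then show ?thesis using xy by auto
    qed
    then have "W \<subseteq> ?R \<or> W \<inter> ?R = {}" by (intro cut') blast
    moreover have "a \<in> pverts (simple_graph W J')" using ab by (simp add: simple_graph_def)
    then have "a \<in> ?R" using D'.reachable_refl by simp
    ultimately have "a \<rightarrow>\<^sup>*\<^bsub>with_proj (simple_graph W J')\<^esub> b" using ab by blast
    then obtain p0 where "D'.awalk a p0 b" using D'.reachable_awalk by blast
    then obtain p where p: "D'.apath a p b" using D'.apath_awalk_to_apath by blast
    then have pc: "pcas a p b" "distinct (pawalk_verts a p)" "set p \<subseteq> parcs (simple_graph W J')"
      by (auto simp: D'.apath_def D'.awalk_def)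
    \<comment> \<open>The path is not empty since \<open>a\<close> and \<open>b\<close> differ, and
      it is not the single arc from \<open>a\<close> to \<open>b\<close> since \<open>X\<close> is
      not in \<open>J'\<close>. So closing it gives a cycle of length at least three.\<close>
    have "2 \<le> length p"
    proof (rule ccontr)
      assume "\<not> 2 \<le> length p"
      then have "p = [] \<or> (\<exists>e. p = [e])" by (cases p) (auto simp: Suc_le_eq not_less_eq_eq length_Suc_conv)
      then show False using pc ab X by (auto simp: simple_graph_def)
    qed
    have app: "pcas x p y \<Longrightarrow> pcas x (p @ [(y, a)]) a \<and> pawalk_verts x (p @ [(y, a)]) = pawalk_verts x p @ [a]" for x y
      by (induction p arbitrary: x) auto
    have "hd (pawalk_verts a p) = a" using pc(1) by (cases p) auto
    then have "a \<notin> set (tl (pawalk_verts a p))" "pawalk_verts a p \<noteq> []"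
      using pc(2) by (cases p; auto)+
    then have "distinct (tl (pawalk_verts a (p @ [(b, a)])))"
      unfolding conjunct2[OF app[OF pc(1)]] using pc(2) by (simp add: distinct_tl)
    moreover have "awalk a (p @ [(b, a)]) a"
    proof -
      have "set (p @ [(b, a)]) \<subseteq> parcs ?D" "a \<in> pverts ?D"
        using pc(3) J'(1) X ab by (auto simp: simple_graph_def insert_commute)
      then show ?thesis using app[OF pc(1)] unfolding awalk_def by blast
    qed
    ultimately have "cycle (p @ [(b, a)])" unfolding cycle_def by blast
    then show ?thesis using \<open>2 \<le> length p\<close> by (intro exI[of _ "p @ [(b, a)]"]) simp
  qed
  ultimately show ?thesis
    using \<open>card W \<le> card J + 1\<close> conn unfolding simple_tree_def by (metis Suc_eq_plus1 not_less_eq_eq le_antisym linorder_not_less order_refl)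
qed

section \<open>Coloured components\<close>

context fin_digraph begin

lemma induce_cut_iff:
  assumes "K \<subseteq> verts G"
  shows "Digraph_Component.connected (G \<restriction> K) \<longleftrightarrow> K \<noteq> {} \<and>
    (\<forall>S. (\<forall>e\<in>arcs G. tail G e \<in> K \<longrightarrow> head G e \<in> K \<longrightarrow> (tail G e \<in> S \<longleftrightarrow> head G e \<in> S)) \<longrightarrow>
       K \<subseteq> S \<or> K \<inter> S = {})"
proof -
  interpret I: wf_digraph "G \<restriction> K" by (rule wellformed_induce_subgraph)
  show ?thesis unfolding I.connected_iff_cut by (simp only: induce_subgraph_verts induce_subgraph_arcs induce_subgraph_tail induce_subgraph_head mem_Collect_eq ball_simps) blast
qed

lemma induced_subgraph_iff:
  "induced_subgraph H G \<longleftrightarrow> (\<exists>K\<subseteq>verts G. H = G \<restriction> K)"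
proof
  assume H: "induced_subgraph H G"
  then have "H = G \<restriction> verts H" "verts H \<subseteq> verts G"
    by (auto simp: induced_subgraph_def induce_subgraph_def subgraph_def compatible_def)
  then show "\<exists>K\<subseteq>verts G. H = G \<restriction> K" by blast
qed (use induced_induce in blast)

text \<open>An induced subgraph is determined by its vertices, which reduces maximality of subgraphs
  to maximality of connected vertex sets.\<close>

lemma connected_components_iff:
  "H \<in> connected_components G \<longleftrightarrow> (\<exists>K\<subseteq>verts G. H = G \<restriction> K \<and> Digraph_Component.connected (G \<restriction> K) \<and>
     (\<forall>K'\<subseteq>verts G. Digraph_Component.connected (G \<restriction> K') \<longrightarrow> \<not> K \<subset> K'))"
    (is "_ \<longleftrightarrow> ?R")
proof
  assume H: "H \<in> connected_components G"
  then have H: "induced_subgraph H G" "Digraph_Component.connected H"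
    and max: "\<And>H'. induced_subgraph H' G \<Longrightarrow> Digraph_Component.connected H' \<Longrightarrow> \<not> verts H \<subset> verts H'"
    by (simp_all add: connected_components_def)
  from H(1) obtain K where K: "K \<subseteq> verts G" "H = G \<restriction> K" unfolding induced_subgraph_iff by (elim exE conjE)
  have "\<not> K \<subset> K'" if "K' \<subseteq> verts G" "Digraph_Component.connected (G \<restriction> K')" for K'
    using max[OF induced_induce[OF that(1)] that(2)] unfolding K(2) by simp
  with K H(2) show ?R by (intro exI[of _ K]) simp
next
  assume ?R
  then obtain K where K: "K \<subseteq> verts G" "H = G \<restriction> K" "Digraph_Component.connected (G \<restriction> K)"
      and max: "\<forall>K'\<subseteq>verts G. Digraph_Component.connected (G \<restriction> K') \<longrightarrow> \<not> K \<subset> K'"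
    by (elim exE conjE)
  have "\<not> verts H \<subset> verts H'" if H': "induced_subgraph H' G" "Digraph_Component.connected H'" for H'
  proof -
    from H'(1) obtain K' where K': "K' \<subseteq> verts G" "H' = G \<restriction> K'"
      unfolding induced_subgraph_iff by (elim exE conjE)
    then show ?thesis using max[rule_format, of K'] H'(2) K(2) by simp
  qed
  then show "H \<in> connected_components G"
    using K induced_induce[OF K(1)] unfolding connected_components_def by simp
qed

lemma connected_Un:
  assumes "K \<subseteq> verts G" "K' \<subseteq> verts G" "K \<inter> K' \<noteq> {}"
    "Digraph_Component.connected (G \<restriction> K)" "Digraph_Component.connected (G \<restriction> K')"
  shows "Digraph_Component.connected (G \<restriction> (K \<union> K'))"
proof -
  have "K \<union> K' \<subseteq> S \<or> (K \<union> K') \<inter> S = {}"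
    if S: "\<forall>e\<in>arcs G. tail G e \<in> K \<union> K' \<longrightarrow> head G e \<in> K \<union> K' \<longrightarrow> (tail G e \<in> S \<longleftrightarrow> head G e \<in> S)" for S
  proof -
    have "K \<subseteq> S \<or> K \<inter> S = {}" "K' \<subseteq> S \<or> K' \<inter> S = {}"
      using S assms(4)[unfolded induce_cut_iff[OF assms(1)], THEN conjunct2, rule_format, of S]
        assms(5)[unfolded induce_cut_iff[OF assms(2)], THEN conjunct2, rule_format, of S] by simp_all
    then show ?thesis using assms(3) by blast
  qed
  then show ?thesis using assms(1-3) by (subst induce_cut_iff) auto
qed

text \<open>The union of two overlapping connected sets is connected, so maximality of the component
  leaves no room outside it.\<close>

lemma component_absorbs:
  assumes H: "H \<in> connected_components G" and K: "K \<subseteq> verts G" "Digraph_Component.connected (G \<restriction> K)"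
    and "K \<inter> verts H \<noteq> {}"
  shows "K \<subseteq> verts H"
proof -
  obtain L where L: "L \<subseteq> verts G" "H = G \<restriction> L" "Digraph_Component.connected (G \<restriction> L)"
      "\<forall>K'\<subseteq>verts G. Digraph_Component.connected (G \<restriction> K') \<longrightarrow> \<not> L \<subset> K'"
    using H unfolding connected_components_iff by (elim exE conjE)
  have "L \<inter> K \<noteq> {}" using assms(4) unfolding L(2) by auto
  from connected_Un[OF L(1) K(1) this L(3) K(2)]
  have "Digraph_Component.connected (G \<restriction> (L \<union> K))" .
  then have "\<not> L \<subset> L \<union> K" using L(4)[rule_format, of "L \<union> K"] L(1) K(1) by simp
  then show ?thesis unfolding L(2) induce_subgraph_verts by blast
qed

lemma component_eq:
  assumes H: "H \<in> connected_components G" "H' \<in> connected_components G" "verts H \<inter> verts H' \<noteq> {}"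
  shows "H = H'"
proof -
  obtain K where K: "K \<subseteq> verts G" "H = G \<restriction> K" "Digraph_Component.connected (G \<restriction> K)"
    using H unfolding connected_components_iff by (elim exE conjE)
  obtain K' where K': "K' \<subseteq> verts G" "H' = G \<restriction> K'" "Digraph_Component.connected (G \<restriction> K')"
    using H unfolding connected_components_iff by (elim exE conjE)
  have "K \<subseteq> K'" using component_absorbs[OF H(2) K(1,3)] H(3) K K' by auto
  moreover have "K' \<subseteq> K" using component_absorbs[OF H(1) K'(1,3)] H(3) K K' by auto
  ultimately show ?thesis using K K' by simp
qed

lemma ex_component:
  assumes v: "v \<in> verts G"
  shows "\<exists>H\<in>connected_components G. v \<in> verts H"
proof -
  let ?A = "{K. K \<subseteq> verts G \<and> v \<in> K \<and> Digraph_Component.connected (G \<restriction> K)}"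
  have "Digraph_Component.connected (G \<restriction> {v})" using v by (subst induce_cut_iff) auto
  then have "{v} \<in> ?A" using v by simp
  then have "?A \<noteq> {}" by (rule ex_in_conv[THEN iffD1, OF exI])
  moreover have "finite ?A" by (rule finite_subset[of _ "Pow (verts G)"]) auto
  ultimately have "\<exists>K\<in>?A. \<forall>K'\<in>?A. K \<subseteq> K' \<longrightarrow> K = K'" by (intro finite_has_maximal)
  then obtain K where K: "K \<in> ?A" "\<forall>K'\<in>?A. K \<subseteq> K' \<longrightarrow> K = K'" by (rule bexE)
  then have "G \<restriction> K \<in> connected_components G" unfolding connected_components_iff by blast
  then show ?thesis using K(1) by (intro bexI[of _ "G \<restriction> K"]) simp_all
qed

lemma arc_in_component:
  assumes H: "H \<in> connected_components G" and e: "e \<in> arcs G" "tail G e \<in> verts H \<or> head G e \<in> verts H"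
  shows "e \<in> arcs H"
proof -
  have "Digraph_Component.connected (G \<restriction> {tail G e, head G e})"
    using e by (subst induce_cut_iff) auto
  then have "{tail G e, head G e} \<subseteq> verts H" using e by (intro component_absorbs[OF H]) auto
  then show ?thesis using H e unfolding connected_components_iff by auto
qed

lemma component_props:
  assumes H: "H \<in> connected_components G"
  shows "verts H \<subseteq> verts G" "arcs H \<subseteq> arcs G" "tail H = tail G" "head H = head G"
    "fin_digraph H" "Digraph_Component.connected H"
proof -
  obtain K where K: "K \<subseteq> verts G" "H = G \<restriction> K" "Digraph_Component.connected (G \<restriction> K)"
    using H unfolding connected_components_iff by (elim exE conjE)
  then show "verts H \<subseteq> verts G" "arcs H \<subseteq> arcs G" "tail H = tail G" "head H = head G" by auto
  have "subgraph H G" using K induced_induce by blast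
  then show "fin_digraph H" "Digraph_Component.connected H" using K fin_digraph_subgraph by simp_all
qed

end

text \<open>Non-loops in one block have equal ends, so there are at least as many such blocks as
  pairs of ends. Hence tree pairings are extremal, which allows the tree condition to be checked
  component by component.\<close>

lemma card_verts_le_link_blocks:
  assumes test: "is_test_graph (G, l)" and m: "m \<in> pairings G c"
  shows "card (verts G) \<le> card (link_blocks G m) + 1"
proof -
  interpret fin_digraph G using test by (simp add: is_test_graph_def)
  have part: "partition_on (arcs G) m" and pair: "\<And>B. B \<in> m \<Longrightarrow> is_pair G c B"
    using m by (auto simp: pairings_def)
  have fin: "finite (link_blocks G m)"
    using part finite_elements[of "arcs G" m] by (auto simp: link_blocks_def)
  let ?g = "\<lambda>B. ends G (SOME e. e \<in> B \<inter> link_arcs G)"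
  have "ends G ` link_arcs G \<subseteq> ?g ` link_blocks G m"
  proof
    fix X assume "X \<in> ends G ` link_arcs G"
    then obtain e where e: "e \<in> link_arcs G" "X = ends G e" by blast
    then obtain B where B: "B \<in> m" "e \<in> B"
      using partition_on_obtains[OF part, of e] by (auto simp: link_arcs_def)
    let ?f = "SOME f. f \<in> B \<inter> link_arcs G"
    have f: "?f \<in> B \<inter> link_arcs G" using B e by (intro someI[of "\<lambda>e. e \<in> B \<inter> link_arcs G" e]) auto
    then have "ends G ?f = ends G e"
      using pair[OF B(1)] B e by (intro ends_eq_of_nested) (auto simp: is_pair_def)
    then show "X \<in> ?g ` link_blocks G m" using B e by (intro image_eqI[of _ _ B]) (auto simp: link_blocks_def)
  qed
  then have "card (ends G ` link_arcs G) \<le> card (?g ` link_blocks G m)"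
    using fin by (intro card_mono) auto
  then show ?thesis using card_verts_le_ends[OF test] card_image_le[OF fin, of ?g] by linarith
qed

section \<open>Pairings and coloured components\<close>

locale coloured_graph =
  fixes G :: "(nat, nat) pre_digraph" and l :: "nat \<Rightarrow> 's" and grp :: "'s \<Rightarrow> 'k"
  assumes test: "is_test_graph (G, l)"
begin

sublocale fin_digraph G using test by (simp add: is_test_graph_def)

abbreviation "c \<equiv> grp \<circ> l"
abbreviation "GS k \<equiv> group_subgraph grp (G, l) k"
abbreviation "C \<equiv> group_components grp (G, l)"

lemma GS_simps:
  "verts (GS k) = tail G ` {e\<in>arcs G. c e = k} \<union> head G ` {e\<in>arcs G. c e = k}"
  "arcs (GS k) = {e\<in>arcs G. c e = k}" "tail (GS k) = tail G" "head (GS k) = head G"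
  by (auto simp: group_subgraph_def Let_def)

lemma fin_digraph_GS: "fin_digraph (GS k)"
  by unfold_locales (auto simp: GS_simps)

lemma C_iff: "H \<in> C \<longleftrightarrow> (\<exists>k. H \<in> connected_components (GS k))"
  by (auto simp: group_components_def)

lemma C_props:
  assumes "H \<in> C"
  shows "verts H \<subseteq> verts G" "arcs H \<subseteq> arcs G" "tail H = tail G" "head H = head G" "is_test_graph (H, l')"
    "verts H \<noteq> {}" "finite (verts H)"
proof -
  obtain k where k: "H \<in> connected_components (GS k)" using assms(1) unfolding C_iff by (elim exE)
  interpret S: fin_digraph "GS k" by (rule fin_digraph_GS)
  note p = S.component_props[OF k]
  show "tail H = tail G" "head H = head G" using p by (auto simp: GS_simps)
  have "verts (GS k) \<subseteq> verts G" by (auto simp: GS_simps)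
  then show "verts H \<subseteq> verts G" using p by blast
  then show "finite (verts H)" by (rule finite_subset) simp
  have "arcs (GS k) \<subseteq> arcs G" by (auto simp: GS_simps)
  then show "arcs H \<subseteq> arcs G" using p by blast
  show "is_test_graph (H, l')" using p by (simp add: is_test_graph_def)
  then show "verts H \<noteq> {}" by (auto simp: is_test_graph_iff_cut)
qed

lemma component_of_arc:
  assumes e: "e \<in> arcs G"
  shows "\<exists>H\<in>C. e \<in> arcs H"
proof -
  interpret S: fin_digraph "GS (c e)" by (rule fin_digraph_GS)
  have "tail G e \<in> verts (GS (c e))" using e by (auto simp: GS_simps)
  then obtain H where H: "H \<in> connected_components (GS (c e))" "tail G e \<in> verts H"
    using S.ex_component by blast
  then have "e \<in> arcs H" using e by (intro S.arc_in_component[OF H(1)]) (auto simp: GS_simps)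
  then show ?thesis using H C_iff by blast
qed

lemma component_arc_iff:
  assumes H: "H \<in> C" "e \<in> arcs H" and f: "f \<in> arcs G" "c f = c e" "ends G e \<inter> ends G f \<noteq> {}"
  shows "f \<in> arcs H"
proof -
  obtain k where k: "H \<in> connected_components (GS k)" using H(1) unfolding C_iff by (elim exE)
  interpret S: fin_digraph "GS k" by (rule fin_digraph_GS)
  have "e \<in> arcs (GS k)" using S.component_props(2)[OF k] H by blast
  then have ke: "c e = k" "e \<in> arcs G" by (auto simp: GS_simps)
  interpret H: fin_digraph H using C_props(5)[OF H(1)] by (simp add: is_test_graph_def)
  have "tail G e \<in> verts H" "head G e \<in> verts H" using H.wellformed H(2) C_props(3,4)[OF H(1)] by metis+
  then have "tail G f \<in> verts H \<or> head G f \<in> verts H" using f(3) by (auto simp: ends_def)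
  then show ?thesis using f ke by (intro S.arc_in_component[OF k]) (auto simp: GS_simps)
qed

lemma component_unique_arc:
  assumes "H \<in> C" "H' \<in> C" "e \<in> arcs H" "e \<in> arcs H'"
  shows "H = H'"
proof -
  obtain k k' where k: "H \<in> connected_components (GS k)" "H' \<in> connected_components (GS k')"
    using assms(1,2) unfolding C_iff by (elim exE)
  interpret S: fin_digraph "GS k" by (rule fin_digraph_GS)
  interpret S': fin_digraph "GS k'" by (rule fin_digraph_GS)
  have "e \<in> arcs (GS k)" "e \<in> arcs (GS k')"
    using S.component_props(2)[OF k(1)] S'.component_props(2)[OF k(2)] assms by blast+
  then have "k = k'" by (auto simp: GS_simps)
  interpret H: fin_digraph H using C_props(5)[OF assms(1)] by (simp add: is_test_graph_def)
  interpret H': fin_digraph H' using C_props(5)[OF assms(2)] by (simp add: is_test_graph_def)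
  have "tail G e \<in> verts H" "tail G e \<in> verts H'"
    using H.tail_in_verts[OF assms(3)] H'.tail_in_verts[OF assms(4)] C_props(3)[OF assms(1)] C_props(3)[OF assms(2)] by simp_all
  then show ?thesis using k \<open>k = k'\<close> by (intro S.component_eq) auto
qed

lemma component_has_arc:
  assumes "H \<in> C" "v \<in> verts H"
  shows "\<exists>e\<in>arcs H. v \<in> ends G e"
proof -
  obtain k where k: "H \<in> connected_components (GS k)" using assms(1) unfolding C_iff by (elim exE)
  interpret S: fin_digraph "GS k" by (rule fin_digraph_GS)
  have "v \<in> verts (GS k)" using S.component_props(1)[OF k] assms by blast
  then obtain e where e: "e \<in> arcs G" "c e = k" "v = tail G e \<or> v = head G e" by (auto simp: GS_simps)
  then have "e \<in> arcs H" using assms by (intro S.arc_in_component[OF k]) (auto simp: GS_simps)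
  then show ?thesis using e by (auto simp: ends_def)
qed

lemma ends_component: "H \<in> C \<Longrightarrow> ends H = ends G"
  using C_props by (simp add: ends_def fun_eq_iff)

lemma ends_in_component: "H \<in> C \<Longrightarrow> e \<in> arcs H \<Longrightarrow> ends G e \<subseteq> verts H"
proof -
  assume H: "H \<in> C" "e \<in> arcs H"
  interpret H: fin_digraph H using C_props(5)[OF H(1)] by (simp add: is_test_graph_def)
  show ?thesis unfolding ends_component[OF H(1), symmetric] using H(2) by (auto simp: ends_def)
qed

lemma arcs_Union: "arcs G = (\<Union>H\<in>C. arcs H)"
  using component_of_arc C_props(2) by blast

lemma finite_C: "finite C"
proof -
  have "inj_on arcs C" using component_unique_arc component_has_arc C_props(6) by (intro inj_onI) (metis ex_in_conv)
  moreover have "arcs ` C \<subseteq> Pow (arcs G)" using C_props(2) by blast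
  ultimately show ?thesis using finite_subset[of "arcs ` C" "Pow (arcs G)"] finite_imageD by auto
qed

lemma is_pair_component: "H \<in> C \<Longrightarrow> is_pair H c B \<longleftrightarrow> is_pair G c B"
  by (simp add: is_pair_def ends_component)

lemma link_arcs_component: "H \<in> C \<Longrightarrow> link_arcs H = link_arcs G \<inter> arcs H"
  using C_props by (auto simp: link_arcs_def)

abbreviation "res m H \<equiv> {B\<in>m. B \<subseteq> arcs H}"

text \<open>Paired edges have the same colour, and nested ends share a vertex, so a pair cannot
  leave its coloured component. This makes the choice of a pairing a local matter.\<close>

lemma pair_in_component:
  assumes B: "is_pair G c B" "B \<subseteq> arcs G"
  shows "\<exists>H\<in>C. B \<subseteq> arcs H"
proof -
  have "B \<noteq> {}" using B by (auto simp: is_pair_def)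
  then obtain e where e: "e \<in> B" by blast
  then obtain H where H: "H \<in> C" "e \<in> arcs H" using component_of_arc B by blast
  have "f \<in> arcs H" if "f \<in> B" for f
  proof (rule component_arc_iff[OF H])
    have "ends G e \<subseteq> ends G f \<or> ends G f \<subseteq> ends G e" "c e = c f"
      using B(1) e that unfolding is_pair_def by blast+
    then show "c f = c e" "ends G e \<inter> ends G f \<noteq> {}" by (auto simp: ends_def)
  qed (use that B in auto)
  then show ?thesis using H by blast
qed

lemma res_pairings:
  assumes m: "m \<in> pairings G c" and H: "H \<in> C"
  shows "res m H \<in> pairings H c"
proof -
  have part: "partition_on (arcs G) m" and pair: "\<And>B. B \<in> m \<Longrightarrow> is_pair G c B"
    using m by (auto simp: pairings_def)
  have sub: "B \<subseteq> arcs G" if "B \<in> m" for B using part that by (auto simp: partition_on_def)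
  have "e \<in> \<Union>(res m H)" if e: "e \<in> arcs H" for e
  proof -
    have "e \<in> arcs G" using e C_props(2)[OF H] by blast
    then obtain B where B: "B \<in> m" "e \<in> B" using partition_on_obtains[OF part] by blast
    obtain H' where "H' \<in> C" "B \<subseteq> arcs H'" using pair_in_component[OF pair sub] B(1) by blast
    then show ?thesis using component_unique_arc[OF H, of H' e] e B by blast
  qed
  then have "\<Union>(res m H) = arcs H" by blast
  moreover have "{} \<notin> m" "disjoint m" using part by (simp_all add: partition_on_def)
  ultimately have "partition_on (arcs H) (res m H)"
    unfolding partition_on_def by (simp add: disjoint_def)
  then show ?thesis using pair H by (auto simp: pairings_def is_pair_component)
qed

lemma Union_res:
  assumes m: "m \<in> pairings G c"
  shows "(\<Union>H\<in>C. res m H) = m"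
proof -
  have "\<exists>H\<in>C. B \<subseteq> arcs H" if "B \<in> m" for B
    using m that by (intro pair_in_component) (auto simp: pairings_def partition_on_def)
  then show ?thesis by blast
qed

lemma block_component_unique:
  assumes "B \<noteq> {}" "H \<in> C" "H' \<in> C" "B \<subseteq> arcs H" "B \<subseteq> arcs H'"
  shows "H = H'"
  using assms component_unique_arc by blast

text \<open>Different components share no arcs, so blocks chosen in them are disjoint, and a
  nonempty block determines the component it came from.\<close>

lemma Union_pairings:
  assumes f: "\<And>H. H \<in> C \<Longrightarrow> f H \<in> pairings H c"
  shows "(\<Union>H\<in>C. f H) \<in> pairings G c" and "\<And>H. H \<in> C \<Longrightarrow> res (\<Union>H\<in>C. f H) H = f H"
proof -
  have part: "partition_on (arcs H) (f H)" if "H \<in> C" for H using f that by (auto simp: pairings_def)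
  have sub: "B \<subseteq> arcs H" "B \<noteq> {}" if "H \<in> C" "B \<in> f H" for H B
    using part[OF that(1)] that(2) by (auto simp: partition_on_def)
  have "\<Union>(\<Union>H\<in>C. f H) = (\<Union>H\<in>C. \<Union>(f H))" by blast
  also have "\<dots> = arcs G" unfolding arcs_Union using part by (intro SUP_cong refl) (auto simp: partition_on_def)
  finally have U: "\<Union>(\<Union>H\<in>C. f H) = arcs G" .
  have "B \<inter> B' = {}" if B: "H \<in> C" "B \<in> f H" "H' \<in> C" "B' \<in> f H'" "B \<noteq> B'" for H H' B B'
  proof (cases "H = H'")
    case True
    then show ?thesis using B part[OF B(1)] by (auto simp: partition_on_def disjoint_def)
  next
    case False
    then show ?thesis using sub[OF B(1,2)] sub[OF B(3,4)] component_unique_arc[OF B(1,3)] by blast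
  qed
  then have "disjoint (\<Union>H\<in>C. f H)" unfolding disjoint_def by (metis UN_E)
  moreover have "{} \<notin> (\<Union>H\<in>C. f H)" using sub(2) by (metis UN_E)
  ultimately have "partition_on (arcs G) (\<Union>H\<in>C. f H)"
    unfolding partition_on_def using U by simp
  moreover have "is_pair G c B" if "H \<in> C" "B \<in> f H" for H B
    using f[OF that(1)] that is_pair_component[OF that(1)] by (auto simp: pairings_def)
  ultimately show "(\<Union>H\<in>C. f H) \<in> pairings G c" by (auto simp: pairings_def)
  show "res (\<Union>H\<in>C. f H) H = f H" if H: "H \<in> C" for H
  proof (intro Set.set_eqI iffI)
    fix B assume "B \<in> res (\<Union>H\<in>C. f H) H"
    then obtain H' where H': "H' \<in> C" "B \<in> f H'" "B \<subseteq> arcs H" by auto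
    then have "H' = H" using block_component_unique[OF sub(2)[OF H'(1,2)] H'(1) H sub(1)[OF H'(1,2)]] by simp
    then show "B \<in> f H" using H' by simp
  next
    fix B assume "B \<in> f H"
    then show "B \<in> res (\<Union>H\<in>C. f H) H" using sub(1)[OF H] H by auto
  qed
qed

lemma card_link_blocks:
  assumes m: "m \<in> pairings G c"
  shows "card (link_blocks G m) = (\<Sum>H\<in>C. card (link_blocks H (res m H)))"
proof -
  have part: "partition_on (arcs G) m" using m by (auto simp: pairings_def)
  have fin: "finite m" using finite_elements[OF finite_arcs part] .
  have ne: "B \<noteq> {}" if "B \<in> m" for B using part that by (auto simp: partition_on_def)
  have "link_blocks G m = (\<Union>H\<in>C. link_blocks H (res m H))"
  proof (intro Set.set_eqI iffI)
    fix B assume B: "B \<in> link_blocks G m"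
    then have "B \<in> (\<Union>H\<in>C. res m H)" unfolding Union_res[OF m] by (simp add: link_blocks_def)
    then obtain H where H: "H \<in> C" "B \<subseteq> arcs H" by auto
    then have "B \<in> link_blocks H (res m H)" using B by (auto simp: link_blocks_def link_arcs_component)
    then show "B \<in> (\<Union>H\<in>C. link_blocks H (res m H))" using H(1) by (rule UN_I[rotated])
  next
    fix B assume "B \<in> (\<Union>H\<in>C. link_blocks H (res m H))"
    then obtain H where "H \<in> C" "B \<in> link_blocks H (res m H)" by (rule UN_E)
    then show "B \<in> link_blocks G m" by (auto simp: link_blocks_def link_arcs_component)
  qed
  also have "card \<dots> = (\<Sum>H\<in>C. card (link_blocks H (res m H)))"
  proof (rule card_UN_disjoint[OF finite_C])
    show "\<forall>H\<in>C. finite (link_blocks H (res m H))" using fin by (simp add: link_blocks_def)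
    show "\<forall>H\<in>C. \<forall>H'\<in>C. H \<noteq> H' \<longrightarrow> link_blocks H (res m H) \<inter> link_blocks H' (res m H') = {}"
    proof (intro ballI impI equals0I)
      fix H H' B assume H: "H \<in> C" "H' \<in> C" "H \<noteq> H'"
        and "B \<in> link_blocks H (res m H) \<inter> link_blocks H' (res m H')"
      then have "B \<in> m" "B \<subseteq> arcs H" "B \<subseteq> arcs H'" by (simp_all add: link_blocks_def)
      from block_component_unique[OF ne[OF this(1)] H(1,2) this(2,3)] H(3) show False by simp
    qed
  qed
  finally show ?thesis .
qed

section \<open>Euler count of the component graph\<close>

definition "shared = {v. \<exists>H\<in>C. \<exists>H'\<in>C. H \<noteq> H' \<and> v \<in> verts H \<and> v \<in> verts H'}"
definition "incidences = {(H, v). H \<in> C \<and> v \<in> shared \<and> v \<in> verts H}"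
definition "incidence_edges = (\<lambda>(H, v). {Inl H, Inr v}) ` incidences"

lemma component_graph_eq:
  "component_graph grp (G, l) = simple_graph (C <+> shared) incidence_edges"
proof -
  have "(\<lambda>(H, v). (Inl H, Inr v)) ` incidences \<union> (\<lambda>(H, v). (Inr v, Inl H)) ` incidences =
      {(a, b). {a, b} \<in> incidence_edges}"
  proof -
    have "{a, b} \<in> incidence_edges \<longleftrightarrow> (\<exists>H v. (H, v) \<in> incidences \<and>
        ((a = Inl H \<and> b = Inr v) \<or> (a = Inr v \<and> b = Inl H)))" for a b
      unfolding incidence_edges_def by (auto simp: doubleton_eq_iff image_def)
    then show ?thesis by (force simp: image_def)
  qed
  then show ?thesis
    unfolding component_graph_def simple_graph_def Let_def
    by (simp add: shared_def[symmetric] incidences_def[symmetric])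
qed

context
  assumes nonempty: "arcs G \<noteq> {}"
begin

lemma vertex_in_component: "v \<in> verts G \<Longrightarrow> \<exists>H\<in>C. v \<in> verts H"
proof -
  assume v: "v \<in> verts G"
  obtain e0 where e0: "e0 \<in> arcs G" using nonempty by blast
  have "\<exists>e\<in>arcs G. v \<in> ends G e"
  proof (rule ccontr)
    assume no: "\<not> (\<exists>e\<in>arcs G. v \<in> ends G e)"
    then have "\<forall>e\<in>arcs G. tail G e \<in> {v} \<longleftrightarrow> head G e \<in> {v}" by (auto simp: ends_def)
    then have "verts G \<subseteq> {v} \<or> verts G \<inter> {v} = {}"
      using test unfolding is_test_graph_iff_cut fst_conv by (elim conjE allE[of _ "{v}"] impE)
    moreover have "tail G e0 \<in> verts G" using e0 by simp
    ultimately have "tail G e0 = v" using v by blast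
    then show False using e0 no by (auto simp: ends_def)
  qed
  then show ?thesis using component_of_arc ends_in_component by blast
qed

lemma C_nonempty: "C \<noteq> {}"
  using nonempty component_of_arc by blast

lemma shared_subset: "shared \<subseteq> verts G"
  using C_props(1) by (auto simp: shared_def)

lemma card_incidence_edges: "card incidence_edges = card incidences"
  unfolding incidence_edges_def by (intro card_image inj_onI) (auto simp: doubleton_eq_iff)

lemma finite_incidences: "finite incidences"
  using finite_C finite_subset[OF shared_subset]
  by (intro finite_subset[of incidences "C \<times> shared"]) (auto simp: incidences_def)

text \<open>The component graph inherits connectivity from \<open>G\<close>. Given a cut
  \<open>S\<close> of it, the vertices lying in a component inside \<open>S\<close> form a set
  crossed by no arc of \<open>G\<close>, because both ends of an arc lie in the component of that
  arc.\<close>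

lemma incidence_cut:
  assumes S: "\<forall>X\<in>incidence_edges. X \<subseteq> S \<or> X \<inter> S = {}"
  shows "C <+> shared \<subseteq> S \<or> (C <+> shared) \<inter> S = {}"
proof -
  have inc: "Inl H \<in> S \<longleftrightarrow> Inr v \<in> S" if "H \<in> C" "v \<in> shared" "v \<in> verts H" for H v
  proof -
    have "{Inl H, Inr v} \<in> incidence_edges" using that by (auto simp: incidence_edges_def incidences_def)
    from S[rule_format, OF this] show ?thesis by auto
  qed
  have same: "Inl H \<in> S \<longleftrightarrow> Inl H' \<in> S" if "H \<in> C" "H' \<in> C" "v \<in> verts H" "v \<in> verts H'" for H H' v
  proof (cases "H = H'")
    case False
    then have "v \<in> shared" using that by (auto simp: shared_def)
    then show ?thesis using inc that by blast
  qed simp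
  let ?Z = "{v. \<exists>H\<in>C. v \<in> verts H \<and> Inl H \<in> S}"
  have "\<forall>e\<in>arcs G. tail G e \<in> ?Z \<longleftrightarrow> head G e \<in> ?Z"
  proof
    fix e assume "e \<in> arcs G"
    then obtain H where H: "H \<in> C" "e \<in> arcs H" using component_of_arc by blast
    then have "tail G e \<in> verts H" "head G e \<in> verts H" using ends_in_component by (auto simp: ends_def)
    then show "tail G e \<in> ?Z \<longleftrightarrow> head G e \<in> ?Z" using same H(1) by blast
  qed
  then have Z: "verts G \<subseteq> ?Z \<or> verts G \<inter> ?Z = {}"
    using test unfolding is_test_graph_iff_cut fst_conv by (elim conjE allE[of _ ?Z] impE)
  have HZ: "Inl H \<in> S \<longleftrightarrow> verts G \<subseteq> ?Z" if "H \<in> C" for H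
  proof -
    have "verts H \<noteq> {}" "verts H \<subseteq> verts G" using \<open>H \<in> C\<close> by (rule C_props)+
    then obtain v where v: "v \<in> verts H" "v \<in> verts G" by blast
    then have "Inl H \<in> S \<longleftrightarrow> v \<in> ?Z" using same that by blast
    then show ?thesis using Z v by blast
  qed
  moreover have "Inr v \<in> S \<longleftrightarrow> verts G \<subseteq> ?Z" if "v \<in> shared" for v
  proof -
    obtain H where "H \<in> C" "v \<in> verts H" using \<open>v \<in> shared\<close> by (auto simp: shared_def)
    then show ?thesis using inc[OF _ that] HZ by blast
  qed
  ultimately show ?thesis by (cases "verts G \<subseteq> ?Z") (auto simp: Plus_def)
qed

text \<open>Count pairs of a component and a vertex in it: shared vertices give the incidences, and
  each other vertex lies in exactly one component.\<close>

lemma sum_card_verts: "(\<Sum>H\<in>C. card (verts H)) = card incidences + card (verts G - shared)"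
proof -
  let ?S = "Sigma C verts" and ?R = "{(H, v). H \<in> C \<and> v \<notin> shared \<and> v \<in> verts H}"
  have finS: "finite ?S" using finite_C C_props(7) by auto
  have "(\<Sum>H\<in>C. card (verts H)) = card ?S" using finite_C C_props(7) by simp
  also have "?S = incidences \<union> ?R" by (auto simp: incidences_def)
  also have "card \<dots> = card incidences + card ?R"
    using finS by (intro card_Un_disjoint) (auto simp: incidences_def intro: finite_subset[of _ ?S])
  also have "card ?R = card (snd ` ?R)"
  proof (rule card_image[symmetric], rule inj_onI)
    fix x y assume "x \<in> ?R" "y \<in> ?R" "snd x = snd y"
    then show "x = y" by (cases x; cases y) (auto simp: shared_def)
  qed
  also have "snd ` ?R = verts G - shared"
  proof (intro Set.set_eqI iffI)
    fix v assume "v \<in> snd ` ?R"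
    then obtain H where "H \<in> C" "v \<notin> shared" "v \<in> verts H" by auto
    then show "v \<in> verts G - shared" using C_props(1)[of H] by blast
  next
    fix v assume v: "v \<in> verts G - shared"
    then obtain H where "H \<in> C" "v \<in> verts H" using vertex_in_component by blast
    then show "v \<in> snd ` ?R" using v by (intro image_eqI[of _ _ "(H, v)"]) auto
  qed
  finally show ?thesis .
qed

text \<open>The component graph has \<open>card C + card shared\<close> vertices and
  \<open>card incidences\<close> edges. By \<open>sum_card_verts\<close>, the defect in its Euler
  inequality equals that of the inequality stated here, so equality means tree in both.\<close>

lemma sum_verts_minus_one:
  "card (verts G) \<le> (\<Sum>H\<in>C. card (verts H) - 1) + 1"
  "simple_tree (component_graph grp (G, l)) \<longleftrightarrow> card (verts G) = (\<Sum>H\<in>C. card (verts H) - 1) + 1"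
proof -
  have finsh: "finite shared" using finite_subset[OF shared_subset] by simp
  have W: "finite (C <+> shared)" "C <+> shared \<noteq> {}" "finite incidence_edges"
    using finite_C finsh C_nonempty finite_incidences by (auto simp: incidence_edges_def Plus_def)
  have J: "X \<subseteq> C <+> shared \<and> card X = 2" if "X \<in> incidence_edges" for X
    using that by (auto simp: incidence_edges_def incidences_def)
  have le: "card (C <+> shared) \<le> card incidence_edges + 1"
    using W J by (intro card_le_of_cut incidence_cut) auto
  have tree: "simple_tree (component_graph grp (G, l)) \<longleftrightarrow> card incidence_edges + 1 = card (C <+> shared)"
    unfolding component_graph_eq using W J incidence_cut by (intro simple_tree_iff) auto
  have "(\<Sum>H\<in>C. card (verts H) - 1) + card C = (\<Sum>H\<in>C. (card (verts H) - 1) + 1)"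
    by (simp only: sum.distrib card_eq_sum)
  also have "\<dots> = (\<Sum>H\<in>C. card (verts H))"
    using C_props(6,7) by (intro sum.cong refl) (simp add: Suc_leI card_gt_0_iff)
  finally have s: "(\<Sum>H\<in>C. card (verts H) - 1) + card C = card incidences + card (verts G - shared)"
    by (simp only: sum_card_verts)
  have d: "card (verts G - shared) + card shared = card (verts G)"
    using card_Diff_subset[OF finsh shared_subset] card_mono[OF _ shared_subset] by simp
  have w: "card (C <+> shared) = card C + card shared" using finite_C finsh by (rule card_Plus)
  show "card (verts G) \<le> (\<Sum>H\<in>C. card (verts H) - 1) + 1"
    using s d w le card_incidence_edges by linarith
  show "simple_tree (component_graph grp (G, l)) \<longleftrightarrow> card (verts G) = (\<Sum>H\<in>C. card (verts H) - 1) + 1"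
    unfolding tree using s d w card_incidence_edges by linarith
qed

text \<open>Both sides of the Euler count add up over the components, so a pairing is a tree pairing exactly
  when all its restrictions are and the component graph is a tree.\<close>

lemma tree_pairing_iff:
  assumes m: "m \<in> pairings G c"
  shows "m \<in> tree_pairings G c \<longleftrightarrow>
    simple_tree (component_graph grp (G, l)) \<and> (\<forall>H\<in>C. res m H \<in> tree_pairings H c)"
proof -
  have le: "card (verts H) - 1 \<le> card (link_blocks H (res m H))" if "H \<in> C" for H
    using card_verts_le_link_blocks[OF C_props(5)[OF that] res_pairings[OF m that]] by simp
  have iff: "res m H \<in> tree_pairings H c \<longleftrightarrow> card (verts H) - 1 = card (link_blocks H (res m H))" if "H \<in> C" for H
    using res_pairings[OF m that] C_props(6,7)[OF that] card_gt_0_iff[of "verts H"]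
    by (auto simp: tree_pairings_def)
  have sum: "(\<Sum>H\<in>C. card (verts H) - 1) = (\<Sum>H\<in>C. card (link_blocks H (res m H))) \<longleftrightarrow>
      (\<forall>H\<in>C. card (verts H) - 1 = card (link_blocks H (res m H)))"
    using sum_mono_inv[OF _ le _ finite_C] by (auto intro: sum.cong)
  have sum_le: "(\<Sum>H\<in>C. card (verts H) - 1) \<le> (\<Sum>H\<in>C. card (link_blocks H (res m H)))"
    by (intro sum_mono le)
  have "m \<in> tree_pairings G c \<longleftrightarrow> (\<Sum>H\<in>C. card (link_blocks H (res m H))) + 1 = card (verts G)"
    using m card_link_blocks[OF m] by (simp add: tree_pairings_def)
  also have "\<dots> \<longleftrightarrow> card (verts G) = (\<Sum>H\<in>C. card (verts H) - 1) + 1 \<and>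
      (\<Sum>H\<in>C. card (verts H) - 1) = (\<Sum>H\<in>C. card (link_blocks H (res m H)))"
    using sum_le sum_verts_minus_one(1) by linarith
  finally show ?thesis unfolding sum sum_verts_minus_one(2) using iff by simp
qed

text \<open>If the component graph is a tree, restriction to the components is a bijection onto
  families of tree pairings, with union as inverse. Otherwise \<open>tree_pairing_iff\<close> leaves
  none.\<close>

lemma card_tree_pairings:
  "card (tree_pairings G c) = (if simple_tree (component_graph grp (G, l))
     then \<Prod>H\<in>C. card (tree_pairings H c) else 0)"
proof (cases "simple_tree (component_graph grp (G, l))")
  case True
  have tp: "tree_pairings H' c \<subseteq> pairings H' c" for H' :: "(nat, nat) pre_digraph" by (auto simp: tree_pairings_def)
  have "bij_betw (\<lambda>m. restrict (res m) C) (tree_pairings G c) (PiE C (\<lambda>H. tree_pairings H c))"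
  proof (rule bij_betw_byWitness[where f' = "\<lambda>f. \<Union>H\<in>C. f H"])
    show "\<forall>m\<in>tree_pairings G c. (\<Union>H\<in>C. restrict (res m) C H) = m"
      using Union_res tp by auto
    show "\<forall>f\<in>PiE C (\<lambda>H. tree_pairings H c). restrict (res (\<Union>H\<in>C. f H)) C = f"
    proof (intro ballI ext)
      fix f H assume f: "f \<in> PiE C (\<lambda>H. tree_pairings H c)"
      have f': "f H' \<in> pairings H' c" if "H' \<in> C" for H' using f tp that by (auto simp: PiE_def Pi_def)
      show "restrict (res (\<Union>H\<in>C. f H)) C H = f H"
        using Union_pairings(2)[of f, OF f'] f by (cases "H \<in> C") (auto simp: PiE_def extensional_def)
    qed
    show "(\<lambda>m. restrict (res m) C) ` tree_pairings G c \<subseteq> PiE C (\<lambda>H. tree_pairings H c)"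
    proof (intro image_subsetI restrict_PiE_iff[THEN iffD2] ballI)
      fix m H assume m: "m \<in> tree_pairings G c" and H: "H \<in> C"
      from m have "m \<in> pairings G c" using tp by blast
      from tree_pairing_iff[OF this] m H show "res m H \<in> tree_pairings H c" by simp
    qed
    show "(\<lambda>f. \<Union>H\<in>C. f H) ` PiE C (\<lambda>H. tree_pairings H c) \<subseteq> tree_pairings G c"
    proof (rule image_subsetI)
      fix f assume f: "f \<in> PiE C (\<lambda>H. tree_pairings H c)"
      have f': "f H' \<in> pairings H' c" if "H' \<in> C" for H' using f tp that by (auto simp: PiE_def Pi_def)
      have "res (\<Union>H\<in>C. f H) H \<in> tree_pairings H c" if H: "H \<in> C" for H
      proof -
        have "res (\<Union>H\<in>C. f H) H = f H" using f' H by (rule Union_pairings(2))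
        moreover have "f H \<in> tree_pairings H c" using f H by (rule PiE_mem)
        ultimately show ?thesis by (simp only:)
      qed
      then show "(\<Union>H\<in>C. f H) \<in> tree_pairings G c"
        using tree_pairing_iff[OF Union_pairings(1)[of f, OF f']] True by simp
    qed
  qed
  then have "card (tree_pairings G c) = card (PiE C (\<lambda>H. tree_pairings H c))" by (rule bij_betw_same_card)
  then show ?thesis using True finite_C by (simp add: card_PiE)
next
  case False
  then have "tree_pairings G c = {}" using tree_pairing_iff by (auto simp: tree_pairings_def)
  then show ?thesis using False by simp
qed

end

lemma edge_weight_components: "edge_weight G p q = (\<Prod>H\<in>C. edge_weight H p q)"
proof -
  have "edge_weight G p q = (\<Prod>H\<in>C. \<Prod>e\<in>arcs H. if tail G e = head G e then q e else p e)"
    unfolding edge_weight_def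
    by (subst arcs_Union, subst prod.UNION_disjoint)
      (use finite_C finite_subset[OF C_props(2)] component_unique_arc in auto)
  also have "\<dots> = (\<Prod>H\<in>C. edge_weight H p q)"
    unfolding edge_weight_def using C_props(3,4) by (intro prod.cong refl) auto
  finally show ?thesis .
qed

lemma inj_limit_components:
  "inj_limit grp P Q (G, l) = (if is_free_product grp (G, l) then \<Prod>H\<in>C. inj_limit grp P Q (H, l) else 0)"
proof (cases "arcs G = {}")
  \<comment> \<open>A connected graph without arcs is a single vertex. Its only pairing is the empty
    one, which is a tree pairing, so both sides are 1, matching the convention for the edgeless
    graph.\<close>
  case True
  have "C = {}" using component_has_arc C_props(2,6) True by blast
  have "card (verts G) \<le> 1" using card_verts_le_ends[OF test] True by (simp add: link_arcs_def)
  moreover have "card (verts G) \<noteq> 0" using test by (auto simp: is_test_graph_iff_cut)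
  ultimately have "card (verts G) = 1" by linarith
  then have "tree_pairings G c = {{}}"
    using True by (auto simp: tree_pairings_def pairings_def link_blocks_def partition_on_def)
  then show ?thesis using True \<open>C = {}\<close> by (simp add: inj_limit_def edge_weight_def is_free_product_def)
next
  case False
  then show ?thesis
    by (auto simp: inj_limit_def is_free_product_def card_tree_pairings edge_weight_components prod.distrib)
qed

end


section \<open>Graph operations on matrices\<close>

text \<open>Matrices of size \<open>n\<close> are functions on pairs of indices that vanish outside \<open>{..<n} \<times> {..<n}\<close>.\<close>

definition op_maps :: "nat \<Rightarrow> graph_op \<Rightarrow> nat \<Rightarrow> nat \<Rightarrow> (nat \<Rightarrow> nat) set" where
  "op_maps n g i j = {\<phi> \<in> verts (op_graph g) \<rightarrow>\<^sub>E {..<n}. \<phi> (op_out g) = i \<and> \<phi> (op_in g) = j}"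

text \<open>The graph operation \<open>Z_g\<close> on matrices. The output carries the row index and
  the input the column index, in line with head before tail on the edges.\<close>

definition op_action :: "nat \<Rightarrow> graph_op \<Rightarrow> nat \<Rightarrow> (nat \<Rightarrow> nat \<Rightarrow> nat \<Rightarrow> complex) \<Rightarrow> nat \<Rightarrow> nat \<Rightarrow> complex" where
  "op_action n g K a i j = (\<Sum>\<phi>\<in>op_maps n g i j.
     \<Prod>k<K. a k (\<phi> (head (op_graph g) k)) (\<phi> (tail (op_graph g) k)))"

definition mat_mul :: "nat \<Rightarrow> (nat \<Rightarrow> nat \<Rightarrow> complex) \<Rightarrow> (nat \<Rightarrow> nat \<Rightarrow> complex) \<Rightarrow> nat \<Rightarrow> nat \<Rightarrow> complex" where
  "mat_mul n a b i j = (\<Sum>k<n. a i k * b k j)"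

definition mat_id :: "nat \<Rightarrow> nat \<Rightarrow> nat \<Rightarrow> complex" where
  "mat_id n i j = (if i = j \<and> i < n then 1 else 0)"

lemma is_graph_opD:
  assumes "is_graph_op K g"
  shows "fin_digraph (op_graph g)" "wf_digraph (op_graph g)" "finite (verts (op_graph g))"
    "arcs (op_graph g) = {..<K}" "op_in g \<in> verts (op_graph g)" "op_out g \<in> verts (op_graph g)"
    "is_test_graph (op_graph g, l)"
    "k < K \<Longrightarrow> tail (op_graph g) k \<in> verts (op_graph g)"
    "k < K \<Longrightarrow> head (op_graph g) k \<in> verts (op_graph g)"
proof -
  show f: "fin_digraph (op_graph g)" and "arcs (op_graph g) = {..<K}"
    "op_in g \<in> verts (op_graph g)" "op_out g \<in> verts (op_graph g)"
    using assms by (auto simp: is_graph_op_def)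
  show "is_test_graph (op_graph g, l)" using assms by (simp add: is_graph_op_def is_test_graph_def)
  interpret fin_digraph "op_graph g" by (rule f)
  show "wf_digraph (op_graph g)" by unfold_locales
  show "finite (verts (op_graph g))" by simp
  show "k < K \<Longrightarrow> tail (op_graph g) k \<in> verts (op_graph g)"
    "k < K \<Longrightarrow> head (op_graph g) k \<in> verts (op_graph g)"
    using assms by (auto simp: is_graph_op_def)
qed

lemma finite_op_maps: "is_graph_op K g \<Longrightarrow> finite (op_maps n g i j)"
  using is_graph_opD(3)[of K g]
  by (intro finite_subset[OF _ finite_PiE[of "verts (op_graph g)" "\<lambda>_. {..<n}"]]) (auto simp: op_maps_def)

lemma op_action_outside:
  assumes "is_graph_op K g" "\<not> (i < n \<and> j < n)"
  shows "op_action n g K a i j = 0"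
proof -
  have "op_maps n g i j = {}"
    using assms is_graph_opD(5,6)[OF assms(1)] by (auto simp: op_maps_def)
  then show ?thesis by (simp add: op_action_def)
qed

lemma op_action_cong:
  "(\<And>k. k < K \<Longrightarrow> a k = b k) \<Longrightarrow> op_action n g K a = op_action n g K b"
  unfolding op_action_def by (intro ext sum.cong prod.cong refl) simp

lemma op_action_upd_add:
  assumes "k < K"
  shows "op_action n g K (a(k := (\<lambda>i j. x i j + y i j))) i j =
    op_action n g K (a(k := x)) i j + op_action n g K (a(k := y)) i j"
proof -
  have "(\<Prod>k'<K. (a(k := z)) k' (\<phi> (head (op_graph g) k')) (\<phi> (tail (op_graph g) k'))) =
      z (\<phi> (head (op_graph g) k)) (\<phi> (tail (op_graph g) k)) *
      (\<Prod>k'\<in>{..<K} - {k}. a k' (\<phi> (head (op_graph g) k')) (\<phi> (tail (op_graph g) k')))" for z \<phi>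
    using assms by (subst prod.remove[of _ k]) auto
  then show ?thesis by (simp add: op_action_def sum.distrib distrib_right)
qed

lemma op_action_upd_smult:
  assumes "k < K"
  shows "op_action n g K (a(k := (\<lambda>i j. t * x i j))) i j = t * op_action n g K (a(k := x)) i j"
proof -
  have "(\<Prod>k'<K. (a(k := z)) k' (\<phi> (head (op_graph g) k')) (\<phi> (tail (op_graph g) k'))) =
      z (\<phi> (head (op_graph g) k)) (\<phi> (tail (op_graph g) k)) *
      (\<Prod>k'\<in>{..<K} - {k}. a k' (\<phi> (head (op_graph g) k')) (\<phi> (tail (op_graph g) k')))" for z \<phi>
    using assms by (subst prod.remove[of _ k]) auto
  then show ?thesis by (simp add: op_action_def sum_distrib_left mult.assoc)
qed

lemma trace_op_action:
  assumes g: "is_graph_op K g"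
  shows "(\<Sum>i<n. op_action n g K a i i) =
    (\<Sum>\<phi> | \<phi> \<in> verts (op_graph g) \<rightarrow>\<^sub>E {..<n} \<and> \<phi> (op_in g) = \<phi> (op_out g).
       \<Prod>k<K. a k (\<phi> (head (op_graph g) k)) (\<phi> (tail (op_graph g) k)))"
proof -
  let ?S = "{\<phi>. \<phi> \<in> verts (op_graph g) \<rightarrow>\<^sub>E {..<n} \<and> \<phi> (op_in g) = \<phi> (op_out g)}"
  let ?w = "\<lambda>\<phi>. \<Prod>k<K. a k (\<phi> (head (op_graph g) k)) (\<phi> (tail (op_graph g) k))"
  have fin: "finite ?S"
    using is_graph_opD(3)[OF g]
    by (intro finite_subset[OF _ finite_PiE[of "verts (op_graph g)" "\<lambda>_. {..<n}"]]) auto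
  have "(\<Sum>\<phi>\<in>?S. ?w \<phi>) = (\<Sum>i<n. \<Sum>\<phi>\<in>{\<phi>. \<phi> \<in> ?S \<and> \<phi> (op_out g) = i}. ?w \<phi>)"
    using is_graph_opD(6)[OF g] by (subst sum.group[OF fin, of "{..<n}" "\<lambda>\<phi>. \<phi> (op_out g)"]) auto
  also have "\<dots> = (\<Sum>i<n. op_action n g K a i i)"
    unfolding op_action_def op_maps_def by (intro sum.cong) auto
  finally show ?thesis by simp
qed

text \<open>On the diagonal the input and the output take the same value, which is precisely the
  gluing made by \<open>op_closure\<close>.\<close>

lemma trace_op_closure:
  assumes g: "is_graph_op (length as) g"
  shows "(\<Sum>i<n. op_action n g (length as) (\<lambda>k. B (as ! k)) i i) = vertex_sum n B (op_closure g as)"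
proof -
  have "vertex_sum n B (op_closure g as) =
    (\<Sum>\<psi> | \<psi> \<in> verts (op_graph g) \<rightarrow>\<^sub>E {..<n} \<and> (\<forall>x y. x = op_in g \<and> y = op_out g \<longrightarrow> \<psi> x = \<psi> y).
       \<Prod>e\<in>arcs (op_graph g). B (as ! e) (\<psi> (head (op_graph g) e)) (\<psi> (tail (op_graph g) e)))"
    unfolding op_closure_def
    by (rule vertex_sum_glue[OF is_graph_opD(2)[OF g]]) (use is_graph_opD[OF g] in auto)
  then show ?thesis unfolding trace_op_action[OF g] is_graph_opD(4)[OF g] by simp
qed

lemma is_test_graph_op_closure: "is_graph_op K g \<Longrightarrow> is_test_graph (op_closure g as)"
  unfolding op_closure_def using is_graph_opD(7) by (intro is_test_graph_glue_connected)

lemma is_graph_op_path: "is_graph_op K (op_path K)"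
proof -
  have "fin_digraph (op_graph (op_path K))" by unfold_locales (auto simp: op_path_def)
  moreover have "{..K} \<subseteq> S \<or> {..K} \<inter> S = {}" if S: "\<forall>k<K. k \<in> S \<longleftrightarrow> Suc k \<in> S" for S
  proof -
    have "k \<in> S \<longleftrightarrow> 0 \<in> S" if "k \<le> K" for k using that by (induction k) (use S in auto)
    then show ?thesis by auto
  qed
  ultimately have "is_test_graph (op_graph (op_path K), \<lambda>_. ())"
    unfolding is_test_graph_iff_cut by (auto simp: op_path_def)
  then show ?thesis by (auto simp: is_graph_op_def is_test_graph_def op_path_def)
qed

lemma op_action_path_Suc:
  assumes "i < n"
  shows "op_action n (op_path (Suc K)) (Suc K) a i j = (\<Sum>l<n. a K i l * op_action n (op_path K) K a l j)"
proof -
  let ?w = "\<lambda>\<phi>. \<Prod>k<K. a k (\<phi> (Suc k)) (\<phi> k)"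
  let ?A = "{\<phi> \<in> {..Suc K} \<rightarrow>\<^sub>E {..<n}. \<phi> (Suc K) = i \<and> \<phi> 0 = j}"
  let ?B = "\<lambda>l. {\<phi> \<in> {..K} \<rightarrow>\<^sub>E {..<n}. \<phi> K = l \<and> \<phi> 0 = j}"
  have "op_action n (op_path (Suc K)) (Suc K) a i j = (\<Sum>\<phi>\<in>?A. a K i (\<phi> K) * ?w \<phi>)"
    unfolding op_action_def op_maps_def op_path_def by (intro sum.cong) auto
  also have "\<dots> = (\<Sum>(l, \<phi>)\<in>Sigma {..<n} ?B. a K i l * ?w \<phi>)"
  proof (rule sum.reindex_bij_witness[where j = "\<lambda>\<phi>. (\<phi> K, restrict \<phi> {..K})"
        and i = "\<lambda>(l, \<phi>). \<phi>(Suc K := i)"], goal_cases)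
    case (1 \<phi>)
    then show ?case by (auto simp: fun_eq_iff PiE_def extensional_def le_Suc_eq)
  next
    case (2 \<phi>)
    then show ?case by auto
  next
    case (3 x)
    then show ?case by (auto simp: fun_eq_iff PiE_def extensional_def)
  next
    case (4 x)
    then show ?case using assms by (auto simp: PiE_def extensional_def le_Suc_eq Pi_def)
  next
    case (5 \<phi>)
    then show ?case by auto
  qed
  also have "\<dots> = (\<Sum>l<n. \<Sum>\<phi>\<in>?B l. a K i l * ?w \<phi>)"
    by (intro sum.Sigma[symmetric]) (auto intro!: finite_subset[OF _ finite_PiE[of "{..K}" "\<lambda>_. {..<n}"]])
  also have "\<dots> = (\<Sum>l<n. a K i l * op_action n (op_path K) K a l j)"
    unfolding op_action_def op_maps_def op_path_def sum_distrib_left by simp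
  finally show ?thesis .
qed

text \<open>Removing the last edge of the path splits off the leftmost factor. For a row index
  outside \<open>{..<n}\<close> there is no map on the left; the support condition makes the product
  vanish as well, since \<open>mat_mul\<close> only bounds the inner index.\<close>

lemma op_action_path:
  assumes supp: "\<And>a i j. a \<in> set as \<Longrightarrow> \<not> (i < n \<and> j < n) \<Longrightarrow> a i j = 0"
  shows "op_action n (op_path (length as)) (length as) ((!) as) = foldr (mat_mul n) (rev as) (mat_id n)"
  using supp
proof (induction as rule: rev_induct)
  case Nil
  show ?case
  proof (intro ext)
    fix i j
    have "op_maps n (op_path 0) i j = (if i = j \<and> i < n then {restrict (\<lambda>_. i) {0}} else {})"
      by (auto simp: op_maps_def op_path_def fun_eq_iff PiE_def extensional_def)
    then show "op_action n (op_path (length [])) (length []) ((!) []) i j =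
        foldr (mat_mul n) (rev []) (mat_id n) i j"
      by (simp add: op_action_def mat_id_def)
  qed
next
  case (snoc b as)
  have IH: "op_action n (op_path (length as)) (length as) ((!) (as @ [b])) = foldr (mat_mul n) (rev as) (mat_id n)"
    using snoc by (subst op_action_cong[of _ _ "(!) as"]) (auto simp: nth_append)
  show ?case
  proof (intro ext)
    fix i j
    show "op_action n (op_path (length (as @ [b]))) (length (as @ [b])) ((!) (as @ [b])) i j =
        foldr (mat_mul n) (rev (as @ [b])) (mat_id n) i j"
    proof (cases "i < n")
      case True
      then show ?thesis using op_action_path_Suc[OF True, of "length as" "(!) (as @ [b])" j] IH by (simp add: mat_mul_def)
    next
      case False
      then show ?thesis using snoc.prems[of b] op_action_outside[OF is_graph_op_path] by (simp add: mat_mul_def)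
    qed
  qed
qed

lemma op_action_iso:
  assumes g: "is_graph_op K g" and h: "graph_op_isomorphism h g g'"
    and g': "is_graph_op K g'" and a: "\<And>k. k < K \<Longrightarrow> a' (iso_arcs h k) = a k"
  shows "op_action n g' K a' = op_action n g K a"
proof (intro ext)
  fix i j
  let ?G = "op_graph g" and ?G' = "op_graph g'" and ?hv = "iso_verts h"
  have iso: "pre_digraph.digraph_isomorphism ?G h" and G': "?G' = app_iso h ?G"
    and io: "op_in g' = ?hv (op_in g)" "op_out g' = ?hv (op_out g)"
    using h by (auto simp: graph_op_isomorphism_def)
  have hv: "inj_on ?hv (verts ?G)" "inj_on (iso_arcs h) {..<K}"
    and ht: "\<And>k. k < K \<Longrightarrow> iso_head h (iso_arcs h k) = ?hv (head ?G k)"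
      "\<And>k. k < K \<Longrightarrow> iso_tail h (iso_arcs h k) = ?hv (tail ?G k)"
    using iso is_graph_opD(4)[OF g] by (auto simp: pre_digraph.digraph_isomorphism_def)
  have arcs: "iso_arcs h ` {..<K} = {..<K}"
    using is_graph_opD(4)[OF g] is_graph_opD(4)[OF g'] G' by (simp add: app_iso_def)
  have inv: "the_inv_into (verts ?G) ?hv (?hv v) = v" if "v \<in> verts ?G" for v
    using hv(1) that by (rule the_inv_into_f_f)
  show "op_action n g' K a' i j = op_action n g K a i j"
    unfolding op_action_def
  proof (rule sum.reindex_bij_witness[where j = "\<lambda>\<phi>. restrict (\<phi> \<circ> ?hv) (verts ?G)"
        and i = "\<lambda>\<phi>. restrict (\<phi> \<circ> the_inv_into (verts ?G) ?hv) (?hv ` verts ?G)"], goal_cases)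
    case (1 \<phi>)
    then show ?case using G' by (auto simp: op_maps_def app_iso_def fun_eq_iff PiE_def extensional_def inv)
  next
    case (2 \<phi>)
    then show ?case using G' io is_graph_opD(5,6)[OF g]
      by (auto simp: op_maps_def app_iso_def PiE_def Pi_def)
  next
    case (3 \<phi>)
    then show ?case by (auto simp: op_maps_def fun_eq_iff PiE_def extensional_def inv)
  next
    case (4 \<phi>)
    then show ?case using G' io is_graph_opD(5,6)[OF g]
      by (auto simp: op_maps_def app_iso_def PiE_def Pi_def inv)
  next
    case (5 \<phi>)
    have "(\<Prod>k<K. a' k (\<phi> (head ?G' k)) (\<phi> (tail ?G' k))) =
        (\<Prod>k\<in>iso_arcs h ` {..<K}. a' k (\<phi> (iso_head h k)) (\<phi> (iso_tail h k)))"
      unfolding arcs G' by (simp add: app_iso_def)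
    also have "\<dots> = (\<Prod>k<K. a k (\<phi> (?hv (head ?G k))) (\<phi> (?hv (tail ?G k))))"
      unfolding prod.reindex[OF hv(2)] using ht a by (intro prod.cong) auto
    finally show ?case using is_graph_opD(8,9)[OF g] by simp
  qed
qed

lemma vertex_sum_iso:
  assumes T: "is_test_graph T" and iso: "test_graph_iso T T'"
  shows "vertex_sum n B T' = vertex_sum n B T"
proof -
  interpret fin_digraph "fst T" using T by (simp add: is_test_graph_def)
  obtain h where h: "pre_digraph.digraph_isomorphism (fst T) h" "fst T' = app_iso h (fst T)"
      "\<And>e. e \<in> arcs (fst T) \<Longrightarrow> snd T' (iso_arcs h e) = snd T e"
    using iso unfolding test_graph_iso_def by blast
  let ?G = "fst T" and ?hv = "iso_verts h"
  have hv: "inj_on ?hv (verts ?G)" "inj_on (iso_arcs h) (arcs ?G)"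
    and ht: "\<And>k. k \<in> arcs ?G \<Longrightarrow> iso_head h (iso_arcs h k) = ?hv (head ?G k)"
      "\<And>k. k \<in> arcs ?G \<Longrightarrow> iso_tail h (iso_arcs h k) = ?hv (tail ?G k)"
    using h(1) by (auto simp: pre_digraph.digraph_isomorphism_def)
  have inv: "the_inv_into (verts ?G) ?hv (?hv v) = v" if "v \<in> verts ?G" for v
    using hv(1) that by (rule the_inv_into_f_f)
  show ?thesis
    unfolding vertex_sum_def
  proof (rule sum.reindex_bij_witness[where j = "\<lambda>\<phi>. restrict (\<phi> \<circ> ?hv) (verts ?G)"
        and i = "\<lambda>\<phi>. restrict (\<phi> \<circ> the_inv_into (verts ?G) ?hv) (?hv ` verts ?G)"], goal_cases)
    case (1 \<phi>)
    then show ?case using h(2) by (auto simp: app_iso_def fun_eq_iff PiE_def extensional_def inv)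
  next
    case (2 \<phi>)
    then show ?case using h(2) by (auto simp: app_iso_def PiE_def Pi_def)
  next
    case (3 \<phi>)
    then show ?case by (auto simp: fun_eq_iff PiE_def extensional_def inv)
  next
    case (4 \<phi>)
    then show ?case using h(2) by (auto simp: app_iso_def PiE_def Pi_def inv)
  next
    case (5 \<phi>)
    have "(\<Prod>e\<in>arcs (fst T'). B (snd T' e) (\<phi> (head (fst T') e)) (\<phi> (tail (fst T') e))) =
        (\<Prod>e\<in>iso_arcs h ` arcs ?G. B (snd T' e) (\<phi> (iso_head h e)) (\<phi> (iso_tail h e)))"
      unfolding h(2) by (simp add: app_iso_def)
    also have "\<dots> = (\<Prod>e\<in>arcs ?G. B (snd T e) (\<phi> (?hv (head ?G e))) (\<phi> (?hv (tail ?G e))))"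
      unfolding prod.reindex[OF hv(2)] using ht h(3) by (intro prod.cong) auto
    finally show ?case by simp
  qed
qed

lemma cnj_op_action:
  assumes "is_graph_op K g"
  shows "cnj (op_action n g K a j i) = op_action n (op_reverse g) K (\<lambda>k i j. cnj (a k j i)) i j"
  unfolding op_action_def op_maps_def op_reverse_def reverse_graph_def by (simp add: conj_commute)

lemma is_graph_op_reverse:
  assumes "is_graph_op K g"
  shows "is_graph_op K (op_reverse g)"
proof -
  interpret fin_digraph "op_graph g" by (rule is_graph_opD(1)[OF assms])
  have "fin_digraph (reverse_graph (op_graph g))"
    by unfold_locales (auto simp: reverse_graph_def)
  moreover have "is_test_graph (op_graph g, \<lambda>_. ())" by (rule is_graph_opD(7)[OF assms])
  ultimately have "is_test_graph (reverse_graph (op_graph g), \<lambda>_. ())"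
    unfolding is_test_graph_iff_cut by (simp add: reverse_graph_def eq_commute)
  then show ?thesis
    using is_graph_opD[OF assms] by (auto simp: is_graph_op_def is_test_graph_def op_reverse_def reverse_graph_def)
qed

subsection \<open>Substitution\<close>

lemma prod_nth_eq_prod_list:
  "(\<Prod>m<length xs. f (xs ! m)) = prod_list (map f xs)" for f :: "'a \<Rightarrow> 'b::comm_monoid_mult"
  by (induction xs) (simp_all add: prod.lessThan_Suc_shift del: prod.lessThan_Suc)

lemma prod_list_concat_pairs:
  "prod_list (map f (concat (map (\<lambda>k. map (Pair k) [0..<d k]) [0..<N]))) = (\<Prod>k<N. \<Prod>l<d k. f (k, l))"
  for f :: "nat \<times> nat \<Rightarrow> 'b::comm_monoid_mult"
proof -
  have "prod_list (map f (map (Pair k) [0..<d k])) = (\<Prod>l<d k. f (k, l))" for k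
    using prod_nth_eq_prod_list[of "\<lambda>l. f (k, l)" "[0..<d k]"] by (simp add: comp_def)
  then show ?thesis by (induction N) (simp_all add: mult.commute)
qed

locale op_substitution =
  fixes g :: graph_op and gs :: "graph_op list" and ass :: "'s list list"
  assumes g: "is_graph_op (length gs) g" and len: "length ass = length gs"
    and gs: "k < length gs \<Longrightarrow> is_graph_op (length (ass ! k)) (gs ! k)"
begin

abbreviation "N \<equiv> length gs"
abbreviation "es \<equiv> op_subst_edges gs"
abbreviation "R \<equiv> op_subst_rel g gs"
abbreviation "G \<equiv> op_graph g"
abbreviation "Gs k \<equiv> op_graph (gs ! k)"

text \<open>The graph underlying \<open>op_subst\<close> before the gluing, isolated so that
  \<open>sum_glue\<close> and \<open>is_test_graph_glue\<close> apply to it.\<close>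

definition D :: "(nat, nat) pre_digraph" where
  "D = \<lparr> verts = (\<lambda>v. prod_encode (0, v)) ` verts G \<union> (\<Union>k<N. (\<lambda>v. prod_encode (Suc k, v)) ` verts (Gs k)),
     arcs = {..<length es},
     tail = (\<lambda>m. case es ! m of (k, j) \<Rightarrow> prod_encode (Suc k, tail (Gs k) j)),
     head = (\<lambda>m. case es ! m of (k, j) \<Rightarrow> prod_encode (Suc k, head (Gs k) j)) \<rparr>"

lemma op_subst_eq: "op_subst g gs = \<lparr> op_graph = glue R D, op_in = glue_map R (prod_encode (0, op_in g)),
    op_out = glue_map R (prod_encode (0, op_out g)) \<rparr>"
  unfolding op_subst_def D_def Let_def ..

lemma card_arcs: "k < N \<Longrightarrow> card (arcs (Gs k)) = length (ass ! k)"
  using is_graph_opD(4)[OF gs] by simp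

lemma es_eq: "es = concat (map (\<lambda>k. map (Pair k) [0..<length (ass ! k)]) [0..<N])"
  unfolding op_subst_edges_def by (intro arg_cong[of _ _ concat] map_cong refl) (simp add: card_arcs)

lemma concat_ass: "concat ass = map (\<lambda>(k, l). ass ! k ! l) es"
proof -
  have "concat ass = concat (map (\<lambda>k. ass ! k) [0..<N])" by (simp add: map_nth flip: len)
  also have "\<dots> = map (\<lambda>(k, l). ass ! k ! l) es"
    unfolding es_eq map_concat by (simp add: comp_def map_nth)
  finally show ?thesis .
qed

lemma length_es: "length es = length (concat ass)"
  by (simp add: concat_ass)

lemma set_es: "set es = {(k, l). k < N \<and> l < length (ass ! k)}"
  unfolding es_eq by auto

lemma verts_D_iff:
  "prod_encode (0, v) \<in> verts D \<longleftrightarrow> v \<in> verts G"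
  "prod_encode (Suc k, v) \<in> verts D \<longleftrightarrow> k < N \<and> v \<in> verts (Gs k)"
  by (auto simp: D_def)

lemma R_in: "R x y \<Longrightarrow> x \<in> verts D \<and> y \<in> verts D"
  unfolding op_subst_rel_def
  using is_graph_opD(5,6)[OF gs] is_graph_opD(8,9)[OF g] by (auto simp: verts_D_iff)

lemma fin_digraph_D: "fin_digraph D"
proof
  fix e assume "e \<in> arcs D"
  then have "es ! e \<in> set es" by (simp add: D_def)
  then obtain k l where "es ! e = (k, l)" "k < N" "l < length (ass ! k)" unfolding set_es by auto
  then have "tail D e = prod_encode (Suc k, tail (Gs k) l)" "head D e = prod_encode (Suc k, head (Gs k) l)"
    by (simp_all add: D_def)
  then show "tail D e \<in> verts D" "head D e \<in> verts D"
    using is_graph_opD(8,9)[OF gs] \<open>k < N\<close> \<open>l < _\<close> by (simp_all only: verts_D_iff simp_thms)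
next
  show "finite (verts D)" "finite (arcs D)"
    using is_graph_opD(3)[OF gs] is_graph_opD(3)[OF g] by (auto simp: D_def)
qed

text \<open>A cut that respects the gluing contains all or nothing of each connected inner graph. As
  that graph joins the two ends of the edge it replaces, the cut crosses no edge of
  \<open>g\<close>, and connectivity of \<open>g\<close> finishes the argument.\<close>

lemma is_graph_op_subst: "is_graph_op (length (concat ass)) (op_subst g gs)"
proof -
  have "is_test_graph (glue R D, \<lambda>_. ())"
  proof (rule is_test_graph_glue[OF fin_digraph_D])
    show "verts D \<noteq> {}" using is_graph_opD(5)[OF g] by (auto simp: D_def)
    fix S assume S: "\<forall>e\<in>arcs D. tail D e \<in> S \<longleftrightarrow> head D e \<in> S" and RS: "\<And>x y. R x y \<Longrightarrow> x \<in> S \<longleftrightarrow> y \<in> S"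
    have inner: "prod_encode (Suc k, v) \<in> S \<longleftrightarrow> prod_encode (Suc k, w) \<in> S"
      if k: "k < N" and vw: "v \<in> verts (Gs k)" "w \<in> verts (Gs k)" for k v w
    proof -
      let ?S = "{v. prod_encode (Suc k, v) \<in> S}"
      have "\<forall>l\<in>arcs (Gs k). tail (Gs k) l \<in> ?S \<longleftrightarrow> head (Gs k) l \<in> ?S"
      proof
        fix l assume "l \<in> arcs (Gs k)"
        then have "(k, l) \<in> set es" using k is_graph_opD(4)[OF gs[OF k]] by (simp add: set_es)
        then obtain m where m: "m < length es" "es ! m = (k, l)" by (metis in_set_conv_nth)
        then have "m \<in> arcs D" by (simp add: D_def)
        from S[rule_format, OF this] show "tail (Gs k) l \<in> ?S \<longleftrightarrow> head (Gs k) l \<in> ?S"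
          using m(2) by (simp add: D_def)
      qed
      then have "verts (Gs k) \<subseteq> ?S \<or> verts (Gs k) \<inter> ?S = {}"
        using is_graph_opD(7)[OF gs[OF k]] unfolding is_test_graph_iff_cut fst_conv
        by (elim conjE allE[of _ ?S] impE)
      then show ?thesis using vw by blast
    qed
    have link: "prod_encode (0, tail G k) \<in> S \<longleftrightarrow> prod_encode (Suc k, op_in (gs ! k)) \<in> S"
      "prod_encode (0, head G k) \<in> S \<longleftrightarrow> prod_encode (Suc k, op_out (gs ! k)) \<in> S" if "k < N" for k
      using RS that unfolding op_subst_rel_def by blast+
    let ?S = "{v. prod_encode (0, v) \<in> S}"
    have "\<forall>k\<in>arcs G. tail G k \<in> ?S \<longleftrightarrow> head G k \<in> ?S"
      using link inner[OF _ is_graph_opD(5)[OF gs] is_graph_opD(6)[OF gs]] is_graph_opD(4)[OF g] by simp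
    then have outer: "verts G \<subseteq> ?S \<or> verts G \<inter> ?S = {}"
      using is_graph_opD(7)[OF g] unfolding is_test_graph_iff_cut fst_conv
      by (elim conjE allE[of _ ?S] impE)
    have "prod_encode (Suc k, v) \<in> S \<longleftrightarrow> verts G \<subseteq> ?S" if "k < N" "v \<in> verts (Gs k)" for k v
    proof -
      have "tail G k \<in> verts G" using is_graph_opD(8)[OF g] that by blast
      then have "tail G k \<in> ?S \<longleftrightarrow> verts G \<subseteq> ?S" using outer by blast
      then show ?thesis using link(1) inner[OF that is_graph_opD(5)[OF gs]] that by simp
    qed
    moreover have "prod_encode (0, v) \<in> S \<longleftrightarrow> verts G \<subseteq> ?S" if "v \<in> verts G" for v
      using outer that by blast
    ultimately show "verts D \<subseteq> S \<or> verts D \<inter> S = {}"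
      by (cases "verts G \<subseteq> ?S") (auto simp: D_def)
  qed
  then have "fin_digraph (glue R D)" "Digraph_Component.connected (glue R D)"
    by (auto simp: is_test_graph_def)
  moreover have "arcs (glue R D) = {..<length (concat ass)}"
    unfolding length_es[symmetric] by (simp add: glue_def D_def)
  moreover have "glue_map R (prod_encode (0, v)) \<in> verts (glue R D)" if "v \<in> verts G" for v
    using that by (auto simp: glue_def D_def)
  ultimately show ?thesis
    using is_graph_opD(5,6)[OF g] by (simp add: is_graph_op_def op_subst_eq)
qed

text \<open>A map of the glued graph is a map \<open>\<phi>\<close> of the outer graph together
  with, for each edge \<open>k\<close>, a map of \<open>gs ! k\<close> whose output and input values
  are those of \<open>\<phi>\<close> at the head and tail of \<open>k\<close>. Distributing the
  product over these independent choices turns each inner sum into an entry of the inner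
  action.\<close>

lemma op_action_subst:
  "op_action n (op_subst g gs) (length (concat ass)) (\<lambda>m. B (concat ass ! m)) =
   op_action n g N (\<lambda>k. op_action n (gs ! k) (length (ass ! k)) (\<lambda>l. B (ass ! k ! l)))"
proof (intro ext)
  fix i j
  let ?w = "\<lambda>\<psi>. \<Prod>k<N. \<Prod>l<length (ass ! k). B (ass ! k ! l)
      (\<psi> (prod_encode (Suc k, head (Gs k) l))) (\<psi> (prod_encode (Suc k, tail (Gs k) l)))"
  have w: "(\<Prod>m<length (concat ass). B (concat ass ! m) (\<psi> (head D m)) (\<psi> (tail D m))) = ?w \<psi>" for \<psi>
  proof -
    let ?f = "\<lambda>(k, l). B (ass ! k ! l) (\<psi> (prod_encode (Suc k, head (Gs k) l))) (\<psi> (prod_encode (Suc k, tail (Gs k) l)))"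
    have "(\<Prod>m<length (concat ass). B (concat ass ! m) (\<psi> (head D m)) (\<psi> (tail D m))) =
        (\<Prod>m<length es. ?f (es ! m))"
      unfolding length_es[symmetric]
      by (intro prod.cong refl) (auto simp: concat_ass D_def split: prod.splits)
    also have "\<dots> = prod_list (map ?f es)" by (rule prod_nth_eq_prod_list)
    also have "\<dots> = ?w \<psi>" unfolding es_eq prod_list_concat_pairs by simp
    finally show ?thesis .
  qed
  let ?c = "\<lambda>\<psi> :: nat \<Rightarrow> nat. \<psi> (prod_encode (0, op_out g)) = i \<and> \<psi> (prod_encode (0, op_in g)) = j"
  let ?H = "\<lambda>\<psi>. if ?c \<psi> then ?w \<psi> else 0"
  have io_D: "prod_encode (0, op_out g) \<in> verts D" "prod_encode (0, op_in g) \<in> verts D"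
    using is_graph_opD(5,6)[OF g] by (auto simp: D_def)
  have finD: "finite (verts D)" using fin_digraph.finite_verts[OF fin_digraph_D] .
  interpret D: fin_digraph D by (rule fin_digraph_D)
  have arcsD: "m < length (concat ass) \<Longrightarrow> m \<in> arcs D" for m by (simp add: length_es[symmetric] D_def)
  have "op_action n (op_subst g gs) (length (concat ass)) (\<lambda>m. B (concat ass ! m)) i j =
      (\<Sum>\<phi>\<in>glue_map R ` verts D \<rightarrow>\<^sub>E {..<n}. ?H (restrict (\<phi> \<circ> glue_map R) (verts D)))"
  proof -
    have "op_action n (op_subst g gs) (length (concat ass)) (\<lambda>m. B (concat ass ! m)) i j =
        (\<Sum>\<phi>\<in>{\<phi> \<in> glue_map R ` verts D \<rightarrow>\<^sub>E {..<n}. ?c (restrict (\<phi> \<circ> glue_map R) (verts D))}.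
           ?w (restrict (\<phi> \<circ> glue_map R) (verts D)))"
      unfolding op_action_def op_maps_def
    proof (rule sum.cong)
      show "{\<phi> \<in> verts (op_graph (op_subst g gs)) \<rightarrow>\<^sub>E {..<n}. \<phi> (op_out (op_subst g gs)) = i \<and> \<phi> (op_in (op_subst g gs)) = j} =
          {\<phi> \<in> glue_map R ` verts D \<rightarrow>\<^sub>E {..<n}. ?c (restrict (\<phi> \<circ> glue_map R) (verts D))}"
        using io_D by (simp add: op_subst_eq glue_def)
      fix \<phi>
      show "(\<Prod>k<length (concat ass). B (concat ass ! k) (\<phi> (head (op_graph (op_subst g gs)) k)) (\<phi> (tail (op_graph (op_subst g gs)) k))) =
          ?w (restrict (\<phi> \<circ> glue_map R) (verts D))"
        unfolding w[symmetric] using arcsD by (intro prod.cong refl) (simp add: op_subst_eq glue_def)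
    qed
    then show ?thesis using finD by (subst (asm) sum.inter_filter) (auto intro!: finite_PiE)
  qed
  also have "\<dots> = (\<Sum>\<psi> | \<psi> \<in> verts D \<rightarrow>\<^sub>E {..<n} \<and> (\<forall>x y. R x y \<longrightarrow> \<psi> x = \<psi> y). ?H \<psi>)"
    by (rule sum_glue[OF R_in])
  also have "\<dots> = (\<Sum>\<psi> | \<psi> \<in> verts D \<rightarrow>\<^sub>E {..<n} \<and> (\<forall>x y. R x y \<longrightarrow> \<psi> x = \<psi> y) \<and> ?c \<psi>. ?w \<psi>)"
  proof -
    have f: "finite {\<psi>. \<psi> \<in> verts D \<rightarrow>\<^sub>E {..<n} \<and> (\<forall>x y. R x y \<longrightarrow> \<psi> x = \<psi> y)}"
      using finD by (intro finite_subset[OF _ finite_PiE[of "verts D" "\<lambda>_. {..<n}"]]) blast+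
    show ?thesis unfolding sum.inter_filter[OF f, symmetric] by (rule sum.cong) blast+
  qed
  \<comment> \<open>The relation only identifies ends of outer edges with outputs and inputs, so
    constancy along it amounts to this list of equations.\<close>
  also have "{\<psi>. \<psi> \<in> verts D \<rightarrow>\<^sub>E {..<n} \<and> (\<forall>x y. R x y \<longrightarrow> \<psi> x = \<psi> y) \<and> ?c \<psi>} =
      {\<psi>. \<psi> \<in> verts D \<rightarrow>\<^sub>E {..<n} \<and> ?c \<psi> \<and>
        (\<forall>k<N. \<psi> (prod_encode (Suc k, op_out (gs ! k))) = \<psi> (prod_encode (0, head G k)) \<and>
               \<psi> (prod_encode (Suc k, op_in (gs ! k))) = \<psi> (prod_encode (0, tail G k)))}"
    (is "_ = ?Psi")
  proof -
    have "(\<forall>x y. R x y \<longrightarrow> \<psi> x = \<psi> y) \<longleftrightarrow>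
        (\<forall>k<N. \<psi> (prod_encode (Suc k, op_out (gs ! k))) = \<psi> (prod_encode (0, head G k)) \<and>
               \<psi> (prod_encode (Suc k, op_in (gs ! k))) = \<psi> (prod_encode (0, tail G k)))" for \<psi> :: "nat \<Rightarrow> nat"
      unfolding op_subst_rel_def by metis
    then show ?thesis by blast
  qed
  also have "(\<Sum>\<psi>\<in>?Psi. ?w \<psi>) =
      (\<Sum>(\<phi>, \<theta>)\<in>Sigma (op_maps n g i j) (\<lambda>\<phi>. PiE {..<N} (\<lambda>k. op_maps n (gs ! k) (\<phi> (head G k)) (\<phi> (tail G k)))).
        \<Prod>k<N. \<Prod>l<length (ass ! k). B (ass ! k ! l) (\<theta> k (head (Gs k) l)) (\<theta> k (tail (Gs k) l)))"
  proof -
    let ?j = "\<lambda>\<psi>. (restrict (\<lambda>v. \<psi> (prod_encode (0, v))) (verts G),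
        restrict (\<lambda>k. restrict (\<lambda>v. \<psi> (prod_encode (Suc k, v))) (verts (Gs k))) {..<N})"
    let ?i = "\<lambda>(\<phi>, \<theta>). restrict (\<lambda>x. case prod_decode x of (0, v) \<Rightarrow> \<phi> v | (Suc k, v) \<Rightarrow> \<theta> k v) (verts D)"
    note D0 = verts_D_iff(1) and DS = verts_D_iff(2)
    have D_cases: "(\<exists>v\<in>verts G. x = prod_encode (0, v)) \<or> (\<exists>k<N. \<exists>v\<in>verts (Gs k). x = prod_encode (Suc k, v))"
      if "x \<in> verts D" for x using that by (auto simp: D_def)
    note ht = is_graph_opD(8,9)[OF g] is_graph_opD(5,6)[OF g] is_graph_opD(5,6)[OF gs]
    show ?thesis
    proof (rule sum.reindex_bij_witness[where i = ?i and j = ?j], goal_cases)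
      case (1 \<psi>)
      show ?case
      proof
        fix x
        show "?i (?j \<psi>) x = \<psi> x"
        proof (cases "x \<in> verts D")
          case True
          from D_cases[OF True] show ?thesis using True by auto
        next
          case False
          then show ?thesis using 1 by (auto simp: PiE_def extensional_def)
        qed
      qed
    next
      case (2 \<psi>)
      have "\<psi> (prod_encode (0, v)) \<in> {..<n}" if "v \<in> verts G" for v
        using 2 D0 that by (auto simp: PiE_def Pi_def)
      moreover have "\<psi> (prod_encode (Suc k, v)) \<in> {..<n}" if "k < N" "v \<in> verts (Gs k)" for k v
        using 2 DS that by (auto simp: PiE_def Pi_def)
      ultimately show ?case using 2 ht by (auto simp: op_maps_def)
    next
      case (3 x)
      obtain \<phi> \<theta> where x: "x = (\<phi>, \<theta>)" by force
      have \<phi>: "\<phi> \<in> extensional (verts G)" and \<theta>: "\<theta> \<in> extensional {..<N}"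
        "\<And>k. k < N \<Longrightarrow> \<theta> k \<in> extensional (verts (Gs k))"
        using 3 unfolding x by (auto simp: op_maps_def PiE_def Pi_def)
      have "fst (?j (?i x)) = \<phi>" using \<phi> unfolding x by (auto simp: D0 extensional_def fun_eq_iff)
      moreover have "snd (?j (?i x)) = \<theta>"
      proof (intro ext)
        fix k v show "snd (?j (?i x)) k v = \<theta> k v"
          using \<theta> unfolding x by (cases "k < N"; cases "v \<in> verts (Gs k)") (auto simp: DS extensional_def)
      qed
      ultimately show ?case unfolding x by (simp add: prod_eq_iff)
    next
      case (4 x)
      obtain \<phi> \<theta> where x: "x = (\<phi>, \<theta>)" by force
      have \<phi>: "\<phi> \<in> op_maps n g i j" and \<theta>: "\<And>k. k < N \<Longrightarrow> \<theta> k \<in> op_maps n (gs ! k) (\<phi> (head G k)) (\<phi> (tail G k))"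
        using 4 unfolding x by (auto simp: PiE_def Pi_def)
      have v0: "?i x (prod_encode (0, v)) = \<phi> v" if "v \<in> verts G" for v using that unfolding x by (simp add: D0)
      have vS: "?i x (prod_encode (Suc k, v)) = \<theta> k v" if "k < N" "v \<in> verts (Gs k)" for k v
        using that unfolding x by (simp add: DS)
      have "?i x \<in> verts D \<rightarrow>\<^sub>E {..<n}"
      proof (rule PiE_I)
        fix y assume "y \<in> verts D"
        then consider v where "v \<in> verts G" "y = prod_encode (0, v)"
          | k v where "k < N" "v \<in> verts (Gs k)" "y = prod_encode (Suc k, v)" using D_cases by blast
        then show "?i x y \<in> {..<n}"
        proof cases
          case (1 v)
          then show ?thesis using v0[OF 1(1)] \<phi> by (auto simp: op_maps_def simp del: restrict_apply)
        next
          case (2 k v)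
          then show ?thesis using vS[OF 2(1,2)] \<theta>[OF 2(1)] by (auto simp: op_maps_def simp del: restrict_apply)
        qed
      qed (auto simp: x)
      moreover have "?c (?i x)" using v0 ht \<phi> by (simp add: op_maps_def)
      moreover have "\<forall>k<N. ?i x (prod_encode (Suc k, op_out (gs ! k))) = ?i x (prod_encode (0, head G k)) \<and>
               ?i x (prod_encode (Suc k, op_in (gs ! k))) = ?i x (prod_encode (0, tail G k))"
        using v0 vS ht \<theta> by (simp add: op_maps_def)
      ultimately show ?case by blast
    next
      case (5 \<psi>)
      show ?case
        unfolding case_prod_conv
        by (intro prod.cong refl) (use is_graph_opD(8,9)[OF gs] in auto)
    qed
  qed
  also have "\<dots> = (\<Sum>\<phi>\<in>op_maps n g i j. \<Sum>\<theta>\<in>PiE {..<N} (\<lambda>k. op_maps n (gs ! k) (\<phi> (head G k)) (\<phi> (tail G k))).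
        \<Prod>k<N. \<Prod>l<length (ass ! k). B (ass ! k ! l) (\<theta> k (head (Gs k) l)) (\<theta> k (tail (Gs k) l)))"
    using finite_op_maps[OF g] finite_op_maps[OF gs] by (intro sum.Sigma[symmetric] ballI finite_PiE) auto
  also have "\<dots> = op_action n g N (\<lambda>k. op_action n (gs ! k) (length (ass ! k)) (\<lambda>l. B (ass ! k ! l))) i j"
    unfolding op_action_def using finite_op_maps[OF gs]
    by (intro sum.cong refl prod_sum_PiE[symmetric]) auto
  finally show "op_action n (op_subst g gs) (length (concat ass)) (\<lambda>m. B (concat ass ! m)) i j =
    op_action n g N (\<lambda>k. op_action n (gs ! k) (length (ass ! k)) (\<lambda>l. B (ass ! k ! l))) i j" .
qed

end

subsection \<open>Gluing marked graphs\<close>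

definition marked_maps :: "nat \<Rightarrow> 's marked_graph \<Rightarrow> (nat \<Rightarrow> nat) \<Rightarrow> (nat \<Rightarrow> nat) set" where
  "marked_maps n t \<alpha> = {\<phi> \<in> verts (fst (fst t)) \<rightarrow>\<^sub>E {..<n}. \<forall>i<length (snd t). \<phi> (snd t ! i) = \<alpha> i}"

text \<open>The tensor of order \<open>length (snd t)\<close> attached to a marked graph, evaluated
  at the indices \<open>\<alpha>\<close>.\<close>

definition marked_sum :: "nat \<Rightarrow> ('s \<Rightarrow> nat \<Rightarrow> nat \<Rightarrow> complex) \<Rightarrow> 's marked_graph \<Rightarrow> (nat \<Rightarrow> nat) \<Rightarrow> complex" where
  "marked_sum n B t \<alpha> = (\<Sum>\<phi>\<in>marked_maps n t \<alpha>. \<Prod>e\<in>arcs (fst (fst t)).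
     B (snd (fst t) e) (\<phi> (head (fst (fst t)) e)) (\<phi> (tail (fst (fst t)) e)))"

lemma disjoint_union_simps:
  "verts (disjoint_union_graph G H) = sum_encode ` (verts G <+> verts H)"
  "arcs (disjoint_union_graph G H) = sum_encode ` (arcs G <+> arcs H)"
  "tail (disjoint_union_graph G H) (sum_encode (Inl e)) = sum_encode (Inl (tail G e))"
  "tail (disjoint_union_graph G H) (sum_encode (Inr f)) = sum_encode (Inr (tail H f))"
  "head (disjoint_union_graph G H) (sum_encode (Inl e)) = sum_encode (Inl (head G e))"
  "head (disjoint_union_graph G H) (sum_encode (Inr f)) = sum_encode (Inr (head H f))"
  by (auto simp: disjoint_union_graph_def)

lemma fin_digraph_disjoint_union:
  assumes "fin_digraph G" "fin_digraph H"
  shows "fin_digraph (disjoint_union_graph G H)"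
proof -
  interpret G: fin_digraph G by fact
  interpret H: fin_digraph H by fact
  show ?thesis
    by unfold_locales (auto simp: disjoint_union_simps Plus_def)
qed

text \<open>As \<open>1 \<le> m\<close>, the first marked vertices are identified, and this alone
  joins the two connected pieces.\<close>

lemma is_test_graph_marked_glue:
  assumes t: "is_marked_graph m S t" "is_marked_graph m S' t'" and m: "1 \<le> m"
  shows "is_test_graph (marked_glue t t')"
proof -
  obtain G l v where tt: "t = ((G, l), v)" by (metis prod.exhaust)
  obtain G' l' v' where tt': "t' = ((G', l'), v')" by (metis prod.exhaust)
  have T: "is_test_graph (G, l)" "length v = m" "set v \<subseteq> verts G"
    and T': "is_test_graph (G', l')" "length v' = m" "set v' \<subseteq> verts G'"
    using t by (auto simp: tt tt' is_marked_graph_def)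
  have "v ! 0 \<in> set v" "v' ! 0 \<in> set v'" using T T' m by (intro nth_mem; simp)+
  then have v0: "v ! 0 \<in> verts G" "v' ! 0 \<in> verts G'" using T(3) T'(3) by blast+
  show ?thesis
    unfolding marked_glue_def tt tt' fst_conv snd_conv
  proof (rule is_test_graph_glue)
    show "fin_digraph (disjoint_union_graph G G')"
      using T(1) T'(1) by (intro fin_digraph_disjoint_union) (auto simp: is_test_graph_def)
    show "verts (disjoint_union_graph G G') \<noteq> {}" using v0 by (auto simp: disjoint_union_simps)
    fix S assume S: "\<forall>e\<in>arcs (disjoint_union_graph G G'). tail (disjoint_union_graph G G') e \<in> S \<longleftrightarrow> head (disjoint_union_graph G G') e \<in> S"
      and R: "\<And>x y. \<exists>i<length v. x = sum_encode (Inl (v ! i)) \<and> y = sum_encode (Inr (v' ! i)) \<Longrightarrow> x \<in> S \<longleftrightarrow> y \<in> S"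
    let ?L = "{x. sum_encode (Inl x) \<in> S}" and ?R = "{x. sum_encode (Inr x) \<in> S}"
    have "\<forall>e\<in>arcs G. tail G e \<in> ?L \<longleftrightarrow> head G e \<in> ?L"
    proof
      fix e assume "e \<in> arcs G"
      then have "sum_encode (Inl e) \<in> arcs (disjoint_union_graph G G')" by (auto simp: disjoint_union_simps)
      from S[rule_format, OF this] show "tail G e \<in> ?L \<longleftrightarrow> head G e \<in> ?L" by (simp add: disjoint_union_simps)
    qed
    then have L: "verts G \<subseteq> ?L \<or> verts G \<inter> ?L = {}"
      using T(1) unfolding is_test_graph_iff_cut fst_conv by (elim conjE allE[of _ ?L] impE)
    have "\<forall>e\<in>arcs G'. tail G' e \<in> ?R \<longleftrightarrow> head G' e \<in> ?R"
    proof
      fix e assume "e \<in> arcs G'"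
      then have "sum_encode (Inr e) \<in> arcs (disjoint_union_graph G G')" by (auto simp: disjoint_union_simps)
      from S[rule_format, OF this] show "tail G' e \<in> ?R \<longleftrightarrow> head G' e \<in> ?R" by (simp add: disjoint_union_simps)
    qed
    then have Rr: "verts G' \<subseteq> ?R \<or> verts G' \<inter> ?R = {}"
      using T'(1) unfolding is_test_graph_iff_cut fst_conv by (elim conjE allE[of _ ?R] impE)
    have "v ! 0 \<in> ?L \<longleftrightarrow> v' ! 0 \<in> ?R" 
    proof -
      have "\<exists>i<length v. sum_encode (Inl (v ! 0)) = sum_encode (Inl (v ! i)) \<and>
          sum_encode (Inr (v' ! 0)) = sum_encode (Inr (v' ! i))"
        using T(2) m by (intro exI[of _ 0]) auto
      from R[OF this] show ?thesis by simp
    qed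
    then show "verts (disjoint_union_graph G G') \<subseteq> S \<or> verts (disjoint_union_graph G G') \<inter> S = {}"
      using L Rr v0 unfolding disjoint_union_simps Plus_def by blast
  qed
qed

text \<open>Sort the maps of the glued graph by their values \<open>\<alpha>\<close> at the
  identified vertices; the rest splits into independent maps of the two graphs. So gluing is the
  contraction of two tensors, which is the source of positivity.\<close>

lemma vertex_sum_marked_glue:
  assumes t: "is_marked_graph m S t" "is_marked_graph m S' t'"
  shows "vertex_sum n B (marked_glue t t') = (\<Sum>\<alpha>\<in>{..<m} \<rightarrow>\<^sub>E {..<n}. marked_sum n B t \<alpha> * marked_sum n B t' \<alpha>)"
proof -
  obtain G l v where tt: "t = ((G, l), v)" by (metis prod.exhaust)
  obtain G' l' v' where tt': "t' = ((G', l'), v')" by (metis prod.exhaust)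
  have T: "is_test_graph (G, l)" "length v = m" "set v \<subseteq> verts G"
    and T': "is_test_graph (G', l')" "length v' = m" "set v' \<subseteq> verts G'"
    using t by (auto simp: tt tt' is_marked_graph_def)
  interpret G: fin_digraph G using T(1) by (simp add: is_test_graph_def)
  interpret G': fin_digraph G' using T'(1) by (simp add: is_test_graph_def)
  let ?D = "disjoint_union_graph G G'"
  interpret D: fin_digraph ?D by (rule fin_digraph_disjoint_union) unfold_locales
  let ?R = "\<lambda>x y. \<exists>i<length v. x = sum_encode (Inl (v ! i)) \<and> y = sum_encode (Inr (v' ! i))"
  let ?w = "\<lambda>\<phi>. \<Prod>e\<in>arcs G. B (l e) (\<phi> (head G e)) (\<phi> (tail G e))"
  let ?w' = "\<lambda>\<phi>. \<Prod>e\<in>arcs G'. B (l' e) (\<phi> (head G' e)) (\<phi> (tail G' e))"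
  let ?ll = "\<lambda>e. case_sum l l' (sum_decode e)"
  have vin: "i < m \<Longrightarrow> v ! i \<in> verts G" "i < m \<Longrightarrow> v' ! i \<in> verts G'" for i using T T' by auto
  have R_in: "x \<in> verts ?D \<and> y \<in> verts ?D" if "?R x y" for x y
    using that vin T(2) by (auto simp: disjoint_union_simps)
  have "vertex_sum n B (marked_glue t t') =
    (\<Sum>\<psi> | \<psi> \<in> verts ?D \<rightarrow>\<^sub>E {..<n} \<and> (\<forall>x y. ?R x y \<longrightarrow> \<psi> x = \<psi> y).
       \<Prod>e\<in>arcs ?D. B (?ll e) (\<psi> (head ?D e)) (\<psi> (tail ?D e)))"
    unfolding marked_glue_def tt tt' fst_conv snd_conv
    by (rule vertex_sum_glue[OF D.wf_digraph_axioms R_in])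
  also have "\<dots> = (\<Sum>\<psi> | \<psi> \<in> verts ?D \<rightarrow>\<^sub>E {..<n} \<and> (\<forall>x y. ?R x y \<longrightarrow> \<psi> x = \<psi> y).
       ?w (\<lambda>x. \<psi> (sum_encode (Inl x))) * ?w' (\<lambda>x. \<psi> (sum_encode (Inr x))))"
  proof (rule sum.cong[OF refl])
    fix \<psi> :: "nat \<Rightarrow> nat"
    have "(\<Prod>e\<in>arcs ?D. B (?ll e) (\<psi> (head ?D e)) (\<psi> (tail ?D e))) =
        (\<Prod>e\<in>arcs G <+> arcs G'. B (?ll (sum_encode e)) (\<psi> (head ?D (sum_encode e))) (\<psi> (tail ?D (sum_encode e))))"
      unfolding disjoint_union_simps(2) by (subst prod.reindex) (auto simp: inj_sum_encode intro!: prod.cong)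
    then show "(\<Prod>e\<in>arcs ?D. B (?ll e) (\<psi> (head ?D e)) (\<psi> (tail ?D e))) =
        ?w (\<lambda>x. \<psi> (sum_encode (Inl x))) * ?w' (\<lambda>x. \<psi> (sum_encode (Inr x)))"
      by (simp add: prod.Plus disjoint_union_simps)
  qed
  also have "{\<psi>. \<psi> \<in> verts ?D \<rightarrow>\<^sub>E {..<n} \<and> (\<forall>x y. ?R x y \<longrightarrow> \<psi> x = \<psi> y)} =
      {\<psi> \<in> verts ?D \<rightarrow>\<^sub>E {..<n}. \<forall>i<m. \<psi> (sum_encode (Inl (v ! i))) = \<psi> (sum_encode (Inr (v' ! i)))}"
    (is "_ = ?Psi") using T(2) by blast
  also have "(\<Sum>\<psi>\<in>?Psi. ?w (\<lambda>x. \<psi> (sum_encode (Inl x))) * ?w' (\<lambda>x. \<psi> (sum_encode (Inr x)))) =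
      (\<Sum>(\<alpha>, \<phi>, \<phi>')\<in>Sigma ({..<m} \<rightarrow>\<^sub>E {..<n}) (\<lambda>\<alpha>. marked_maps n t \<alpha> \<times> marked_maps n t' \<alpha>). ?w \<phi> * ?w' \<phi>')"
  proof -
    let ?j = "\<lambda>\<psi>. (restrict (\<lambda>i. \<psi> (sum_encode (Inl (v ! i)))) {..<m},
        restrict (\<lambda>x. \<psi> (sum_encode (Inl x))) (verts G), restrict (\<lambda>x. \<psi> (sum_encode (Inr x))) (verts G'))"
    let ?i = "\<lambda>(\<alpha>, \<phi>, \<phi>'). restrict (\<lambda>x. case_sum \<phi> \<phi>' (sum_decode x)) (verts ?D)"
    have DL: "sum_encode (Inl x) \<in> verts ?D \<longleftrightarrow> x \<in> verts G" for x
      by (auto simp: disjoint_union_simps sum_encode_eq)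
    have DR: "sum_encode (Inr x) \<in> verts ?D \<longleftrightarrow> x \<in> verts G'" for x
      by (auto simp: disjoint_union_simps sum_encode_eq)
    have D_cases: "(\<exists>x\<in>verts G. y = sum_encode (Inl x)) \<or> (\<exists>x\<in>verts G'. y = sum_encode (Inr x))"
      if "y \<in> verts ?D" for y using that by (auto simp: disjoint_union_simps)
    have mm: "marked_maps n t \<alpha> = {\<phi> \<in> verts G \<rightarrow>\<^sub>E {..<n}. \<forall>i<m. \<phi> (v ! i) = \<alpha> i}"
      "marked_maps n t' \<alpha> = {\<phi> \<in> verts G' \<rightarrow>\<^sub>E {..<n}. \<forall>i<m. \<phi> (v' ! i) = \<alpha> i}" for \<alpha>
      using T(2) T'(2) by (simp_all add: marked_maps_def tt tt')
    show ?thesis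
    proof (rule sum.reindex_bij_witness[where i = ?i and j = ?j], goal_cases)
      case (1 \<psi>)
      show ?case
      proof
        fix x
        show "?i (?j \<psi>) x = \<psi> x"
        proof (cases "x \<in> verts ?D")
          case True
          from D_cases[OF True] show ?thesis using True by auto
        next
          case False
          then show ?thesis using 1 by (auto simp: PiE_def extensional_def)
        qed
      qed
    next
      case (2 \<psi>)
      have "\<psi> (sum_encode (Inl x)) \<in> {..<n}" if "x \<in> verts G" for x using 2 DL that by (auto simp: PiE_def Pi_def)
      moreover have "\<psi> (sum_encode (Inr x)) \<in> {..<n}" if "x \<in> verts G'" for x using 2 DR that by (auto simp: PiE_def Pi_def)
      ultimately show ?case using 2 vin by (auto simp: mm)
    next
      case (3 x)
      obtain \<alpha> \<phi> \<phi>' where x: "x = (\<alpha>, \<phi>, \<phi>')" by (metis prod.exhaust)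
      have e: "\<alpha> \<in> extensional {..<m}" "\<phi> \<in> extensional (verts G)" "\<phi>' \<in> extensional (verts G')"
        and \<alpha>: "\<And>i. i < m \<Longrightarrow> \<phi> (v ! i) = \<alpha> i"
        using 3 unfolding x by (auto simp: mm PiE_def)
      have "fst (?j (?i x)) = \<alpha>" using e(1) \<alpha> vin unfolding x by (auto simp: DL extensional_def fun_eq_iff)
      moreover have "fst (snd (?j (?i x))) = \<phi>" using e(2) unfolding x by (auto simp: DL extensional_def fun_eq_iff)
      moreover have "snd (snd (?j (?i x))) = \<phi>'" using e(3) unfolding x by (auto simp: DR extensional_def fun_eq_iff)
      ultimately show ?case unfolding x by (simp add: prod_eq_iff)
    next
      case (4 x)
      obtain \<alpha> \<phi> \<phi>' where x: "x = (\<alpha>, \<phi>, \<phi>')" by (metis prod.exhaust)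
      have p: "\<phi> \<in> verts G \<rightarrow>\<^sub>E {..<n}" "\<phi>' \<in> verts G' \<rightarrow>\<^sub>E {..<n}"
        "\<And>i. i < m \<Longrightarrow> \<phi> (v ! i) = \<phi>' (v' ! i)" using 4 unfolding x by (auto simp: mm)
      have vL: "?i x (sum_encode (Inl y)) = \<phi> y" if "y \<in> verts G" for y using that unfolding x by (simp add: DL)
      have vR: "?i x (sum_encode (Inr y)) = \<phi>' y" if "y \<in> verts G'" for y using that unfolding x by (simp add: DR)
      have "?i x \<in> verts ?D \<rightarrow>\<^sub>E {..<n}"
      proof (rule PiE_I)
        fix y assume "y \<in> verts ?D"
        then consider z where "z \<in> verts G" "y = sum_encode (Inl z)"
          | z where "z \<in> verts G'" "y = sum_encode (Inr z)" using D_cases by blast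
        then show "?i x y \<in> {..<n}"
        proof cases
          case (1 z)
          then show ?thesis unfolding 1(2) vL[OF 1(1)] using p(1) by auto
        next
          case (2 z)
          then show ?thesis unfolding 2(2) vR[OF 2(1)] using p(2) by auto
        qed
      qed (auto simp: x)
      then show ?case using vL vR vin p(3) by simp
    next
      case (5 \<psi>)
      then show ?case by simp
    qed
  qed
  also have "\<dots> = (\<Sum>\<alpha>\<in>{..<m} \<rightarrow>\<^sub>E {..<n}. \<Sum>(\<phi>, \<phi>')\<in>marked_maps n t \<alpha> \<times> marked_maps n t' \<alpha>. ?w \<phi> * ?w' \<phi>')"
  proof -
    have "finite (marked_maps n t \<alpha>)" "finite (marked_maps n t' \<alpha>)" for \<alpha>
      by (rule finite_subset[OF _ finite_PiE[of "verts G" "\<lambda>_. {..<n}"]], auto simp: marked_maps_def tt)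
        (rule finite_subset[OF _ finite_PiE[of "verts G'" "\<lambda>_. {..<n}"]], auto simp: marked_maps_def tt')
    then show ?thesis by (subst sum.Sigma) (auto intro!: finite_PiE)
  qed
  also have "\<dots> = (\<Sum>\<alpha>\<in>{..<m} \<rightarrow>\<^sub>E {..<n}. marked_sum n B t \<alpha> * marked_sum n B t' \<alpha>)"
    unfolding marked_sum_def sum_product sum.cartesian_product by (simp add: tt tt')
  finally show ?thesis .
qed

lemma marked_sum_star:
  assumes "\<And>s i j. s \<in> S \<Longrightarrow> B (st s) i j = cnj (B s j i)" and "is_marked_graph m S t"
  shows "marked_sum n B (marked_star st t) \<alpha> = cnj (marked_sum n B t \<alpha>)"
proof -
  have "snd (fst t) e \<in> S" if "e \<in> arcs (fst (fst t))" for e using assms(2) that by (auto simp: is_marked_graph_def)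
  then show ?thesis
    unfolding marked_sum_def marked_maps_def marked_star_def reverse_graph_def
    by (simp add: assms(1))
qed

lemma is_marked_graph_star:
  assumes "is_marked_graph m S t" "\<And>s. s \<in> S \<Longrightarrow> st s \<in> S"
  shows "is_marked_graph m S (marked_star st t)"
proof -
  interpret fin_digraph "fst (fst t)" using assms(1) by (simp add: is_marked_graph_def is_test_graph_def)
  have "fin_digraph (reverse_graph (fst (fst t)))"
    by unfold_locales (auto simp: reverse_graph_def)
  then have "is_test_graph (fst (marked_star st t))"
    using assms(1) by (simp add: is_marked_graph_def is_test_graph_iff_cut marked_star_def reverse_graph_def eq_commute)
  then show ?thesis using assms by (auto simp: is_marked_graph_def marked_star_def reverse_graph_def)
qed


section \<open>Traffic spaces of random matrices\<close>

text \<open>A sequence of random matrices \<open>F n \<omega> i j\<close>, whose randomness \<open>\<omega>\<close> is a set of natural numbers, is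
  encoded as an element of the type \<open>traffic_elem\<close>: the arguments are stored in a graph operation.\<close>

type_synonym matrix_seq = "nat \<Rightarrow> nat set \<Rightarrow> nat \<Rightarrow> nat \<Rightarrow> complex"

definition mk_elem :: "matrix_seq \<Rightarrow> graph_op \<times> 'l list \<Rightarrow> complex" where
  "mk_elem F = (\<lambda>(g, _). F (op_in g) (verts (op_graph g)) (tail (op_graph g) 0) (head (op_graph g) 0))"

definition entry :: "(graph_op \<times> 'l list \<Rightarrow> complex) \<Rightarrow> matrix_seq" where
  "entry x n \<omega> i j = x (\<lparr> op_graph = \<lparr> verts = \<omega>, arcs = {}, tail = (\<lambda>_. i), head = (\<lambda>_. j) \<rparr>,
     op_in = n, op_out = 0 \<rparr>, [])"

lemma entry_mk_elem [simp]: "entry (mk_elem F) = F"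
  by (simp add: entry_def mk_elem_def fun_eq_iff)

inductive_set lin_span :: "matrix_seq set \<Rightarrow> matrix_seq set" for B where
  base: "F \<in> B \<Longrightarrow> F \<in> lin_span B"
| add: "F \<in> lin_span B \<Longrightarrow> F' \<in> lin_span B \<Longrightarrow> (\<lambda>n \<omega> i j. F n \<omega> i j + F' n \<omega> i j) \<in> lin_span B"
| smult: "F \<in> lin_span B \<Longrightarrow> (\<lambda>n \<omega> i j. t * F n \<omega> i j) \<in> lin_span B"

text \<open>The labels are moved from \<open>B\<close> to its span one edge at a time, each by
  induction over the span with all other labels fixed. It reduces multilinear statements about
  graphs to generating labels.\<close>

lemma multilinear_induct:
  assumes "finite E"
    and base: "\<And>l. (\<And>e. e \<in> E \<Longrightarrow> l e \<in> B) \<Longrightarrow> P l"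
    and add: "\<And>l e x y. e \<in> E \<Longrightarrow> P (l(e := x)) \<Longrightarrow> P (l(e := y)) \<Longrightarrow>
      P (l(e := (\<lambda>n \<omega> i j. x n \<omega> i j + y n \<omega> i j)))"
    and smult: "\<And>l e x t. e \<in> E \<Longrightarrow> P (l(e := x)) \<Longrightarrow> P (l(e := (\<lambda>n \<omega> i j. t * x n \<omega> i j)))"
    and l: "\<And>e. e \<in> E \<Longrightarrow> l e \<in> lin_span B"
  shows "P l"
proof -
  have "\<forall>l. (\<forall>e\<in>F. l e \<in> lin_span B) \<longrightarrow> (\<forall>e\<in>E - F. l e \<in> B) \<longrightarrow> P l" if "F \<subseteq> E" for F
    using finite_subset[OF that \<open>finite E\<close>] that
  proof (induction F rule: finite_induct)
    case empty
    then show ?case using base by blast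
  next
    case (insert e F)
    show ?case
    proof (intro allI impI)
      fix l assume l: "\<forall>e\<in>insert e F. l e \<in> lin_span B" "\<forall>e\<in>E - insert e F. l e \<in> B"
      have "P (l(e := x))" if "x \<in> lin_span B" for x
        using that
      proof induction
        case (base x)
        have "\<forall>e'\<in>F. (l(e := x)) e' \<in> lin_span B" using l(1) insert.hyps by auto
        moreover have "\<forall>e'\<in>E - F. (l(e := x)) e' \<in> B" using l(2) base by auto
        ultimately show ?case using insert by blast
      next
        case (add F F')
        have "e \<in> E" using insert.prems by simp
        then show ?case using add.IH by (rule assms(3))
      next
        case (smult F t)
        have "e \<in> E" using insert.prems by simp
        then show ?case using smult.IH by (rule assms(4))
      qed
      from this[of "l e"] show "P l" using l(1) by simp
    qed
  qed
  from this[OF subset_refl] show ?thesis using l by blast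
qed

lemma vertex_sum_upd:
  assumes "finite (arcs G)" "e \<in> arcs G"
  shows "vertex_sum n (\<lambda>F. F n \<omega>) (G, l(e := z)) = (\<Sum>\<phi>\<in>verts G \<rightarrow>\<^sub>E {..<n}.
     z n \<omega> (\<phi> (head G e)) (\<phi> (tail G e)) * (\<Prod>e'\<in>arcs G - {e}. l e' n \<omega> (\<phi> (head G e')) (\<phi> (tail G e'))))"
  unfolding vertex_sum_def fst_conv snd_conv
  by (intro sum.cong refl, subst prod.remove[OF assms]) auto

lemma mat_mul_eq: "mat_mul n a b = (\<lambda>i j. \<Sum>k<n. a i k * b k j)"
  by (intro ext) (rule mat_mul_def)

lemma mat_mul_id_right: "(\<And>i j. \<not> (i < n \<and> j < n) \<Longrightarrow> a i j = 0) \<Longrightarrow> mat_mul n a (mat_id n) = a"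
  by (intro ext) (auto simp: mat_mul_def mat_id_def if_distrib cong: if_cong)

lemma mat_mul_id_left:
  assumes "\<And>i j. \<not> (i < n \<and> j < n) \<Longrightarrow> a i j = 0"
  shows "mat_mul n (mat_id n) a = a"
proof (intro ext)
  fix i j
  have "mat_mul n (mat_id n) a i j = (\<Sum>k<n. if k = i then a k j else 0)"
    unfolding mat_mul_def mat_id_def by (intro sum.cong) auto
  then show "mat_mul n (mat_id n) a i j = a i j" using assms by (cases "i < n") auto
qed

lemma op_action_upd_fun:
  assumes "k < K"
  shows "op_action n g K (a(k := (\<lambda>i j. x i j + y i j))) =
      (\<lambda>i j. op_action n g K (a(k := x)) i j + op_action n g K (a(k := y)) i j)"
    and "op_action n g K (a(k := (\<lambda>i j. t * x i j))) = (\<lambda>i j. t * op_action n g K (a(k := x)) i j)"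
  by (intro ext op_action_upd_add op_action_upd_smult assms)+

lemma mat_mul_assoc: "mat_mul n (mat_mul n a b) c = mat_mul n a (mat_mul n b c)"
proof (intro ext)
  fix i j
  have "mat_mul n (mat_mul n a b) c i j = (\<Sum>k<n. \<Sum>l<n. a i l * b l k * c k j)"
    by (simp add: mat_mul_def sum_distrib_right)
  also have "\<dots> = (\<Sum>l<n. \<Sum>k<n. a i l * b l k * c k j)" by (rule sum.swap)
  finally show "mat_mul n (mat_mul n a b) c i j = mat_mul n a (mat_mul n b c) i j"
    by (simp add: mat_mul_def sum_distrib_left mult.assoc)
qed

lemma nonneg_Reals_limit:
  fixes f :: "nat \<Rightarrow> complex"
  assumes "f \<longlonglongrightarrow> L" "\<And>n. f n \<in> \<real>\<^sub>\<ge>\<^sub>0"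
  shows "L \<in> \<real>\<^sub>\<ge>\<^sub>0"
proof -
  have "0 \<le> Re L" using assms(2)
    by (intro LIMSEQ_le_const[OF tendsto_Re[OF assms(1)]]) (auto simp: complex_nonneg_Reals_iff)
  moreover have "Im L = 0" using assms(2) tendsto_Im[OF assms(1)]
    by (auto simp: complex_nonneg_Reals_iff LIMSEQ_const_iff)
  ultimately show ?thesis by (simp add: complex_nonneg_Reals_iff)
qed

lemma nonneg_Reals_sum_cnj: "finite I \<Longrightarrow> (\<Sum>\<alpha>\<in>I. cnj (w \<alpha>) * w \<alpha>) \<in> \<real>\<^sub>\<ge>\<^sub>0"
  by (induction I rule: finite_induct) (auto simp: complex_nonneg_Reals_iff add_nonneg_nonneg)

text \<open>Finite support makes every function integrable, so convergence of traces is the only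
  analytic assumption, and only for the generators. Self-adjoint generators make adjoints of graph
  operations into graph operations in the same generators.\<close>

locale matrix_traffic_model =
  fixes R :: "nat \<Rightarrow> nat set pmf" and gen :: "'i \<Rightarrow> matrix_seq"
  assumes finite_support: "finite (set_pmf (R n))"
    and gen_outside: "\<not> (a < n \<and> b < n) \<Longrightarrow> gen i n \<omega> a b = 0"
    and gen_selfadjoint: "cnj (gen i n \<omega> b a) = gen i n \<omega> a b"
    and gen_converges: "is_test_graph T \<Longrightarrow>
      convergent (\<lambda>n. LINT \<omega>|measure_pmf (R n). 1 / of_nat n * vertex_sum n (\<lambda>i. gen i n \<omega>) T)"
begin

abbreviation Ex :: "nat \<Rightarrow> (nat set \<Rightarrow> complex) \<Rightarrow> complex" where
  "Ex n f \<equiv> LINT \<omega>|measure_pmf (R n). f \<omega>"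

lemma integrable_R [simp]: "integrable (measure_pmf (R n)) f" for f :: "nat set \<Rightarrow> complex"
  by (rule integrable_measure_pmf_finite[OF finite_support])

lemma Ex_nonneg:
  assumes "\<And>\<omega>. f \<omega> \<in> \<real>\<^sub>\<ge>\<^sub>0"
  shows "Ex n f \<in> \<real>\<^sub>\<ge>\<^sub>0"
proof -
  have f: "f \<omega> = of_real (Re (f \<omega>))" "0 \<le> Re (f \<omega>)" for \<omega>
    using assms[of \<omega>] by (auto simp: complex_nonneg_Reals_iff complex_eq_iff)
  have "Ex n f = (LINT \<omega>|measure_pmf (R n). of_real (Re (f \<omega>)))" using f(1) by (intro Bochner_Integration.integral_cong refl)
  also have "\<dots> = of_real (LINT \<omega>|measure_pmf (R n). Re (f \<omega>))" by (rule integral_complex_of_real)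
  finally have eq: "Ex n f = of_real (LINT \<omega>|measure_pmf (R n). Re (f \<omega>))" .
  show ?thesis unfolding eq nonneg_Reals_of_real_iff
    by (rule Bochner_Integration.integral_nonneg) (rule f(2))
qed

definition op_seq :: "graph_op \<Rightarrow> 'i list \<Rightarrow> matrix_seq" where
  "op_seq g is = (\<lambda>n \<omega>. op_action n g (length is) (\<lambda>k. gen (is ! k) n \<omega>))"

definition op_seqs :: "matrix_seq set" where
  "op_seqs = {op_seq g is | g is. is_graph_op (length is) g}"

definition A :: "matrix_seq set" where "A = lin_span op_seqs"

lemma op_seq_in: "is_graph_op (length is) g \<Longrightarrow> op_seq g is \<in> A"
  unfolding A_def by (rule lin_span.base) (auto simp: op_seqs_def)

lemma A_add: "F \<in> A \<Longrightarrow> F' \<in> A \<Longrightarrow> (\<lambda>n \<omega> i j. F n \<omega> i j + F' n \<omega> i j) \<in> A"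
  and A_smult: "F \<in> A \<Longrightarrow> (\<lambda>n \<omega> i j. t * F n \<omega> i j) \<in> A"
  unfolding A_def by (rule lin_span.add) (auto intro: lin_span.smult)

lemma A_outside: "F \<in> A \<Longrightarrow> \<not> (i < n \<and> j < n) \<Longrightarrow> F n \<omega> i j = 0"
  unfolding A_def
  by (induction rule: lin_span.induct) (auto simp: op_seqs_def op_seq_def op_action_outside)

text \<open>Substitution merges an operation applied to operations into a single one, so
  \<open>op_seqs\<close> is closed under graph operations.\<close>

lemma op_seqs_op_action:
  assumes g: "is_graph_op K g" and a: "\<And>k. k < K \<Longrightarrow> a k \<in> op_seqs"
  shows "\<exists>h js. is_graph_op (length js) h \<and> (\<lambda>n \<omega>. op_action n g K (\<lambda>k. a k n \<omega>)) = op_seq h js"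
proof -
  have "\<exists>h js. a k = op_seq h js \<and> is_graph_op (length js) h" if "k < K" for k
    using a[OF that] by (auto simp: op_seqs_def)
  then obtain h js where hj: "\<And>k. k < K \<Longrightarrow> a k = op_seq (h k) (js k) \<and> is_graph_op (length (js k)) (h k)"
    by metis
  let ?gs = "map h [0..<K]" and ?ass = "map js [0..<K]"
  interpret S: op_substitution g ?gs ?ass using g hj by unfold_locales auto
  have "op_action n g K (\<lambda>k. a k n \<omega>) = op_seq (op_subst g ?gs) (concat ?ass) n \<omega>" for n \<omega>
    unfolding op_seq_def S.op_action_subst[of n "\<lambda>i. gen i n \<omega>"] using hj
    by (simp, intro op_action_cong) (simp add: op_seq_def)
  then have "(\<lambda>n \<omega>. op_action n g K (\<lambda>k. a k n \<omega>)) = op_seq (op_subst g ?gs) (concat ?ass)"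
    by (intro ext) simp
  then show ?thesis using S.is_graph_op_subst by (intro exI conjI)
qed

lemma A_op_action:
  assumes g: "is_graph_op K g" and a: "\<And>k. k < K \<Longrightarrow> a k \<in> A"
  shows "(\<lambda>n \<omega>. op_action n g K (\<lambda>k. a k n \<omega>)) \<in> A"
proof (rule multilinear_induct[where E = "{..<K}" and B = op_seqs and l = a
      and P = "\<lambda>a. (\<lambda>n \<omega>. op_action n g K (\<lambda>k. a k n \<omega>)) \<in> A"])
  fix l :: "nat \<Rightarrow> matrix_seq" assume "\<And>k. k \<in> {..<K} \<Longrightarrow> l k \<in> op_seqs"
  then obtain h js where "is_graph_op (length js) h" "(\<lambda>n \<omega>. op_action n g K (\<lambda>k. l k n \<omega>)) = op_seq h js"
    using op_seqs_op_action[OF g, of l] by (auto simp del: fun_eq_iff)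
  then show "(\<lambda>n \<omega>. op_action n g K (\<lambda>k. l k n \<omega>)) \<in> A" using op_seq_in by simp
next
  fix l :: "nat \<Rightarrow> matrix_seq" and k x y assume k: "k \<in> {..<K}"
  have upd: "(\<lambda>k'. (l(k := z)) k' n \<omega>) = (\<lambda>k'. l k' n \<omega>)(k := z n \<omega>)" for z n \<omega> by auto
  assume x: "(\<lambda>n \<omega>. op_action n g K (\<lambda>k'. (l(k := x)) k' n \<omega>)) \<in> A"
    and y: "(\<lambda>n \<omega>. op_action n g K (\<lambda>k'. (l(k := y)) k' n \<omega>)) \<in> A"
  show "(\<lambda>n \<omega>. op_action n g K (\<lambda>k'. (l(k := (\<lambda>n \<omega> i j. x n \<omega> i j + y n \<omega> i j))) k' n \<omega>)) \<in> A"
    using A_add[OF x y] k unfolding upd by (simp add: op_action_upd_fun)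
next
  fix l :: "nat \<Rightarrow> matrix_seq" and k x t assume k: "k \<in> {..<K}"
  have upd: "(\<lambda>k'. (l(k := z)) k' n \<omega>) = (\<lambda>k'. l k' n \<omega>)(k := z n \<omega>)" for z n \<omega> by auto
  assume x: "(\<lambda>n \<omega>. op_action n g K (\<lambda>k'. (l(k := x)) k' n \<omega>)) \<in> A"
  show "(\<lambda>n \<omega>. op_action n g K (\<lambda>k'. (l(k := (\<lambda>n \<omega> i j. t * x n \<omega> i j))) k' n \<omega>)) \<in> A"
    using A_smult[OF x, of t] k unfolding upd by (simp add: op_action_upd_fun)
qed (use a in \<open>auto simp: A_def\<close>)

definition mean :: "matrix_seq test_graph \<Rightarrow> nat \<Rightarrow> complex" where
  "mean T n = Ex n (\<lambda>\<omega>. 1 / of_nat n * vertex_sum n (\<lambda>F. F n \<omega>) T)"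

text \<open>By multilinearity the labels may be taken from \<open>op_seqs\<close>. The graph is then
  the trace of a graph operation in such labels, substitution makes it one operation in the
  generators, and its closure is a test graph covered by \<open>gen_converges\<close>.\<close>

lemma mean_converges:
  assumes T: "is_test_graph (G, l)" and l: "\<And>e. e \<in> arcs G \<Longrightarrow> l e \<in> A"
  shows "convergent (mean (G, l))"
proof -
  interpret fin_digraph G using T by (simp add: is_test_graph_def)
  show ?thesis
  proof (rule multilinear_induct[where E = "arcs G" and B = op_seqs and l = l
        and P = "\<lambda>l. convergent (mean (G, l))"])
    fix l :: "nat \<Rightarrow> matrix_seq" assume l: "\<And>e. e \<in> arcs G \<Longrightarrow> l e \<in> op_seqs"
    define K where "K = card (arcs G)"
    obtain f where f: "bij_betw f {..<K} (arcs G)"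
      using ex_bij_betw_nat_finite[OF finite_arcs] by (auto simp: K_def atLeast0LessThan)
    obtain v0 where v0: "v0 \<in> verts G" using T by (auto simp: is_test_graph_iff_cut)
    \<comment> \<open>With input and output at the same vertex, the trace of the action runs over
      all maps of the graph. The bijection \<open>f\<close> numbers the arcs, as a graph operation
      requires.\<close>
    define g where "g = \<lparr> op_graph = \<lparr> verts = verts G, arcs = {..<K}, tail = tail G \<circ> f, head = head G \<circ> f \<rparr>,
      op_in = v0, op_out = v0 \<rparr>"
    have fin: "f k \<in> arcs G" if "k < K" for k using f that by (auto simp: bij_betw_def)
    have "fin_digraph (op_graph g)" by unfold_locales (auto simp: g_def fin)
    moreover have "(\<forall>k\<in>{..<K}. tail G (f k) \<in> S \<longleftrightarrow> head G (f k) \<in> S) \<longleftrightarrow> (\<forall>e\<in>arcs G. tail G e \<in> S \<longleftrightarrow> head G e \<in> S)" for S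
      using bij_betw_ball[OF f, of "\<lambda>e. tail G e \<in> S \<longleftrightarrow> head G e \<in> S"] by simp
    ultimately have "is_test_graph (op_graph g, l)"
      using T unfolding is_test_graph_iff_cut by (simp add: g_def)
    then have g: "is_graph_op K g" using v0 by (simp add: is_graph_op_def is_test_graph_def g_def)
    obtain h js where h: "is_graph_op (length js) h"
      and eq: "(\<lambda>n \<omega>. op_action n g K (\<lambda>k. l (f k) n \<omega>)) = op_seq h js"
      using op_seqs_op_action[OF g, of "\<lambda>k. l (f k)"] l fin by blast
    have "vertex_sum n (\<lambda>F. F n \<omega>) (G, l) = vertex_sum n (\<lambda>i. gen i n \<omega>) (op_closure h js)" for n \<omega>
    proof -
      have "vertex_sum n (\<lambda>F. F n \<omega>) (G, l) = (\<Sum>i<n. op_action n g K (\<lambda>k. l (f k) n \<omega>) i i)"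
        unfolding trace_op_action[OF g] vertex_sum_def
        by (intro sum.cong) (auto simp: g_def prod.reindex_bij_betw[OF f, symmetric])
      also have "\<dots> = (\<Sum>i<n. op_seq h js n \<omega> i i)" using fun_cong[OF fun_cong[OF eq, of n], of \<omega>] by simp
      also have "\<dots> = vertex_sum n (\<lambda>i. gen i n \<omega>) (op_closure h js)"
        unfolding op_seq_def by (rule trace_op_closure[OF h])
      finally show ?thesis .
    qed
    then have "mean (G, l) = (\<lambda>n. Ex n (\<lambda>\<omega>. 1 / of_nat n * vertex_sum n (\<lambda>i. gen i n \<omega>) (op_closure h js)))"
      by (simp add: mean_def fun_eq_iff)
    then show "convergent (mean (G, l))"
      using gen_converges[OF is_test_graph_op_closure[OF h]] by simp
  next
    fix l :: "nat \<Rightarrow> matrix_seq" and e x y assume e: "e \<in> arcs G"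
    assume x: "convergent (mean (G, l(e := x)))" and y: "convergent (mean (G, l(e := y)))"
    have "mean (G, l(e := (\<lambda>n \<omega> i j. x n \<omega> i j + y n \<omega> i j))) =
        (\<lambda>n. mean (G, l(e := x)) n + mean (G, l(e := y)) n)"
      unfolding mean_def vertex_sum_upd[OF finite_arcs e]
      by (simp only: Bochner_Integration.integral_add[OF integrable_R integrable_R, symmetric] distrib_right
          sum.distrib distrib_left)
    then show "convergent (mean (G, l(e := (\<lambda>n \<omega> i j. x n \<omega> i j + y n \<omega> i j))))"
      using convergent_add[OF x y] by simp
  next
    fix l :: "nat \<Rightarrow> matrix_seq" and e x t assume e: "e \<in> arcs G"
    assume x: "convergent (mean (G, l(e := x)))"
    have "mean (G, l(e := (\<lambda>n \<omega> i j. t * x n \<omega> i j))) = (\<lambda>n. t * mean (G, l(e := x)) n)"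
      unfolding mean_def vertex_sum_upd[OF finite_arcs e]
      by (simp only: mult.assoc sum_distrib_left[symmetric] mult.left_commute[of _ t]
          Bochner_Integration.integral_mult_right_zero)
    then show "convergent (mean (G, l(e := (\<lambda>n \<omega> i j. t * x n \<omega> i j))))"
      using convergent_mult[OF convergent_const x, of t] by simp
  qed (use l in \<open>auto simp: A_def\<close>)
qed

lemma gen_in: "gen i \<in> A"
proof -
  have "op_seq (op_path 1) [i] = gen i"
  proof (intro ext)
    fix n \<omega> a b
    have "op_action n (op_path (length [gen i n \<omega>])) (length [gen i n \<omega>]) ((!) [gen i n \<omega>]) =
        foldr (mat_mul n) (rev [gen i n \<omega>]) (mat_id n)"
    proof (rule op_action_path)
      fix a :: "nat \<Rightarrow> nat \<Rightarrow> complex" and j k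
      assume "a \<in> set [gen i n \<omega>]" "\<not> (j < n \<and> k < n)"
      then show "a j k = 0" using gen_outside[of j n k i \<omega>] by simp
    qed
    also have "\<dots> = gen i n \<omega>" by (simp add: mat_mul_id_right[OF gen_outside])
    also have "op_action n (op_path (length [gen i n \<omega>])) (length [gen i n \<omega>]) ((!) [gen i n \<omega>]) =
        op_seq (op_path 1) [i] n \<omega>"
      unfolding op_seq_def by (simp, rule op_action_cong) simp
    finally show "op_seq (op_path 1) [i] n \<omega> a b = gen i n \<omega> a b" by simp
  qed
  then show ?thesis using op_seq_in[of "[i]" "op_path 1"] is_graph_op_path[of 1] by simp
qed

lemma A_path:
  assumes "set as \<subseteq> A"
  shows "op_action n (op_path (length as)) (length as) (\<lambda>k. (as ! k) n \<omega>) =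
    foldr (mat_mul n) (rev (map (\<lambda>F. F n \<omega>) as)) (mat_id n)"
proof -
  have "op_action n (op_path (length as)) (length as) (\<lambda>k. (as ! k) n \<omega>) =
      op_action n (op_path (length as)) (length as) ((!) (map (\<lambda>F. F n \<omega>) as))"
    by (rule op_action_cong) simp
  also have "\<dots> = foldr (mat_mul n) (rev (map (\<lambda>F. F n \<omega>) as)) (mat_id n)"
  proof -
    have "op_action n (op_path (length as')) (length as') ((!) as') = foldr (mat_mul n) (rev as') (mat_id n)"
      if "as' = map (\<lambda>F. F n \<omega>) as" for as'
    proof (rule op_action_path)
      fix a :: "nat \<Rightarrow> nat \<Rightarrow> complex" and i j assume "a \<in> set as'" "\<not> (i < n \<and> j < n)"
      then show "a i j = 0" using that assms A_outside by auto
    qed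
    from this[OF refl] show ?thesis by simp
  qed
  finally show ?thesis .
qed

lemma id_in: "(\<lambda>n \<omega>. mat_id n) \<in> A"
  using A_op_action[OF is_graph_op_path[of 0], of "\<lambda>k. [] ! k"] A_path[of "[]"] by simp

lemma mul_in:
  assumes "F \<in> A" "F' \<in> A"
  shows "(\<lambda>n \<omega>. mat_mul n (F n \<omega>) (F' n \<omega>)) \<in> A"
proof -
  have "(\<lambda>n \<omega>. op_action n (op_path 2) 2 (\<lambda>k. ([F', F] ! k) n \<omega>)) \<in> A"
    using assms by (intro A_op_action is_graph_op_path) (auto simp: less_2_cases_iff)
  moreover have "op_action n (op_path 2) 2 (\<lambda>k. ([F', F] ! k) n \<omega>) = mat_mul n (F n \<omega>) (F' n \<omega>)" for n \<omega>
    using A_path[of "[F', F]" n \<omega>] assms A_outside by (simp add: mat_mul_id_right numeral_2_eq_2)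
  ultimately show ?thesis by simp
qed

lemma zero_in: "(\<lambda>n \<omega> i j. 0) \<in> A"
  using A_smult[OF id_in, of 0] by simp

lemma star_in: "F \<in> A \<Longrightarrow> (\<lambda>n \<omega> i j. cnj (F n \<omega> j i)) \<in> A"
  unfolding A_def
proof (induction rule: lin_span.induct)
  case (base F)
  then obtain g js where F: "F = op_seq g js" "is_graph_op (length js) g" by (auto simp: op_seqs_def)
  have "cnj (F n \<omega> j i) = op_seq (op_reverse g) js n \<omega> i j" for n \<omega> i j
    unfolding F(1) op_seq_def cnj_op_action[OF F(2)] by (simp add: gen_selfadjoint)
  then show ?case using op_seq_in[OF is_graph_op_reverse[OF F(2)]] by (simp add: A_def)
qed (auto intro: lin_span.add lin_span.smult)

text \<open>Elements are whole sequences over all sizes, without identifying sequences that agree in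
  the limit. Thus the algebraic laws and the laws of graph operations hold at each size separately,
  and limits only appear in the state and the traffic state.\<close>

definition model :: "(graph_op \<times> 'l list \<Rightarrow> complex) traffic_space" where
  "model = \<lparr> carrier = mk_elem ` A,
     mult = (\<lambda>x y. mk_elem (\<lambda>n \<omega>. mat_mul n (entry x n \<omega>) (entry y n \<omega>))),
     one = mk_elem (\<lambda>n \<omega>. mat_id n),
     zero = mk_elem (\<lambda>n \<omega> i j. 0),
     add = (\<lambda>x y. mk_elem (\<lambda>n \<omega> i j. entry x n \<omega> i j + entry y n \<omega> i j)),
     smult = (\<lambda>t x. mk_elem (\<lambda>n \<omega> i j. t * entry x n \<omega> i j)),
     star = (\<lambda>x. mk_elem (\<lambda>n \<omega> i j. cnj (entry x n \<omega> j i))),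
     state = (\<lambda>x. lim (\<lambda>n. Ex n (\<lambda>\<omega>. 1 / of_nat n * (\<Sum>i<n. entry x n \<omega> i i)))),
     graph_action = (\<lambda>g xs. mk_elem (\<lambda>n \<omega>. op_action n g (length xs) (\<lambda>k. entry (xs ! k) n \<omega>))),
     traffic_state = (\<lambda>T. lim (\<lambda>n. Ex n (\<lambda>\<omega>. 1 / of_nat n * vertex_sum n (\<lambda>x. entry x n \<omega>) T))) \<rparr>"

lemma model_simps [simp]:
  "carrier model = mk_elem ` A"
  "x \<otimes>\<^bsub>model\<^esub> y = mk_elem (\<lambda>n \<omega>. mat_mul n (entry x n \<omega>) (entry y n \<omega>))"
  "\<one>\<^bsub>model\<^esub> = mk_elem (\<lambda>n \<omega>. mat_id n)"
  "\<zero>\<^bsub>model\<^esub> = mk_elem (\<lambda>n \<omega> i j. 0)"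
  "x \<oplus>\<^bsub>model\<^esub> y = mk_elem (\<lambda>n \<omega> i j. entry x n \<omega> i j + entry y n \<omega> i j)"
  "t \<odot>\<^bsub>model\<^esub> x = mk_elem (\<lambda>n \<omega> i j. t * entry x n \<omega> i j)"
  "star model x = mk_elem (\<lambda>n \<omega> i j. cnj (entry x n \<omega> j i))"
  "state model x = lim (\<lambda>n. Ex n (\<lambda>\<omega>. 1 / of_nat n * (\<Sum>i<n. entry x n \<omega> i i)))"
  "graph_action model g xs = mk_elem (\<lambda>n \<omega>. op_action n g (length xs) (\<lambda>k. entry (xs ! k) n \<omega>))"
  "traffic_state model T = lim (\<lambda>n. Ex n (\<lambda>\<omega>. 1 / of_nat n * vertex_sum n (\<lambda>x. entry x n \<omega>) T))"
  by (simp_all add: model_def)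

lemma in_carrier:
  assumes "x \<in> mk_elem ` A"
  shows "entry x \<in> A" "mk_elem (entry x) = x" "mk_elem (\<lambda>n \<omega> i j. entry x n \<omega> i j) = x"
  using assms by auto

lemma carrier_outside: "x \<in> mk_elem ` A \<Longrightarrow> \<not> (i < n \<and> j < n) \<Longrightarrow> entry x n \<omega> i j = 0"
  using A_outside in_carrier(1) by blast

lemma traffic_state_converges:
  assumes "is_test_graph T" "snd T ` arcs (fst T) \<subseteq> mk_elem ` A"
  shows "convergent (\<lambda>n. Ex n (\<lambda>\<omega>. 1 / of_nat n * vertex_sum n (\<lambda>x. entry x n \<omega>) T))"
proof -
  have "convergent (mean (fst T, entry \<circ> snd T))"
    using assms in_carrier(1) by (intro mean_converges) (auto intro: is_test_graph_relabel[of "fst T" "snd T"])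
  moreover have "mean (fst T, entry \<circ> snd T) = (\<lambda>n. Ex n (\<lambda>\<omega>. 1 / of_nat n * vertex_sum n (\<lambda>x. entry x n \<omega>) T))"
    unfolding mean_def vertex_sum_def fst_conv snd_conv o_apply ..
  ultimately show ?thesis by simp
qed

lemma is_test_graph_loop: "is_test_graph (loop_graph s)"
proof -
  have "fin_digraph (fst (loop_graph s))" by unfold_locales (auto simp: loop_graph_def)
  then show ?thesis unfolding is_test_graph_iff_cut by (auto simp: loop_graph_def)
qed

lemma vertex_sum_loop: "vertex_sum n B (loop_graph s) = (\<Sum>i<n. B s i i)"
  unfolding vertex_sum_def loop_graph_def fst_conv snd_conv
  by (rule sum.reindex_bij_witness[where i = "\<lambda>i. restrict (\<lambda>_. i) {0}" and j = "\<lambda>\<phi>. \<phi> 0"])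
    (auto simp: fun_eq_iff PiE_def extensional_def)

lemma state_converges:
  assumes "x \<in> mk_elem ` A"
  shows "convergent (\<lambda>n. Ex n (\<lambda>\<omega>. 1 / of_nat n * (\<Sum>i<n. entry x n \<omega> i i)))"
  using traffic_state_converges[OF is_test_graph_loop, of x] assms
  unfolding vertex_sum_loop by (simp add: loop_graph_def)

lemma abelian_group_model: "abelian_group model"
proof (rule abelian_groupI, goal_cases)
  case (1 x y)
  then show ?case using A_add in_carrier(1) by auto
next
  case 2
  then show ?case using zero_in by simp
next
  case (6 x)
  then show ?case using A_smult[OF in_carrier(1), of x "-1"]
    by (intro bexI[of _ "mk_elem (\<lambda>n \<omega> i j. - 1 * entry x n \<omega> i j)"]) auto
qed (auto simp: add_ac in_carrier(3))

lemma ring_model: "ring model"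
proof (rule ringI[OF abelian_group_model])
  show "monoid model"
  proof (rule monoidI, goal_cases)
    case (1 x y)
    then show ?case using mul_in in_carrier(1) by auto
  next
    case 2
    then show ?case using id_in by simp
  next
    case (4 x)
    then have "x \<in> mk_elem ` A" by simp
    then show ?case by (simp add: mat_mul_id_left[OF carrier_outside] in_carrier)
  next
    case (5 x)
    then have "x \<in> mk_elem ` A" by simp
    then show ?case by (simp add: mat_mul_id_right[OF carrier_outside] in_carrier)
  qed (simp add: mat_mul_assoc)
qed (simp_all add: mat_mul_eq distrib_left distrib_right sum.distrib)

lemma module_model: "module (class_ring :: complex ring) model"
proof (rule moduleI[OF _ abelian_group_model])
  show "cring (class_ring :: complex ring)" by (rule class_cring.is_cring)
qed (auto simp: A_smult algebra_simps in_carrier)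

lemma star_algebra_model: "star_algebra model"
proof (rule star_algebra.intro[OF ring_model module_model], goal_cases)
  case (3 x)
  then have "x \<in> mk_elem ` A" by simp
  from star_in[OF in_carrier(1)[OF this]] show ?case unfolding model_simps by (rule imageI)
next
  case (4 x)
  then show ?case by (simp add: in_carrier)
qed (simp_all add: mat_mul_eq sum_distrib_left mult_ac)

lemma lim_add: "convergent f \<Longrightarrow> convergent h \<Longrightarrow> lim (\<lambda>n. f n + h n) = lim f + lim h" for f h :: "nat \<Rightarrow> complex"
  by (intro limI tendsto_add) (auto simp: convergent_LIMSEQ_iff)

lemma lim_mult_const: "convergent f \<Longrightarrow> lim (\<lambda>n. t * f n) = t * lim f" for f :: "nat \<Rightarrow> complex"
  by (intro limI tendsto_mult_left) (auto simp: convergent_LIMSEQ_iff)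

lemma prob_space_model: "tracial_star_prob_space model"
proof (intro tracial_star_prob_space.intro star_algebra_model tracial_star_prob_space_axioms.intro, goal_cases)
  case (1 x y)
  then have "convergent (\<lambda>n. Ex n (\<lambda>\<omega>. 1 / of_nat n * (\<Sum>i<n. entry x n \<omega> i i)))"
    "convergent (\<lambda>n. Ex n (\<lambda>\<omega>. 1 / of_nat n * (\<Sum>i<n. entry y n \<omega> i i)))"
    using state_converges by auto
  from lim_add[OF this] show ?case
    by (simp only: model_simps entry_mk_elem sum.distrib distrib_left
        Bochner_Integration.integral_add[OF integrable_R integrable_R])
next
  case (2 x t)
  then have "convergent (\<lambda>n. Ex n (\<lambda>\<omega>. 1 / of_nat n * (\<Sum>i<n. entry x n \<omega> i i)))"
    using state_converges by auto
  from lim_mult_const[OF this, of t] show ?case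
    by (simp only: model_simps entry_mk_elem sum_distrib_left[symmetric] mult.left_commute[of _ t]
        Bochner_Integration.integral_mult_right_zero)
next
  case 3
  have "(\<lambda>n. 1 :: complex) \<longlonglongrightarrow> 1" by simp
  then have "(\<lambda>n. Ex n (\<lambda>\<omega>. 1 / of_nat n * (\<Sum>i<n. mat_id n i i))) \<longlonglongrightarrow> 1"
    by (rule Lim_transform_eventually) (auto intro!: eventually_sequentiallyI[of 1] simp: mat_id_def)
  then show ?case by (simp add: limI)
next
  case (4 x)
  then have c: "convergent (\<lambda>n. Ex n (\<lambda>\<omega>. 1 / of_nat n * (\<Sum>i<n. entry (star model x \<otimes>\<^bsub>model\<^esub> x) n \<omega> i i)))"
    using mul_in[OF star_in] in_carrier(1) by (intro state_converges) auto
  show ?case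
    unfolding model_simps(8)
  proof (rule nonneg_Reals_limit[OF c[unfolded convergent_LIMSEQ_iff]], rule Ex_nonneg)
    fix n \<omega>
    have "(\<Sum>i<n. entry (star model x \<otimes>\<^bsub>model\<^esub> x) n \<omega> i i) =
        (\<Sum>(i, k)\<in>{..<n} \<times> {..<n}. cnj (entry x n \<omega> k i) * entry x n \<omega> k i)"
      by (simp add: mat_mul_def sum.cartesian_product)
    also have "\<dots> \<in> \<real>\<^sub>\<ge>\<^sub>0"
      unfolding case_prod_unfold by (rule nonneg_Reals_sum_cnj) simp
    finally show "1 / of_nat n * (\<Sum>i<n. entry (star model x \<otimes>\<^bsub>model\<^esub> x) n \<omega> i i) \<in> \<real>\<^sub>\<ge>\<^sub>0"
      by (intro nonneg_Reals_mult_I) (simp_all add: complex_nonneg_Reals_iff)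
  qed
next
  case (5 x y)
  have "(\<Sum>i<n. mat_mul n (entry x n \<omega>) (entry y n \<omega>) i i) = (\<Sum>i<n. mat_mul n (entry y n \<omega>) (entry x n \<omega>) i i)" for n \<omega>
    unfolding mat_mul_def by (subst sum.swap) (simp add: mult.commute)
  then show ?case by simp
qed

lemma entry_update:
  assumes "k < length as"
  shows "op_action n g (length as) (\<lambda>k'. entry (as[k := z] ! k') n \<omega>) =
    op_action n g (length as) ((\<lambda>k'. entry (as ! k') n \<omega>)(k := entry z n \<omega>))"
  using assms by (intro op_action_cong) (auto simp: nth_list_update)

lemma foldr_model:
  "foldr (\<otimes>\<^bsub>model\<^esub>) xs \<one>\<^bsub>model\<^esub> =
     mk_elem (\<lambda>n \<omega>. foldr (mat_mul n) (map (\<lambda>x. entry x n \<omega>) xs) (mat_id n))"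
  by (induction xs) simp_all

text \<open>At fixed size and outcome, gluing is contraction and the star is conjugation of tensors.
  The double sum is therefore \<open>1 / n\<close> times the sum over \<open>\<alpha>\<close> of the
  squared modulus of a linear combination of tensor entries. Expectation and limit preserve
  nonnegativity.\<close>

lemma traffic_state_pos_model:
  assumes m: "1 \<le> m" and F: "finite F" "\<forall>s\<in>F. is_marked_graph m (mk_elem ` A) s"
  shows "(\<Sum>s\<in>F. \<Sum>s'\<in>F. cnj (u s) * u s' * traffic_state model (marked_glue (marked_star (star model) s) s')) \<in> \<real>\<^sub>\<ge>\<^sub>0"
proof -
  let ?C = "mk_elem ` A :: (graph_op \<times> 'l list \<Rightarrow> complex) set"
  let ?st = "star model"
  let ?gl = "\<lambda>s s'. marked_glue (marked_star ?st s) s'"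
  let ?E = "\<lambda>n s s'. Ex n (\<lambda>\<omega>. 1 / of_nat n * vertex_sum n (\<lambda>x. entry x n \<omega>) (?gl s s'))"
  have st: "?st x \<in> ?C" if "x \<in> ?C" for x
    using star_in[OF in_carrier(1)[OF that]] unfolding model_simps by (rule imageI)
  have mg: "is_marked_graph m ?C (marked_star ?st s)" "is_marked_graph m ?C s" if "s \<in> F" for s
    using F(2) that by (auto intro: is_marked_graph_star[OF _ st] simp del: model_simps)
  have "convergent (\<lambda>n. ?E n s s')" if s: "s \<in> F" "s' \<in> F" for s s'
  proof (rule traffic_state_converges)
    show "is_test_graph (?gl s s')" by (rule is_test_graph_marked_glue[OF mg(1)[OF s(1)] mg(2)[OF s(2)] m])
    show "snd (?gl s s') ` arcs (fst (?gl s s')) \<subseteq> ?C"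
      using mg(1)[OF s(1)] mg(2)[OF s(2)]
      by (auto simp: marked_glue_def glue_def disjoint_union_simps is_marked_graph_def)
  qed
  then have lim: "(\<lambda>n. ?E n s s') \<longlonglongrightarrow> traffic_state model (?gl s s')" if "s \<in> F" "s' \<in> F" for s s'
    using that by (simp add: convergent_LIMSEQ_iff)
  have "(\<lambda>n. \<Sum>s\<in>F. \<Sum>s'\<in>F. cnj (u s) * u s' * ?E n s s') \<longlonglongrightarrow>
      (\<Sum>s\<in>F. \<Sum>s'\<in>F. cnj (u s) * u s' * traffic_state model (?gl s s'))"
    by (intro tendsto_sum tendsto_mult tendsto_const lim)
  then show ?thesis
  proof (rule nonneg_Reals_limit)
    fix n
    let ?I = "{..<m} \<rightarrow>\<^sub>E {..<n}" and ?w = "\<lambda>\<omega> s \<alpha>. marked_sum n (\<lambda>x. entry x n \<omega>) s \<alpha>"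
    have "(\<Sum>s\<in>F. \<Sum>s'\<in>F. cnj (u s) * u s' * ?E n s s') =
        Ex n (\<lambda>\<omega>. \<Sum>s\<in>F. \<Sum>s'\<in>F. cnj (u s) * u s' * (1 / of_nat n * vertex_sum n (\<lambda>x. entry x n \<omega>) (?gl s s')))"
      by (simp only: Bochner_Integration.integral_sum[OF integrable_R] Bochner_Integration.integral_mult_right_zero)
    also have "\<dots> \<in> \<real>\<^sub>\<ge>\<^sub>0"
    proof (rule Ex_nonneg)
      fix \<omega>
      have vs: "vertex_sum n (\<lambda>x. entry x n \<omega>) (?gl s s') = (\<Sum>\<alpha>\<in>?I. cnj (?w \<omega> s \<alpha>) * ?w \<omega> s' \<alpha>)"
        if "s \<in> F" "s' \<in> F" for s s'
        unfolding vertex_sum_marked_glue[OF mg(1)[OF that(1)] mg(2)[OF that(2)]]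
        using marked_sum_star[of ?C "\<lambda>x. entry x n \<omega>" ?st m s] mg(2)[OF that(1)] by simp
      have "(\<Sum>s\<in>F. \<Sum>s'\<in>F. cnj (u s) * u s' * (1 / of_nat n * vertex_sum n (\<lambda>x. entry x n \<omega>) (?gl s s'))) =
          (\<Sum>s\<in>F. \<Sum>s'\<in>F. \<Sum>\<alpha>\<in>?I. 1 / of_nat n * (cnj (u s * ?w \<omega> s \<alpha>) * (u s' * ?w \<omega> s' \<alpha>)))"
        by (intro sum.cong refl) (simp add: vs sum_distrib_left sum_divide_distrib mult_ac)
      also have "\<dots> = (\<Sum>\<alpha>\<in>?I. \<Sum>s\<in>F. \<Sum>s'\<in>F. 1 / of_nat n * (cnj (u s * ?w \<omega> s \<alpha>) * (u s' * ?w \<omega> s' \<alpha>)))"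
      proof -
        have "(\<Sum>s\<in>F. \<Sum>s'\<in>F. \<Sum>\<alpha>\<in>?I. f s s' \<alpha>) = (\<Sum>\<alpha>\<in>?I. \<Sum>s\<in>F. \<Sum>s'\<in>F. f s s' \<alpha>)" for f :: "_ \<Rightarrow> _ \<Rightarrow> _ \<Rightarrow> complex"
        proof -
          have "(\<Sum>s\<in>F. \<Sum>s'\<in>F. \<Sum>\<alpha>\<in>?I. f s s' \<alpha>) = (\<Sum>s\<in>F. \<Sum>\<alpha>\<in>?I. \<Sum>s'\<in>F. f s s' \<alpha>)"
            by (rule sum.cong[OF refl], rule sum.swap)
          also have "\<dots> = (\<Sum>\<alpha>\<in>?I. \<Sum>s\<in>F. \<Sum>s'\<in>F. f s s' \<alpha>)" by (rule sum.swap)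
          finally show ?thesis .
        qed
        then show ?thesis .
      qed
      also have "\<dots> = 1 / of_nat n * (\<Sum>\<alpha>\<in>?I. cnj (\<Sum>s\<in>F. u s * ?w \<omega> s \<alpha>) * (\<Sum>s\<in>F. u s * ?w \<omega> s \<alpha>))"
      proof -
        have "(\<Sum>s\<in>F. \<Sum>s'\<in>F. c * (cnj (w s) * w s')) = c * (cnj (\<Sum>s\<in>F. w s) * (\<Sum>s\<in>F. w s))"
          for c :: complex and w
          unfolding cnj_sum sum_product by (simp only: sum_distrib_left)
        then show ?thesis by (simp only: sum_distrib_left[symmetric])
      qed
      also have "\<dots> \<in> \<real>\<^sub>\<ge>\<^sub>0"
        by (intro nonneg_Reals_mult_I nonneg_Reals_sum_cnj finite_PiE) (simp_all add: complex_nonneg_Reals_iff)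
      finally show "(\<Sum>s\<in>F. \<Sum>s'\<in>F. cnj (u s) * u s' * (1 / of_nat n * vertex_sum n (\<lambda>x. entry x n \<omega>) (?gl s s'))) \<in> \<real>\<^sub>\<ge>\<^sub>0" .
    qed
    finally show "(\<Sum>s\<in>F. \<Sum>s'\<in>F. cnj (u s) * u s' * ?E n s s') \<in> \<real>\<^sub>\<ge>\<^sub>0" .
  qed
qed

lemma traffic_space_model: "traffic_space model"
proof (intro traffic_space.intro prob_space_model traffic_space_axioms.intro, goal_cases)
  case (1 as g)
  then have "as ! k \<in> mk_elem ` A" if "k < length as" for k
    using nth_mem[OF that] by auto
  from A_op_action[OF 1(1) in_carrier(1)[OF this]] show ?case
    unfolding model_simps by (rule imageI)
next
  case (2 as g k x y)
  then show ?case by (simp add: entry_update op_action_upd_fun)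
next
  case (3 as g k x t)
  then show ?case by (simp add: entry_update op_action_upd_fun)
next
  case (4 gs g ass)
  have len: "length ass = length gs" using 4(2) by (rule list_all2_lengthD)
  have gs: "is_graph_op (length (ass ! k)) (gs ! k)" if "k < length gs" for k
    using list_all2_nthD2[OF 4(2) that] by simp
  interpret S: op_substitution g gs ass using 4(1) len gs by unfold_locales
  have "op_action n (op_subst g gs) (length (concat ass)) (\<lambda>m. entry (concat ass ! m) n \<omega>) =
      op_action n g (length gs) (\<lambda>k. entry (map2 (graph_action model) gs ass ! k) n \<omega>)" for n \<omega>
    unfolding S.op_action_subst[of n "\<lambda>x. entry x n \<omega>"] using len by (intro op_action_cong) simp
  then show ?case using len by simp
next
  case (5 as)
  then have "set (map entry as) \<subseteq> A" using in_carrier(1) by auto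
  note path = A_path[OF this]
  have "op_action n (op_path (length as)) (length as) (\<lambda>k. entry (as ! k) n \<omega>) =
      foldr (mat_mul n) (rev (map (\<lambda>x. entry x n \<omega>) as)) (mat_id n)" for n \<omega>
  proof -
    have "op_action n (op_path (length as)) (length as) (\<lambda>k. entry (as ! k) n \<omega>) =
        op_action n (op_path (length as)) (length as) (\<lambda>k. (map entry as ! k) n \<omega>)"
      by (rule op_action_cong) simp
    then show ?thesis using path[of n \<omega>] by (simp add: comp_def)
  qed
  then show ?case unfolding foldr_model by (simp add: rev_map)
next
  case (6 as g g' h as')
  then have "op_action n g' (length as) (\<lambda>k. entry (as' ! k) n \<omega>) =
      op_action n g (length as) (\<lambda>k. entry (as ! k) n \<omega>)" for n \<omega>
    by (intro op_action_iso[OF 6(1) 6(3) 6(2)]) simp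
  then show ?case using 6(5) by simp
next
  case (7 as g)
  have "cnj (op_action n g (length as) (\<lambda>k. entry (as ! k) n \<omega>) j i) =
      op_action n (op_reverse g) (length as) (\<lambda>k. entry (map (star model) as ! k) n \<omega>) i j" for n \<omega> i j
    unfolding cnj_op_action[OF 7(1)] by (rule fun_cong[OF fun_cong[OF op_action_cong]]) simp
  then show ?case by simp
next
  case (8 T T')
  then show ?case using vertex_sum_iso[OF 8(1,4)] by simp
next
  case (9 as g)
  then show ?case by (simp add: trace_op_closure[OF 9(1), of _ "\<lambda>x. entry x _ _"])
next
  case (10 m F u)
  then show ?case using traffic_state_pos_model[of m F u] by (simp only: model_simps(1))
qed

end


section \<open>Random signs\<close>

text \<open>Minimum and maximum make the code independent of the order of the indices, so the sign
  matrices are symmetric. Codes are numbers because an outcome in the model is a set of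
  numbers.\<close>

definition sign_code :: "bool \<Rightarrow> nat \<Rightarrow> nat \<Rightarrow> nat" where
  "sign_code k a b = prod_encode (of_bool k, prod_encode (min a b, max a b))"

definition sign_codes :: "nat \<Rightarrow> nat set" where
  "sign_codes n = (\<lambda>(k, a, b). sign_code k a b) ` (UNIV \<times> {..<n} \<times> {..<n})"

text \<open>A uniformly random subset of the codes is a family of independent fair signs, with
  membership meaning plus one.\<close>

definition random_signs :: "nat \<Rightarrow> nat set pmf" where
  "random_signs n = pmf_of_set (Pow (sign_codes n))"

definition sign :: "bool \<Rightarrow> nat set \<Rightarrow> nat \<Rightarrow> nat \<Rightarrow> real" where
  "sign k \<omega> a b = (if sign_code k a b \<in> \<omega> then 1 else - 1)"

lemma finite_sign_codes: "finite (sign_codes n)"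
  by (simp add: sign_codes_def)

lemma finite_random_signs: "finite (set_pmf (random_signs n))"
  by (simp add: random_signs_def finite_sign_codes Pow_not_empty)

lemma sum_Pow_prod:
  fixes f :: "'a \<Rightarrow> bool \<Rightarrow> 'b :: comm_semiring_1"
  assumes "finite I"
  shows "(\<Sum>\<omega>\<in>Pow I. \<Prod>i\<in>I. f i (i \<in> \<omega>)) = (\<Prod>i\<in>I. f i True + f i False)"
  unfolding prod_add[OF assms]
proof (rule sum.cong[OF refl])
  fix \<omega> assume "\<omega> \<in> Pow I"
  then have I: "I = \<omega> \<union> (I - \<omega>)" and "finite \<omega>" using assms finite_subset by auto
  have "(\<Prod>i\<in>I. f i (i \<in> \<omega>)) = (\<Prod>i\<in>\<omega>. f i (i \<in> \<omega>)) * (\<Prod>i\<in>I - \<omega>. f i (i \<in> \<omega>))"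
    using \<open>finite \<omega>\<close> assms by (subst I, intro prod.union_disjoint) auto
  then show "(\<Prod>i\<in>I. f i (i \<in> \<omega>)) = (\<Prod>i\<in>\<omega>. f i True) * (\<Prod>i\<in>I - \<omega>. f i False)" by simp
qed

text \<open>Pad the product with factors 1 at the codes outside \<open>J\<close>. The average over
  all subsets then factorises over the codes, each code in \<open>J\<close> giving the mean of
  \<open>1\<close> and \<open>(- 1) ^ r i\<close>.\<close>

lemma random_signs_moment:
  assumes "J \<subseteq> sign_codes n"
  shows "(LINT \<omega>|measure_pmf (random_signs n). (\<Prod>i\<in>J. (if i \<in> \<omega> then 1 else - 1) ^ r i)) =
    (\<Prod>i\<in>J. of_bool (even (r i)) :: real)"
proof -
  let ?I = "sign_codes n"
  let ?f = "\<lambda>i b. if i \<in> J then (if b then 1 else - 1 :: real) ^ r i else 1"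
  note fin = finite_sign_codes[of n]
  have J: "(\<Prod>i\<in>J. h i) = (\<Prod>i\<in>?I. if i \<in> J then h i else 1)" for h :: "nat \<Rightarrow> real"
    using assms fin by (intro prod.mono_neutral_cong_left) auto
  have "(LINT \<omega>|measure_pmf (random_signs n). (\<Prod>i\<in>J. (if i \<in> \<omega> then 1 else - 1 :: real) ^ r i)) =
      (\<Sum>\<omega>\<in>Pow ?I. \<Prod>i\<in>?I. ?f i (i \<in> \<omega>)) / card (Pow ?I)"
    unfolding random_signs_def J using fin by (intro integral_pmf_of_set) auto
  also have "\<dots> = (\<Prod>i\<in>?I. ?f i True + ?f i False) / 2 ^ card ?I"
    using fin by (simp add: sum_Pow_prod[of ?I ?f] card_Pow)
  also have "\<dots> = (\<Prod>i\<in>?I. (?f i True + ?f i False) / 2)"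
    by (simp add: prod_dividef)
  also have "\<dots> = (\<Prod>i\<in>?I. if i \<in> J then of_bool (even (r i)) else 1)"
    by (intro prod.cong) auto
  finally show ?thesis unfolding J .
qed

text \<open>Even powers of a sign are 1 and odd powers have mean 0. The instance is used twice: for
  the convergence of the model, and for the injective version of the limit of two independent
  copies.\<close>

interpretation signs: wigner_moments "\<lambda>n. measure_pmf (random_signs n)" "\<lambda>_. sign" "\<lambda>_ _ r. of_bool (even r)"
proof (standard, goal_cases)
  case (1 n \<omega> a b k)
  then show ?case by (simp add: sign_def sign_code_def min.commute max.commute)
next
  case (2 n K r)
  let ?h = "\<lambda>x. sign_code (fst x) (Min (snd x)) (Max (snd x))"
  have pair: "\<exists>a<n. \<exists>b<n. a \<le> b \<and> x = (fst x, {a, b})" if x: "x \<in> K" for x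
  proof -
    obtain a b where "a < n" "b < n" "snd x = {a, b}" using 2(3)[OF x] by (elim exE conjE)
    then show ?thesis by (cases "a \<le> b") (metis prod.collapse, metis insert_commute nat_le_linear prod.collapse)
  qed
  have inj: "inj_on ?h K"
  proof (rule inj_onI)
    fix x y assume xy: "x \<in> K" "y \<in> K" "?h x = ?h y"
    obtain a b where x: "a \<le> b" "x = (fst x, {a, b})" using pair[OF xy(1)] by (elim exE conjE)
    obtain c d where y: "c \<le> d" "y = (fst y, {c, d})" using pair[OF xy(2)] by (elim exE conjE)
    have sx: "snd x = {a, b}" and sy: "snd y = {c, d}" using x(2) y(2) by (metis snd_conv)+
    have "fst x = fst y" "a = c" "b = d"
      using xy(3) x(1) y(1) unfolding sx sy by (auto simp: sign_code_def of_bool_def split: if_splits)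
    then show "x = y" by (intro prod_eqI) (simp_all add: sx sy)
  qed
  have sub: "?h ` K \<subseteq> sign_codes n"
  proof
    fix i assume "i \<in> ?h ` K"
    then obtain x where x: "x \<in> K" "i = ?h x" by blast
    obtain a b where ab: "a < n" "b < n" "a \<le> b" "x = (fst x, {a, b})" using pair[OF x(1)] by (elim exE conjE)
    then have "snd x = {a, b}" by (metis snd_conv)
    then show "i \<in> sign_codes n" using ab x(2)
      by (auto simp: sign_codes_def intro!: image_eqI[of _ _ "(fst x, a, b)"])
  qed
  have inv: "inv_into K ?h (?h x) = x" if "x \<in> K" for x using inj that by (rule inv_into_f_f)
  have "(LINT \<omega>|measure_pmf (random_signs n). (\<Prod>x\<in>K. sign (fst x) \<omega> (Min (snd x)) (Max (snd x)) ^ r x)) =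
      (LINT \<omega>|measure_pmf (random_signs n). (\<Prod>i\<in>?h ` K. (if i \<in> \<omega> then 1 else - 1) ^ r (inv_into K ?h i)))"
    unfolding prod.reindex[OF inj] by (simp add: inv sign_def cong: prod.cong)
  also have "\<dots> = (\<Prod>x\<in>K. of_bool (even (r x)))"
    unfolding random_signs_moment[OF sub] unfolding prod.reindex[OF inj] by (simp add: inv cong: prod.cong)
  finally show ?case
    by (simp add: has_bochner_integral_iff integrable_measure_pmf_finite[OF finite_random_signs])
next
  case (3 k d)
  show ?case by (rule exI[of _ 1]) simp
qed simp_all

section \<open>Stability of the limit\<close>

text \<open>The label consists of the copy and the two parameters. Entries are cut off outside the
  square of size \<open>n\<close>, as the model demands of its generators.\<close>

definition sign_gen :: "bool \<times> real \<times> real \<Rightarrow> matrix_seq" where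
  "sign_gen = (\<lambda>(k, p, q) n \<omega> a b.
     if a < n \<and> b < n then of_real (wigner_entry p q (sign k \<omega>) n a b) else 0)"

lemma sign_gen_converges:
  assumes "is_test_graph T"
  shows "(\<lambda>n. LINT \<omega>|measure_pmf (random_signs n). 1 / of_nat n * vertex_sum n (\<lambda>s. sign_gen s n \<omega>) T)
    \<longlonglongrightarrow> traffic_limit fst (\<lambda>s. fst (snd s)) (\<lambda>s. snd (snd s)) T"
proof -
  interpret fin_digraph "fst T" using assms by (simp add: is_test_graph_def)
  have "vertex_sum n (\<lambda>s. sign_gen s n \<omega>) T =
      vertex_sum n (\<lambda>s a b. of_real (wigner_entry (fst (snd s)) (snd (snd s)) (sign (fst s) \<omega>) n a b)) T" for n \<omega>
    unfolding vertex_sum_def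
  proof (intro sum.cong prod.cong refl)
    fix \<phi> e assume "\<phi> \<in> verts (fst T) \<rightarrow>\<^sub>E {..<n}" "e \<in> arcs (fst T)"
    then have "\<phi> (head (fst T) e) < n" "\<phi> (tail (fst T) e) < n" by auto
    then show "sign_gen (snd T e) n \<omega> (\<phi> (head (fst T) e)) (\<phi> (tail (fst T) e)) =
      of_real (wigner_entry (fst (snd (snd T e))) (snd (snd (snd T e))) (sign (fst (snd T e)) \<omega>) n
        (\<phi> (head (fst T) e)) (\<phi> (tail (fst T) e)))"
      by (simp add: sign_gen_def case_prod_unfold)
  qed
  then show ?thesis
    using signs.traffic_converges_limit[where clr = "fst :: bool \<times> real \<times> real \<Rightarrow> bool"
        and P = "\<lambda>s. fst (snd s)" and Q = "\<lambda>s. snd (snd s)", unfolded traffic_converges_def, rule_format, OF assms]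
    by (simp only:)
qed

interpretation signs: matrix_traffic_model random_signs sign_gen
proof (standard, goal_cases)
  case (1 n)
  show ?case by (rule finite_random_signs)
next
  case (2 a n b i \<omega>)
  then show ?case by (auto simp: sign_gen_def case_prod_unfold)
next
  case (3 i n \<omega> b a)
  have "sign k \<omega> b a = sign k \<omega> a b" for k by (simp add: sign_def sign_code_def min.commute max.commute)
  then show ?case by (auto simp: sign_gen_def case_prod_unfold wigner_entry_def)
next
  case (4 T)
  then show ?case by (rule convergentI[OF sign_gen_converges])
qed

section \<open>Two-colourings and the centering of the limit\<close>

lemma tree_pairings_const: "tree_pairings G (\<lambda>_. k) = tree_pairings G (\<lambda>_. k')"
  by (simp add: tree_pairings_def pairings_def is_pair_def)

lemma traffic_limit_const: "traffic_limit (\<lambda>_. k) P Q = traffic_limit (\<lambda>_. k') P Q"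
  by (intro ext) (simp add: traffic_limit_def inj_limit_def comp_def tree_pairings_const[of _ k k'])

lemma traffic_limit_relabel:
  "traffic_limit clr P Q (G, \<lambda>e. h (l e)) = traffic_limit (\<lambda>s. clr (h s)) (\<lambda>s. P (h s)) (\<lambda>s. Q (h s)) (G, l)"
  by (simp add: traffic_limit_def inj_limit_def quotient_graph_def comp_def)

text \<open>A quotient keeps the single arc, which has no partner, so there is no pairing at
  all.\<close>

lemma traffic_limit_loop:
  fixes clr :: "'s \<Rightarrow> 'k"
  shows "traffic_limit clr P Q (loop_graph s) = 0"
proof -
  have "tree_pairings (fst (quotient_graph \<pi> (loop_graph s))) c = {}" for \<pi> and c :: "nat \<Rightarrow> 'k"
  proof (rule ccontr)
    assume "tree_pairings (fst (quotient_graph \<pi> (loop_graph s))) c \<noteq> {}"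
    then obtain m where m: "partition_on {0 :: nat} m" "\<And>B. B \<in> m \<Longrightarrow> card B = 2"
      by (auto simp: tree_pairings_def pairings_def is_pair_def quotient_graph_def glue_def loop_graph_def)
    obtain B where B: "B \<in> m" using partition_on_obtains[OF m(1)] by blast
    then have "B \<subseteq> {0}" using m(1) by (auto simp: partition_on_def)
    from card_mono[OF _ this] m(2)[OF B] show False by simp
  qed
  then show ?thesis by (simp add: traffic_limit_def inj_limit_def)
qed

text \<open>A colouring constant on the blocks is a free choice of one colour per block.\<close>

lemma card_block_constant:
  assumes m: "partition_on E m" and "finite E"
  shows "card {\<kappa>\<in>E \<rightarrow>\<^sub>E (UNIV :: bool set). block_constant m \<kappa>} = 2 ^ card m"
proof -
  have fin: "finite m" using finite_elements[OF assms(2,1)] .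
  have blk: "\<exists>!B. B \<in> m \<and> e \<in> B" if e: "e \<in> E" for e
  proof -
    obtain B where "B \<in> m" "e \<in> B" by (rule partition_on_obtains[OF m e])
    then show ?thesis using disjointD[OF partition_onD2[OF m]] by blast
  qed
  define b where "b e = (THE B. B \<in> m \<and> e \<in> B)" for e
  have b: "b e \<in> m" "e \<in> b e" if "e \<in> E" for e using theI'[OF blk[OF that]] by (auto simp: b_def)
  have b_eq: "b e = B" if "B \<in> m" "e \<in> B" for B e
  proof -
    have "e \<in> E" using m that by (auto simp: partition_on_def)
    then show ?thesis using blk b that by blast
  qed
  have rep: "\<exists>e. e \<in> B" if "B \<in> m" for B using partition_onD3[OF m] that by (metis ex_in_conv)
  have sub: "B \<subseteq> E" if "B \<in> m" for B using m that by (auto simp: partition_on_def)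
  let ?S = "{\<kappa>\<in>E \<rightarrow>\<^sub>E (UNIV :: bool set). block_constant m \<kappa>}"
  have "bij_betw (\<lambda>g. restrict (\<lambda>e. g (b e)) E) (m \<rightarrow>\<^sub>E (UNIV :: bool set)) ?S"
  proof (rule bij_betwI[where g = "\<lambda>\<kappa>. restrict (\<lambda>B. \<kappa> (SOME e. e \<in> B)) m"])
    show "(\<lambda>g. restrict (\<lambda>e. g (b e)) E) \<in> (m \<rightarrow>\<^sub>E UNIV) \<rightarrow> ?S"
    proof
      fix g :: "_ \<Rightarrow> bool" assume "g \<in> m \<rightarrow>\<^sub>E UNIV"
      have "block_constant m (restrict (\<lambda>e. g (b e)) E)"
        unfolding block_constant_def
      proof (intro ballI)
        fix B v w assume B: "B \<in> m" "v \<in> B" "w \<in> B"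
        then show "restrict (\<lambda>e. g (b e)) E v = restrict (\<lambda>e. g (b e)) E w"
          using sub[OF B(1)] b_eq[OF B(1,2)] b_eq[OF B(1,3)] by auto
      qed
      then show "restrict (\<lambda>e. g (b e)) E \<in> ?S" by simp
    qed
    show "(\<lambda>\<kappa>. restrict (\<lambda>B. \<kappa> (SOME e. e \<in> B)) m) \<in> ?S \<rightarrow> (m \<rightarrow>\<^sub>E UNIV)" by auto
  next
    fix g :: "'a set \<Rightarrow> bool" assume g: "g \<in> m \<rightarrow>\<^sub>E UNIV"
    show "restrict (\<lambda>B. restrict (\<lambda>e. g (b e)) E (SOME e. e \<in> B)) m = g"
    proof
      fix B
      show "restrict (\<lambda>B. restrict (\<lambda>e. g (b e)) E (SOME e. e \<in> B)) m B = g B"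
      proof (cases "B \<in> m")
        case True
        have e: "(SOME e. e \<in> B) \<in> B" using rep[OF True] by (rule someI_ex)
        then show ?thesis using True sub[OF True] b_eq[OF True e] by auto
      next
        case False
        then show ?thesis using g by (auto simp: PiE_def extensional_def)
      qed
    qed
  next
    fix \<kappa> assume \<kappa>: "\<kappa> \<in> ?S"
    show "restrict (\<lambda>e. restrict (\<lambda>B. \<kappa> (SOME e. e \<in> B)) m (b e)) E = \<kappa>"
    proof
      fix e
      show "restrict (\<lambda>e. restrict (\<lambda>B. \<kappa> (SOME e. e \<in> B)) m (b e)) E e = \<kappa> e"
      proof (cases "e \<in> E")
        case True
        have "(SOME e'. e' \<in> b e) \<in> b e" using b(2)[OF True] by (rule someI)
        then have "\<kappa> (SOME e'. e' \<in> b e) = \<kappa> e" using \<kappa> b[OF True] unfolding block_constant_def by blast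
        then show ?thesis using True b(1)[OF True] by simp
      next
        case False
        then show ?thesis using \<kappa> by (auto simp: PiE_def extensional_def)
      qed
    qed
  qed
  from bij_betw_same_card[OF this] show ?thesis using fin by (simp add: card_PiE)
qed

text \<open>A pairing of \<open>2 r\<close> edges is compatible with \<open>2 ^ r\<close> of the two-colourings of the edges.\<close>

lemma sum_tree_pairings:
  assumes "finite (arcs G)"
  shows "(\<Sum>\<kappa>\<in>arcs G \<rightarrow>\<^sub>E (UNIV :: bool set). real (card (tree_pairings G \<kappa>))) =
    sqrt 2 ^ card (arcs G) * real (card (tree_pairings G (\<lambda>_. ())))"
proof -
  let ?K = "arcs G \<rightarrow>\<^sub>E (UNIV :: bool set)" and ?T = "tree_pairings G (\<lambda>_. ())"
  have finK: "finite ?K" using assms by (intro finite_PiE) auto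
  have finT: "finite ?T" by (rule finite_tree_pairings[OF assms])
  have pair: "is_pair G \<kappa> B \<longleftrightarrow> is_pair G (\<lambda>_. ()) B \<and> (\<forall>e\<in>B. \<forall>e'\<in>B. \<kappa> e = \<kappa> e')" for \<kappa> :: "_ \<Rightarrow> bool" and B
    unfolding is_pair_def by blast
  have eq: "tree_pairings G \<kappa> = {m\<in>?T. block_constant m \<kappa>}" for \<kappa> :: "_ \<Rightarrow> bool"
    unfolding tree_pairings_def pairings_def block_constant_def pair ball_conj_distrib by blast
  have "(\<Sum>\<kappa>\<in>?K. real (card (tree_pairings G \<kappa>))) = (\<Sum>\<kappa>\<in>?K. \<Sum>m\<in>?T. if block_constant m \<kappa> then 1 else 0)"
    unfolding eq using finT by (simp add: sum.If_cases Int_def)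
  also have "\<dots> = (\<Sum>m\<in>?T. \<Sum>\<kappa>\<in>?K. if block_constant m \<kappa> then 1 else 0)" by (rule sum.swap)
  also have "\<dots> = (\<Sum>m\<in>?T. sqrt 2 ^ card (arcs G))"
  proof (rule sum.cong[OF refl])
    fix m assume "m \<in> ?T"
    then have m: "partition_on (arcs G) m" "\<And>B. B \<in> m \<Longrightarrow> card B = 2"
      by (auto simp: tree_pairings_def pairings_def is_pair_def)
    have "card (arcs G) = (\<Sum>B\<in>m. card B)" by (rule product_partition[OF m(1)]) (metis m(2) card.infinite zero_neq_numeral)
    also have "\<dots> = card m * 2" using m(2) by simp
    finally have "sqrt 2 ^ card (arcs G) = (sqrt 2 ^ 2) ^ card m" by (simp only: power_mult[symmetric] mult.commute)
    moreover have "(\<Sum>\<kappa>\<in>?K. if block_constant m \<kappa> then 1 else 0 :: real) = real (card {\<kappa>\<in>?K. block_constant m \<kappa>})"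
      using finK by (simp add: sum.If_cases Int_def)
    ultimately show "(\<Sum>\<kappa>\<in>?K. if block_constant m \<kappa> then 1 else 0) = sqrt 2 ^ card (arcs G)"
      by (simp add: card_block_constant[OF m(1) assms])
  qed
  finally show ?thesis by simp
qed

lemma sum_traffic_limit:
  assumes "finite (arcs G)"
  shows "(\<Sum>\<kappa>\<in>arcs G \<rightarrow>\<^sub>E (UNIV :: bool set). traffic_limit fst (\<lambda>s. fst (snd s)) (\<lambda>s. snd (snd s)) (G, \<lambda>e. (\<kappa> e, l e))) =
    of_real (sqrt 2 ^ card (arcs G)) * traffic_limit (\<lambda>_. ()) fst snd (G, l)"
proof -
  let ?K = "arcs G \<rightarrow>\<^sub>E (UNIV :: bool set)"
  let ?G = "\<lambda>\<pi>. fst (quotient_graph \<pi> (G, l))"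
  let ?w = "\<lambda>\<pi>. edge_weight (?G \<pi>) (fst \<circ> l) (snd \<circ> l)"
  have arcs: "arcs (?G \<pi>) = arcs G" for \<pi> by (simp add: quotient_graph_def glue_def)
  have "(\<Sum>\<kappa>\<in>?K. traffic_limit fst (\<lambda>s. fst (snd s)) (\<lambda>s. snd (snd s)) (G, \<lambda>e. (\<kappa> e, l e))) =
      (\<Sum>\<kappa>\<in>?K. \<Sum>\<pi> | partition_on (verts G) \<pi>. of_real (?w \<pi> * real (card (tree_pairings (?G \<pi>) \<kappa>))))"
    by (simp add: traffic_limit_def inj_limit_def quotient_graph_def comp_def)
  also have "\<dots> = (\<Sum>\<pi> | partition_on (verts G) \<pi>. \<Sum>\<kappa>\<in>?K. of_real (?w \<pi> * real (card (tree_pairings (?G \<pi>) \<kappa>))))"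
    by (rule sum.swap)
  also have "\<dots> = (\<Sum>\<pi> | partition_on (verts G) \<pi>.
      of_real (?w \<pi> * (sqrt 2 ^ card (arcs G) * real (card (tree_pairings (?G \<pi>) (\<lambda>_. ()))))))"
  proof (rule sum.cong[OF refl])
    fix \<pi>
    have "finite (arcs (?G \<pi>))" unfolding arcs by (rule assms)
    from sum_tree_pairings[OF this] show "(\<Sum>\<kappa>\<in>?K. complex_of_real (?w \<pi> * real (card (tree_pairings (?G \<pi>) \<kappa>)))) =
      of_real (?w \<pi> * (sqrt 2 ^ card (arcs G) * real (card (tree_pairings (?G \<pi>) (\<lambda>_. ())))))"
      unfolding arcs of_real_sum[symmetric] sum_distrib_left[symmetric] by (simp only:)
  qed
  also have "\<dots> = of_real (sqrt 2 ^ card (arcs G)) * traffic_limit (\<lambda>_. ()) fst snd (G, l)"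
    by (simp add: traffic_limit_def inj_limit_def sum_distrib_left quotient_graph_def comp_def mult_ac)
  finally show ?thesis .
qed

text \<open>Here the colour of an edge is its group, so \<open>inj_limit_components\<close> is
  exactly the required factorisation. Agreement of \<open>\<tau>\<close> with the limit is asked on
  test graphs only; this suffices because quotients and components are again test graphs.\<close>

lemma factorises_traffic_limit:
  fixes \<tau> :: "(('k \<times> 'i) \<times> star_exp) test_graph \<Rightarrow> complex"
  assumes \<tau>: "\<And>T. is_test_graph T \<Longrightarrow> \<tau> T = traffic_limit (\<lambda>s. fst (fst s)) P Q T"
    and inj: "\<And>T. is_test_graph T \<Longrightarrow>
      injective_version (traffic_limit (\<lambda>s. fst (fst s)) P Q) T = inj_limit (\<lambda>s. fst (fst s)) P Q T"
  shows "factorises_over_free_products \<tau>"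
proof -
  let ?grp = "\<lambda>s :: ('k \<times> 'i) \<times> star_exp. fst (fst s)"
  have \<tau>0: "injective_version \<tau> T = inj_limit ?grp P Q T" if "is_test_graph T" for T
    unfolding inj[OF that, symmetric] injective_version_def
    by (intro sum.cong refl arg_cong2[where f = times] \<tau> is_test_graph_quotient that)
  have "injective_version \<tau> T = (if is_free_product ?grp T
      then \<Prod>H\<in>group_components ?grp T. injective_version \<tau> (H, snd T) else 0)" if T: "is_test_graph T" for T
  proof -
    obtain G l where [simp]: "T = (G, l)" by (rule prod.exhaust)
    interpret coloured_graph G l ?grp using T by unfold_locales simp
    have "(\<Prod>H\<in>C. injective_version \<tau> (H, l)) = (\<Prod>H\<in>C. inj_limit ?grp P Q (H, l))"
      by (intro prod.cong refl \<tau>0 C_props(5))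
    then show ?thesis using \<tau>0[OF T] inj_limit_components[of P Q] by simp
  qed
  then show ?thesis by (simp add: factorises_over_free_products_def Let_def)
qed

definition wigner_traffic_limit :: "(real \<times> real) star_test_graph \<Rightarrow> complex" where
  "wigner_traffic_limit = traffic_limit (\<lambda>_. ()) (\<lambda>s. fst (fst s)) (\<lambda>s. snd (fst s))"

text \<open>The two families are the sign matrices of colours \<open>False\<close> and
  \<open>True\<close>, and the constant is 2. Expanding the sum at each edge gives a sum over all
  two-colourings of the edges, which \<open>sum_traffic_limit\<close> evaluates.\<close>

lemma stable_wigner_traffic_limit: "stable wigner_traffic_limit"
proof -
  let ?A = "signs.model :: (real \<times> real) traffic_elem traffic_space"
  let ?\<nu> = wigner_traffic_limit
  define a :: "bool \<Rightarrow> real \<times> real \<Rightarrow> (real \<times> real) traffic_elem" where "a k i = mk_elem (sign_gen (k, i))" for k i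
  have star: "exp_star ?A \<epsilon> (a k i) = a k i" for \<epsilon> k i
    by (cases \<epsilon>) (simp_all add: a_def signs.gen_selfadjoint)
  \<comment> \<open>General \<open>k\<close> and \<open>i\<close> cover both the joint distribution
    needed for independence and the distribution of each copy.\<close>
  have dist: "traffic_dist ?A (\<lambda>s. a (k s) (i s)) T =
      traffic_limit (\<lambda>s. k (fst s)) (\<lambda>s. fst (i (fst s))) (\<lambda>s. snd (i (fst s))) T"
    if "is_test_graph T" for k :: "'s \<Rightarrow> bool" and i and T :: "'s star_test_graph"
  proof -
    have "is_test_graph (fst T, \<lambda>e. (k (fst (snd T e)), i (fst (snd T e))))"
      using that by (simp add: is_test_graph_def)
    note lim = limI[OF sign_gen_converges[OF this]]
    have "traffic_dist ?A (\<lambda>s. a (k s) (i s)) T =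
        traffic_limit fst (\<lambda>s. fst (snd s)) (\<lambda>s. snd (snd s)) (fst T, \<lambda>e. (k (fst (snd T e)), i (fst (snd T e))))"
      unfolding lim[symmetric] traffic_dist_def star
      by (simp add: vertex_sum_def a_def)
    also have "\<dots> = traffic_limit (\<lambda>s. k (fst s)) (\<lambda>s. fst (i (fst s))) (\<lambda>s. snd (i (fst s))) T"
      using traffic_limit_relabel[of fst "\<lambda>s. fst (snd s)" "\<lambda>s. snd (snd s)" "fst T"
          "\<lambda>s. (k (fst s), i (fst s))" "snd T"] by simp
    finally show ?thesis .
  qed
  have "traffic_space ?A" by (rule signs.traffic_space_model)
  moreover have "\<forall>k i. a k i \<in> carrier ?A" by (simp add: a_def signs.gen_in)
  moreover have "traffic_independent ?A a"
    unfolding traffic_independent_def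
  proof (rule factorises_traffic_limit)
    fix T :: "((bool \<times> real \<times> real) \<times> star_exp) test_graph" assume "is_test_graph T"
    then show "traffic_dist ?A (\<lambda>(k, i). a k i) T =
        traffic_limit (\<lambda>s. fst (fst s)) (\<lambda>s. fst (snd (fst s))) (\<lambda>s. snd (snd (fst s))) T"
      unfolding case_prod_unfold by (rule dist)
  qed (rule signs.injective_version_traffic_limit)
  moreover have "traffic_dist ?A (a k) T = ?\<nu> T" if "is_test_graph T" for k T
    using dist[OF that, of "\<lambda>_. k" "\<lambda>s. s"] unfolding wigner_traffic_limit_def traffic_limit_const[of k _ _ "()"] by simp
  moreover have "traffic_dist ?A (\<lambda>i. a False i \<oplus>\<^bsub>?A\<^esub> a True i) T =
      of_real (sqrt 2 ^ card (arcs (fst T))) * ?\<nu> T" if T: "is_test_graph T" for T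
  proof -
    define G and l where "G = fst T" and "l = (\<lambda>e. fst (snd T e))"
    interpret fin_digraph G using T by (simp add: is_test_graph_def G_def)
    let ?K = "arcs G \<rightarrow>\<^sub>E (UNIV :: bool set)"
    let ?S = "\<lambda>n \<kappa>. LINT \<omega>|measure_pmf (random_signs n).
        1 / of_nat n * vertex_sum n (\<lambda>s. sign_gen s n \<omega>) (G, \<lambda>e. (\<kappa> e, l e))"
    \<comment> \<open>Writing the sum of the two copies as a sum over \<open>UNIV\<close> lets the
      product over edges expand into a sum over colourings.\<close>
    let ?z = "\<lambda>i. mk_elem (\<lambda>n \<omega> x y. \<Sum>k\<in>UNIV. sign_gen (k, i) n \<omega> x y) :: (real \<times> real) traffic_elem"
    have self: "exp_star ?A \<epsilon> (a False i \<oplus>\<^bsub>?A\<^esub> a True i) = ?z i" for \<epsilon> i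
      by (cases \<epsilon>) (simp_all add: a_def signs.gen_selfadjoint UNIV_bool add.commute)
    have vs: "vertex_sum n (\<lambda>x. entry x n \<omega>) (G, \<lambda>e. ?z (l e)) =
        (\<Sum>\<kappa>\<in>?K. vertex_sum n (\<lambda>s. sign_gen s n \<omega>) (G, \<lambda>e. (\<kappa> e, l e)))" for n \<omega>
    proof -
      have "vertex_sum n (\<lambda>x. entry x n \<omega>) (G, \<lambda>e. ?z (l e)) =
        (\<Sum>\<phi>\<in>verts G \<rightarrow>\<^sub>E {..<n}. \<Sum>\<kappa>\<in>?K. \<Prod>e\<in>arcs G. sign_gen (\<kappa> e, l e) n \<omega> (\<phi> (head G e)) (\<phi> (tail G e)))"
        unfolding vertex_sum_def fst_conv snd_conv entry_mk_elem
        by (intro sum.cong refl prod_sum_PiE) simp_all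
      also have "\<dots> = (\<Sum>\<kappa>\<in>?K. \<Sum>\<phi>\<in>verts G \<rightarrow>\<^sub>E {..<n}. \<Prod>e\<in>arcs G. sign_gen (\<kappa> e, l e) n \<omega> (\<phi> (head G e)) (\<phi> (tail G e)))"
        by (rule sum.swap)
      finally show ?thesis by (simp only: vertex_sum_def fst_conv snd_conv)
    qed
    have "signs.Ex n (\<lambda>\<omega>. 1 / of_nat n * vertex_sum n (\<lambda>x. entry x n \<omega>)
          (G, \<lambda>e. ?z (l e))) = (\<Sum>\<kappa>\<in>?K. ?S n \<kappa>)" for n
      unfolding vs sum_distrib_left by (rule Bochner_Integration.integral_sum[OF signs.integrable_R])
    then have "traffic_dist ?A (\<lambda>i. a False i \<oplus>\<^bsub>?A\<^esub> a True i) T = lim (\<lambda>n. \<Sum>\<kappa>\<in>?K. ?S n \<kappa>)"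
      unfolding traffic_dist_def self G_def[symmetric]
      unfolding signs.model_simps(10) by (simp only: l_def)
    also have "\<dots> = (\<Sum>\<kappa>\<in>?K. traffic_limit fst (\<lambda>s. fst (snd s)) (\<lambda>s. snd (snd s)) (G, \<lambda>e. (\<kappa> e, l e)))"
    proof (intro limI tendsto_sum sign_gen_converges)
      show "is_test_graph (G, \<lambda>e. (\<kappa> e, l e))" for \<kappa>
        using T by (simp add: is_test_graph_def G_def)
    qed
    also have "\<dots> = of_real (sqrt 2 ^ card (arcs G)) * traffic_limit (\<lambda>_. ()) fst snd (G, l)"
      by (rule sum_traffic_limit) simp
    also have "traffic_limit (\<lambda>_. ()) fst snd (G, l) = ?\<nu> T"
      using traffic_limit_relabel[of "\<lambda>_. ()" fst snd G fst "snd T"]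
      by (simp add: wigner_traffic_limit_def l_def G_def)
    finally show ?thesis unfolding G_def .
  qed
  ultimately show ?thesis
    unfolding stable_def
    by (intro conjI allI exI[of _ ?A] exI[of _ a] exI[of _ 2] impI)
      (simp_all add: wigner_traffic_limit_def traffic_limit_loop del: split_paired_All)
qed

theorem lemma3p2p2:
  fixes M :: "nat \<Rightarrow> 'w measure" and X :: "nat \<Rightarrow> nat \<Rightarrow> 'w \<Rightarrow> real mat"
  assumes "real_wigner M X"
  shows "asymptotically_traffic_independent M (\<lambda>n l. M_family (X n l)) \<and>
    (\<exists>\<nu>. stable \<nu> \<and>
      (\<forall>l. traffic_converges (\<lambda>n. mat_traffic_dist (M n) n (M_family (X n l))) \<nu>) \<and>
      (\<forall>(M' :: nat \<Rightarrow> 'u measure) (X' :: nat \<Rightarrow> nat \<Rightarrow> 'u \<Rightarrow> real mat).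
         real_wigner M' X' \<longrightarrow>
         (\<forall>l. traffic_converges (\<lambda>n. mat_traffic_dist (M' n) n (M_family (X' n l))) \<nu>)))"
proof -
  \<comment> \<open>The type \<open>'v\<close> of outcomes is arbitrary here, so that one fact
    serves both the given matrices and any other choice. A constant colour may be replaced by
    \<open>()\<close>, which removes the dependence on \<open>l\<close>.\<close>
  have univ: "traffic_converges (\<lambda>n. mat_traffic_dist (M n) n (M_family (X n l))) wigner_traffic_limit"
    if "real_wigner M X" for M :: "nat \<Rightarrow> 'v measure" and X :: "nat \<Rightarrow> nat \<Rightarrow> 'v \<Rightarrow> real mat" and l
    using traffic_converges_M_family[OF that, of "\<lambda>_. l" "\<lambda>i. i"]
    unfolding wigner_traffic_limit_def traffic_limit_const[of l _ _ "()"] .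
  interpret wigner_moments M "\<lambda>n k \<omega> a b. X n k \<omega> $$ (a, b)"
    "\<lambda>n x r. LINT \<omega>|M n. (X n (fst x) \<omega> $$ (Min (snd x), Max (snd x))) ^ r"
    by (rule real_wigner_moments[OF assms])
  have "asymptotically_traffic_independent M (\<lambda>n l. M_family (X n l))"
    unfolding asymptotically_traffic_independent_def case_prod_unfold
  proof (intro exI conjI)
    show "traffic_converges (\<lambda>n. mat_traffic_dist (M n) n (\<lambda>s. M_family (X n (fst s)) (snd s)))
        (traffic_limit (\<lambda>s. fst (fst s)) (\<lambda>s. fst (snd (fst s))) (\<lambda>s. snd (snd (fst s))))"
      by (rule traffic_converges_M_family[OF assms])
  qed (rule factorises_traffic_limit[OF refl injective_version_traffic_limit])
  then show ?thesis
    by (intro conjI exI[of _ wigner_traffic_limit] allI impI stable_wigner_traffic_limit univ assms)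
qed

end
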